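(* Let $m\ge 1$ and $M=\mathbb{Z}^{2m}\backslash\mathbb{R}^{2m}$. For any translation-invariant symplectic form $\omega$ on $M$ representing an integer cohomology class and any translation-invariant Riemannian metric $h$ on $M$, the spectrum $\mathrm{Spec}(\omega,h)$ determines whether $(M,h,\omega)$ is Kähler; that is, if $(h,\omega)$ and $(h',\omega')$ are two such pairs with $\mathrm{Spec}(\omega,h)=\mathrm{Spec}(\omega',h')$, then $(M,h,\omega)$ is Kähler if and only if $(M,h',\omega')$ is Kähler. Moreover, all translation-invariant Kähler structures $(h,\omega)$ of given volume on $M$ with $\omega$ representing an integer cohomology class are quantum equivalent (here both $\omega$ and $h$ are allowed to vary): if $(h,\omega)$ and $(h',\omega')$ are two such Kähler structures with the same volume, then $\mathrm{Spec}(k\omega,h)=\mathrm{Spec}(k\omega',h')$ for all $k\in\mathbb{Z}^+$.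
   Context: A metric or $2$-form on $M=\mathbb{Z}^{2m}\backslash\mathbb{R}^{2m}$ is translation-invariant if its pullback to $\mathbb{R}^{2m}$ is invariant under all translations. $(M,h,\omega)$ is Kähler, or $(h,\omega)$ is a Kähler structure on $M$, if there exists a complex structure $J$ on $M$ such that $(M,h,J)$ is a Kähler manifold whose associated Kähler form is $\omega$. "Volume" is the Riemannian volume of $(M,h)$ (which in the Kähler case equals the symplectic volume of $(M,\omega)$). Let $\omega$ be a translation-invariant symplectic structure on $M$ representing an integer cohomology class and $h$ a translation-invariant metric. Let $L$ be a Hermitian complex line bundle over $M$ with Chern class $[\omega]$, and $\nabla$ a Hermitian connection on $L$ with curvature $-2\pi i\omega$; denote also by $\nabla$ the induced connection on $L^{\otimes k}$, $k\in\mathbb{Z}^+$. Let $\Delta=-\operatorname{trace}(\nabla^2)$ be the associated Laplacian (trace with respect to $h$) on sections of $L^{\otimes k}$, and $\widehat H_k=\frac{\hbar^2}{2}\Delta$ with $\hbar=1/k$. $\mathrm{Spec}(k\omega,h)$ denotes the spectrum of $\widehat H_k$, with multiplicities; it does not depend on the choices of $L$ and $\nabla$. $\mathrm{Spec}(\omega,h)$ is the case $k=1$. *)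

theory Defs
  imports "HOL-Analysis.Analysis" "HOL-Library.Function_Algebras"
begin

section \<open>Smooth functions and tensor fields on the torus\<close>

text \<open>
  The Euclidean space of dimension \<open>2m\<close>, with \<open>m = CARD('m) \<ge> 1\<close>. Objects on the torus
  \<open>M\<close> (the quotient by the integer lattice) are given by their lattice-periodic pullbacks
  to this space; a tensor field is a function of the base point and of tangent vectors.
\<close>

type_synonym 'm euc = "real ^ ('m + 'm)"

abbreviation dderiv ::
  "('a::real_normed_vector \<Rightarrow> 'b::real_normed_vector) \<Rightarrow> 'a \<Rightarrow> 'a \<Rightarrow> 'b" where
  "dderiv f x v \<equiv> frechet_derivative f (at x) v"

primrec Ck_on ::
  "nat \<Rightarrow> 'a::euclidean_space set \<Rightarrow> ('a \<Rightarrow> 'b::real_normed_vector) \<Rightarrow> bool" where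
  "Ck_on 0 U f \<longleftrightarrow> continuous_on U f"
| "Ck_on (Suc k) U f \<longleftrightarrow>
     (\<forall>x\<in>U. f differentiable (at x)) \<and> (\<forall>v. Ck_on k U (\<lambda>x. dderiv f x v))"

text \<open>Only meant for open \<open>U\<close>.\<close>

definition smooth_on :: "'a::euclidean_space set \<Rightarrow> ('a \<Rightarrow> 'b::real_normed_vector) \<Rightarrow> bool" where
  "smooth_on U f \<longleftrightarrow> (\<forall>k. Ck_on k U f)"

definition lattice :: "(real ^ 'n) set" where
  "lattice = {a. \<forall>i. a $ i \<in> \<int>}"

definition periodic_on :: "(real ^ 'n) set \<Rightarrow> (real ^ 'n \<Rightarrow> 'b) \<Rightarrow> bool" where
  "periodic_on U f \<longleftrightarrow> (\<forall>x\<in>U. \<forall>a\<in>lattice. f (x + a) = f x)"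

text \<open>Translations have identity differential, so pulling back a tensor field by a translation
  only moves the base point.\<close>

definition translation_invariant :: "(real ^ 'n \<Rightarrow> 'b) \<Rightarrow> bool" where
  "translation_invariant T \<longleftrightarrow> (\<forall>a x. T (x + a) = T x)"

type_synonym 'm bilinear_field = "'m euc \<Rightarrow> 'm euc \<Rightarrow> 'm euc \<Rightarrow> real"

definition riemannian_metric :: "'m::finite bilinear_field \<Rightarrow> bool" where
  "riemannian_metric h \<longleftrightarrow>
     periodic_on UNIV h \<and> (\<forall>u v. smooth_on UNIV (\<lambda>x. h x u v)) \<and>
     (\<forall>x. bilinear (h x) \<and> (\<forall>u v. h x u v = h x v u) \<and> (\<forall>u. u \<noteq> 0 \<longrightarrow> h x u u > 0))"

text \<open>The exterior derivative is evaluated on constant (hence commuting) vector fields.\<close>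

definition closed_form :: "'m::finite bilinear_field \<Rightarrow> bool" where
  "closed_form \<omega> \<longleftrightarrow>
     (\<forall>x u v w. dderiv (\<lambda>y. \<omega> y v w) x u + dderiv (\<lambda>y. \<omega> y w u) x v
        + dderiv (\<lambda>y. \<omega> y u v) x w = 0)"

definition symplectic_form :: "'m::finite bilinear_field \<Rightarrow> bool" where
  "symplectic_form \<omega> \<longleftrightarrow>
     periodic_on UNIV \<omega> \<and> (\<forall>u v. smooth_on UNIV (\<lambda>x. \<omega> x u v)) \<and>
     (\<forall>x. bilinear (\<omega> x) \<and> (\<forall>u. \<omega> x u u = 0) \<and> (\<forall>u. u \<noteq> 0 \<longrightarrow> (\<exists>v. \<omega> x u v \<noteq> 0))) \<and>
     closed_form \<omega>"

text \<open>A closed 2-form represents an integer class iff its periods are integers; the second homology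
  of the torus is generated by the 2-tori spanned by pairs of lattice vectors.\<close>

definition integer_class :: "'m::finite bilinear_field \<Rightarrow> bool" where
  "integer_class \<omega> \<longleftrightarrow>
     (\<forall>u\<in>lattice. \<forall>v\<in>lattice.
        integral {0..1} (\<lambda>s. integral {0..1} (\<lambda>t. \<omega> (s *\<^sub>R u + t *\<^sub>R v) u v)) \<in> \<int>)"

definition gram :: "'m::finite bilinear_field \<Rightarrow> 'm euc \<Rightarrow> real ^ ('m + 'm) ^ ('m + 'm)" where
  "gram h x = (\<chi> i j. h x (axis i 1) (axis j 1))"

definition riemannian_volume :: "'m::finite bilinear_field \<Rightarrow> real" where
  "riemannian_volume h = integral (cbox 0 1) (\<lambda>x. sqrt (det (gram h x)))"


section \<open>Complex structures and Kaehler structures\<close>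

text \<open>A complex structure is given by its endomorphism field \<open>J\<close> together with the existence of
  local holomorphic coordinates inducing it.\<close>

definition complex_structure :: "('m::finite euc \<Rightarrow> 'm euc \<Rightarrow> 'm euc) \<Rightarrow> bool" where
  "complex_structure J \<longleftrightarrow>
     periodic_on UNIV J \<and> (\<forall>v. smooth_on UNIV (\<lambda>x. J x v)) \<and>
     (\<forall>x. linear (J x) \<and> (\<forall>v. J x (J x v) = - v)) \<and>
     (\<forall>p. \<exists>U (\<phi> :: 'm euc \<Rightarrow> complex ^ 'm).
        open U \<and> p \<in> U \<and> smooth_on U \<phi> \<and> inj_on \<phi> U \<and>
        (\<forall>x\<in>U. bij (dderiv \<phi> x) \<and> (\<forall>v. dderiv \<phi> x (J x v) = \<i> *s dderiv \<phi> x v)))"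

definition kaehler_manifold ::
  "'m::finite bilinear_field \<Rightarrow> ('m euc \<Rightarrow> 'm euc \<Rightarrow> 'm euc) \<Rightarrow> 'm bilinear_field \<Rightarrow> bool" where
  "kaehler_manifold h J \<omega> \<longleftrightarrow>
     riemannian_metric h \<and> complex_structure J \<and>
     (\<forall>x u v. h x (J x u) (J x v) = h x u v) \<and>
     (\<forall>x u v. \<omega> x u v = h x (J x u) v) \<and> closed_form \<omega>"

definition kaehler :: "'m::finite bilinear_field \<Rightarrow> 'm bilinear_field \<Rightarrow> bool" where
  "kaehler h \<omega> \<longleftrightarrow> (\<exists>J. kaehler_manifold h J \<omega>)"


section \<open>Hermitian line bundles with connection\<close>

text \<open>
  A Hermitian line bundle over the torus is given by unitary local trivialisations over an open
  cover: \<open>patch L i\<close> is the preimage of the \<open>i\<close>-th open set and \<open>trans L i j\<close> is the transition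
  function, so that a section with local expressions \<open>s i\<close> satisfies \<open>s i = trans L i j * s j\<close>.
\<close>

record ('i, 'm) line_bundle =
  patch :: "'i \<Rightarrow> 'm euc set"
  trans :: "'i \<Rightarrow> 'i \<Rightarrow> 'm euc \<Rightarrow> complex"

definition hermitian_line_bundle :: "('i, 'm::finite) line_bundle \<Rightarrow> bool" where
  "hermitian_line_bundle L \<longleftrightarrow>
     (\<Union>i. patch L i) = UNIV \<and>
     (\<forall>i. open (patch L i) \<and> (\<forall>x\<in>patch L i. \<forall>a\<in>lattice. x + a \<in> patch L i)) \<and>
     (\<forall>i j. smooth_on (patch L i \<inter> patch L j) (trans L i j) \<and>
        periodic_on (patch L i \<inter> patch L j) (trans L i j) \<and>
        (\<forall>x\<in>patch L i \<inter> patch L j. norm (trans L i j x) = 1)) \<and>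
     (\<forall>i j k. \<forall>x\<in>patch L i \<inter> patch L j \<inter> patch L k.
        trans L i j x * trans L j k x = trans L i k x)"

text \<open>A connection is given by its local connection forms, \<open>\<nabla> = d + \<theta> i\<close> in the \<open>i\<close>-th
  trivialisation. It is Hermitian iff these are purely imaginary.\<close>

type_synonym ('i, 'm) connection_forms = "'i \<Rightarrow> 'm euc \<Rightarrow> 'm euc \<Rightarrow> complex"

definition hermitian_connection ::
  "('i, 'm::finite) line_bundle \<Rightarrow> ('i, 'm) connection_forms \<Rightarrow> bool" where
  "hermitian_connection L \<theta> \<longleftrightarrow>
     (\<forall>i. periodic_on (patch L i) (\<theta> i) \<and> (\<forall>v. smooth_on (patch L i) (\<lambda>x. \<theta> i x v)) \<and>
        (\<forall>x\<in>patch L i. linear (\<theta> i x) \<and> (\<forall>v. Re (\<theta> i x v) = 0))) \<and>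
     (\<forall>i j. \<forall>x\<in>patch L i \<inter> patch L j. \<forall>v.
        \<theta> j x v = \<theta> i x v + dderiv (trans L i j) x v / trans L i j x)"

definition curvature ::
  "('i, 'm::finite) connection_forms \<Rightarrow> 'i \<Rightarrow> 'm euc \<Rightarrow> 'm euc \<Rightarrow> 'm euc \<Rightarrow> complex" where
  "curvature \<theta> i x u v = dderiv (\<lambda>y. \<theta> i y v) x u - dderiv (\<lambda>y. \<theta> i y u) x v"

text \<open>The Chern class of \<open>L\<close> is represented by \<open>\<i> / (2 * pi)\<close> times the curvature of any
  connection, so the curvature condition says in particular that it is the class of \<open>\<omega>\<close> (the
  integer cohomology of the torus has no torsion).\<close>

definition prequantum_bundle ::
  "'m::finite bilinear_field \<Rightarrow> ('i, 'm) line_bundle \<Rightarrow> ('i, 'm) connection_forms \<Rightarrow> bool" where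
  "prequantum_bundle \<omega> L \<theta> \<longleftrightarrow>
     hermitian_line_bundle L \<and> hermitian_connection L \<theta> \<and>
     (\<forall>i. \<forall>x\<in>patch L i. \<forall>u v. curvature \<theta> i x u v = - 2 * pi * \<i> * \<omega> x u v)"

definition tensor_power :: "nat \<Rightarrow> ('i, 'm::finite) line_bundle \<Rightarrow> ('i, 'm) line_bundle" where
  "tensor_power k L = \<lparr>patch = patch L, trans = (\<lambda>i j x. trans L i j x ^ k)\<rparr>"

definition power_connection ::
  "nat \<Rightarrow> ('i, 'm::finite) connection_forms \<Rightarrow> ('i, 'm) connection_forms" where
  "power_connection k \<theta> = (\<lambda>i x v. of_nat k * \<theta> i x v)"

text \<open>Local expressions are set to 0 outside their domain, so that different functions represent
  different sections.\<close>

definition smooth_sections ::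
  "('i, 'm::finite) line_bundle \<Rightarrow> ('i \<Rightarrow> 'm euc \<Rightarrow> complex) set" where
  "smooth_sections L =
     {s. (\<forall>i. smooth_on (patch L i) (s i) \<and> periodic_on (patch L i) (s i) \<and>
            (\<forall>x. x \<notin> patch L i \<longrightarrow> s i x = 0)) \<and>
         (\<forall>i j. \<forall>x\<in>patch L i \<inter> patch L j. s i x = trans L i j x * s j x)}"


section \<open>The Laplacian and its spectrum\<close>

text \<open>The Koszul formula for constant (hence commuting) vector fields \<open>u\<close>, \<open>v\<close>.\<close>

definition levi_civita :: "'m::finite bilinear_field \<Rightarrow> 'm euc \<Rightarrow> 'm euc \<Rightarrow> 'm euc \<Rightarrow> 'm euc" where
  "levi_civita h x u v =
     (THE z. \<forall>w. 2 * h x z w = dderiv (\<lambda>y. h y v w) x u + dderiv (\<lambda>y. h y u w) x v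
                                - dderiv (\<lambda>y. h y u v) x w)"

text \<open>The next three operators act on local expressions of sections, in one fixed trivialisation
  with connection form \<open>\<alpha>\<close>.\<close>

definition covd ::
  "('m::finite euc \<Rightarrow> 'm euc \<Rightarrow> complex) \<Rightarrow> 'm euc \<Rightarrow> ('m euc \<Rightarrow> complex) \<Rightarrow> 'm euc \<Rightarrow> complex" where
  "covd \<alpha> v f x = dderiv f x v + \<alpha> x v * f x"

definition second_covd ::
  "'m::finite bilinear_field \<Rightarrow> ('m euc \<Rightarrow> 'm euc \<Rightarrow> complex) \<Rightarrow> 'm euc \<Rightarrow> 'm euc
     \<Rightarrow> ('m euc \<Rightarrow> complex) \<Rightarrow> 'm euc \<Rightarrow> complex" where
  "second_covd h \<alpha> u v f x = covd \<alpha> u (covd \<alpha> v f) x - covd \<alpha> (levi_civita h x u v) f x"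

definition laplacian ::
  "'m::finite bilinear_field \<Rightarrow> ('m euc \<Rightarrow> 'm euc \<Rightarrow> complex)
     \<Rightarrow> ('m euc \<Rightarrow> complex) \<Rightarrow> 'm euc \<Rightarrow> complex" where
  "laplacian h \<alpha> f x =
     - (\<Sum>i\<in>UNIV. \<Sum>j\<in>UNIV.
          complex_of_real (matrix_inv (gram h x) $ i $ j) * second_covd h \<alpha> (axis i 1) (axis j 1) f x)"

definition eigensections ::
  "nat \<Rightarrow> 'm::finite bilinear_field \<Rightarrow> ('i, 'm) line_bundle \<Rightarrow> ('i, 'm) connection_forms
     \<Rightarrow> complex \<Rightarrow> ('i \<Rightarrow> 'm euc \<Rightarrow> complex) set" where
  "eigensections k h L \<theta> \<mu> =
     {s \<in> smooth_sections (tensor_power k L). \<forall>i. \<forall>x\<in>patch L i.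
        (1 / of_nat k)\<^sup>2 / 2 * laplacian h (power_connection k \<theta> i) (s i) x = \<mu> * s i x}"

text \<open>The spectrum with multiplicities of the quantum Hamiltonian on the \<open>k\<close>-th tensor power, as the
  function sending a number to its multiplicity as an eigenvalue (0 for non-eigenvalues). The
  eigenspaces are finite-dimensional, because the operator is elliptic and the torus compact.\<close>

definition Spec ::
  "nat \<Rightarrow> 'm::finite bilinear_field \<Rightarrow> ('i, 'm) line_bundle \<Rightarrow> ('i, 'm) connection_forms
     \<Rightarrow> complex \<Rightarrow> nat" where
  "Spec k h L \<theta> \<mu> =
     vector_space.dim (\<lambda>(c::complex) s i x. c * s i x) (eigensections k h L \<theta> \<mu>)"

end

theory Submission
  imports Defs
begin

text \<open>
  In an \<open>h\<close>-orthonormal frame \<open>e\<^sub>j, f\<^sub>j\<close> with \<open>\<omega>(e\<^sub>j, f\<^sub>j) = a\<^sub>j > 0\<close> (all other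
  values of \<open>\<omega>\<close> being 0) the Laplacian is a sum of commuting harmonic oscillators, so that the
  spectrum on the \<open>k\<close>-th power consists of the numbers \<open>(\<pi> / k) \<Sum> a\<^sub>j (2 n\<^sub>j + 1)\<close> with
  \<open>n\<^sub>j \<ge> 0\<close>, each occurring with multiplicity the dimension of the space of ground states. Ground
  states are holomorphic sections for the complex structure sending \<open>e\<^sub>j\<close> to \<open>f\<^sub>j\<close>; in a
  Frobenius basis of the lattice for \<open>\<omega>\<close>, with elementary divisors \<open>d\<^sub>j\<close>, they are theta
  functions, and there are \<open>\<Prod> k d\<^sub>j\<close> independent ones.

  The pair is Kaehler iff all \<open>a\<^sub>j\<close> are 1. This is visible in the support of the spectrum for
  \<open>k = 1\<close>: its elements are then exactly \<open>\<pi> (m + 2 n)\<close>, so in an isospectral pair the lowest one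
  gives \<open>\<Sum> a\<^sub>j = m\<close> and the next ones force every \<open>a\<^sub>j\<close> to be a positive integer. In the
  Kaehler case \<open>\<Prod> d\<^sub>j\<close> is the volume, which leaves nothing in the formula that could vary.

  No completeness of eigenfunctions is used: an eigenspace is split by the ladder operators as long
  as the eigenvalue can be lowered, and this stops because the maximum principle bounds the
  eigenvalues from below.
\<close>

section \<open>Calculus of smooth functions\<close>

text \<open>Two unrelated bases are in play: the frame \<open>e\<close>, \<open>f\<close> is adapted
  to \<open>h\<close> but ignores the lattice, the Frobenius basis is adapted to the lattice but
  ignores \<open>h\<close>. One decides where the eigenvalues lie, the other how often each occurs.
  They meet only in the ground states, where \<open>h\<close> enters through a period matrix on
  which the number of theta functions does not depend.

  Bundle, cover and connection are arbitrary, so sections are compared with one fixed model: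
  functions on the covering space with a linear potential and a prescribed quasi-periodicity. The
  given connection and the model have the same curvature, so they differ by a flat unitary frame on
  the covering space. What remains of \<open>L\<close> and \<open>\<theta>\<close> is the behaviour
  of this frame under the lattice, a character, and a translation of the torus absorbs it. Since
  \<open>h\<close> and \<open>\<omega>\<close> are invariant, the translation does not affect the
  operator.

  The ladder argument is purely algebraic and involves no inner product on sections. It has to
  produce finite dimensions along with the count, because a bare \<open>dim\<close> says nothing
  when a space is infinite-dimensional.\<close>

lemma dderivI: "(f has_derivative f') (at x) \<Longrightarrow> dderiv f x v = f' v"
  by (simp add: frechet_derivative_at[symmetric])

lemma has_dderiv: "f differentiable (at x) \<Longrightarrow> (f has_derivative dderiv f x) (at x)"
  by (simp add: frechet_derivative_works[symmetric])

lemma dderiv_cong: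
  assumes "open U" "x \<in> U" "\<And>y. y \<in> U \<Longrightarrow> f y = g y" "f differentiable (at x)"
  shows "dderiv g x v = dderiv f x v" "g differentiable (at x)"
proof -
  have "(g has_derivative dderiv f x) (at x)"
    using has_derivative_transform_within_open[OF has_dderiv[OF assms(4)] assms(1,2)] assms(3) by blast
  then show "dderiv g x v = dderiv f x v" "g differentiable (at x)"
    using dderivI[OF \<open>(g has_derivative dderiv f x) (at x)\<close>] by (auto simp: differentiable_def)
qed

lemma Ck_on_cong:
  assumes "open U"
  shows "(\<And>x. x \<in> U \<Longrightarrow> f x = g x) \<Longrightarrow> Ck_on k U f \<Longrightarrow> Ck_on k U g"
proof (induction k arbitrary: f g)
  case 0
  then show ?case by (metis Ck_on.simps(1) continuous_on_cong)
next
  case (Suc k)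
  have d: "f differentiable (at x)" if "x \<in> U" for x using Suc.prems that by simp
  have "Ck_on k U (\<lambda>x. dderiv g x v)" for v
  proof (rule Suc.IH)
    show "Ck_on k U (\<lambda>x. dderiv f x v)" using Suc.prems by simp
    show "dderiv f x v = dderiv g x v" if "x \<in> U" for x
      using dderiv_cong(1)[OF assms that, of f g] Suc.prems(1) d that by simp
  qed
  moreover have "g differentiable (at x)" if "x \<in> U" for x
    using dderiv_cong(2)[OF assms that, of f g] Suc.prems(1) d that by simp
  ultimately show ?case by simp
qed

lemma smooth_on_cong:
  "open U \<Longrightarrow> (\<And>x. x \<in> U \<Longrightarrow> f x = g x) \<Longrightarrow> smooth_on U f \<Longrightarrow> smooth_on U g"
  unfolding smooth_on_def using Ck_on_cong by blast

lemma differentiable_at_imp_continuous_on: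
  "(\<And>x. x \<in> U \<Longrightarrow> f differentiable (at x)) \<Longrightarrow> continuous_on U f"
  by (meson continuous_at_imp_continuous_on differentiable_imp_continuous_within)

text \<open>The product rule leaves one factor undifferentiated, so the induction for products has
  to lower the class of that factor by one.\<close>

lemma Ck_on_Suc_imp: "Ck_on (Suc k) U f \<Longrightarrow> Ck_on k U f"
proof (induction k arbitrary: f)
  case 0
  then show ?case
    by (simp add: differentiable_at_imp_continuous_on)
next
  case (Suc k)
  then have "\<And>v. Ck_on k U (\<lambda>x. dderiv f x v)" by (metis Ck_on.simps(2))
  then show ?case using Suc.prems by (metis Ck_on.simps(2))
qed

lemma Ck_on_local:
  assumes "\<And>x. x \<in> U \<Longrightarrow> \<exists>V. open V \<and> x \<in> V \<and> Ck_on k V f"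
  shows "Ck_on k U f"
  using assms
proof (induction k arbitrary: f)
  case 0
  then have "\<forall>x\<in>U. continuous (at x) f"
    by (metis Ck_on.simps(1) continuous_on_eq_continuous_at)
  then show ?case by (simp add: continuous_at_imp_continuous_on)
next
  case (Suc k)
  have "Ck_on k U (\<lambda>x. dderiv f x v)" for v
    by (rule Suc.IH) (use Suc.prems in \<open>metis Ck_on.simps(2)\<close>)
  then show ?case using Suc.prems by (metis Ck_on.simps(2))
qed

lemma Ck_on_subset: "V \<subseteq> U \<Longrightarrow> Ck_on k U f \<Longrightarrow> Ck_on k V f"
  by (induction k arbitrary: f) (auto intro: continuous_on_subset)

lemma smooth_on_local:
  assumes "\<And>x. x \<in> U \<Longrightarrow> \<exists>V. open V \<and> x \<in> V \<and> smooth_on V f"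
  shows "smooth_on U f"
  unfolding smooth_on_def by (intro allI Ck_on_local) (use assms smooth_on_def in blast)

lemma smooth_on_subset: "smooth_on U f \<Longrightarrow> V \<subseteq> U \<Longrightarrow> smooth_on V f"
  unfolding smooth_on_def using Ck_on_subset by blast

lemma smooth_on_differentiable: "smooth_on U f \<Longrightarrow> x \<in> U \<Longrightarrow> f differentiable (at x)"
  unfolding smooth_on_def by (metis Ck_on.simps(2))

lemma smooth_on_has_derivative:
  "smooth_on U f \<Longrightarrow> x \<in> U \<Longrightarrow> (f has_derivative dderiv f x) (at x)"
  using smooth_on_differentiable has_dderiv by blast

lemma smooth_on_dderiv: "smooth_on U f \<Longrightarrow> smooth_on U (\<lambda>x. dderiv f x v)"
  unfolding smooth_on_def by (metis Ck_on.simps(2))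

lemma smooth_on_continuous: "smooth_on U f \<Longrightarrow> continuous_on U f"
  unfolding smooth_on_def by (metis Ck_on.simps(1))

lemma smooth_on_UNIV_continuous: "smooth_on UNIV f \<Longrightarrow> continuous_on S f"
  using smooth_on_continuous continuous_on_subset by blast

lemma Ck_on_const: "Ck_on k U (\<lambda>x. c)"
  by (induction k arbitrary: c) auto

lemma Ck_on_add: "open U \<Longrightarrow> Ck_on k U f \<Longrightarrow> Ck_on k U g \<Longrightarrow> Ck_on k U (\<lambda>x. f x + g x)"
proof (induction k arbitrary: f g)
  case 0 then show ?case by (auto intro: continuous_on_add)
next
  case (Suc k)
  have d: "((\<lambda>x. f x + g x) has_derivative (\<lambda>v. dderiv f x v + dderiv g x v)) (at x)" if "x \<in> U" for x
    using Suc.prems that by (auto intro!: has_derivative_add has_dderiv)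
  have e: "dderiv (\<lambda>x. f x + g x) x v = dderiv f x v + dderiv g x v"
    "(\<lambda>x. f x + g x) differentiable (at x)" if "x \<in> U" for x v
    using d[OF that] dderivI[OF d[OF that]] by (auto simp: differentiable_def)
  have "Ck_on k U (\<lambda>x. dderiv (\<lambda>x. f x + g x) x v)" for v
    by (rule Ck_on_cong[OF Suc.prems(1) _ Suc.IH[of "\<lambda>x. dderiv f x v" "\<lambda>x. dderiv g x v"]])
      (use Suc.prems e in auto)
  then show ?case using e by simp
qed

lemma Ck_on_mult:
  fixes f g :: "'a::euclidean_space \<Rightarrow> 'b::real_normed_algebra"
  shows "open U \<Longrightarrow> Ck_on k U f \<Longrightarrow> Ck_on k U g \<Longrightarrow> Ck_on k U (\<lambda>x. f x * g x)"
proof (induction k arbitrary: f g)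
  case 0 then show ?case by (auto intro: continuous_on_mult)
next
  case (Suc k)
  have d: "((\<lambda>x. f x * g x) has_derivative (\<lambda>v. f x * dderiv g x v + dderiv f x v * g x)) (at x)"
    if "x \<in> U" for x
    using Suc.prems that by (auto intro!: has_derivative_mult has_dderiv)
  have e: "dderiv (\<lambda>x. f x * g x) x v = f x * dderiv g x v + dderiv f x v * g x"
    "(\<lambda>x. f x * g x) differentiable (at x)" if "x \<in> U" for x v
    using d[OF that] dderivI[OF d[OF that]] by (auto simp: differentiable_def)
  have "Ck_on k U (\<lambda>x. f x * dderiv g x v + dderiv f x v * g x)" for v
    using Suc.prems Ck_on_Suc_imp[of k U f] Ck_on_Suc_imp[of k U g]
    by (intro Ck_on_add Suc.IH) auto
  then have "Ck_on k U (\<lambda>x. dderiv (\<lambda>x. f x * g x) x v)" for v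
    by (rule Ck_on_cong[OF Suc.prems(1), rotated]) (use e in auto)
  then show ?case using e by simp
qed

lemma Ck_on_bounded_linear:
  assumes "open U" "bounded_linear L"
  shows "Ck_on k U f \<Longrightarrow> Ck_on k U (\<lambda>x. L (f x))"
proof (induction k arbitrary: f)
  case 0 then show ?case using bounded_linear.continuous_on[OF assms(2), of U f] 0 by simp
next
  case (Suc k)
  have d: "((\<lambda>x. L (f x)) has_derivative (\<lambda>v. L (dderiv f x v))) (at x)" if "x \<in> U" for x
    using Suc.prems that by (auto intro!: bounded_linear.has_derivative[OF assms(2)] has_dderiv)
  have e: "dderiv (\<lambda>x. L (f x)) x v = L (dderiv f x v)"
    "(\<lambda>x. L (f x)) differentiable (at x)" if "x \<in> U" for x v
    using d[OF that] dderivI[OF d[OF that]] by (auto simp: differentiable_def)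
  have "Ck_on k U (\<lambda>x. dderiv (\<lambda>x. L (f x)) x v)" for v
    by (rule Ck_on_cong[OF assms(1) _ Suc.IH[of "\<lambda>x. dderiv f x v"]])
      (use Suc.prems e in auto)
  then show ?case using e by simp
qed

lemma Ck_on_affine:
  assumes "open U" "bounded_linear L" "\<And>y. y \<in> U \<Longrightarrow> L y + c \<in> V"
  shows "Ck_on k V f \<Longrightarrow> Ck_on k U (\<lambda>y. f (L y + c))"
proof (induction k arbitrary: f)
  case 0
  have "continuous_on U (\<lambda>y. L y + c)"
    by (intro continuous_intros linear_continuous_on assms)
  then show ?case using continuous_on_compose2[of V f U] 0 assms by auto
next
  case (Suc k)
  have L: "((\<lambda>y. L y + c) has_derivative L) (at y)" for y
    using has_derivative_add[OF bounded_linear_imp_has_derivative[OF assms(2)] has_derivative_const]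
    by simp
  have d: "((\<lambda>y. f (L y + c)) has_derivative (\<lambda>v. dderiv f (L y + c) (L v))) (at y)" if "y \<in> U" for y
    using Suc.prems assms(3)[OF that]
    by (auto intro!: has_derivative_compose[OF L] has_dderiv)
  have e: "dderiv (\<lambda>y. f (L y + c)) y v = dderiv f (L y + c) (L v)"
    "(\<lambda>y. f (L y + c)) differentiable (at y)" if "y \<in> U" for y v
    using d[OF that] dderivI[OF d[OF that]] by (auto simp: differentiable_def)
  have "Ck_on k U (\<lambda>y. dderiv (\<lambda>y. f (L y + c)) y v)" for v
    by (rule Ck_on_cong[OF assms(1) _ Suc.IH[of "\<lambda>x. dderiv f x (L v)"]])
      (use Suc.prems e in auto)
  then show ?case using e by simp
qed

lemma smooth_on_const: "smooth_on U (\<lambda>x. c)"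
  by (simp add: smooth_on_def Ck_on_const)

lemma smooth_on_add: "open U \<Longrightarrow> smooth_on U f \<Longrightarrow> smooth_on U g \<Longrightarrow> smooth_on U (\<lambda>x. f x + g x)"
  by (simp add: smooth_on_def Ck_on_add)

lemma smooth_on_mult:
  fixes f g :: "'a::euclidean_space \<Rightarrow> 'b::real_normed_algebra"
  shows "open U \<Longrightarrow> smooth_on U f \<Longrightarrow> smooth_on U g \<Longrightarrow> smooth_on U (\<lambda>x. f x * g x)"
  by (simp add: smooth_on_def Ck_on_mult)

lemma smooth_on_bounded_linear:
  "open U \<Longrightarrow> bounded_linear L \<Longrightarrow> smooth_on U f \<Longrightarrow> smooth_on U (\<lambda>x. L (f x))"
  by (simp add: smooth_on_def Ck_on_bounded_linear)

lemma smooth_on_affine: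
  "open U \<Longrightarrow> bounded_linear L \<Longrightarrow> (\<And>y. y \<in> U \<Longrightarrow> L y + c \<in> V) \<Longrightarrow> smooth_on V f
    \<Longrightarrow> smooth_on U (\<lambda>y. f (L y + c))"
  unfolding smooth_on_def by (intro allI Ck_on_affine[where V = V]) auto

lemma dderiv_affine:
  assumes "bounded_linear L" "f differentiable (at (L y + c))"
  shows "((\<lambda>y. f (L y + c)) has_derivative (\<lambda>v. dderiv f (L y + c) (L v))) (at y)"
proof -
  have L: "((\<lambda>y. L y + c) has_derivative L) (at y)"
    using has_derivative_add[OF bounded_linear_imp_has_derivative[OF assms(1)] has_derivative_const]
    by simp
  show ?thesis by (rule has_derivative_compose[OF L has_dderiv[OF assms(2)]])
qed

lemma smooth_on_linear:
  assumes "open U" "bounded_linear L" shows "smooth_on U L"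
proof -
  have "Ck_on k U L" for k
  proof (cases k)
    case 0 then show ?thesis using assms by (simp add: linear_continuous_on)
  next
    case (Suc n)
    have "dderiv L x v = L v" for x v
      by (rule dderivI) (rule bounded_linear_imp_has_derivative[OF assms(2)])
    then show ?thesis using Suc bounded_linear_imp_differentiable[OF assms(2)] by (simp add: Ck_on_const)
  qed
  then show ?thesis by (simp add: smooth_on_def)
qed

lemma smooth_on_power:
  fixes f :: "'a::euclidean_space \<Rightarrow> 'b::real_normed_algebra_1"
  shows "open U \<Longrightarrow> smooth_on U f \<Longrightarrow> smooth_on U (\<lambda>x. f x ^ n)"
  by (induction n) (auto intro: smooth_on_const smooth_on_mult)

text \<open>Bootstrapping: the derivative is a smooth multiple of \<open>g\<close> itself, so each
  class already reached yields the next. Frames are known only through such an equation.\<close>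

lemma smooth_on_multiplicative_ode:
  fixes g :: "'a::euclidean_space \<Rightarrow> complex"
  assumes "open U" "\<And>x. x \<in> U \<Longrightarrow> (g has_derivative (\<lambda>v. \<beta> x v * g x)) (at x)"
    "\<And>v. smooth_on U (\<lambda>x. \<beta> x v)"
  shows "smooth_on U g"
proof -
  have d: "g differentiable (at x)" "dderiv g x v = \<beta> x v * g x" if "x \<in> U" for x v
    using assms(2)[OF that] dderivI[OF assms(2)[OF that]] by (auto simp: differentiable_def)
  have "Ck_on k U g" for k
  proof (induction k)
    case 0 then show ?case
      using d(1) by (simp add: differentiable_at_imp_continuous_on)
  next
    case (Suc k)
    have "Ck_on k U (\<lambda>x. dderiv g x v)" for v
      by (rule Ck_on_cong[OF assms(1) _ Ck_on_mult[OF assms(1) _ Suc]])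
        (use assms(3) d in \<open>auto simp: smooth_on_def\<close>)
    then show ?case using d by simp
  qed
  then show ?thesis by (simp add: smooth_on_def)
qed

section \<open>Symmetry of second derivatives and primitives of closed 1-forms\<close>

lemma dderiv_linear: "f differentiable (at x) \<Longrightarrow> linear (dderiv f x)"
  using has_dderiv has_derivative_linear by blast

lemma has_vector_derivative_line:
  fixes f :: "'a::real_normed_vector \<Rightarrow> 'b::real_normed_vector"
  assumes "(f has_derivative f') (at (x + t *\<^sub>R v))"
  shows "((\<lambda>t. f (x + t *\<^sub>R v)) has_vector_derivative f' v) (at t within S)"
proof -
  have "((\<lambda>t. x + t *\<^sub>R v) has_derivative (\<lambda>s. s *\<^sub>R v)) (at t)"
    by (auto intro!: derivative_eq_intros)
  from has_derivative_compose[OF this assms]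
  have "((\<lambda>t. f (x + t *\<^sub>R v)) has_derivative (\<lambda>s. s *\<^sub>R f' v)) (at t)"
    by (simp add: linear_cmul[OF has_derivative_linear[OF assms]])
  then show ?thesis
    by (simp add: has_vector_derivative_def has_derivative_at_withinI)
qed

text \<open>The mean value theorem is applied once per direction. The second difference is symmetric
  in \<open>u\<close> and \<open>v\<close>, whereas the derivative on the right depends on the
  order; this asymmetry is what the next lemma exploits.\<close>

lemma second_difference_mvt:
  fixes f :: "'a::euclidean_space \<Rightarrow> real"
  assumes f: "smooth_on UNIV f" and s: "s > 0"
  obtains \<xi> \<eta> where "0 < \<xi>" "\<xi> < s" "0 < \<eta>" "\<eta> < s"
    "f (x + s *\<^sub>R u + s *\<^sub>R v) - f (x + s *\<^sub>R u) - f (x + s *\<^sub>R v) + f x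
      = s * s * dderiv (\<lambda>y. dderiv f y u) (x + \<xi> *\<^sub>R u + \<eta> *\<^sub>R v) v"
proof -
  define g where "g r = f ((x + s *\<^sub>R v) + r *\<^sub>R u) - f (x + r *\<^sub>R u)" for r
  have fd: "(f has_derivative dderiv f y) (at y)" for y
    using smooth_on_has_derivative[OF f] by simp
  have g: "(g has_real_derivative (dderiv f ((x + s *\<^sub>R v) + r *\<^sub>R u) u - dderiv f (x + r *\<^sub>R u) u)) (at r)" for r
    unfolding g_def has_real_derivative_iff_has_vector_derivative
    by (intro has_vector_derivative_diff has_vector_derivative_line fd)
  obtain \<xi> where \<xi>: "0 < \<xi>" "\<xi> < s" and e1: "g s - g 0 = (s - 0) *
      (dderiv f ((x + s *\<^sub>R v) + \<xi> *\<^sub>R u) u - dderiv f (x + \<xi> *\<^sub>R u) u)"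
    using MVT2[of 0 s g, OF s g] by blast
  define k where "k r = dderiv f ((x + \<xi> *\<^sub>R u) + r *\<^sub>R v) u" for r
  have fd2: "((\<lambda>y. dderiv f y u) has_derivative dderiv (\<lambda>y. dderiv f y u) y) (at y)" for y
    using smooth_on_has_derivative[OF smooth_on_dderiv[OF f]] by simp
  have k: "(k has_real_derivative dderiv (\<lambda>y. dderiv f y u) ((x + \<xi> *\<^sub>R u) + r *\<^sub>R v) v) (at r)" for r
    unfolding k_def has_real_derivative_iff_has_vector_derivative
    by (intro has_vector_derivative_line fd2)
  obtain \<eta> where \<eta>: "0 < \<eta>" "\<eta> < s" and e2: "k s - k 0 = (s - 0) *
      dderiv (\<lambda>y. dderiv f y u) ((x + \<xi> *\<^sub>R u) + \<eta> *\<^sub>R v) v"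
    using MVT2[of 0 s k, OF s k] by blast
  show ?thesis
    by (rule that[OF \<xi> \<eta>]) (use e1 e2 in \<open>simp add: g_def k_def algebra_simps\<close>)
qed

text \<open>One second difference, evaluated in both orders, gives points arbitrarily close to
  \<open>x\<close> at which the two mixed derivatives agree. Continuity carries the equality to
  \<open>x\<close>.\<close>

lemma dderiv_commute_real:
  fixes f :: "'a::euclidean_space \<Rightarrow> real"
  assumes f: "smooth_on UNIV f"
  shows "dderiv (\<lambda>y. dderiv f y u) x v = dderiv (\<lambda>y. dderiv f y v) x u"
proof -
  define F where "F y = dderiv (\<lambda>y. dderiv f y u) y v" for y
  define G where "G y = dderiv (\<lambda>y. dderiv f y v) y u" for y
  have cont: "continuous (at x) F" "continuous (at x) G"
    unfolding F_def G_def using smooth_on_continuous[OF smooth_on_dderiv[OF smooth_on_dderiv[OF f]]]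
    by (auto simp: continuous_on_eq_continuous_at)
  have near: "\<exists>y z. dist y x \<le> s * (norm u + norm v) \<and> dist z x \<le> s * (norm u + norm v) \<and> F y = G z"
    if s: "s > 0" for s
  proof -
    obtain a b where ab: "0 < a" "a < s" "0 < b" "b < s"
      "f (x + s *\<^sub>R u + s *\<^sub>R v) - f (x + s *\<^sub>R u) - f (x + s *\<^sub>R v) + f x
      = s * s * dderiv (\<lambda>y. dderiv f y u) (x + a *\<^sub>R u + b *\<^sub>R v) v"
      using second_difference_mvt[OF f s] by blast
    obtain c d where cd: "0 < c" "c < s" "0 < d" "d < s"
      "f (x + s *\<^sub>R v + s *\<^sub>R u) - f (x + s *\<^sub>R v) - f (x + s *\<^sub>R u) + f x
      = s * s * dderiv (\<lambda>y. dderiv f y v) (x + c *\<^sub>R v + d *\<^sub>R u) u"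
      using second_difference_mvt[OF f s] by blast
    have "s * s * F (x + a *\<^sub>R u + b *\<^sub>R v) = s * s * G (x + c *\<^sub>R v + d *\<^sub>R u)"
      unfolding F_def G_def ab(5)[symmetric] cd(5)[symmetric] by (simp add: add.commute add.left_commute)
    then have "F (x + a *\<^sub>R u + b *\<^sub>R v) = G (x + c *\<^sub>R v + d *\<^sub>R u)" using s by simp
    moreover have "norm (a *\<^sub>R u + b *\<^sub>R v) \<le> s * (norm u + norm v)" "norm (c *\<^sub>R v + d *\<^sub>R u) \<le> s * (norm u + norm v)"
      using ab cd add_mono[of "a * norm u" "s * norm u" "b * norm v" "s * norm v"]
        add_mono[of "d * norm u" "s * norm u" "c * norm v" "s * norm v"]
      by (auto intro!: order_trans[OF norm_triangle_ineq] simp: distrib_left mult_right_mono add.commute)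
    ultimately show ?thesis
      by (metis (no_types, lifting) add.assoc add_diff_cancel_left' dist_norm)
  qed
  show ?thesis
  proof (rule ccontr)
    assume "\<not> ?thesis"
    then have "F x \<noteq> G x" by (simp add: F_def G_def)
    define e where "e = dist (F x) (G x) / 2"
    have e: "e > 0" using \<open>F x \<noteq> G x\<close> by (simp add: e_def)
    obtain d1 d2 where d: "d1 > 0" "d2 > 0" "\<And>y. dist y x < d1 \<Longrightarrow> dist (F y) (F x) < e"
      "\<And>y. dist y x < d2 \<Longrightarrow> dist (G y) (G x) < e"
      using cont e unfolding continuous_at_eps_delta by metis
    define n where "n = norm u + norm v + 1"
    have n: "n > 0" "norm u + norm v < n" by (auto simp: n_def add_nonneg_pos)
    define s where "s = min d1 d2 / n"
    have s: "s > 0" using d n by (simp add: s_def)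
    then have "s * (norm u + norm v) < s * n" using n by simp
    also have "s * n = min d1 d2" using n by (simp add: s_def)
    finally obtain y z where "dist (F y) (F x) < e" "dist (G z) (G x) < e" "F y = G z"
      using near[OF s] d by (metis le_less_trans min_less_iff_conj)
    then have "dist (F x) (G x) < 2 * e" by (metis dist_commute dist_triangle_less_add mult_2)
    then show False by (simp add: e_def)
  qed
qed

lemma dderiv_commute:
  fixes f :: "'a::euclidean_space \<Rightarrow> complex"
  assumes f: "smooth_on UNIV f"
  shows "dderiv (\<lambda>y. dderiv f y u) x v = dderiv (\<lambda>y. dderiv f y v) x u"
proof -
  have *: "L (dderiv (\<lambda>y. dderiv f y u) x v) = L (dderiv (\<lambda>y. dderiv f y v) x u)"
    if L: "bounded_linear L" for L :: "complex \<Rightarrow> real"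
  proof -
    have c: "dderiv (\<lambda>y. L (g y)) y w = L (dderiv g y w)" if "smooth_on UNIV g" for g :: "'a \<Rightarrow> complex" and y w
      by (rule dderivI) (auto intro!: bounded_linear.has_derivative[OF L] smooth_on_has_derivative[OF that])
    show ?thesis
      using dderiv_commute_real[OF smooth_on_bounded_linear[OF open_UNIV L f], of u x v]
      by (simp add: c f smooth_on_dderiv)
  qed
  show ?thesis
    by (rule complex_eqI) (intro *[OF bounded_linear_Re] *[OF bounded_linear_Im])+
qed

text \<open>Continuity of the candidates on the finitely many basis vectors bounds
  \<open>\<beta> y - \<beta> x\<close> uniformly near \<open>x\<close>. The mean value inequality
  along the segment from \<open>x\<close> then controls the remainder.\<close>

lemma has_derivative_from_directional:
  fixes f :: "'a::euclidean_space \<Rightarrow> 'b::real_normed_vector"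
  assumes U: "open U" "x \<in> U" and lin: "\<And>y. y \<in> U \<Longrightarrow> linear (\<beta> y)"
    and cont: "\<And>v. continuous_on U (\<lambda>y. \<beta> y v)"
    and dir: "\<And>y v. y \<in> U \<Longrightarrow> ((\<lambda>t. f (y + t *\<^sub>R v)) has_vector_derivative \<beta> y v) (at 0)"
  shows "(f has_derivative \<beta> x) (at x)"
  unfolding has_derivative_at_alt
proof (intro conjI allI impI)
  show "bounded_linear (\<beta> x)" using lin[OF U(2)] by (simp add: linear_conv_bounded_linear)
  fix e :: real assume e: "0 < e"
  define n where "n = real DIM('a)"
  have n: "n > 0" by (simp add: n_def)
  obtain r where r: "r > 0" "ball x r \<subseteq> U" using U openE by blast
  have "\<exists>d>0. \<forall>y. dist y x < d \<longrightarrow> dist (\<beta> y b) (\<beta> x b) < e / n" for b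
    using cont[of b] U e n unfolding continuous_on_eq_continuous_at[OF U(1)] continuous_at_eps_delta
    by (meson divide_pos_pos)
  then obtain d where d: "\<And>b. d b > 0" "\<And>b y. dist y x < d b \<Longrightarrow> dist (\<beta> y b) (\<beta> x b) < e / n"
    by metis
  define D where "D = min r (Min (d ` Basis))"
  have D: "D > 0" using d r by (simp add: D_def)
  have \<beta>: "norm (\<beta> y w - \<beta> x w) \<le> e * norm w" if y: "dist y x < D" for y w
  proof -
    have "y \<in> U" using y r by (auto simp: D_def dist_commute)
    then have lin': "linear (\<lambda>w. \<beta> y w - \<beta> x w)" using lin U(2) by (intro linear_compose_sub) auto
    have "\<beta> y w - \<beta> x w = (\<Sum>b\<in>Basis. (w \<bullet> b) *\<^sub>R (\<beta> y b - \<beta> x b))"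
      using linear_sum[OF lin', of "\<lambda>b. (w \<bullet> b) *\<^sub>R b" Basis] linear_cmul[OF lin']
      by (simp add: euclidean_representation)
    also have "norm \<dots> \<le> (\<Sum>b\<in>(Basis::'a set). norm w * (e / n))"
    proof (rule sum_norm_le)
      fix b :: 'a assume b: "b \<in> Basis"
      then have "D \<le> d b" by (simp add: D_def min.coboundedI2)
      then have "norm (\<beta> y b - \<beta> x b) \<le> e / n" using d(2)[of y b] y by (simp add: dist_norm)
      then show "norm ((w \<bullet> b) *\<^sub>R (\<beta> y b - \<beta> x b)) \<le> norm w * (e / n)"
        using mult_mono[OF Basis_le_norm[OF b, of w], of "norm (\<beta> y b - \<beta> x b)" "e / n"] by simp
    qed
    also have "\<dots> = e * norm w" using n by (simp add: n_def)
    finally show ?thesis .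
  qed
  have "norm (f y - f x - \<beta> x (y - x)) \<le> e * norm (y - x)" if y: "norm (y - x) < D" for y
  proof -
    define w where "w = y - x"
    define p where "p t = f (x + t *\<^sub>R w) - t *\<^sub>R \<beta> x w" for t
    have in_ball: "dist (x + t *\<^sub>R w) x < D" if "t \<in> {0..1}" for t
    proof -
      have "\<bar>t\<bar> * norm w \<le> norm w" using that by (simp add: mult_left_le_one_le)
      then show ?thesis using y by (simp add: dist_norm w_def[symmetric])
    qed
    have p: "(p has_vector_derivative (\<beta> (x + t *\<^sub>R w) w - \<beta> x w)) (at t within {0..1})" if t: "t \<in> {0..1}" for t
    proof -
      have "x + t *\<^sub>R w \<in> U" using in_ball[OF t] r by (auto simp: D_def dist_commute)
      have sh: "((\<lambda>s::real. s - t) has_derivative (\<lambda>r. r)) (at t)" by (auto intro!: derivative_eq_intros)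
      from dir[OF \<open>x + t *\<^sub>R w \<in> U\<close>, of w]
      have "((\<lambda>s. f (x + (t + s) *\<^sub>R w)) has_vector_derivative \<beta> (x + t *\<^sub>R w) w) (at 0)"
        by (simp add: scaleR_add_left add.assoc)
      then have "((\<lambda>s. f (x + s *\<^sub>R w)) has_vector_derivative \<beta> (x + t *\<^sub>R w) w) (at t)"
        using has_derivative_compose[of "\<lambda>s. s - t" "\<lambda>r. r" t UNIV "\<lambda>s. f (x + (t + s) *\<^sub>R w)" "\<lambda>r. r *\<^sub>R \<beta> (x + t *\<^sub>R w) w"]
        by (simp add: has_vector_derivative_def sh)
      moreover have "((\<lambda>s. s *\<^sub>R \<beta> x w) has_vector_derivative \<beta> x w) (at t)"
        by (auto intro!: derivative_eq_intros simp: has_vector_derivative_def)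
      ultimately show ?thesis unfolding p_def
        by (rule has_vector_derivative_at_within[OF has_vector_derivative_diff])
    qed
    have "norm (p 1 - p 0) \<le> (e * norm w) * norm (1 - 0 :: real)"
    proof (rule differentiable_bound[of "{0..1}" p "\<lambda>t s. s *\<^sub>R (\<beta> (x + t *\<^sub>R w) w - \<beta> x w)"])
      show "(p has_derivative (\<lambda>s. s *\<^sub>R (\<beta> (x + t *\<^sub>R w) w - \<beta> x w))) (at t within {0..1})"
        if "t \<in> {0..1}" for t using p[OF that] by (simp add: has_vector_derivative_def)
      show "onorm (\<lambda>s. s *\<^sub>R (\<beta> (x + t *\<^sub>R w) w - \<beta> x w)) \<le> e * norm w" if "t \<in> {0..1}" for t
        by (rule onorm_le) (use \<beta>[OF in_ball[OF that], of w] in \<open>simp add: mult.commute mult_left_mono\<close>)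
    qed auto
    then show ?thesis by (simp add: p_def w_def algebra_simps)
  qed
  then show "\<exists>d>0. \<forall>y. norm (y - x) < d \<longrightarrow> norm (f y - f x - \<beta> x (y - x)) \<le> e * norm (y - x)"
    using D by blast
qed

text \<open>The primitive integrates \<open>\<beta>\<close> along the segment from a base point
  \<open>c\<close>. After differentiation under the integral, closedness turns the integrand into
  the derivative of \<open>t *\<^sub>R \<beta> (c + t *\<^sub>R (x - c)) v\<close> with respect to
  \<open>t\<close>, so only the end point contributes.\<close>

lemma Poincare_1form:
  fixes \<beta> :: "'a::euclidean_space \<Rightarrow> 'a \<Rightarrow> complex"
  assumes U: "open U" "convex U" "U \<noteq> {}" and lin: "\<And>y. y \<in> U \<Longrightarrow> linear (\<beta> y)"
    and sm: "\<And>v. smooth_on U (\<lambda>y. \<beta> y v)"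
    and closed: "\<And>y u v. y \<in> U \<Longrightarrow> dderiv (\<lambda>y. \<beta> y v) y u = dderiv (\<lambda>y. \<beta> y u) y v"
  obtains \<phi> where "\<And>x. x \<in> U \<Longrightarrow> (\<phi> has_derivative \<beta> x) (at x)"
proof -
  obtain c where c: "c \<in> U" using U by blast
  have rep: "\<beta> y w = (\<Sum>b\<in>Basis. (w \<bullet> b) *\<^sub>R \<beta> y b)" if "y \<in> U" for y w
    using linear_sum[OF lin[OF that], of "\<lambda>b. (w \<bullet> b) *\<^sub>R b" Basis] linear_cmul[OF lin[OF that]]
    by (simp add: euclidean_representation)
  define \<phi> where "\<phi> x = integral (cbox 0 1) (\<lambda>t::real. \<Sum>b\<in>Basis. ((x - c) \<bullet> b) *\<^sub>R \<beta> (c + t *\<^sub>R (x - c)) b)" for x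
  have inU: "c + t *\<^sub>R (y - c) \<in> U" if "y \<in> U" "t \<in> {0..1}" for y t
  proof -
    have "(1 - t) *\<^sub>R c + t *\<^sub>R y \<in> U" using U(2) c that by (intro convexD) auto
    then show ?thesis by (simp add: algebra_simps)
  qed
  have cont: "continuous_on U (\<lambda>y. \<beta> y v)" "continuous_on U (\<lambda>y. dderiv (\<lambda>y. \<beta> y v) y w)" for v w
    using sm smooth_on_continuous smooth_on_dderiv by blast+
  have dir: "((\<lambda>s. \<phi> (x + s *\<^sub>R v)) has_vector_derivative \<beta> x v) (at 0)" if x: "x \<in> U" for x v
  proof -
    obtain r where r: "r > 0" "ball x r \<subseteq> U" using U(1) x openE by blast
    define \<delta> where "\<delta> = r / (norm v + 1)"
    have \<delta>: "\<delta> > 0" using r by (simp add: \<delta>_def add_nonneg_pos)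
    have xs: "x + s *\<^sub>R v \<in> U" if "s \<in> ball 0 \<delta>" for s :: real
    proof -
      have "\<bar>s\<bar> * norm v \<le> \<bar>s\<bar> * (norm v + 1)" by (simp add: mult_left_mono)
      also have "\<dots> < \<delta> * (norm v + 1)" using that by (intro mult_strict_right_mono) (auto simp: add_nonneg_pos)
      also have "\<dots> = r" by (simp add: \<delta>_def add_nonneg_eq_0_iff)
      finally have "norm (s *\<^sub>R v) < r" by simp
      then show ?thesis using r by (auto simp: dist_norm)
    qed
    define \<gamma> where "\<gamma> s t = c + t *\<^sub>R (x + s *\<^sub>R v - c)" for s t :: real
    have \<gamma>U: "\<gamma> s t \<in> U" if "s \<in> ball 0 \<delta>" "t \<in> {0..1}" for s t
      using inU[OF xs] that by (simp add: \<gamma>_def)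
    define F where "F s t = (\<Sum>b\<in>Basis. ((x + s *\<^sub>R v - c) \<bullet> b) *\<^sub>R \<beta> (\<gamma> s t) b)" for s t
    define F' where "F' s t = (\<Sum>b\<in>Basis. ((x + s *\<^sub>R v - c) \<bullet> b) *\<^sub>R (t *\<^sub>R dderiv (\<lambda>y. \<beta> y b) (\<gamma> s t) v)
        + (v \<bullet> b) *\<^sub>R \<beta> (\<gamma> s t) b)" for s t
    have bd: "((\<lambda>y. \<beta> y b) has_derivative dderiv (\<lambda>y. \<beta> y b) y) (at y)" if "y \<in> U" for y b
      using smooth_on_has_derivative[OF sm that] .
    have \<gamma>cont: "continuous_on S (\<lambda>z. \<gamma> (fst z) (snd z))" for S :: "(real \<times> real) set"
      unfolding \<gamma>_def by (intro continuous_intros)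
    have "((\<lambda>s. integral (cbox 0 1) (F s)) has_vector_derivative integral (cbox 0 1) (F' 0)) (at 0 within ball 0 \<delta>)"
    proof (rule leibniz_rule_vector_derivative)
      fix s t :: real assume st: "s \<in> ball 0 \<delta>" "t \<in> cbox 0 (1::real)"
      have "((\<lambda>s. \<beta> (\<gamma> s t) b) has_vector_derivative t *\<^sub>R dderiv (\<lambda>y. \<beta> y b) (\<gamma> s t) v) (at s within ball 0 \<delta>)" for b
      proof -
        have eq: "\<gamma> s t = (c + t *\<^sub>R (x - c)) + s *\<^sub>R (t *\<^sub>R v)" for s by (simp add: \<gamma>_def algebra_simps)
        have "\<gamma> s t \<in> U" using \<gamma>U st by simp
        then show ?thesis
          using has_vector_derivative_line[where f = "\<lambda>y. \<beta> y b" and x = "c + t *\<^sub>R (x - c)" and v = "t *\<^sub>R v" and t = s and S = "ball 0 \<delta>", OF bd]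
          by (simp add: eq linear_cmul[OF has_derivative_linear[OF bd]])
      qed
      then show "((\<lambda>s. F s t) has_vector_derivative F' s t) (at s within ball 0 \<delta>)"
        unfolding F_def F'_def
        by (intro has_vector_derivative_sum has_vector_derivative_scaleR)
          (auto intro!: derivative_eq_intros simp: inner_add_left inner_diff_left)
    next
      fix s :: real assume s: "s \<in> ball 0 \<delta>"
      have "continuous_on (cbox 0 1) (\<lambda>t. \<gamma> s t)" unfolding \<gamma>_def by (intro continuous_intros)
      then have "continuous_on (cbox 0 1) (\<lambda>t. \<beta> (\<gamma> s t) b)" for b
        by (rule continuous_on_compose2[OF cont(1)]) (use \<gamma>U s in auto)
      then show "F s integrable_on cbox 0 1"
        unfolding F_def by (intro integrable_continuous continuous_intros)
    next
      have "continuous_on (ball 0 \<delta> \<times> cbox 0 1) (\<lambda>z. \<beta> (\<gamma> (fst z) (snd z)) b)"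
        "continuous_on (ball 0 \<delta> \<times> cbox 0 1) (\<lambda>z. dderiv (\<lambda>y. \<beta> y b) (\<gamma> (fst z) (snd z)) v)" for b
        by (rule continuous_on_compose2[OF cont(1) \<gamma>cont] continuous_on_compose2[OF cont(2) \<gamma>cont], use \<gamma>U in auto)+
      then show "continuous_on (ball 0 \<delta> \<times> cbox 0 1) (\<lambda>(s, t). F' s t)"
        unfolding F'_def split_beta by (intro continuous_intros)
    qed (use \<delta> in auto)
    moreover have "integral (cbox 0 1) (F s) = \<phi> (x + s *\<^sub>R v)" for s
      by (simp add: \<phi>_def F_def[abs_def] \<gamma>_def)
    moreover have "integral (cbox 0 1) (F' 0) = \<beta> x v"
    proof -
      have F'0: "F' 0 t = t *\<^sub>R dderiv (\<lambda>y. \<beta> y v) (c + t *\<^sub>R (x - c)) (x - c) + \<beta> (c + t *\<^sub>R (x - c)) v"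
        if t: "t \<in> {0..1}" for t
      proof -
        let ?y = "c + t *\<^sub>R (x - c)"
        have y: "?y \<in> U" using inU[OF x t] .
        have "linear (dderiv (\<lambda>y. \<beta> y v) ?y)" using bd[OF y] has_derivative_linear by blast
        then have "dderiv (\<lambda>y. \<beta> y v) ?y (x - c) = (\<Sum>b\<in>Basis. ((x - c) \<bullet> b) *\<^sub>R dderiv (\<lambda>y. \<beta> y v) ?y b)"
          using linear_sum[of "dderiv (\<lambda>y. \<beta> y v) ?y" "\<lambda>b. ((x - c) \<bullet> b) *\<^sub>R b" Basis] linear_cmul[of "dderiv (\<lambda>y. \<beta> y v) ?y"]
          by (simp add: euclidean_representation)
        then show ?thesis
          unfolding F'_def \<gamma>_def using rep[OF y, of v]
          by (simp add: sum.distrib scaleR_sum_right closed[OF y, of v] mult.commute)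
      qed
      have "((\<lambda>t. t *\<^sub>R \<beta> (c + t *\<^sub>R (x - c)) v) has_vector_derivative
          (t *\<^sub>R dderiv (\<lambda>y. \<beta> y v) (c + t *\<^sub>R (x - c)) (x - c) + 1 *\<^sub>R \<beta> (c + t *\<^sub>R (x - c)) v)) (at t within {0..1})"
        if t: "t \<in> {0..1}" for t
        by (intro has_vector_derivative_scaleR has_vector_derivative_line bd inU[OF x t]) (auto intro!: derivative_eq_intros)
      then have "((\<lambda>t. t *\<^sub>R dderiv (\<lambda>y. \<beta> y v) (c + t *\<^sub>R (x - c)) (x - c) + \<beta> (c + t *\<^sub>R (x - c)) v)
          has_integral (1 *\<^sub>R \<beta> (c + 1 *\<^sub>R (x - c)) v - 0 *\<^sub>R \<beta> (c + 0 *\<^sub>R (x - c)) v)) {0..1}"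
        using fundamental_theorem_of_calculus[of 0 1 "\<lambda>t. t *\<^sub>R \<beta> (c + t *\<^sub>R (x - c)) v"] by simp
      then have "(F' 0 has_integral \<beta> x v) {0..1}"
        by (subst has_integral_cong[OF F'0]) auto
      then show ?thesis by (simp add: integral_unique)
    qed
    ultimately show ?thesis
      using at_within_open[of "0::real" "ball 0 \<delta>"] \<delta> by simp
  qed
  show ?thesis
  proof (rule that)
    show "(\<phi> has_derivative \<beta> x) (at x)" if "x \<in> U" for x
      by (rule has_derivative_from_directional[OF U(1) that lin cont(1) dir])
  qed
qed

section \<open>Parallel frames of line bundles\<close>

definition ee :: "real \<Rightarrow> complex" where "ee t = cis (2 * pi * t)"

lemma ee_add: "ee (s + t) = ee s * ee t"
  by (simp add: ee_def cis_mult distrib_left)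

lemma ee_0 [simp]: "ee 0 = 1"
  by (simp add: ee_def)

lemma norm_ee [simp]: "norm (ee t) = 1"
  by (simp add: ee_def)

lemma ee_nonzero [simp]: "ee t \<noteq> 0"
  by (simp add: ee_def)

lemma cnj_ee: "cnj (ee t) = ee (- t)"
  by (simp add: ee_def cis_cnj)

lemma ee_power: "ee t ^ n = ee (of_nat n * t)"
  by (simp add: ee_def Complex.DeMoivre mult_ac)

lemma ee_Ints: "t \<in> \<int> \<Longrightarrow> ee t = 1"
  by (auto simp: ee_def cis_multiple_2pi)

lemma ee_surj: "norm z = 1 \<Longrightarrow> \<exists>t. z = ee t"
proof -
  assume "norm z = 1"
  then have "z = cis (Arg z)" using rcis_cmod_Arg[of z] by (simp add: rcis_def)
  then show ?thesis by (intro exI[of _ "Arg z / (2 * pi)"]) (simp add: ee_def)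
qed

lemma ee_eq_exp: "ee t = exp (2 * pi * \<i> * of_real t)"
  by (simp add: ee_def cis_conv_exp mult_ac)

lemma ee_has_derivative:
  assumes "(f has_derivative f') (at x within S)"
  shows "((\<lambda>x. ee (f x)) has_derivative (\<lambda>v. (2 * pi * \<i> * of_real (f' v)) * ee (f x))) (at x within S)"
proof -
  have e: "(exp has_derivative (*) (exp z)) (at z)" for z :: complex
    using DERIV_exp[of z] by (simp add: has_field_derivative_def)
  have "((\<lambda>x. 2 * pi * \<i> * complex_of_real (f x)) has_derivative (\<lambda>v. 2 * pi * \<i> * complex_of_real (f' v))) (at x within S)"
    by (intro has_derivative_mult_right has_derivative_of_real assms)
  from has_derivative_compose[OF this e] show ?thesis
    unfolding ee_eq_exp by (simp add: mult.commute)
qed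

lemma cnj_cancel: "norm z = 1 \<Longrightarrow> z * cnj z = 1" "norm z = 1 \<Longrightarrow> cnj z * z = 1"
  using complex_norm_square[of z] by (auto simp: mult.commute)

text \<open>A flat unitary frame of the bundle obtained by tensoring with the trivial bundle with connection
  \<open>- \<alpha>\<close>; it is not periodic.\<close>

definition parallel_frame ::
  "('i, 'm::finite) line_bundle \<Rightarrow> ('i, 'm) connection_forms \<Rightarrow> ('m euc \<Rightarrow> 'm euc \<Rightarrow> complex)
    \<Rightarrow> 'm euc set \<Rightarrow> ('i \<Rightarrow> 'm euc \<Rightarrow> complex) \<Rightarrow> bool" where
  "parallel_frame L \<theta> \<alpha> U g \<longleftrightarrow> (\<forall>i. \<forall>x\<in>U \<inter> patch L i. norm (g i x) = 1 \<and>
     (g i has_derivative (\<lambda>v. (\<alpha> x v - \<theta> i x v) * g i x)) (at x) \<and>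
     (\<forall>j. x \<in> patch L j \<longrightarrow> g i x = trans L i j x * g j x))"

lemma parallel_frameD:
  assumes "parallel_frame L \<theta> \<alpha> U g" "x \<in> U" "x \<in> patch L i"
  shows "norm (g i x) = 1" "(g i has_derivative (\<lambda>v. (\<alpha> x v - \<theta> i x v) * g i x)) (at x)"
    "\<And>j. x \<in> patch L j \<Longrightarrow> g i x = trans L i j x * g j x"
  using assms unfolding parallel_frame_def by blast+

lemma parallel_frame_subset: "parallel_frame L \<theta> \<alpha> U g \<Longrightarrow> V \<subseteq> U \<Longrightarrow> parallel_frame L \<theta> \<alpha> V g"
  unfolding parallel_frame_def by blast

lemma parallel_frame_scale:
  assumes "parallel_frame L \<theta> \<alpha> U g" "norm c = 1"
  shows "parallel_frame L \<theta> \<alpha> U (\<lambda>i x. c * g i x)"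
  unfolding parallel_frame_def
proof (intro allI ballI conjI impI)
  fix i x assume x: "x \<in> U \<inter> patch L i"
  note P = parallel_frameD[OF assms(1) IntD1[OF x] IntD2[OF x]]
  show "norm (c * g i x) = 1" using P x assms(2) by (simp add: norm_mult)
  show "((\<lambda>x. c * g i x) has_derivative (\<lambda>v. (\<alpha> x v - \<theta> i x v) * (c * g i x))) (at x)"
    using has_derivative_mult_right[OF P(2), of c] x by (simp add: mult_ac)
  fix j assume "x \<in> patch L j"
  then show "c * g i x = trans L i j x * (c * g j x)" using P(3)[of j] x by simp
qed

lemma parallel_frame_cong:
  assumes g: "parallel_frame L \<theta> \<alpha> U g" and op: "open U" "\<And>i. open (patch L i)"
    and eq: "\<And>i x. x \<in> U \<Longrightarrow> x \<in> patch L i \<Longrightarrow> g i x = g' i x"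
  shows "parallel_frame L \<theta> \<alpha> U g'"
  unfolding parallel_frame_def
proof (intro allI ballI conjI impI)
  fix i x assume x: "x \<in> U \<inter> patch L i"
  note P = parallel_frameD[OF g IntD1[OF x] IntD2[OF x]]
  show "norm (g' i x) = 1" using P x eq by simp
  have e: "g i x = g' i x" using x eq by simp
  show "(g' i has_derivative (\<lambda>v. (\<alpha> x v - \<theta> i x v) * g' i x)) (at x)"
    unfolding e[symmetric]
    by (rule has_derivative_transform_within_open[of "g i" _ _ _ "U \<inter> patch L i"]) (use P x op eq in auto)
  fix j assume "x \<in> patch L j"
  then show "g' i x = trans L i j x * g' j x" using P(3)[of j] x eq by simp
qed

context
  fixes L :: "('i, 'm::finite) line_bundle" and \<theta> :: "('i, 'm) connection_forms"
    and \<alpha> :: "'m euc \<Rightarrow> 'm euc \<Rightarrow> complex" and \<omega> :: "'m bilinear_field"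
  assumes bndl: "hermitian_line_bundle L" and conn: "hermitian_connection L \<theta>"
    and curv: "\<And>i x u v. x \<in> patch L i \<Longrightarrow> curvature \<theta> i x u v = - 2 * pi * \<i> * \<omega> x u v"
    and alpha: "\<And>v. smooth_on UNIV (\<lambda>x. \<alpha> x v)" "\<And>x. linear (\<alpha> x)" "\<And>x v. Re (\<alpha> x v) = 0"
    "\<And>x u v. dderiv (\<lambda>y. \<alpha> y v) x u - dderiv (\<lambda>y. \<alpha> y u) x v = - 2 * pi * \<i> * \<omega> x u v"
begin

lemma open_patch: "open (patch L i)"
  using bndl unfolding hermitian_line_bundle_def by blast

lemma patch_cover: "\<exists>i. x \<in> patch L i"
  using bndl unfolding hermitian_line_bundle_def by blast

lemma norm_trans: "x \<in> patch L i \<Longrightarrow> x \<in> patch L j \<Longrightarrow> norm (trans L i j x) = 1"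
  using bndl unfolding hermitian_line_bundle_def by blast

lemma trans_cocycle:
  "x \<in> patch L i \<Longrightarrow> x \<in> patch L j \<Longrightarrow> x \<in> patch L k \<Longrightarrow> trans L i j x * trans L j k x = trans L i k x"
  using bndl unfolding hermitian_line_bundle_def by blast

lemma trans_derivative:
  "x \<in> patch L i \<Longrightarrow> x \<in> patch L j \<Longrightarrow> (trans L i j has_derivative dderiv (trans L i j) x) (at x)"
  using bndl unfolding hermitian_line_bundle_def by (blast intro: smooth_on_has_derivative)

lemma connection_change: "x \<in> patch L i \<Longrightarrow> x \<in> patch L j \<Longrightarrow>
   \<theta> j x v = \<theta> i x v + dderiv (trans L i j) x v / trans L i j x"
  using conn unfolding hermitian_connection_def by blast

lemma connection_props:
  "smooth_on (patch L i) (\<lambda>x. \<theta> i x v)" "x \<in> patch L i \<Longrightarrow> linear (\<theta> i x)" "x \<in> patch L i \<Longrightarrow> Re (\<theta> i x v) = 0"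
  using conn unfolding hermitian_connection_def by blast+

text \<open>Equal curvatures make \<open>\<alpha> - \<theta> i\<close> closed on a ball inside one
  patch. The exponential of a primitive is a frame there, unitary because both forms are imaginary;
  transition functions carry it to the other patches, and the cocycle rule makes this
  consistent.\<close>

lemma parallel_frame_local:
  obtains U g where "open U" "x0 \<in> U" "parallel_frame L \<theta> \<alpha> U g"
proof -
  obtain i where i: "x0 \<in> patch L i" using patch_cover by blast
  obtain r where r: "r > 0" "ball x0 r \<subseteq> patch L i" using open_patch i openE by blast
  define U where "U = ball x0 r"
  have U: "open U" "convex U" "U \<noteq> {}" "x0 \<in> U" "U \<subseteq> patch L i" using r by (auto simp: U_def)
  have d\<theta>: "(\<lambda>y. \<theta> i y v) differentiable (at y)" if "y \<in> U" for y v
    using smooth_on_differentiable[OF connection_props(1)] U(5) that by blast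
  have d\<alpha>: "(\<lambda>y. \<alpha> y v) differentiable (at y)" for y v
    using smooth_on_differentiable[OF alpha(1)] by blast
  have dd: "dderiv (\<lambda>y. \<alpha> y v - \<theta> i y v) y u = dderiv (\<lambda>y. \<alpha> y v) y u - dderiv (\<lambda>y. \<theta> i y v) y u"
    if "y \<in> U" for y u v
    by (rule dderivI) (intro has_derivative_diff has_dderiv d\<theta> d\<alpha> that)
  obtain \<phi> where \<phi>: "\<And>x. x \<in> U \<Longrightarrow> (\<phi> has_derivative (\<lambda>v. \<alpha> x v - \<theta> i x v)) (at x)"
  proof (rule Poincare_1form[OF U(1,2,3), of "\<lambda>x v. \<alpha> x v - \<theta> i x v"])
    show "linear (\<lambda>v. \<alpha> y v - \<theta> i y v)" if "y \<in> U" for y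
      using that alpha(2) connection_props(2) U(5) by (intro linear_compose_sub) auto
    show "smooth_on U (\<lambda>y. \<alpha> y v - \<theta> i y v)" for v
    proof -
      have "smooth_on U (\<lambda>y. \<alpha> y v + - \<theta> i y v)"
        by (intro smooth_on_add smooth_on_bounded_linear[OF U(1) bounded_linear_minus[OF bounded_linear_ident]] U)
          (use smooth_on_subset[OF alpha(1)] smooth_on_subset[OF connection_props(1) U(5)] in auto)
      then show ?thesis by simp
    qed
    show "dderiv (\<lambda>y. \<alpha> y v - \<theta> i y v) y u = dderiv (\<lambda>y. \<alpha> y u - \<theta> i y u) y v" if "y \<in> U" for y u v
    proof -
      have "y \<in> patch L i" using that U by auto
      then have "dderiv (\<lambda>y. \<alpha> y v) y u - dderiv (\<lambda>y. \<alpha> y u) y v = dderiv (\<lambda>y. \<theta> i y v) y u - dderiv (\<lambda>y. \<theta> i y u) y v"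
        using curv[of y i u v] alpha(4)[of v y u] unfolding curvature_def by simp
      then show ?thesis unfolding dd[OF that] by algebra
    qed
  qed (rule that)
  define G where "G x = exp (\<phi> x - \<phi> x0)" for x
  have G: "(G has_derivative (\<lambda>v. (\<alpha> x v - \<theta> i x v) * G x)) (at x)" if "x \<in> U" for x
  proof -
    have e: "(exp has_derivative (*) (exp z)) (at z)" for z :: complex
      using DERIV_exp[of z] by (simp add: has_field_derivative_def)
    have "((\<lambda>x. \<phi> x - \<phi> x0) has_derivative (\<lambda>v. \<alpha> x v - \<theta> i x v)) (at x)"
      using has_derivative_diff[OF \<phi>[OF that] has_derivative_const] by simp
    from has_derivative_compose[OF this e] show ?thesis unfolding G_def by (simp add: mult.commute)
  qed
  have "((\<lambda>x. Re (\<phi> x)) has_derivative (\<lambda>v. 0)) (at x within U)" if "x \<in> U" for x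
    using bounded_linear.has_derivative[OF bounded_linear_Re \<phi>[OF that]] that U(5) alpha(3) connection_props(3)[of x i]
    by (auto intro: has_derivative_at_withinI simp: subset_iff)
  then have "Re (\<phi> x) = Re (\<phi> x0)" if "x \<in> U" for x
    using has_derivative_zero_unique[OF U(2), of "\<lambda>x. Re (\<phi> x)" x x0] that U(4) by blast
  then have nG: "norm (G x) = 1" if "x \<in> U" for x
    using that by (simp add: G_def)
  have "parallel_frame L \<theta> \<alpha> U (\<lambda>j x. trans L j i x * G x)"
    unfolding parallel_frame_def
  proof (intro allI ballI conjI impI)
    fix j x assume "x \<in> U \<inter> patch L j"
    then have x: "x \<in> U" "x \<in> patch L j" "x \<in> patch L i" using U by auto
    show "norm (trans L j i x * G x) = 1" using nG norm_trans x by (simp add: norm_mult)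
    have nz: "trans L j i x \<noteq> 0" using norm_trans x by fastforce
    show "((\<lambda>x. trans L j i x * G x) has_derivative (\<lambda>v. (\<alpha> x v - \<theta> j x v) * (trans L j i x * G x))) (at x)"
      by (rule has_derivative_eq_rhs[OF has_derivative_mult[OF trans_derivative[OF x(2,3)] G[OF x(1)]]])
        (use nz in \<open>simp add: connection_change[OF x(2,3)] field_simps fun_eq_iff\<close>)
    fix k assume "x \<in> patch L k"
    then show "trans L j i x * G x = trans L j k x * (trans L k i x * G x)"
      using trans_cocycle[OF x(2) _ x(3), of k] by (simp add: mult.assoc[symmetric])
  qed
  then show ?thesis using that U by blast
qed

text \<open>In \<open>g i x * cnj (g' i x)\<close> the transition functions cancel, so the quotient
  is a function on \<open>U\<close>. The two imaginary logarithmic derivatives cancel as well, and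
  convexity makes a function with zero derivative constant.\<close>

lemma parallel_frame_ratio:
  assumes g: "parallel_frame L \<theta> \<alpha> U g" "parallel_frame L \<theta> \<alpha> U g'" and U: "open U" "convex U"
  obtains c where "norm c = 1" "\<And>i x. x \<in> U \<Longrightarrow> x \<in> patch L i \<Longrightarrow> g i x = c * g' i x"
proof (cases "U = {}")
  case True then show ?thesis using that[of 1] by simp
next
  case False
  then obtain x0 where x0: "x0 \<in> U" by blast
  define \<iota> where "\<iota> x = (SOME i. x \<in> patch L i)" for x
  have \<iota>: "x \<in> patch L (\<iota> x)" for x unfolding \<iota>_def using patch_cover by (rule someI_ex)
  define \<rho> where "\<rho> x = g (\<iota> x) x * cnj (g' (\<iota> x) x)" for x
  have indep: "\<rho> x = g i x * cnj (g' i x)" if "x \<in> U" "x \<in> patch L i" for x i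
  proof -
    have "\<rho> x = trans L (\<iota> x) i x * g i x * cnj (trans L (\<iota> x) i x * g' i x)"
      unfolding \<rho>_def using parallel_frameD(3)[OF g(1) that(1) \<iota> that(2)] parallel_frameD(3)[OF g(2) that(1) \<iota> that(2)] by simp
    also have "\<dots> = (trans L (\<iota> x) i x * cnj (trans L (\<iota> x) i x)) * (g i x * cnj (g' i x))" by simp
    also have "\<dots> = g i x * cnj (g' i x)" using cnj_cancel(1)[OF norm_trans[OF \<iota> that(2)]] by simp
    finally show ?thesis .
  qed
  have "(\<rho> has_derivative (\<lambda>v. 0)) (at x within U)" if x: "x \<in> U" for x
  proof -
    let ?i = "\<iota> x"
    note P = parallel_frameD(2)[OF g(1) x \<iota>] parallel_frameD(2)[OF g(2) x \<iota>]
    have re: "cnj (\<alpha> x v - \<theta> ?i x v) = - (\<alpha> x v - \<theta> ?i x v)" for v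
      using alpha(3)[of x v] connection_props(3)[OF \<iota>, of x v] by (simp add: complex_eq_iff)
    have "((\<lambda>x. g ?i x * cnj (g' ?i x)) has_derivative (\<lambda>v. g ?i x * cnj ((\<alpha> x v - \<theta> ?i x v) * g' ?i x)
        + (\<alpha> x v - \<theta> ?i x v) * g ?i x * cnj (g' ?i x))) (at x)"
      by (intro has_derivative_mult bounded_linear.has_derivative[OF bounded_linear_cnj] P)
    then have "((\<lambda>x. g ?i x * cnj (g' ?i x)) has_derivative (\<lambda>v. 0)) (at x)"
      by (rule has_derivative_eq_rhs) (simp only: complex_cnj_mult re fun_eq_iff, simp add: algebra_simps)
    then have "(\<rho> has_derivative (\<lambda>v. 0)) (at x)"
      by (rule has_derivative_transform_within_open[of _ _ _ _ "U \<inter> patch L ?i"])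
        (use U open_patch x \<iota> indep in auto)
    then show ?thesis by (rule has_derivative_at_withinI)
  qed
  then have c: "\<rho> x = \<rho> x0" if "x \<in> U" for x
    using has_derivative_zero_unique[OF U(2), of \<rho> x x0] that x0 by blast
  show ?thesis
  proof (rule that[of "\<rho> x0"])
    show "norm (\<rho> x0) = 1" unfolding \<rho>_def using parallel_frameD(1)[OF g(1) x0 \<iota>] parallel_frameD(1)[OF g(2) x0 \<iota>]
      by (simp add: norm_mult)
    fix i x assume x: "x \<in> U" "x \<in> patch L i"
    have "\<rho> x0 * g' i x = g i x * (cnj (g' i x) * g' i x)" using c[OF x(1)] indep[OF x] by simp
    then show "g i x = \<rho> x0 * g' i x" using cnj_cancel(2)[OF parallel_frameD(1)[OF g(2) x]] by simp
  qed
qed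

text \<open>Convex sets overlap in a convex set, where a single constant relates the frames; scaling
  one frame by it makes them agree.\<close>

lemma parallel_frame_glue:
  assumes g: "parallel_frame L \<theta> \<alpha> U g" "parallel_frame L \<theta> \<alpha> V g'"
    and UV: "open U" "convex U" "open V" "convex V"
  obtains k where "parallel_frame L \<theta> \<alpha> (U \<union> V) k"
proof -
  obtain c where c: "norm c = 1" "\<And>i x. x \<in> U \<inter> V \<Longrightarrow> x \<in> patch L i \<Longrightarrow> g i x = c * g' i x"
    using parallel_frame_ratio[of "U \<inter> V" g g'] parallel_frame_subset[OF g(1)] parallel_frame_subset[OF g(2)] UV
    by (metis convex_Int inf_le1 inf_le2 open_Int)
  define k where "k i x = (if x \<in> U then g i x else c * g' i x)" for i x
  have "parallel_frame L \<theta> \<alpha> U k"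
    by (rule parallel_frame_cong[OF g(1) UV(1) open_patch]) (simp add: k_def)
  moreover have "parallel_frame L \<theta> \<alpha> V k"
    by (rule parallel_frame_cong[OF parallel_frame_scale[OF g(2) c(1)] UV(3) open_patch]) (use c(2) in \<open>simp add: k_def\<close>)
  ultimately have "parallel_frame L \<theta> \<alpha> (U \<union> V) k" unfolding parallel_frame_def by blast
  then show ?thesis using that by blast
qed

text \<open>The neighbourhood of radius \<open>e\<close> of the segment from 0 to \<open>x\<close>.
  Tubes are convex and all contain the origin, so frames on two tubes can be compared there.\<close>

definition tube :: "'m euc \<Rightarrow> real \<Rightarrow> 'm euc set" where
  "tube x e = (\<Union>a\<in>closed_segment 0 x. \<Union>b\<in>ball 0 e. {a + b})"

lemma tube_props: "open (tube x e)" "convex (tube x e)" "e > 0 \<Longrightarrow> 0 \<in> tube x e" "ball x e \<subseteq> tube x e"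
proof -
  have eq: "tube x e = {a + b |a b. a \<in> closed_segment 0 x \<and> b \<in> ball 0 e}" unfolding tube_def by blast
  show "open (tube x e)" unfolding tube_def by (rule open_sums) simp
  show "convex (tube x e)" unfolding tube_def by (rule convex_sums) auto
  show "0 \<in> tube x e" if "e > 0" using that unfolding eq by force
  show "ball x e \<subseteq> tube x e"
  proof
    fix y assume "y \<in> ball x e"
    then have "x \<in> closed_segment 0 x" "y - x \<in> ball 0 e" "y = x + (y - x)" by (auto simp: dist_norm norm_minus_commute)
    then show "y \<in> tube x e" unfolding eq by blast
  qed
qed

text \<open>A Lebesgue number \<open>e\<close> of the cover of the segment by domains of local
  frames allows the frame to be continued along the segment in steps shorter than
  \<open>e / 2\<close>.\<close>

lemma parallel_frame_tube: "\<exists>e>0. \<exists>g. parallel_frame L \<theta> \<alpha> (tube x e) g"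
proof -
  define \<G> where "\<G> = {U. open U \<and> (\<exists>g. parallel_frame L \<theta> \<alpha> U g)}"
  have "closed_segment 0 x \<subseteq> \<Union>\<G>" 
  proof
    fix y :: "'m euc"
    obtain U g where "open U" "y \<in> U" "parallel_frame L \<theta> \<alpha> U g" using parallel_frame_local[of y] .
    then show "y \<in> \<Union>\<G>" unfolding \<G>_def by blast
  qed
  moreover have "open G" if "G \<in> \<G>" for G using that by (simp add: \<G>_def)
  ultimately obtain e where e: "e > 0" "\<And>y. y \<in> closed_segment 0 x \<Longrightarrow> \<exists>G\<in>\<G>. ball y e \<subseteq> G"
    using Heine_Borel_lemma[OF compact_segment, of 0 x \<G>] by metis
  have loc: "\<exists>g. parallel_frame L \<theta> \<alpha> (ball y e) g" if y: "y \<in> closed_segment 0 x" for y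
  proof -
    obtain G g where "ball y e \<subseteq> G" "parallel_frame L \<theta> \<alpha> G g" using e(2)[OF y] unfolding \<G>_def by auto
    then show ?thesis using parallel_frame_subset by metis
  qed
  \<comment> \<open>Subdivision points closer than \<open>e / 2\<close> ensure that the tube of
    radius \<open>e / 2\<close> to the next point is covered by the tube to the current point
    together with the ball of radius \<open>e\<close> around it.\<close>
  obtain N where N: "norm x / (e / 2) < real N" using reals_Archimedean2 by blast
  have "0 \<le> norm x / (e / 2)" using e by simp
  then have N0: "N > 0" using N by linarith
  have xN: "norm x / N < e / 2" using N N0 e by (simp add: field_simps)
  have "n \<le> N \<Longrightarrow> \<exists>g. parallel_frame L \<theta> \<alpha> (tube ((real n / N) *\<^sub>R x) (e / 2)) g" for n
  proof (induction n)
    case 0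
    have "tube ((real 0 / N) *\<^sub>R x) (e / 2) = ball 0 (e / 2)" by (auto simp: tube_def)
    moreover have "ball 0 (e / 2) \<subseteq> ball (0::'m euc) e" using e by auto
    moreover obtain g where g: "parallel_frame L \<theta> \<alpha> (ball 0 e) g" using loc[of 0] by auto
    ultimately have "parallel_frame L \<theta> \<alpha> (tube ((real 0 / N) *\<^sub>R x) (e / 2)) g"
      by (intro parallel_frame_subset[OF g]) simp
    then show ?case by blast
  next
    case (Suc n)
    let ?y = "(real n / N) *\<^sub>R x" and ?z = "(real (Suc n) / N) *\<^sub>R x"
    obtain g where g: "parallel_frame L \<theta> \<alpha> (tube ?y (e / 2)) g" using Suc by auto
    have "?y \<in> closed_segment 0 x" using Suc.prems N0 by (auto simp: in_segment intro!: exI[of _ "real n / N"])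
    then obtain g' where g': "parallel_frame L \<theta> \<alpha> (ball ?y e) g'" using loc by blast
    obtain k where k: "parallel_frame L \<theta> \<alpha> (tube ?y (e / 2) \<union> ball ?y e) k"
      using parallel_frame_glue[OF g g'] tube_props by auto
    have "tube ?z (e / 2) \<subseteq> tube ?y (e / 2) \<union> ball ?y e"
    proof
      fix w assume "w \<in> tube ?z (e / 2)"
      then obtain s b where s: "0 \<le> s" "s \<le> 1" "norm b < e / 2" "w = s *\<^sub>R ?z + b"
        by (auto simp: tube_def in_segment)
      define t where "t = s * real (Suc n)"
      have t: "0 \<le> t" "t \<le> n + 1" "w = (t / N) *\<^sub>R x + b" using s mult_right_mono[of s 1 "real (Suc n)"] by (auto simp: t_def)
      show "w \<in> tube ?y (e / 2) \<union> ball ?y e"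
      proof (cases "t \<le> n")
        case True
        have "(t / N) *\<^sub>R x \<in> closed_segment 0 ?y"
        proof (cases "n = 0")
          case False
          then show ?thesis using True t by (auto simp: in_segment intro!: exI[of _ "t / n"])
        qed (use True t in auto)
        moreover have "b \<in> ball 0 (e / 2)" using s by simp
        ultimately show ?thesis unfolding tube_def t(3) by blast
      next
        case False
        have "norm (?y - w) \<le> norm (((n - t) / N) *\<^sub>R x) + norm b"
          using norm_triangle_ineq4[of "((n - t) / N) *\<^sub>R x" b] unfolding t(3)
          by (simp add: algebra_simps diff_divide_distrib)
        also have "norm (((n - t) / N) *\<^sub>R x) = (t - n) * (norm x / N)" using False by simp
        also have "\<dots> \<le> 1 * (norm x / N)" using t False by (intro mult_right_mono) auto
        finally have "norm (?y - w) < e" using xN s(3) by linarith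
        then show ?thesis by (simp add: dist_norm)
      qed
    qed
    then show ?case using k parallel_frame_subset by blast
  qed
  from this[of N] show ?thesis using N0 e by (intro exI[of _ "e / 2"]) simp
qed

text \<open>Frames on tubes are normalised to 1 at the origin. The intersection of two tubes is
  convex and contains the origin, so the constant relating their frames is 1 and they define one
  frame everywhere.\<close>

lemma parallel_frame_global: obtains g where "parallel_frame L \<theta> \<alpha> UNIV g"
proof -
  obtain i0 where i0: "0 \<in> patch L i0" using patch_cover by blast
  have "\<exists>e g. e > 0 \<and> parallel_frame L \<theta> \<alpha> (tube x e) g \<and> g i0 0 = 1" for x
  proof -
    obtain e g where e: "e > 0" and g: "parallel_frame L \<theta> \<alpha> (tube x e) g" using parallel_frame_tube by blast
    have n: "norm (g i0 0) = 1" using parallel_frameD(1)[OF g tube_props(3)[OF e] i0] .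
    have "parallel_frame L \<theta> \<alpha> (tube x e) (\<lambda>i y. cnj (g i0 0) * g i y)"
      by (rule parallel_frame_scale[OF g]) (simp add: n)
    then show ?thesis using e cnj_cancel(2)[OF n] by blast
  qed
  then obtain e G where e: "\<And>x. e x > 0" and G: "\<And>x. parallel_frame L \<theta> \<alpha> (tube x (e x)) (G x)" and G0: "\<And>x. G x i0 0 = 1"
    by metis
  define g where "g i x = G x i x" for i x
  have agree: "G x i y = g i y" if y: "y \<in> ball x (e x)" "y \<in> patch L i" for x y i
  proof -
    let ?U = "tube x (e x) \<inter> tube y (e y)"
    have U: "open ?U" "convex ?U" "0 \<in> ?U" "y \<in> ?U" 
      using e y tube_props(3)[of "e x" x] tube_props(3)[of "e y" y] tube_props(4)[of x "e x"] tube_props(4)[of y "e y"]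
      by (auto intro!: convex_Int open_Int tube_props(1,2) simp: subset_iff)
    obtain c where "norm c = 1" and c: "\<And>i z. z \<in> ?U \<Longrightarrow> z \<in> patch L i \<Longrightarrow> G x i z = c * G y i z"
      using parallel_frame_ratio[OF parallel_frame_subset[OF G[of x] Int_lower1] parallel_frame_subset[OF G[of y] Int_lower2] U(1,2)] by blast
    from c[OF U(3) i0] have "c = 1" by (simp add: G0)
    then show ?thesis using c[OF U(4) y(2)] by (simp add: g_def)
  qed
  have "parallel_frame L \<theta> \<alpha> (ball x (e x)) g" for x
    by (rule parallel_frame_cong[OF parallel_frame_subset[OF G[of x] tube_props(4)] open_ball open_patch agree])
  then have "parallel_frame L \<theta> \<alpha> UNIV g" unfolding parallel_frame_def using e by (meson Int_iff centre_in_ball)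
  then show ?thesis using that by blast
qed

end

section \<open>Lattice coordinates and the model gauge\<close>

type_synonym 'm phase = "(real ^ 'm) \<times> (real ^ 'm)"

text \<open>The 1-form with components \<open>d j * p j\<close> along \<open>dq j\<close> at the
  point \<open>x = (p, q)\<close>, evaluated on \<open>v\<close>. Its antisymmetrisation is the
  Frobenius normal form of \<open>\<omega>\<close>.\<close>

definition pform :: "('m::finite \<Rightarrow> nat) \<Rightarrow> 'm phase \<Rightarrow> 'm phase \<Rightarrow> real" where
  "pform d x v = (\<Sum>j\<in>UNIV. real (d j) * (fst x $ j * snd v $ j))"

lemma pform_simps:
  "pform d (x + y) v = pform d x v + pform d y v" "pform d x (v + w) = pform d x v + pform d x w"
  "pform d (r *\<^sub>R x) v = r * pform d x v" "pform d x (r *\<^sub>R v) = r * pform d x v"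
  "pform d (- x) v = - pform d x v" "pform d x (- v) = - pform d x v"
  "pform d (x - y) v = pform d x v - pform d y v" "pform d x (v - w) = pform d x v - pform d x w"
  "pform d 0 v = 0" "pform d x 0 = 0"
  by (auto simp: pform_def distrib_left distrib_right sum.distrib sum_distrib_left sum_negf sum_subtractf
      right_diff_distrib left_diff_distrib mult_ac)

lemma pform_linear: "linear (pform d x)" "linear (\<lambda>x. pform d x v)"
  by (rule linearI; simp add: pform_simps)+

lemma pform_axis: "pform d (axis j 1, 0) y = real (d j) * snd y $ j"
  "pform d y (0, axis j 1) = fst y $ j * real (d j)" "pform d (0, q) y = 0" "pform d y (p, 0) = 0"
proof -
  have "pform d (axis j 1, 0) y = (\<Sum>i\<in>UNIV. if i = j then real (d i) * snd y $ i else 0)"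
    unfolding pform_def by (rule sum.cong) (auto simp: axis_def)
  then show "pform d (axis j 1, 0) y = real (d j) * snd y $ j" by simp
  have "pform d y (0, axis j 1) = (\<Sum>i\<in>UNIV. if i = j then fst y $ i * real (d i) else 0)"
    unfolding pform_def by (rule sum.cong) (auto simp: axis_def)
  then show "pform d y (0, axis j 1) = fst y $ j * real (d j)" by simp
qed (simp_all add: pform_def)

lemma lattice_closed: "0 \<in> lattice" "x \<in> lattice \<Longrightarrow> y \<in> lattice \<Longrightarrow> x + y \<in> lattice"
  "x \<in> lattice \<Longrightarrow> - x \<in> lattice" "axis j 1 \<in> lattice" "x \<in> lattice \<Longrightarrow> y \<in> lattice \<Longrightarrow> x - y \<in> lattice"
  by (auto simp: lattice_def axis_def)

lemma lattice_int_scale: "r \<in> \<int> \<Longrightarrow> x \<in> lattice \<Longrightarrow> r *\<^sub>R x \<in> lattice"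
  by (auto simp: lattice_def)

lemma lattice_sum: "(\<And>i. i \<in> I \<Longrightarrow> f i \<in> lattice) \<Longrightarrow> sum f I \<in> lattice"
  by (induction I rule: infinite_finite_induct) (auto intro: lattice_closed)

lemma pform_Ints: "x \<in> lattice \<times> lattice \<Longrightarrow> y \<in> lattice \<times> lattice \<Longrightarrow> pform d x y \<in> \<int>"
  by (auto simp: pform_def lattice_def intro!: Ints_sum Ints_mult)

lemma int_multiple_induct:
  fixes x :: "'a::real_vector"
  assumes "P 0" "\<And>y z. P y \<Longrightarrow> P z \<Longrightarrow> P (y + z)" "\<And>y. P y \<Longrightarrow> P (- y)" "P x" "r \<in> \<int>"
  shows "P (r *\<^sub>R x)"
proof -
  have n: "P (real n *\<^sub>R x)" for n
    by (induction n) (use assms in \<open>auto simp: scaleR_add_left\<close>)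
  obtain k where k: "r = of_int k" using assms(5) by (auto elim: Ints_cases)
  show ?thesis
  proof (cases "k \<ge> 0")
    case True
    then show ?thesis using n[of "nat k"] k by simp
  next
    case False
    then show ?thesis using assms(3)[OF n[of "nat (- k)"]] k by simp
  qed
qed

lemma lattice_pair_induct:
  fixes P :: "'m::finite phase \<Rightarrow> bool"
  assumes P: "P 0" "\<And>y z. P y \<Longrightarrow> P z \<Longrightarrow> P (y + z)" "\<And>y. P y \<Longrightarrow> P (- y)"
    and g: "\<And>j. P (axis j 1, 0)" "\<And>j. P (0, axis j 1)" and x: "x \<in> lattice \<times> lattice"
  shows "P x"
proof -
  have S: "P (\<Sum>i\<in>I. f i)" if "\<And>i. P (f i)" for f :: "'m \<Rightarrow> 'm phase" and I
    by (induction I rule: infinite_finite_induct) (use that P in auto)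
  have i: "fst x $ j \<in> \<int>" "snd x $ j \<in> \<int>" for j using x by (auto simp: lattice_def)
  have "x = (\<Sum>j\<in>UNIV. fst x $ j *\<^sub>R (axis j 1, 0)) + (\<Sum>j\<in>UNIV. snd x $ j *\<^sub>R (0, axis j 1))"
    by (simp add: prod_eq_iff fst_sum snd_sum vec_eq_iff sum.distrib axis_def if_distrib if_distribR cong: if_cong)
  also have "P \<dots>" by (intro P(2) S int_multiple_induct[of P] P g i)
  finally show ?thesis .
qed

text \<open>A parallel frame changes by a unitary character of the lattice under lattice translations. The
  translation by \<open>c\<close> removes this character, because \<open>\<omega>\<close> is nondegenerate.\<close>

lemma gauge_exists:
  fixes \<Phi> :: "'m::finite phase \<Rightarrow> 'm euc" and L :: "('i, 'm) line_bundle"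
  assumes pre: "prequantum_bundle \<omega> L \<theta>" and inv: "\<And>x. \<omega> x = \<omega> 0"
    and \<Phi>: "linear \<Phi>" "bij \<Phi>" "\<Phi> ` (lattice \<times> lattice) = lattice"
    and \<omega>\<Phi>: "\<And>y z. \<omega> 0 (\<Phi> y) (\<Phi> z) = pform d y z - pform d z y" and d: "\<And>j. d j > 0"
  obtains c \<gamma> where
    "\<And>i y. \<Phi> y + c \<in> patch L i \<Longrightarrow> norm (\<gamma> i y) = 1"
    "\<And>i y. \<Phi> y + c \<in> patch L i \<Longrightarrow>
      (\<gamma> i has_derivative (\<lambda>v. (- 2 * pi * \<i> * pform d y v - \<theta> i (\<Phi> y + c) (\<Phi> v)) * \<gamma> i y)) (at y)"
    "\<And>i j y. \<Phi> y + c \<in> patch L i \<Longrightarrow> \<Phi> y + c \<in> patch L j \<Longrightarrow> \<gamma> i y = trans L i j (\<Phi> y + c) * \<gamma> j y"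
    "\<And>i y b. \<Phi> y + c \<in> patch L i \<Longrightarrow> b \<in> lattice \<times> lattice \<Longrightarrow> \<gamma> i y = ee (pform d b y) * \<gamma> i (y + b)"
proof -
  have bndl: "hermitian_line_bundle L" and conn: "hermitian_connection L \<theta>"
    and curv: "\<And>i x u v. x \<in> patch L i \<Longrightarrow> curvature \<theta> i x u v = - 2 * pi * \<i> * \<omega> x u v"
    using pre unfolding prequantum_bundle_def by auto
  have opn: "open (patch L i)" and inv_patch: "x \<in> patch L i \<Longrightarrow> a \<in> lattice \<Longrightarrow> x + a \<in> patch L i" for i x a
    using bndl unfolding hermitian_line_bundle_def by blast+
  have cover: "\<exists>i. x \<in> patch L i" for x using bndl unfolding hermitian_line_bundle_def by blast
  have per: "trans L i j (x + a) = trans L i j x" "\<theta> i (x + a) = \<theta> i x"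
    if "x \<in> patch L i" "x \<in> patch L j" "a \<in> lattice" for i j x a
    using that bndl conn unfolding hermitian_line_bundle_def hermitian_connection_def periodic_on_def by blast+
  define F where "F = inv \<Phi>"
  have F: "F (\<Phi> y) = y" "\<Phi> (F x) = x" for x y
    using \<Phi>(2) by (auto simp: F_def bij_is_inj bij_is_surj surj_f_inv_f)
  have linF: "linear F"
    by (rule linearI) (metis F linear_add[OF \<Phi>(1)], metis F linear_scale[OF \<Phi>(1)])
  note F_simps = linear_add[OF linF] linear_scale[OF linF] linear_add[OF \<Phi>(1)] linear_scale[OF \<Phi>(1)]
  define A where "A x v = pform d (F x) (F v)" for x v
  have A_simps: "A (x + y) v = A x v + A y v" "A x (v + w) = A x v + A x w" "A (r *\<^sub>R x) v = r * A x v"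
    "A x (r *\<^sub>R v) = r * A x v" "A 0 v = 0" for x y v w r
    using linear_0[OF linF] by (auto simp: A_def F_simps pform_simps)
  have A\<omega>: "A u v - A v u = \<omega> x u v" for x u v
    using \<omega>\<Phi>[of "F u" "F v"] by (simp add: A_def F inv[of x])
  define \<alpha> where "\<alpha> x v = - 2 * pi * \<i> * complex_of_real (A x v)" for x v
  have lin\<alpha>: "linear (\<lambda>x. \<alpha> x v)" "linear (\<alpha> x)" for x v
    by (auto intro!: linearI simp: \<alpha>_def A_simps algebra_simps scaleR_conv_of_real[where 'a = complex])
  have bl: "bounded_linear (\<lambda>x. \<alpha> x v)" for v using lin\<alpha>(1) linear_conv_bounded_linear by blast
  have d\<alpha>: "dderiv (\<lambda>y. \<alpha> y v) x u = \<alpha> u v" for x u v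
    by (rule dderivI) (rule bounded_linear_imp_has_derivative[OF bl])
  have al: "smooth_on UNIV (\<lambda>x. \<alpha> x v)" "Re (\<alpha> x v) = 0"
    "dderiv (\<lambda>y. \<alpha> y v) x u - dderiv (\<lambda>y. \<alpha> y u) x v = - 2 * pi * \<i> * \<omega> x u v" for x u v
    unfolding d\<alpha> A\<omega>[symmetric]
    using smooth_on_linear[OF open_UNIV bl] by (simp_all add: \<alpha>_def algebra_simps)
  obtain g where g: "parallel_frame L \<theta> \<alpha> UNIV g"
    using parallel_frame_global[OF bndl conn curv al(1) lin\<alpha>(2) al(2,3)] by blast
  note gD = parallel_frameD[OF g UNIV_I]
  have bA: "((\<lambda>x. A a (f x)) has_derivative (\<lambda>v. A a (f' v))) (at x)" if "(f has_derivative f') (at x)"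
    for a x f f'
  proof -
    have "bounded_linear (A a)" using linear_conv_bounded_linear by (metis linearI A_simps(2,4) real_scaleR_def)
    from bounded_linear.has_derivative[OF this that] show ?thesis .
  qed
  have "\<exists>\<kappa>. norm \<kappa> = 1 \<and> (\<forall>i. \<forall>x\<in>patch L i. g i x = \<kappa> * ee (A a x) * g i (x + a))" if a: "a \<in> lattice" for a
  proof -
    \<comment> \<open>Translation by \<open>a\<close> changes the potential \<open>\<alpha>\<close>
      by a constant form, and the factor \<open>ee (A a x)\<close> compensates for it. Hence
      \<open>g'\<close> is again parallel and differs from \<open>g\<close> by a constant.\<close>
    define g' where "g' i x = g i (x + a) * ee (A a x)" for i x
    have "parallel_frame L \<theta> \<alpha> UNIV g'"
      unfolding parallel_frame_def
    proof (intro allI ballI conjI impI)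
      fix i x assume "x \<in> UNIV \<inter> patch L i"
      then have x: "x \<in> patch L i" "x + a \<in> patch L i" using inv_patch a by auto
      show "norm (g' i x) = 1" using gD(1)[OF x(2)] by (simp add: g'_def norm_mult)
      have s: "((\<lambda>x. x + a) has_derivative (\<lambda>v. v)) (at x)" by (auto intro!: derivative_eq_intros)
      have "((\<lambda>x. g i (x + a) * ee (A a x)) has_derivative (\<lambda>v. g i (x + a) * ((2 * pi * \<i> * of_real (A a v)) * ee (A a x))
         + (\<alpha> (x + a) v - \<theta> i (x + a) v) * g i (x + a) * ee (A a x))) (at x)"
        by (intro has_derivative_mult ee_has_derivative bA has_derivative_ident has_derivative_compose[OF s gD(2)[OF x(2)]])
      then show "(g' i has_derivative (\<lambda>v. (\<alpha> x v - \<theta> i x v) * g' i x)) (at x)"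
        unfolding g'_def by (rule has_derivative_eq_rhs)
          (simp only: per(2)[OF x(1) x(1) a] fun_eq_iff, simp add: \<alpha>_def A_simps algebra_simps)
      fix j assume "x \<in> patch L j"
      then show "g' i x = trans L i j x * g' j x"
        using gD(3)[OF x(2), of j] inv_patch[of x j a] a per(1)[OF x(1), of j a] by (simp add: g'_def)
    qed
    from parallel_frame_ratio[OF bndl conn curv al(1) lin\<alpha>(2) al(2,3) g this]
    obtain c where "norm c = 1" "\<And>i x. x \<in> patch L i \<Longrightarrow> g i x = c * g' i x"
      by auto
    then show ?thesis by (intro exI[of _ c]) (simp add: g'_def mult_ac)
  qed
  then obtain \<kappa> where \<kappa>1: "\<And>a. a \<in> lattice \<Longrightarrow> norm (\<kappa> a) = 1"
    and \<kappa>: "\<And>a i x. a \<in> lattice \<Longrightarrow> x \<in> patch L i \<Longrightarrow> g i x = \<kappa> a * ee (A a x) * g i (x + a)"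
    by metis
  have gen: "\<exists>r. \<kappa> (\<Phi> b) = ee r" if "b \<in> lattice \<times> lattice" for b
    using \<kappa>1[of "\<Phi> b"] ee_surj that \<Phi>(3) by blast
  have ax: "(axis j 1, 0 :: real ^ 'm) \<in> lattice \<times> lattice" "(0 :: real ^ 'm, axis j 1) \<in> lattice \<times> lattice" for j :: 'm
    by (auto simp: lattice_closed)
  obtain r s where rs: "\<And>j. \<kappa> (\<Phi> (axis j 1, 0)) = ee (r j)" "\<And>j. \<kappa> (\<Phi> (0, axis j 1)) = ee (s j)"
    using gen[OF ax(1)] gen[OF ax(2)] by metis
  \<comment> \<open>Solves the linear equations saying that the pairing of \<open>C\<close> with
    each lattice generator cancels the phases \<open>r j\<close> and \<open>s j\<close>; this is
    where division by \<open>d j\<close> is possible.\<close>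
  define C :: "'m phase" where "C = (\<chi> j. s j / d j, \<chi> j. - r j / d j)"
  define c where "c = \<Phi> C"
  define X where "X b = \<kappa> (\<Phi> b) * ee (pform d b C - pform d C b)" for b
  have \<Phi>lat: "\<Phi> b \<in> lattice" if "b \<in> lattice \<times> lattice" for b using \<Phi>(3) that by blast
  \<comment> \<open>Moving from 0 by \<open>\<Phi> b\<close> and then by \<open>\<Phi> a\<close> is
    compared with moving by the sum. The discrepancy \<open>ee (A (\<Phi> a) (\<Phi> b))\<close> is
    1 because the potential is integral on lattice vectors.\<close>
  have \<kappa>add: "\<kappa> (\<Phi> (a + b)) = \<kappa> (\<Phi> a) * \<kappa> (\<Phi> b)" if ab: "a \<in> lattice \<times> lattice" "b \<in> lattice \<times> lattice" for a b
  proof -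
    obtain i where i: "0 \<in> patch L i" using cover by blast
    have l: "\<Phi> a \<in> lattice" "\<Phi> b \<in> lattice" "\<Phi> a + \<Phi> b \<in> lattice"
      using \<Phi>lat[OF ab(1)] \<Phi>lat[OF ab(2)] lattice_closed(2) by blast+
    have i': "\<Phi> b \<in> patch L i" using inv_patch[OF i l(2)] by simp
    have "g i 0 \<noteq> 0" using gD(1)[OF i] by auto
    moreover have "g i (\<Phi> a + \<Phi> b) \<noteq> 0" using gD(1)[OF inv_patch[OF i l(3)]] by auto
    moreover have "A (\<Phi> a) (\<Phi> b) \<in> \<int>" using pform_Ints[OF ab] by (simp add: A_def F)
    then have "ee (A (\<Phi> a) (\<Phi> b)) = 1" by (rule ee_Ints)
    moreover have A0: "A x 0 = 0" for x using A_simps(4)[of x 0 0] by simp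
    ultimately show ?thesis
      using \<kappa>[OF l(2) i] \<kappa>[OF l(1) i'] \<kappa>[OF l(3) i] by (simp add: F_simps A0 add.commute)
  qed
  have \<kappa>0: "\<kappa> (\<Phi> 0) = 1"
    using \<kappa>add[of 0 0] \<kappa>1[of "\<Phi> 0"] \<Phi>lat[of 0] by (auto simp: lattice_closed zero_prod_def)
  have X1: "X b = 1" if "b \<in> lattice \<times> lattice" for b
  proof -
    have "b \<in> lattice \<times> lattice \<and> X b = 1"
    proof (rule lattice_pair_induct[OF _ _ _ _ _ that])
      show "0 \<in> lattice \<times> lattice \<and> X 0 = 1" 
        by (intro conjI) (simp add: zero_prod_def lattice_closed, simp add: X_def \<kappa>0 pform_simps)
      show "y + z \<in> lattice \<times> lattice \<and> X (y + z) = 1"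
        if "y \<in> lattice \<times> lattice \<and> X y = 1" "z \<in> lattice \<times> lattice \<and> X z = 1" for y z
      proof -
        have e: "pform d (y + z) C - pform d C (y + z) = (pform d y C - pform d C y) + (pform d z C - pform d C z)"
          by (simp add: pform_simps)
        have "X (y + z) = X y * X z"
          unfolding X_def e ee_add \<kappa>add[OF conjunct1[OF that(1)] conjunct1[OF that(2)]] by simp
        then show ?thesis using that by (auto simp: lattice_closed)
      qed
      show "- y \<in> lattice \<times> lattice \<and> X (- y) = 1" if y: "y \<in> lattice \<times> lattice \<and> X y = 1" for y
      proof -
        have m: "- y \<in> lattice \<times> lattice" using y by (auto simp: lattice_closed)
        have "\<kappa> (\<Phi> y) * \<kappa> (\<Phi> (- y)) = 1" using \<kappa>add[of y "- y"] y m \<kappa>0 by simp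
        moreover have "X y * X (- y) = \<kappa> (\<Phi> y) * \<kappa> (\<Phi> (- y)) * ee ((pform d y C - pform d C y) + - (pform d y C - pform d C y))"
          unfolding ee_add by (simp add: X_def pform_simps mult_ac)
        ultimately have "X y * X (- y) = 1" by simp
        then show ?thesis using y m by simp
      qed
      show "(axis j 1, 0 :: real ^ 'm) \<in> lattice \<times> lattice \<and> X (axis j 1, 0) = 1" for j
        using d[of j] ax[of j] by (simp add: X_def rs pform_axis C_def ee_add[symmetric])
      show "(0 :: real ^ 'm, axis j 1) \<in> lattice \<times> lattice \<and> X (0, axis j 1) = 1" for j
        using d[of j] ax[of j] by (simp add: X_def rs pform_axis C_def ee_add[symmetric])
    qed
    then show ?thesis by blast
  qed
  \<comment> \<open>Recentring the coordinates at \<open>c\<close> adds the constant form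
    \<open>pform d C\<close> to the potential; the extra phase removes it again.\<close>
  define \<gamma> where "\<gamma> i y = g i (\<Phi> y + c) * ee (pform d C y)" for i y
  have bl\<Phi>: "bounded_linear \<Phi>" using \<Phi>(1) linear_conv_bounded_linear by blast
  show ?thesis
  proof (rule that[of c \<gamma>])
    fix i y assume y: "\<Phi> y + c \<in> patch L i"
    show "norm (\<gamma> i y) = 1" using gD(1)[OF y] by (simp add: \<gamma>_def norm_mult)
    have s: "((\<lambda>y. \<Phi> y + c) has_derivative \<Phi>) (at y)"
      using has_derivative_add[OF bounded_linear_imp_has_derivative[OF bl\<Phi>] has_derivative_const] by simp
    have bp: "(pform d C has_derivative pform d C) (at y)"
      using bounded_linear_imp_has_derivative pform_linear(1) linear_conv_bounded_linear by blast
    have "(\<gamma> i has_derivative (\<lambda>v. g i (\<Phi> y + c) * ((2 * pi * \<i> * of_real (pform d C v)) * ee (pform d C y))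
         + (\<alpha> (\<Phi> y + c) (\<Phi> v) - \<theta> i (\<Phi> y + c) (\<Phi> v)) * g i (\<Phi> y + c) * ee (pform d C y))) (at y)"
      unfolding \<gamma>_def
      by (intro has_derivative_mult ee_has_derivative bp has_derivative_compose[OF s gD(2)[OF y]])
    then show "(\<gamma> i has_derivative (\<lambda>v. (- 2 * pi * \<i> * pform d y v - \<theta> i (\<Phi> y + c) (\<Phi> v)) * \<gamma> i y)) (at y)"
      by (rule has_derivative_eq_rhs)
        (simp add: \<gamma>_def \<alpha>_def A_simps fun_eq_iff algebra_simps, simp add: A_def F c_def algebra_simps)
    show "\<gamma> i y = trans L i j (\<Phi> y + c) * \<gamma> j y" if "\<Phi> y + c \<in> patch L j" for j
      using gD(3)[OF y that] by (simp add: \<gamma>_def)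
    fix b :: "'m phase" assume b: "b \<in> lattice \<times> lattice"
    have "g i (\<Phi> y + c) = \<kappa> (\<Phi> b) * ee (A (\<Phi> b) (\<Phi> y + c)) * g i (\<Phi> (y + b) + c)"
      using \<kappa>[OF \<Phi>lat[OF b] y] by (simp add: F_simps add_ac)
    moreover have "A (\<Phi> b) (\<Phi> y + c) = pform d b y + pform d b C"
      by (simp add: A_simps) (simp add: A_def F c_def)
    ultimately have "\<gamma> i y = (\<kappa> (\<Phi> b) * ee (pform d b C)) * ee (pform d b y) * g i (\<Phi> (y + b) + c) * ee (pform d C y)"
      by (simp add: \<gamma>_def ee_add)
    also have "\<kappa> (\<Phi> b) * ee (pform d b C) = X b * ee (pform d C b)"
      by (simp add: X_def mult.assoc ee_add[symmetric])
    also have "\<dots> = ee (pform d C b)" using X1[OF b] by simp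
    finally show "\<gamma> i y = ee (pform d b y) * \<gamma> i (y + b)"
      by (simp add: \<gamma>_def pform_simps ee_add mult_ac)
  qed
qed

section \<open>Normal forms of a symplectic form\<close>

lemma exists_Basis_notin_span:
  fixes S :: "'a::euclidean_space set"
  assumes "finite S" "card S < DIM('a)"
  obtains b where "b \<in> Basis" "b \<notin> span S"
proof -
  have "\<not> Basis \<subseteq> span S"
  proof
    assume "Basis \<subseteq> span S"
    then have "dim (Basis :: 'a set) \<le> card S" by (rule dim_le_card[OF _ assms(1)])
    then show False using assms(2) dim_span[of "Basis :: 'a set"] by (simp add: span_Basis)
  qed
  then show ?thesis using that by blast
qed

locale bilin =
  fixes b :: "'a::euclidean_space \<Rightarrow> 'a \<Rightarrow> real"
  assumes bil: "bilinear b"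
begin

lemmas bil_simps = bilinear_ladd[OF bil] bilinear_radd[OF bil] bilinear_lmul[OF bil, simplified]
  bilinear_rmul[OF bil, simplified] bilinear_lneg[OF bil] bilinear_rneg[OF bil]
  bilinear_lzero[OF bil] bilinear_rzero[OF bil] bilinear_lsub[OF bil] bilinear_rsub[OF bil]

lemma lin: "linear (b x)" "linear (\<lambda>x. b x y)"
  using bil by (auto simp: bilinear_def)

lemma sum_left: "b (sum f I) y = (\<Sum>i\<in>I. b (f i) y)"
  by (rule linear_sum[OF lin(2)])

lemma sum_right: "b x (sum f I) = (\<Sum>i\<in>I. b x (f i))"
  by (rule linear_sum[OF lin(1)])

end

locale symplectic = bilin w for w :: "'a::euclidean_space \<Rightarrow> 'a \<Rightarrow> real" +
  assumes alt: "w x x = 0" and nondeg: "x \<noteq> 0 \<Longrightarrow> \<exists>y. w x y \<noteq> 0"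
begin

lemma skew: "w x y = - w y x"
proof -
  have "w x x + w x y + (w y x + w y y) = 0" using alt[of "x + y"] by (simp add: bil_simps)
  then show ?thesis using alt[of x] alt[of y] by simp
qed

lemma nondeg_Basis: "x \<noteq> 0 \<Longrightarrow> \<exists>y\<in>Basis. w x y \<noteq> 0"
proof (rule ccontr)
  assume x: "x \<noteq> 0" and "\<not> (\<exists>y\<in>Basis. w x y \<noteq> 0)"
  then have z: "w x y = 0" if "y \<in> Basis" for y using that by blast
  have "w x y = 0" for y
  proof -
    have "w x y = w x (\<Sum>i\<in>Basis. (y \<bullet> i) *\<^sub>R i)" by (simp add: euclidean_representation)
    also have "\<dots> = 0" by (simp add: sum_right bil_simps z)
    finally show ?thesis .
  qed
  then show False using nondeg[OF x] by blast
qed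

end

lemma card_two_images:
  assumes "finite K" shows "card (u ` K \<union> v ` K) \<le> 2 * card K"
  using card_Un_le[of "u ` K" "v ` K"] card_image_le[OF assms, of u] card_image_le[OF assms, of v] by linarith

section \<open>Frobenius bases of the lattice\<close>

definition frobenius_partial :: "('m euc \<Rightarrow> 'm::finite euc \<Rightarrow> real) \<Rightarrow> 'm set \<Rightarrow> ('m \<Rightarrow> 'm euc) \<Rightarrow> ('m \<Rightarrow> 'm euc) \<Rightarrow> ('m \<Rightarrow> nat) \<Rightarrow> bool" where
  "frobenius_partial w K u v d \<longleftrightarrow>
     (\<forall>j\<in>K. u j \<in> lattice \<and> v j \<in> lattice \<and> d j > 0) \<and>
     (\<forall>i\<in>K. \<forall>j\<in>K. w (u i) (v j) = (if i = j then real (d j) else 0) \<and> w (u i) (u j) = 0 \<and> w (v i) (v j) = 0) \<and>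
     (\<forall>j\<in>K. \<forall>x\<in>lattice. w (u j) x / d j \<in> \<int> \<and> w x (v j) / d j \<in> \<int>)"

text \<open>The next pair realises the least positive value \<open>D\<close> of \<open>w\<close> on
  the part of the lattice that is \<open>w\<close>-orthogonal to the earlier pairs. Division with
  remainder makes every value against this pair a multiple of \<open>D\<close>, which is the
  divisibility that keeps the next projection inside the lattice.\<close>

lemma frobenius_basis:
  fixes w :: "'m::finite euc \<Rightarrow> 'm euc \<Rightarrow> real"
  assumes w: "symplectic w" and int: "\<And>x y. x \<in> lattice \<Longrightarrow> y \<in> lattice \<Longrightarrow> w x y \<in> \<int>"
  obtains u v d where "frobenius_partial w UNIV u v d"
proof -
  interpret symplectic w by fact
  have "\<exists>u v d. frobenius_partial w K u v d" if "finite K" for K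
    using that
  proof induction
    case empty
    then show ?case by (simp add: frobenius_partial_def)
  next
    case (insert k K)
    then obtain u v d where I: "frobenius_partial w K u v d" by blast
    then have d: "\<And>j. j \<in> K \<Longrightarrow> d j > 0" and lat: "\<And>j. j \<in> K \<Longrightarrow> u j \<in> lattice" "\<And>j. j \<in> K \<Longrightarrow> v j \<in> lattice"
      and uv: "\<And>i j. i \<in> K \<Longrightarrow> j \<in> K \<Longrightarrow> w (u i) (v j) = (if i = j then real (d j) else 0)"
        "\<And>i j. i \<in> K \<Longrightarrow> j \<in> K \<Longrightarrow> w (u i) (u j) = 0" "\<And>i j. i \<in> K \<Longrightarrow> j \<in> K \<Longrightarrow> w (v i) (v j) = 0"
      and dvd: "\<And>j x. j \<in> K \<Longrightarrow> x \<in> lattice \<Longrightarrow> w (u j) x / d j \<in> \<int>" "\<And>j x. j \<in> K \<Longrightarrow> x \<in> lattice \<Longrightarrow> w x (v j) / d j \<in> \<int>"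
      unfolding frobenius_partial_def by blast+
    \<comment> \<open>The \<open>w\<close>-orthogonal projection away from the pairs found so far.
      Its coefficients are integers on lattice vectors by the divisibility clause.\<close>
    define \<pi> where "\<pi> x = x - (\<Sum>j\<in>K. (w x (v j) / d j) *\<^sub>R u j) - (\<Sum>j\<in>K. (w (u j) x / d j) *\<^sub>R v j)" for x
    define \<Lambda> where "\<Lambda> = {x \<in> lattice. \<forall>j\<in>K. w (u j) x = 0 \<and> w (v j) x = 0}"
    have vu: "w (v i) (u j) = (if i = j then - real (d j) else 0)" if "i \<in> K" "j \<in> K" for i j
      using uv(1)[OF that(2,1)] skew[of "v i" "u j"] by auto
    have \<pi>\<Lambda>: "\<pi> x \<in> \<Lambda>" if x: "x \<in> lattice" for x
    proof -
      have "\<pi> x \<in> lattice"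
        unfolding \<pi>_def using x lat dvd by (intro lattice_closed(5) lattice_sum lattice_int_scale) auto
      moreover have "w (u j) (\<pi> x) = 0" if j: "j \<in> K" for j
      proof -
        have "w (u j) (\<pi> x) = w (u j) x - (\<Sum>i\<in>K. (w (u i) x / d i) * (if i = j then real (d j) else 0))"
          unfolding \<pi>_def by (simp add: bil_simps sum_right uv j) (rule sum.cong; simp add: uv j)
        then show ?thesis using insert.hyps(1) j d[OF j] by (simp add: if_distrib[of "\<lambda>z. _ * z"] cong: if_cong)
      qed
      moreover have "w (v j) (\<pi> x) = 0" if j: "j \<in> K" for j
      proof -
        have "w (v j) (\<pi> x) = w (v j) x - (\<Sum>i\<in>K. (w x (v i) / d i) * (if i = j then - real (d j) else 0))"
          unfolding \<pi>_def by (simp add: bil_simps sum_right uv j) (rule sum.cong; simp add: vu j)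
        then show ?thesis using insert.hyps(1) j d[OF j] skew[of "v j" x] by (simp add: if_distrib[of "\<lambda>z. _ * z"] cong: if_cong)
      qed
      ultimately show ?thesis by (simp add: \<Lambda>_def)
    qed
    have w\<pi>: "w x (\<pi> y) = w x y" if x: "x \<in> \<Lambda>" for x y
    proof -
      have "w x (u j) = 0" "w x (v j) = 0" if "j \<in> K" for j
        using x that skew[of x "u j"] skew[of x "v j"] by (auto simp: \<Lambda>_def)
      then show ?thesis by (simp add: \<pi>_def bil_simps sum_right)
    qed
    have \<Lambda>_closed: "x - r *\<^sub>R y \<in> \<Lambda>" if "x \<in> \<Lambda>" "y \<in> \<Lambda>" "r \<in> \<int>" for x y r
      using that by (auto simp: \<Lambda>_def bil_simps intro: lattice_closed lattice_int_scale)
    have Blat: "b \<in> lattice" if "b \<in> Basis" for b :: "'m euc"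
      using that by (auto simp: Basis_vec_def lattice_closed)
    have "K \<subset> UNIV" using insert.hyps by blast
    then have "card K < CARD('m)" by (simp add: psubset_card_mono)
    then have "card (u ` K \<union> v ` K) < DIM('m euc)"
      using card_two_images[OF insert.hyps(1), of u v] by simp
    then obtain b :: "'m euc" where b: "b \<in> Basis" "b \<notin> span (u ` K \<union> v ` K)"
      using exists_Basis_notin_span[of "u ` K \<union> v ` K"] insert.hyps(1) by blast
    have "\<pi> b \<noteq> 0"
    proof
      assume "\<pi> b = 0"
      then have "b = (\<Sum>j\<in>K. (w b (v j) / d j) *\<^sub>R u j) + (\<Sum>j\<in>K. (w (u j) b / d j) *\<^sub>R v j)" by (simp add: \<pi>_def algebra_simps)
      also have "\<dots> \<in> span (u ` K \<union> v ` K)"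
        by (intro span_add span_sum span_scale span_base) auto
      finally show False using b by blast
    qed
    then obtain b' where b': "b' \<in> Basis" "w (\<pi> b) b' \<noteq> 0" using nondeg_Basis by blast
    define N where "N = {n::nat. n > 0 \<and> (\<exists>x\<in>\<Lambda>. \<exists>y\<in>\<Lambda>. w x y = real n)}"
    have nat_of: "\<exists>n::nat. r = real n" if "r \<in> \<int>" "r \<ge> 0" for r :: real
      using that by (metis Ints_cases of_int_0_le_iff of_nat_nat)
    have "N \<noteq> {}"
    proof -
      have m: "\<pi> b \<in> \<Lambda>" "\<pi> b' \<in> \<Lambda>" using \<pi>\<Lambda> Blat b b' by auto
      have nz: "w (\<pi> b) (\<pi> b') \<noteq> 0" using w\<pi>[OF m(1)] b' by simp
      have i: "w (\<pi> b) (\<pi> b') \<in> \<int>" "w (\<pi> b') (\<pi> b) \<in> \<int>" using m int by (auto simp: \<Lambda>_def)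
      show ?thesis
      proof (cases "w (\<pi> b) (\<pi> b') > 0")
        case True
        then obtain n where "w (\<pi> b) (\<pi> b') = real n" using nat_of[OF i(1)] by auto
        then show ?thesis using True m by (auto simp: N_def)
      next
        case False
        then have p: "w (\<pi> b') (\<pi> b) > 0" using nz skew[of "\<pi> b'" "\<pi> b"] by auto
        then obtain n where "w (\<pi> b') (\<pi> b) = real n" using nat_of[OF i(2)] by auto
        then show ?thesis using p m by (auto simp: N_def)
      qed
    qed
    define D where "D = (LEAST n. n \<in> N)"
    have "D \<in> N" unfolding D_def using \<open>N \<noteq> {}\<close> by (metis LeastI ex_in_conv)
    then obtain x y where D: "D > 0" and xy: "x \<in> \<Lambda>" "y \<in> \<Lambda>" "w x y = real D" by (auto simp: N_def)
    have Dle: "D \<le> n" if "n \<in> N" for n unfolding D_def using that by (rule Least_le)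
    \<comment> \<open>Subtracting a multiple of \<open>q'\<close> from \<open>q\<close> replaces the
      value by its remainder modulo \<open>D\<close>. A nonzero remainder would be a positive value
      below the minimum.\<close>
    have key: "w p q / D \<in> \<int>" if p: "p \<in> \<Lambda>" "q \<in> \<Lambda>" and q: "q' \<in> \<Lambda>" "w p q' = real D" for p q q'
    proof -
      have "w p q \<in> \<int>" using p int by (auto simp: \<Lambda>_def)
      then obtain z where z: "w p q = of_int z" by (auto elim: Ints_cases)
      define r where "r = z mod int D"
      have r: "0 \<le> r" "r < int D" using D by (auto simp: r_def)
      have "w p (q - of_int (z div int D) *\<^sub>R q') = of_int (z - (z div int D) * int D)"
        by (simp add: bil_simps z q(2))
      also have "z - (z div int D) * int D = r" by (simp add: r_def minus_div_mult_eq_mod)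
      finally have wr: "w p (q - of_int (z div int D) *\<^sub>R q') = real (nat r)" using r by simp
      have "r = 0"
      proof (rule ccontr)
        assume "r \<noteq> 0"
        then have "nat r \<in> N" unfolding N_def using r wr p(1) \<Lambda>_closed[OF p(2) q(1), of "of_int (z div int D)"] by auto
        then show False using Dle r by force
      qed
      then have "int D dvd z" by (auto simp: r_def)
      then show ?thesis using D z by (auto elim!: dvdE)
    qed
    have kx: "w x z / D \<in> \<int>" if "z \<in> lattice" for z
      using key[OF xy(1) \<pi>\<Lambda>[OF that] xy(2,3)] w\<pi>[OF xy(1)] by simp
    have ky: "w z y / D \<in> \<int>" if "z \<in> lattice" for z
    proof -
      \<comment> \<open>Skewness lets \<open>- y\<close> and \<open>x\<close> play the roles of
        \<open>x\<close> and \<open>y\<close>, with the same value \<open>D\<close>.\<close>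
      have "w (- y) z / D \<in> \<int>"
      proof -
        have my: "- y \<in> \<Lambda>" using xy(2) by (auto simp: \<Lambda>_def bil_simps lattice_closed)
        have "w (- y) x = real D" using xy(3) skew[of x y] by (simp add: bil_simps)
        from key[OF my \<pi>\<Lambda>[OF that] xy(1) this] show ?thesis using w\<pi>[OF my] by simp
      qed
      then show ?thesis using skew[of z y] by (simp add: bil_simps)
    qed
    have zz: "w (u j) x = 0" "w (v j) x = 0" "w (u j) y = 0" "w (v j) y = 0"
      "w x (u j) = 0" "w x (v j) = 0" "w y (u j) = 0" "w y (v j) = 0" if "j \<in> K" for j
      using xy that skew[of x "u j"] skew[of x "v j"] skew[of y "u j"] skew[of y "v j"] by (auto simp: \<Lambda>_def)
    have "frobenius_partial w (insert k K) (u(k := x)) (v(k := y)) (d(k := D))"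
      unfolding frobenius_partial_def using insert.hyps(2) d lat uv dvd D xy kx ky zz alt
      by (auto simp: \<Lambda>_def)
    then show ?case by blast
  qed
  then show ?thesis using that by (meson finite)
qed

section \<open>Simultaneous normal form of a metric and a symplectic form\<close>

text \<open>The first-order condition that identifies a maximiser of \<open>w\<close> on pairs of unit vectors as a
  pair of the normal form.\<close>

lemma max_functional_is_inner:
  fixes h :: "'a::euclidean_space \<Rightarrow> 'a \<Rightarrow> real"
  assumes h: "bilin h" "\<And>x y. h x y = h y x" "\<And>x. x \<noteq> 0 \<Longrightarrow> h x x > 0"
    and W: "subspace W" and \<phi>: "linear \<phi>" and f: "f \<in> W" "h f f = 1" "\<phi> f = a" "a > 0"
    and max: "\<And>y. y \<in> W \<Longrightarrow> h y y = 1 \<Longrightarrow> \<phi> y \<le> a" and z: "z \<in> W"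
  shows "\<phi> z = a * h f z"
proof -
  interpret bilin h by fact
  have orth: "\<phi> y = 0" if y: "y \<in> W" "h f y = 0" for y
  proof (rule ccontr)
    assume nz: "\<phi> y \<noteq> 0"
    define n where "n = h y y"
    have n: "n \<ge> 0" using h(3)[of y] by (cases "y = 0") (auto simp: n_def bil_simps)
    \<comment> \<open>The step is proportional to the supposed first-order gain. With this
      denominator the gain is \<open>t\<^sup>2 * (a * n + 1)\<close>, which exceeds the loss
      \<open>a * t\<^sup>2 * n / 2\<close> caused by renormalising to unit length.\<close>
    define t where "t = \<phi> y / (a * n + 1)"
    define s where "s = sqrt (1 + t\<^sup>2 * n)"
    have s: "s > 0" "s * s = 1 + t\<^sup>2 * n" using n by (auto simp: s_def add_pos_nonneg)
    have "h (f + t *\<^sub>R y) (f + t *\<^sub>R y) = s * s"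
      unfolding s(2) by (simp add: bil_simps f y h(2)[of y f] n_def power2_eq_square)
    then have "h ((1 / s) *\<^sub>R (f + t *\<^sub>R y)) ((1 / s) *\<^sub>R (f + t *\<^sub>R y)) = 1"
      using s(1) by (simp add: bilinear_lmul[OF bil] bilinear_rmul[OF bil])
    then have "\<phi> ((1 / s) *\<^sub>R (f + t *\<^sub>R y)) \<le> a"
      using W f(1) y(1) by (intro max) (auto intro: subspace_add subspace_scale)
    then have "(a + t * \<phi> y) / s \<le> a" using linear_add[OF \<phi>] linear_scale[OF \<phi>] f(3) by (simp add: add_divide_distrib)
    then have "a + t * \<phi> y \<le> a * s" using s(1) by (simp add: field_simps)
    also have "s \<le> 1 + t\<^sup>2 * n / 2"
    proof -
      have "0 \<le> (s - 1)\<^sup>2" by simp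
      then show ?thesis using s(2) by (simp add: power2_eq_square algebra_simps)
    qed
    finally have le: "t * \<phi> y \<le> a * (t\<^sup>2 * n / 2)" using f(4) by (simp add: distrib_left)
    have p: "a * n + 1 > 0" using n f(4) by (simp add: add_nonneg_pos)
    have t\<phi>: "\<phi> y = t * (a * n + 1)" using p by (simp add: t_def)
    have "t\<^sup>2 * (a * n + 1) \<le> t\<^sup>2 * (a * n / 2)" using le unfolding t\<phi> by (simp add: power2_eq_square algebra_simps)
    moreover have "t\<^sup>2 > 0" using nz p by (simp add: t_def)
    ultimately have "a * n + 1 \<le> a * n / 2" by (simp only: mult_le_cancel_left_pos)
    then show False using n f(4) mult_nonneg_nonneg[of a n] by linarith
  qed
  have "z - h f z *\<^sub>R f \<in> W" using W z f(1) by (auto intro: subspace_diff subspace_scale)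
  moreover have "h f (z - h f z *\<^sub>R f) = 0" by (simp add: bil_simps f)
  ultimately have "\<phi> (z - h f z *\<^sub>R f) = 0" by (rule orth)
  then show ?thesis using linear_diff[OF \<phi>] linear_scale[OF \<phi>] f(3) by simp
qed

lemma form_lower_bound:
  fixes h :: "'a::euclidean_space \<Rightarrow> 'a \<Rightarrow> real"
  assumes h: "bilin h" "\<And>x. x \<noteq> 0 \<Longrightarrow> h x x > 0"
  obtains c where "c > 0" "\<And>x. c * (norm x)\<^sup>2 \<le> h x x"
proof -
  interpret bilin h by fact
  have bb: "bounded_bilinear h" using bil bilinear_conv_bounded_bilinear by blast
  have cont: "continuous_on S (\<lambda>x. h x x)" for S
    by (intro bounded_bilinear.continuous_on[OF bb] continuous_on_id)
  have ne: "sphere (0::'a) 1 \<noteq> {}" by simp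
  obtain p where p: "p \<in> sphere 0 1" "\<And>x. x \<in> sphere 0 1 \<Longrightarrow> h p p \<le> h x x"
    using continuous_attains_inf[OF compact_sphere ne cont] by blast
  have c: "h p p > 0" using p(1) by (intro h(2)) auto
  have "h p p * (norm x)\<^sup>2 \<le> h x x" for x
  proof (cases "x = 0")
    case False
    then have "h p p \<le> h ((1 / norm x) *\<^sub>R x) ((1 / norm x) *\<^sub>R x)" by (intro p(2)) simp
    also have "\<dots> = h x x / (norm x)\<^sup>2" by (simp add: bilinear_lmul[OF bil] bilinear_rmul[OF bil] power2_eq_square)
    finally show ?thesis using False by (simp add: field_simps)
  qed (simp add: bil_simps)
  then show ?thesis using c that by blast
qed

lemma compact_unit_sphere_form:
  fixes h :: "'a::euclidean_space \<Rightarrow> 'a \<Rightarrow> real"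
  assumes h: "bilin h" "\<And>x. x \<noteq> 0 \<Longrightarrow> h x x > 0"
  shows "compact {x. h x x = 1}"
proof -
  interpret bilin h by fact
  have bb: "bounded_bilinear h" using bil bilinear_conv_bounded_bilinear by blast
  have cont: "continuous_on UNIV (\<lambda>x. h x x)"
    by (intro bounded_bilinear.continuous_on[OF bb] continuous_on_id)
  have "closed {x. h x x = 1}"
    using continuous_closed_preimage_constant[OF cont closed_UNIV, of 1] by simp
  moreover have "bounded {x. h x x = 1}"
  proof -
    obtain c where c: "c > 0" "\<And>x. c * (norm x)\<^sup>2 \<le> h x x" using form_lower_bound[OF h] by blast
    have "norm x \<le> 1 / sqrt c" if x: "h x x = 1" for x
    proof -
      have "sqrt ((norm x)\<^sup>2 * c) \<le> 1" using c(2)[of x] x by (simp add: mult.commute)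
      then show ?thesis using c(1) by (simp add: real_sqrt_mult field_simps)
    qed
    then show ?thesis by (auto intro!: boundedI)
  qed
  ultimately show ?thesis using compact_eq_bounded_closed by blast
qed

text \<open>The relations for \<open>w\<close> are required against every vector \<open>x\<close>,
  not just on the frame. They express that the \<open>h\<close>-orthogonal complement of the chosen
  pairs is also their \<open>w\<close>-orthogonal complement, which lets the induction continue
  inside it.\<close>

definition normal_partial :: "('a \<Rightarrow> 'a::euclidean_space \<Rightarrow> real) \<Rightarrow> ('a \<Rightarrow> 'a \<Rightarrow> real) \<Rightarrow> 'm set \<Rightarrow> ('m \<Rightarrow> 'a) \<Rightarrow> ('m \<Rightarrow> 'a) \<Rightarrow> ('m \<Rightarrow> real) \<Rightarrow> bool" where
  "normal_partial h w K e f a \<longleftrightarrow>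
     (\<forall>i\<in>K. \<forall>j\<in>K. h (e i) (e j) = (if i = j then 1 else 0) \<and> h (f i) (f j) = (if i = j then 1 else 0) \<and> h (e i) (f j) = 0) \<and>
     (\<forall>j\<in>K. a j > 0 \<and> (\<forall>x. w (e j) x = a j * h (f j) x \<and> w x (f j) = a j * h (e j) x))"

text \<open>On the complement \<open>W\<close> of the earlier pairs, \<open>w\<close> attains a
  maximum over pairs of unit vectors. The first-order condition in each argument says that
  \<open>w p\<close> and \<open>\<lambda>x. w x q\<close> are \<open>A\<close> times the
  \<open>h\<close>-products with the partner.\<close>

lemma symplectic_normal_form:
  fixes h w :: "'a::euclidean_space \<Rightarrow> 'a \<Rightarrow> real"
  assumes h: "bilin h" "\<And>x y. h x y = h y x" "\<And>x. x \<noteq> 0 \<Longrightarrow> h x x > 0" and w: "symplectic w"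
    and dim: "DIM('a) = 2 * CARD('m::finite)"
  obtains e f :: "'m::finite \<Rightarrow> 'a" and a where "normal_partial h w UNIV e f a"
proof -
  interpret symplectic w by fact
  interpret h: bilin h by fact
  have bb: "bounded_bilinear w" using bil bilinear_conv_bounded_bilinear by blast
  have hl: "bounded_linear (h x)" for x using h.lin(1) linear_conv_bounded_linear by blast
  have "\<exists>(e :: 'm \<Rightarrow> 'a) f a. normal_partial h w K e f a" if "finite K" for K
    using that
  proof induction
    case empty
    then show ?case by (simp add: normal_partial_def)
  next
    case (insert k K)
    then obtain e f :: "'m \<Rightarrow> 'a" and a where I: "normal_partial h w K e f a" by blast
    then have orth: "\<And>i j. i \<in> K \<Longrightarrow> j \<in> K \<Longrightarrow> h (e i) (e j) = (if i = j then 1 else 0)"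
        "\<And>i j. i \<in> K \<Longrightarrow> j \<in> K \<Longrightarrow> h (f i) (f j) = (if i = j then 1 else 0)"
        "\<And>i j. i \<in> K \<Longrightarrow> j \<in> K \<Longrightarrow> h (e i) (f j) = 0"
      and a: "\<And>j. j \<in> K \<Longrightarrow> a j > 0"
      and we: "\<And>j x. j \<in> K \<Longrightarrow> w (e j) x = a j * h (f j) x" and wf: "\<And>j x. j \<in> K \<Longrightarrow> w x (f j) = a j * h (e j) x"
      unfolding normal_partial_def by blast+
    define W where "W = {x. \<forall>j\<in>K. h (e j) x = 0 \<and> h (f j) x = 0}"
    define \<pi> where "\<pi> x = x - (\<Sum>j\<in>K. h (e j) x *\<^sub>R e j) - (\<Sum>j\<in>K. h (f j) x *\<^sub>R f j)" for x
    have W: "subspace W" by (auto simp: W_def subspace_def h.bil_simps)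
    have \<pi>W: "\<pi> x \<in> W" for x
    proof -
      have "h (e j) (\<pi> x) = 0" if j: "j \<in> K" for j
      proof -
        have "h (e j) (\<pi> x) = h (e j) x - (\<Sum>i\<in>K. h (e i) x * (if i = j then 1 else 0))"
          unfolding \<pi>_def by (simp add: h.bil_simps h.sum_right orth j) (rule sum.cong; simp add: orth j)
        then show ?thesis using insert.hyps(1) j by (simp add: if_distrib[of "\<lambda>z. _ * z"] cong: if_cong)
      qed
      moreover have "h (f j) (\<pi> x) = 0" if j: "j \<in> K" for j
      proof -
        have o: "h (f j) (e i) = 0" if "i \<in> K" for i using orth(3)[OF that j] h(2) by metis
        have "h (f j) (\<pi> x) = h (f j) x - (\<Sum>i\<in>K. h (f i) x * (if i = j then 1 else 0))"
          unfolding \<pi>_def by (simp add: h.bil_simps h.sum_right o j) (rule sum.cong; simp add: orth j)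
        then show ?thesis using insert.hyps(1) j by (simp add: if_distrib[of "\<lambda>z. _ * z"] cong: if_cong)
      qed
      ultimately show ?thesis by (simp add: W_def)
    qed
    have Wz: "w x (e j) = 0" "w x (f j) = 0" "w (e j) x = 0" "w (f j) x = 0" if "x \<in> W" "j \<in> K" for x j
      using that we[OF that(2)] wf[OF that(2)] skew[of x "e j"] skew[of "f j" x] by (auto simp: W_def)
    have w\<pi>: "w x (\<pi> y) = w x y" "w (\<pi> y) x = w y x" "h x (\<pi> y) = h x y" if x: "x \<in> W" for x y
    proof -
      have "h x (e j) = 0" "h x (f j) = 0" if "j \<in> K" for j using x that h(2) by (auto simp: W_def)
      then show "w x (\<pi> y) = w x y" "w (\<pi> y) x = w y x" "h x (\<pi> y) = h x y"
        using Wz[OF x] by (simp_all add: \<pi>_def bil_simps h.bil_simps sum_right sum_left h.sum_right)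
    qed
    have "K \<subset> UNIV" using insert.hyps by blast
    then have "card K < CARD('m)" by (simp add: psubset_card_mono)
    then have "card (e ` K \<union> f ` K) < DIM('a)"
      using card_two_images[OF insert.hyps(1), of e f] dim by simp
    then obtain b :: 'a where b: "b \<in> Basis" "b \<notin> span (e ` K \<union> f ` K)"
      using exists_Basis_notin_span[of "e ` K \<union> f ` K"] insert.hyps(1) by blast
    have b0: "\<pi> b \<noteq> 0"
    proof
      assume "\<pi> b = 0"
      then have "b = (\<Sum>j\<in>K. h (e j) b *\<^sub>R e j) + (\<Sum>j\<in>K. h (f j) b *\<^sub>R f j)" by (simp add: \<pi>_def algebra_simps)
      also have "\<dots> \<in> span (e ` K \<union> f ` K)"
        by (intro span_add span_sum span_scale span_base) auto
      finally show False using b by blast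
    qed
    then obtain b' where b': "w (\<pi> b) b' \<noteq> 0" using nondeg by blast
    define U where "U = W \<inter> {x. h x x = 1}"
    have normalize: "(1 / sqrt (h x x)) *\<^sub>R x \<in> U" if "x \<in> W" "x \<noteq> 0" for x
      using h(3)[OF that(2)] that(1) W by (auto simp: U_def h.bil_simps real_sqrt_mult_self intro!: subspace_scale)
    have "closed W"
    proof -
      have "W = (\<Inter>j\<in>K. {x. h (e j) x = 0} \<inter> {x. h (f j) x = 0})" by (auto simp: W_def)
      moreover have "closed {x. h y x = 0}" for y
        using continuous_closed_preimage_constant[OF linear_continuous_on[OF hl] closed_UNIV, of y 0] by simp
      ultimately show ?thesis by (auto intro!: closed_INT closed_Int)
    qed
    then have cU: "compact U" unfolding U_def by (rule closed_Int_compact[OF _ compact_unit_sphere_form[OF h(1,3)]])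
    have ne: "U \<times> U \<noteq> {}" using normalize[OF \<pi>W b0] by auto
    have "continuous_on (U \<times> U) (\<lambda>z. w (fst z) (snd z))"
      by (intro bounded_bilinear.continuous_on[OF bb] continuous_intros)
    from continuous_attains_sup[OF compact_Times[OF cU cU] ne this]
    obtain p q where pq: "p \<in> U" "q \<in> U" and mx: "\<And>x y. x \<in> U \<Longrightarrow> y \<in> U \<Longrightarrow> w x y \<le> w p q" by auto
    define A where "A = w p q"
    \<comment> \<open>Both orders of a pair with nonzero value are admissible, and skewness makes
      one of the two values positive.\<close>
    have A: "A > 0"
    proof -
      have nz: "w (\<pi> b) (\<pi> b') \<noteq> 0" using w\<pi>(1)[OF \<pi>W] b' by simp
      then have b'0: "\<pi> b' \<noteq> 0" by (auto simp: bil_simps)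
      define x where "x = (1 / sqrt (h (\<pi> b) (\<pi> b))) *\<^sub>R \<pi> b"
      define y where "y = (1 / sqrt (h (\<pi> b') (\<pi> b'))) *\<^sub>R \<pi> b'"
      have xy: "x \<in> U" "y \<in> U" using normalize \<pi>W b0 b'0 by (auto simp: x_def y_def)
      have "w x y \<noteq> 0" using nz h(3)[OF b0] h(3)[OF b'0] by (simp add: x_def y_def bil_simps)
      then show ?thesis using mx[OF xy] mx[OF xy(2,1)] skew[of x y] by (auto simp: A_def)
    qed
    have pW: "p \<in> W" "q \<in> W" "h p p = 1" "h q q = 1" using pq by (auto simp: U_def)
    \<comment> \<open>The first-order condition holds on \<open>W\<close>; since
      \<open>\<pi>\<close> changes neither side when paired with elements of \<open>W\<close>, it
      extends to all vectors.\<close>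
    have wp: "w p x = A * h q x" for x
    proof -
      have "w p (\<pi> x) = A * h q (\<pi> x)"
        by (rule max_functional_is_inner[OF h W lin(1) pW(2,4) _ A])
          (use mx[OF pq(1)] \<pi>W in \<open>auto simp: A_def U_def\<close>)
      then show ?thesis using w\<pi>[OF pW(1)] w\<pi>[OF pW(2)] by simp
    qed
    have wq: "w x q = A * h p x" for x
    proof -
      have "w (\<pi> x) q = A * h p (\<pi> x)"
        by (rule max_functional_is_inner[OF h W lin(2) pW(1,3) _ A])
          (use mx[OF _ pq(2)] \<pi>W in \<open>auto simp: A_def U_def\<close>)
      then show ?thesis using w\<pi>[OF pW(1)] w\<pi>[OF pW(2)] by simp
    qed
    have hpq: "h p q = 0" using wp[of p] alt[of p] A h(2)[of p q] by simp
    have hz: "h p (e j) = 0" "h p (f j) = 0" "h q (e j) = 0" "h q (f j) = 0"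
      "h (e j) p = 0" "h (f j) p = 0" "h (e j) q = 0" "h (f j) q = 0" if "j \<in> K" for j
      using pW(1,2) that h(2)[of p "e j"] h(2)[of p "f j"] h(2)[of q "e j"] h(2)[of q "f j"] by (auto simp: W_def)
    have "normal_partial h w (insert k K) (e(k := p)) (f(k := q)) (a(k := A))"
      unfolding normal_partial_def using insert.hyps(2) orth a we wf hz pW wp wq A hpq by auto
    then show ?case by blast
  qed
  then show ?thesis using that by (meson finite)
qed

section \<open>Determinants, coordinates and the trace\<close>

definition formmat :: "(real ^ 'n \<Rightarrow> real ^ 'n \<Rightarrow> real) \<Rightarrow> real ^ 'n ^ 'n" where
  "formmat b = (\<chi> i j. b (axis i 1) (axis j 1))"

lemma axis_expansion: "(\<Sum>i\<in>UNIV. x $ i *\<^sub>R axis i 1) = (x :: real ^ 'n)"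
  using basis_expansion[of x] by (simp add: scalar_mult_eq_scaleR)

lemma axis_sum:
  fixes c :: "real ^ 'n \<Rightarrow> real ^ 'n \<Rightarrow> real"
  assumes "bilin c" shows "(\<Sum>i\<in>UNIV. x $ i * c (axis i 1) y) = c x y" "(\<Sum>i\<in>UNIV. x $ i * c y (axis i 1)) = c y x"
proof -
  interpret c: bilin c by fact
  show "(\<Sum>i\<in>UNIV. x $ i * c (axis i 1) y) = c x y"
    by (subst (2) axis_expansion[of x, symmetric]) (simp add: c.sum_left c.bil_simps)
  show "(\<Sum>i\<in>UNIV. x $ i * c y (axis i 1)) = c y x"
    by (subst (2) axis_expansion[of x, symmetric]) (simp add: c.sum_right c.bil_simps)
qed

lemma formmat_congruence:
  fixes c :: "real ^ 'n \<Rightarrow> real ^ 'n \<Rightarrow> real" and B :: "'n \<Rightarrow> real ^ 'n"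
  assumes "bilin c"
  defines "P \<equiv> (\<chi> i k. B k $ i)"
  shows "(\<chi> k l. c (B k) (B l)) = transpose P ** formmat c ** P"
    "transpose P ** formmat c = (\<chi> k j. c (B k) (axis j 1))"
proof -
  note ax = axis_sum[OF assms(1)]
  show e: "transpose P ** formmat c = (\<chi> k j. c (B k) (axis j 1))"
    by (simp add: matrix_matrix_mult_def transpose_def P_def formmat_def ax)
  show "(\<chi> k l. c (B k) (B l)) = transpose P ** formmat c ** P"
    unfolding e by (simp add: matrix_matrix_mult_def P_def mult.commute[of "c _ _"] ax)
qed

lemma det_Ints: "(\<And>i j. A $ i $ j \<in> \<int>) \<Longrightarrow> det (A :: real ^ 'n ^ 'n) \<in> \<int>"
  unfolding det_def by (intro Ints_sum Ints_mult Ints_prod) (auto simp: sign_def)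

lemma abs_det_unimodular:
  fixes P Q :: "real ^ 'n ^ 'n"
  assumes "\<And>i j. P $ i $ j \<in> \<int>" "\<And>i j. Q $ i $ j \<in> \<int>" "Q ** P = mat 1"
  shows "\<bar>det P\<bar> = 1"
proof -
  obtain p q :: int where pq: "det P = of_int p" "det Q = of_int q"
    using det_Ints[of P] det_Ints[of Q] assms(1,2) by (auto elim!: Ints_cases)
  have "det Q * det P = 1" using assms(3) det_mul[of Q P] by simp
  then have "of_int (q * p) = (of_int 1 :: real)" by (simp add: pq)
  then have "q * p = 1" by (simp only: of_int_eq_iff)
  then have "\<bar>p\<bar> = 1" using abs_zmult_eq_1[of p q] by (simp add: mult.commute)
  then show ?thesis using pq by (metis of_int_1 of_int_abs)
qed

text \<open>The square of the determinant is a power of \<open>- 1\<close>; absolute values remove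
  the sign whatever the parity of the dimension.\<close>

lemma abs_det_complex_structure:
  fixes J :: "real ^ 'n ^ 'n"
  assumes "J ** J = mat (- 1)" shows "\<bar>det J\<bar> = 1"
proof -
  have "det (mat (- 1) :: real ^ 'n ^ 'n) = (\<Prod>i\<in>(UNIV::'n set). - 1)"
    by (subst det_diagonal) (auto simp: mat_def)
  then have e: "det J * det J = (- 1) ^ CARD('n)" using det_mul[of J J] assms by simp
  have "\<bar>det J * det J\<bar> = 1" unfolding e by (simp add: power_abs)
  then have "\<bar>det J\<bar>\<^sup>2 = 1" by (simp add: abs_mult power2_eq_square)
  then show ?thesis using power2_eq_1_iff[of "\<bar>det J\<bar>"] by auto
qed

lemma sum_UNIV_sum: "(\<Sum>k\<in>(UNIV::('m::finite + 'n::finite) set). g k) = (\<Sum>j\<in>UNIV. g (Inl j)) + (\<Sum>j\<in>UNIV. g (Inr j))"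
  using sum.Plus[of "UNIV::'m set" "UNIV::'n set" g] by simp

text \<open>The change to the Frobenius basis is unimodular, and in that basis \<open>w\<close> is
  the diagonal matrix with each \<open>d j\<close> occurring twice, times a matrix that squares to
  \<open>- 1\<close>.\<close>

lemma frobenius_det:
  fixes w :: "'m::finite euc \<Rightarrow> 'm euc \<Rightarrow> real"
  assumes w: "symplectic w" and fr: "frobenius_partial w UNIV u v d"
  shows "\<bar>det (formmat w)\<bar> = (\<Prod>j\<in>UNIV. real (d j))\<^sup>2"
proof -
  interpret symplectic w by fact
  have bw: "bilin w" by unfold_locales
  have d: "\<And>j. d j > 0" and lat: "\<And>j. u j \<in> lattice" "\<And>j. v j \<in> lattice"
    and uv: "\<And>i j. w (u i) (v j) = (if i = j then real (d j) else 0)"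
      "\<And>i j. w (u i) (u j) = 0" "\<And>i j. w (v i) (v j) = 0"
    and dvd: "\<And>j x. x \<in> lattice \<Longrightarrow> w (u j) x / d j \<in> \<int>" "\<And>j x. x \<in> lattice \<Longrightarrow> w x (v j) / d j \<in> \<int>"
    using fr unfolding frobenius_partial_def by auto
  have vu: "w (v i) (u j) = (if i = j then - real (d j) else 0)" for i j
    using uv(1)[of j i] skew[of "v i" "u j"] by auto
  define B where "B = case_sum u v"
  define P :: "real ^ ('m + 'm) ^ ('m + 'm)" where "P = (\<chi> i k. B k $ i)"
  \<comment> \<open>The rows are the coordinate functionals of the basis, read off by pairing with
    the partner vectors. They are integral by the divisibility clause, so \<open>P\<close> is
    invertible over the integers.\<close>
  define Q :: "real ^ ('m + 'm) ^ ('m + 'm)" where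
    "Q = (\<chi> k i. case k of Inl j \<Rightarrow> w (axis i 1) (v j) / d j | Inr j \<Rightarrow> w (u j) (axis i 1) / d j)"
  note ax = axis_sum[OF bw]
  have "Q ** P = mat 1"
  proof -
    have "(Q ** P) $ k $ l = (mat 1 :: real ^ ('m + 'm) ^ ('m + 'm)) $ k $ l" for k l
    proof (cases k)
      case (Inl j)
      have "(Q ** P) $ k $ l = (\<Sum>i\<in>UNIV. B l $ i * w (axis i 1) (v j)) / d j"
        by (simp add: matrix_matrix_mult_def Q_def P_def Inl sum_divide_distrib mult.commute)
      then show ?thesis using d[of j] by (cases l) (auto simp: ax B_def uv Inl mat_def)
    next
      case (Inr j)
      have "(Q ** P) $ k $ l = (\<Sum>i\<in>UNIV. B l $ i * w (u j) (axis i 1)) / d j"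
        by (simp add: matrix_matrix_mult_def Q_def P_def Inr sum_divide_distrib mult.commute)
      then show ?thesis using d[of j] by (cases l) (auto simp: ax B_def uv Inr mat_def)
    qed
    then show ?thesis by (simp add: vec_eq_iff)
  qed
  moreover have "P $ i $ k \<in> \<int>" for i k
    using lat by (cases k) (auto simp: P_def B_def lattice_def)
  moreover have "Q $ k $ i \<in> \<int>" for k i
    using dvd[OF lattice_closed(4)] by (cases k) (auto simp: Q_def)
  ultimately have P1: "\<bar>det P\<bar> = 1" using abs_det_unimodular by blast
  define J0 :: "real ^ ('m + 'm) ^ ('m + 'm)" where
    "J0 = (\<chi> k l. case k of Inl i \<Rightarrow> (case l of Inl j \<Rightarrow> 0 | Inr j \<Rightarrow> if i = j then 1 else 0)
        | Inr i \<Rightarrow> (case l of Inl j \<Rightarrow> if i = j then - 1 else 0 | Inr j \<Rightarrow> 0))"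
  define g where "g k = (case k of Inl j \<Rightarrow> real (d j) | Inr j \<Rightarrow> real (d j))" for k :: "'m + 'm"
  define Dg :: "real ^ ('m + 'm) ^ ('m + 'm)" where "Dg = (\<chi> k l. if k = l then g k else 0)"
  have "(J0 ** J0) $ k $ l = (mat (- 1) :: real ^ ('m + 'm) ^ ('m + 'm)) $ k $ l" for k l
    by (cases k; cases l) (auto simp: matrix_matrix_mult_def J0_def mat_def sum_UNIV_sum if_distrib[of "\<lambda>z. _ * z"] if_distribR cong: if_cong)
  then have J1: "\<bar>det J0\<bar> = 1" by (intro abs_det_complex_structure) (simp add: vec_eq_iff)
  have "(\<Prod>k\<in>(UNIV::('m + 'm) set). g k) = (\<Prod>j\<in>UNIV. real (d j)) * (\<Prod>j\<in>UNIV. real (d j))"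
    using prod.Plus[of "UNIV::'m set" "UNIV::'m set" g] by (simp add: g_def)
  then have D: "det Dg = (\<Prod>j\<in>UNIV. real (d j))\<^sup>2"
    by (subst det_diagonal) (auto simp: Dg_def power2_eq_square)
  have "(\<chi> k l. w (B k) (B l)) $ k $ l = (Dg ** J0) $ k $ l" for k l
  proof -
    have "(Dg ** J0) $ k $ l = g k * J0 $ k $ l"
      by (simp add: matrix_matrix_mult_def Dg_def if_distrib[of "\<lambda>z. z * _"] cong: if_cong)
    then show ?thesis by (cases k; cases l) (auto simp: B_def g_def J0_def uv vu)
  qed
  then have "transpose P ** formmat w ** P = Dg ** J0"
    using formmat_congruence(1)[OF bw, of B] by (simp add: P_def vec_eq_iff)
  then have "det P * det (formmat w) * det P = det Dg * det J0" by (metis det_mul det_transpose)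
  then have "\<bar>det P\<bar> * \<bar>det (formmat w)\<bar> * \<bar>det P\<bar> = \<bar>det Dg\<bar> * \<bar>det J0\<bar>" by (metis abs_mult)
  then show ?thesis by (simp add: P1 J1 D)
qed

text \<open>Coordinates are recovered by pairing with the partner vector and dividing by
  \<open>d j\<close>. Injectivity follows, and divisibility makes the recovered coordinates of a
  lattice vector integers.\<close>

lemma frobenius_coordinates:
  fixes w :: "'m::finite euc \<Rightarrow> 'm euc \<Rightarrow> real"
  assumes w: "symplectic w" and fr: "frobenius_partial w UNIV u v d"
  defines "\<Phi> \<equiv> \<lambda>y :: 'm phase. (\<Sum>j\<in>UNIV. fst y $ j *\<^sub>R u j) + (\<Sum>j\<in>UNIV. snd y $ j *\<^sub>R v j)"
  shows "linear \<Phi>" "bij \<Phi>" "\<Phi> ` (lattice \<times> lattice) = lattice"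
    "\<And>y z. w (\<Phi> y) (\<Phi> z) = pform d y z - pform d z y"
proof -
  interpret symplectic w by fact
  have d: "\<And>j. d j > 0" and lat: "\<And>j. u j \<in> lattice" "\<And>j. v j \<in> lattice"
    and uv: "\<And>i j. w (u i) (v j) = (if i = j then real (d j) else 0)"
      "\<And>i j. w (u i) (u j) = 0" "\<And>i j. w (v i) (v j) = 0"
    and dvd: "\<And>j x. x \<in> lattice \<Longrightarrow> w (u j) x / d j \<in> \<int>" "\<And>j x. x \<in> lattice \<Longrightarrow> w x (v j) / d j \<in> \<int>"
    using fr unfolding frobenius_partial_def by auto
  have vu: "w (v i) (u j) = (if i = j then - real (d j) else 0)" for i j
    using uv(1)[of j i] skew[of "v i" "u j"] by auto
  show lin\<Phi>: "linear \<Phi>"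
    by (rule linearI) (simp_all add: \<Phi>_def sum.distrib scaleR_add_left scaleR_sum_right scaleR_right_distrib)
  have wu: "w (u j) (\<Phi> z) = d j * snd z $ j" for j z
    by (simp add: \<Phi>_def bil_simps sum_right uv if_distrib[of "\<lambda>z. _ * z"] mult.commute cong: if_cong)
  have wv: "w (v j) (\<Phi> z) = - (d j * fst z $ j)" for j z
    by (simp add: \<Phi>_def bil_simps sum_right uv vu if_distrib[of "\<lambda>z. _ * z"] mult.commute cong: if_cong)
  show "w (\<Phi> y) (\<Phi> z) = pform d y z - pform d z y" for y z
  proof -
    have "w (\<Phi> y) (\<Phi> z) = (\<Sum>j\<in>UNIV. fst y $ j * w (u j) (\<Phi> z)) + (\<Sum>j\<in>UNIV. snd y $ j * w (v j) (\<Phi> z))"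
      by (subst (1) \<Phi>_def) (simp add: bil_simps sum_left)
    then show ?thesis by (simp add: wu wv pform_def sum_negf mult_ac)
  qed
  define F where "F x = (\<chi> j. w x (v j) / d j, \<chi> j. w (u j) x / d j)" for x
  have F\<Phi>: "F (\<Phi> y) = y" for y
    using d wv skew[of "\<Phi> y"] by (auto simp: F_def wu prod_eq_iff vec_eq_iff less_imp_neq[symmetric])
  then have inj: "inj \<Phi>" by (metis injI)
  have "surj \<Phi>"
    by (rule linear_injective_imp_surjective[OF lin\<Phi> inj]) (simp add: dim_UNIV)
  with inj show bij: "bij \<Phi>" by (simp add: bij_def)
  show "\<Phi> ` (lattice \<times> lattice) = lattice"
  proof (intro equalityI subsetI)
    fix x assume "x \<in> \<Phi> ` (lattice \<times> lattice)"
    then obtain p q where pq: "p \<in> lattice" "q \<in> lattice" "x = \<Phi> (p, q)" by auto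
    have "\<Phi> (p, q) \<in> lattice"
      unfolding \<Phi>_def fst_conv snd_conv
      by (intro lattice_closed(2) lattice_sum lattice_int_scale lat) (use pq in \<open>auto simp: lattice_def\<close>)
    then show "x \<in> lattice" using pq by simp
  next
    fix x :: "'m euc" assume x: "x \<in> lattice"
    have "x = \<Phi> (F x)" using F\<Phi> \<open>surj \<Phi>\<close> by (metis surj_def)
    moreover have "F x \<in> lattice \<times> lattice"
      unfolding F_def lattice_def mem_Times_iff by (simp add: dvd[OF x])
    ultimately show "x \<in> \<Phi> ` (lattice \<times> lattice)" by (rule image_eqI)
  qed
qed

lemma complex_structure_det:
  fixes h w :: "real ^ 'n \<Rightarrow> real ^ 'n \<Rightarrow> real"
  assumes h: "bilin h" and J: "linear J" "\<And>v. J (J v) = - v" and w: "\<And>u v. w u v = h (J u) v"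
  shows "\<bar>det (formmat w)\<bar> = \<bar>det (formmat h)\<bar>"
proof -
  define K where "K = matrix J"
  have "K ** K = matrix (J \<circ> J)" unfolding K_def using matrix_compose[OF J(1,1)] by simp
  also have "J \<circ> J = uminus" using J(2) by auto
  also have "matrix uminus = (mat (- 1) :: real ^ 'n ^ 'n)"
    by (simp add: matrix_def mat_def axis_def vec_eq_iff)
  finally have K1: "\<bar>det K\<bar> = 1" by (rule abs_det_complex_structure)
  have "formmat w = transpose K ** formmat h"
    using formmat_congruence(2)[OF h, of "\<lambda>k. J (axis k 1)"]
    by (simp add: K_def matrix_def formmat_def w transpose_def vec_eq_iff matrix_matrix_mult_def)
  then have "det (formmat w) = det K * det (formmat h)" by (metis det_mul det_transpose)
  then show ?thesis by (simp add: abs_mult K1)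
qed

text \<open>If the columns of \<open>P\<close> are orthonormal, then \<open>P\<close> times its
  transpose inverts the Gram matrix. The formula turns the trace in the Laplacian into a sum over
  the frame; the second claim is the orthonormal expansion.\<close>

lemma normal_basis_matrix:
  fixes h :: "'m::finite euc \<Rightarrow> 'm euc \<Rightarrow> real" and e f :: "'m \<Rightarrow> 'm euc"
  assumes h: "bilin h" "\<And>x y. h x y = h y x" and n: "normal_partial h w UNIV e f a"
  shows "matrix_inv (formmat h) $ i $ j = (\<Sum>k\<in>UNIV. e k $ i * e k $ j + f k $ i * f k $ j)"
    "x = (\<Sum>j\<in>UNIV. h (e j) x *\<^sub>R e j + h (f j) x *\<^sub>R f j)"
proof -
  interpret bilin h by fact
  have orth: "h (e i) (e j) = (if i = j then 1 else 0)" "h (f i) (f j) = (if i = j then 1 else 0)"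
    "h (e i) (f j) = 0" "h (f i) (e j) = 0" for i j
    using n h(2)[of "f i" "e j"] unfolding normal_partial_def by auto
  define B where "B = case_sum e f"
  define P :: "real ^ ('m + 'm) ^ ('m + 'm)" where "P = (\<chi> i k. B k $ i)"
  note cg = formmat_congruence[OF h(1), of B, folded P_def]
  have "(\<chi> k l. h (B k) (B l)) $ k $ l = (mat 1 :: real ^ ('m + 'm) ^ ('m + 'm)) $ k $ l" for k l
    by (cases k; cases l) (auto simp: B_def orth mat_def)
  then have "transpose P ** formmat h ** P = mat 1" using cg(1) by (simp add: vec_eq_iff)
  then have PG: "P ** (transpose P ** formmat h) = mat 1" by (simp add: matrix_left_right_inverse)
  then have GP: "(P ** transpose P) ** formmat h = mat 1" by (simp add: matrix_mul_assoc)
  then have GP': "formmat h ** (P ** transpose P) = mat 1" by (simp add: matrix_left_right_inverse)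
  have "matrix_inv (formmat h) = P ** transpose P"
  proof -
    have ex: "\<exists>X. formmat h ** X = mat 1 \<and> X ** formmat h = mat 1" using GP GP' by blast
    then have "matrix_inv (formmat h) ** formmat h = mat 1"
      unfolding matrix_inv_def by (metis (mono_tags, lifting) someI_ex)
    then have "matrix_inv (formmat h) ** formmat h ** (P ** transpose P) = P ** transpose P" by simp
    then show ?thesis using GP' by (simp add: matrix_mul_assoc[symmetric])
  qed
  then show "matrix_inv (formmat h) $ i $ j = (\<Sum>k\<in>UNIV. e k $ i * e k $ j + f k $ i * f k $ j)"
    by (simp add: matrix_matrix_mult_def transpose_def P_def sum_UNIV_sum B_def sum.distrib)
  have PG': "(\<Sum>k\<in>UNIV. B k $ i * h (B k) (axis l 1)) = (if i = l then 1 else 0)" for i l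
    using PG unfolding cg(2) by (simp add: matrix_matrix_mult_def P_def mat_def vec_eq_iff)
  have "x $ i = (\<Sum>k\<in>UNIV. B k $ i * h (B k) x)" for i
  proof -
    have "(\<Sum>k\<in>UNIV. B k $ i * h (B k) x) = (\<Sum>k\<in>UNIV. \<Sum>l\<in>UNIV. x $ l * (B k $ i * h (B k) (axis l 1)))"
      by (simp add: axis_sum(2)[OF h(1), symmetric, of "B _" x] sum_distrib_left mult_ac)
    also have "\<dots> = (\<Sum>l\<in>UNIV. x $ l * (\<Sum>k\<in>UNIV. B k $ i * h (B k) (axis l 1)))"
      by (subst sum.swap) (simp add: sum_distrib_left)
    also have "\<dots> = x $ i" by (simp add: PG' if_distrib[of "\<lambda>z. _ * z"] cong: if_cong)
    finally show ?thesis by simp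
  qed
  then show "x = (\<Sum>j\<in>UNIV. h (e j) x *\<^sub>R e j + h (f j) x *\<^sub>R f j)"
    by (simp add: vec_eq_iff sum_UNIV_sum B_def sum.distrib mult.commute)
qed

section \<open>The Kaehler condition and the volume\<close>

lemma kaehler_iff_normal:
  fixes h \<omega> :: "'m::finite bilinear_field" and e f :: "'m \<Rightarrow> 'm euc"
  assumes h: "riemannian_metric h" "\<And>x. h x = h 0" and \<omega>: "symplectic_form \<omega>" "\<And>x. \<omega> x = \<omega> 0"
    and n: "normal_partial (h 0) (\<omega> 0) UNIV e f a"
  shows "kaehler h \<omega> \<longleftrightarrow> (\<forall>j. a j = 1)"
proof
  define H W where "H = h 0" and "W = \<omega> 0"
  have H: "bilin H" "\<And>x y. H x y = H y x" "\<And>x. x \<noteq> 0 \<Longrightarrow> H x x > 0"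
    using h(1) unfolding riemannian_metric_def bilin_def H_def by auto
  have W: "bilin W" "\<And>x. W x x = 0"
    using \<omega>(1) unfolding symplectic_form_def bilin_def W_def by auto
  interpret H: bilin H by fact
  interpret W: bilin W by fact
  have skew: "W x y = - W y x" for x y
  proof -
    have "W x x + W x y + (W y x + W y y) = 0" using W(2)[of "x + y"] by (simp add: W.bil_simps)
    then show ?thesis using W(2)[of x] W(2)[of y] by simp
  qed
  have orth: "H (e i) (e j) = (if i = j then 1 else 0)" "H (f i) (f j) = (if i = j then 1 else 0)"
    "H (e i) (f j) = 0" "H (f i) (e j) = 0" and a: "a j > 0"
    and we: "W (e j) x = a j * H (f j) x" "W x (f j) = a j * H (e j) x" for i j x
    using n H(2)[of "f i" "e j"] unfolding normal_partial_def H_def W_def by auto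
  have H_ext: "x = y" if "\<And>z. H x z = H y z" for x y
  proof (rule ccontr)
    assume "x \<noteq> y"
    then have "H (x - y) (x - y) > 0" by (intro H(3)) simp
    then show False using that[of "x - y"] by (simp add: H.bil_simps)
  qed
  {
    assume "kaehler h \<omega>"
    then obtain J where J: "kaehler_manifold h J \<omega>" unfolding kaehler_def by blast
    \<comment> \<open>\<open>J\<close> may vary with the point, but
      \<open>\<omega> = h (J _) _\<close> and the definiteness of \<open>h\<close> determine its
      value at 0 on the frame. Squaring to \<open>- 1\<close> then forces
      \<open>(a j)\<^sup>2 = 1\<close>.\<close>
    define K where "K = J 0"
    have K: "linear K" "\<And>v. K (K v) = - v" "\<And>u v. W u v = H (K u) v"
      using J unfolding kaehler_manifold_def complex_structure_def K_def W_def H_def by auto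
    show "\<forall>j. a j = 1"
    proof
      fix j
      have Ke: "K (e j) = a j *\<^sub>R f j"
        by (rule H_ext) (simp add: K(3)[symmetric] we H.bil_simps)
      have Kf: "K (f j) = - a j *\<^sub>R e j"
        using skew[of "f j"] by (intro H_ext) (simp add: K(3)[symmetric] we H.bil_simps)
      have "- e j = a j *\<^sub>R (- a j *\<^sub>R e j)" using K(2)[of "e j"] by (simp add: Ke linear_scale[OF K(1)] Kf)
      then have "H (- e j) (e j) = H (a j *\<^sub>R (- a j *\<^sub>R e j)) (e j)" by simp
      then have "a j * a j = 1" by (simp add: H.bil_simps orth)
      then have "(a j)\<^sup>2 = 1" by (simp add: power2_eq_square)
      then show "a j = 1" using a[of j] by (simp add: power2_eq_1_iff)
    qed
  next
    assume a1: "\<forall>j. a j = 1"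
    note expan = normal_basis_matrix(2)[OF H(1,2) n[folded H_def W_def]]
    define K where "K x = (\<Sum>j\<in>UNIV. H (e j) x *\<^sub>R f j - H (f j) x *\<^sub>R e j)" for x
    have HK: "H (e j) (K x) = - H (f j) x" "H (f j) (K x) = H (e j) x" for j x
      by (simp_all add: K_def H.sum_right H.bil_simps orth if_distrib[of "\<lambda>z. _ * z"] sum_subtractf sum_negf cong: if_cong)
    have K: "linear K"
      by (rule linearI) (simp_all add: K_def H.bil_simps scaleR_add_left sum.distrib[symmetric] scaleR_sum_right algebra_simps)
    have KK: "K (K v) = - v" for v
    proof -
      have "K (K v) = - (\<Sum>j\<in>UNIV. H (e j) v *\<^sub>R e j + H (f j) v *\<^sub>R f j)"
        by (subst K_def) (auto simp: HK sum_negf[symmetric] intro!: sum.cong)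
      then show ?thesis using expan[of v] by simp
    qed
    have WK: "W u v = H (K u) v" for u v
    proof -
      have "W u v = (\<Sum>j\<in>UNIV. H (e j) u * W (e j) v + H (f j) u * W (f j) v)"
        by (subst expan[of u]) (simp add: W.sum_left W.bil_simps)
      also have "\<dots> = H (K u) v"
        using skew[of "f _" v] by (simp add: we a1 K_def H.sum_left H.bil_simps)
      finally show ?thesis .
    qed
    have HKK: "H (K u) (K v) = H u v" for u v
      using WK[of u "K v"] skew[of u "K v"] WK[of "K v" u] H(2)[of u v] by (simp add: KK H.bil_simps)
    \<comment> \<open>These linear coordinates intertwine \<open>K\<close> with multiplication by
      \<i>, so a single global chart provides the holomorphic coordinates at every point.\<close>
    define \<phi> where "\<phi> x = (\<chi> j. Complex (H (e j) x) (H (f j) x))" for x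
    have \<phi>K: "\<phi> (K v) = \<i> *s \<phi> v" for v
      by (simp add: \<phi>_def vec_eq_iff HK complex_eq_iff)
    have lin\<phi>: "linear \<phi>"
      by (rule linearI) (simp_all add: \<phi>_def vec_eq_iff H.bil_simps complex_eq_iff)
    then have bl: "bounded_linear \<phi>" using linear_conv_bounded_linear by blast
    have d\<phi>: "dderiv \<phi> x v = \<phi> v" for x v
      by (rule dderivI) (rule bounded_linear_imp_has_derivative[OF bl])
    have d\<phi>': "dderiv \<phi> x = \<phi>" for x by (rule ext) (rule d\<phi>)
    have inj: "inj \<phi>"
    proof (rule injI)
      fix x y assume "\<phi> x = \<phi> y"
      then have "H (e j) x = H (e j) y" "H (f j) x = H (f j) y" for j by (auto simp: \<phi>_def vec_eq_iff)
      then show "x = y" using expan[of x] expan[of y] by simp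
    qed
    have surj: "surj \<phi>"
    proof (rule surjI)
      fix z
      show "\<phi> (\<Sum>j\<in>UNIV. Re (z $ j) *\<^sub>R e j + Im (z $ j) *\<^sub>R f j) = z"
        by (simp add: \<phi>_def vec_eq_iff H.sum_right H.bil_simps orth if_distrib[of "\<lambda>z. _ * z"] complex_eq_iff cong: if_cong)
    qed
    have bij: "bij (dderiv \<phi> x)" for x using inj surj unfolding bij_def by (simp add: d\<phi>')
    have "complex_structure (\<lambda>x. K)"
      unfolding complex_structure_def periodic_on_def
      using K KK smooth_on_linear[OF open_UNIV bl] inj bij \<phi>K
      by (auto simp: smooth_on_const d\<phi>' intro!: exI[of _ "UNIV :: 'm euc set"] exI[of _ \<phi>])
    then have "kaehler_manifold h (\<lambda>x. K) \<omega>"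
      unfolding kaehler_manifold_def
      using h(1) \<omega>(1) HKK WK h(2) \<omega>(2) unfolding H_def W_def symplectic_form_def by metis
    then show "kaehler h \<omega>" unfolding kaehler_def by blast
  }
qed

text \<open>Through a complex structure \<open>\<omega>\<close> and \<open>h\<close> have Gram
  determinants of equal absolute value. Together with \<open>frobenius_det\<close> this ties the
  lattice invariant, the product of the \<open>d j\<close>, to the Riemannian volume.\<close>

lemma kaehler_volume:
  fixes h \<omega> :: "'m::finite bilinear_field"
  assumes h: "riemannian_metric h" "\<And>x. h x = h 0" and "kaehler h \<omega>"
  shows "\<bar>det (formmat (\<omega> 0))\<bar> = (riemannian_volume h)\<^sup>2"
proof -
  obtain J where J: "kaehler_manifold h J \<omega>" using assms(3) unfolding kaehler_def by blast
  have H: "bilin (h 0)" using h(1) unfolding riemannian_metric_def bilin_def by auto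
  have K: "linear (J 0)" "\<And>v. J 0 (J 0 v) = - v" "\<And>u v. \<omega> 0 u v = h 0 (J 0 u) v"
    using J unfolding kaehler_manifold_def complex_structure_def by auto
  have g: "gram h x = formmat (h 0)" for x unfolding gram_def formmat_def h(2)[of x] ..
  have "riemannian_volume h = sqrt (det (formmat (h 0)))"
    unfolding riemannian_volume_def g by (simp add: content_cbox_cart interval_ne_empty_cart)
  \<comment> \<open>\<open>sqrt\<close> is an odd function in HOL, so the square of a root is the
    absolute value of its argument.\<close>
  then have "(riemannian_volume h)\<^sup>2 = \<bar>det (formmat (h 0))\<bar>" by (simp add: real_sqrt_abs2 power2_eq_square flip: real_sqrt_mult)
  then show ?thesis using complex_structure_det[OF H K] by simp
qed

section \<open>Ladder operators\<close>

text \<open>An explicit basis with \<open>n\<close> elements of the subspace \<open>V\<close>.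
  \<open>vector_space.dim\<close> is 0 for an infinite-dimensional space too, so it could not carry
  the finiteness through the inductions.\<close>

definition fdim :: "(complex \<Rightarrow> 'v::ab_group_add \<Rightarrow> 'v) \<Rightarrow> 'v set \<Rightarrow> nat \<Rightarrow> bool" where
  "fdim s V n \<longleftrightarrow> (\<exists>\<phi>. (\<forall>f. f \<in> V \<longleftrightarrow> (\<exists>c. f = (\<Sum>i<n. s (c i) (\<phi> i)))) \<and>
     (\<forall>c. (\<Sum>i<n. s (c i) (\<phi> i)) = 0 \<longrightarrow> (\<forall>i<n. c i = 0)))"

lemma fdimI:
  assumes "finite I" "\<And>f. f \<in> V \<longleftrightarrow> (\<exists>c. f = (\<Sum>i\<in>I. s (c i) (\<phi> i)))"
    "\<And>c. (\<Sum>i\<in>I. s (c i) (\<phi> i)) = 0 \<Longrightarrow> \<forall>i\<in>I. c i = 0"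
  shows "fdim s V (card I)"
proof -
  obtain b where b: "bij_betw b {..<card I} I"
    using ex_bij_betw_nat_finite[OF assms(1)] by (auto simp: atLeast0LessThan)
  define b' where "b' = inv_into {..<card I} b"
  have b': "b' (b i) = i" if "i < card I" for i
    using b that by (simp add: b'_def bij_betw_def)
  have r: "(\<Sum>i<card I. s (c (b i)) (\<phi> (b i))) = (\<Sum>i\<in>I. s (c i) (\<phi> i))" for c
    using sum.reindex_bij_betw[OF b, of "\<lambda>i. s (c i) (\<phi> i)"] .
  have r': "(\<Sum>i<card I. s (c i) (\<phi> (b i))) = (\<Sum>i\<in>I. s (c (b' i)) (\<phi> i))" for c
    unfolding r[symmetric, of "\<lambda>i. c (b' i)"] using b' by (intro sum.cong) auto
  show ?thesis unfolding fdim_def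
  proof (intro exI[of _ "\<lambda>i. \<phi> (b i)"] conjI allI impI)
    show "f \<in> V \<longleftrightarrow> (\<exists>c. f = (\<Sum>i<card I. s (c i) (\<phi> (b i))))" for f
      unfolding assms(2) by (metis r r')
    fix c i assume "(\<Sum>i<card I. s (c i) (\<phi> (b i))) = 0" "i < card I"
    then have "\<forall>i\<in>I. c (b' i) = 0" unfolding r' by (intro assms(3))
    then show "c i = 0" using b' b \<open>i < card I\<close> by (metis bij_betwE lessThan_iff)
  qed
qed

lemma fdim_dim:
  assumes "vector_space s" "fdim s V n"
  shows "vector_space.dim s V = n"
proof -
  interpret vector_space s by fact
  obtain \<phi> where V: "\<And>f. f \<in> V \<longleftrightarrow> (\<exists>c. f = (\<Sum>i<n. s (c i) (\<phi> i)))"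
    and ind: "\<And>c. (\<Sum>i<n. s (c i) (\<phi> i)) = 0 \<Longrightarrow> \<forall>i<n. c i = 0"
    using assms(2) unfolding fdim_def by blast
  have inj: "inj_on \<phi> {..<n}"
  proof (rule inj_onI)
    fix i j assume ij: "i \<in> {..<n}" "j \<in> {..<n}" "\<phi> i = \<phi> j"
    show "i = j"
    proof (rule ccontr)
      assume ne: "i \<noteq> j"
      define c :: "nat \<Rightarrow> complex" where "c = (\<lambda>k. (if k = i then 1 else 0) - (if k = j then 1 else 0))"
      have "(\<Sum>k<n. s (c k) (\<phi> k)) = (\<Sum>k<n. (if k = i then \<phi> k else 0)) - (\<Sum>k<n. (if k = j then \<phi> k else 0))"
        unfolding sum_subtractf[symmetric] by (intro sum.cong) (auto simp: c_def scale_left_diff_distrib)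
      also have "\<dots> = 0" using ij by simp
      finally have "c i = 0" using ind ij by blast
      then show False using ne by (simp add: c_def)
    qed
  qed
  have r: "(\<Sum>v\<in>\<phi> ` {..<n}. s (u v) v) = (\<Sum>i<n. s (u (\<phi> i)) (\<phi> i))" for u
    by (simp add: sum.reindex[OF inj])
  define \<psi> where "\<psi> = inv_into {..<n} \<phi>"
  have \<psi>: "\<psi> (\<phi> i) = i" if "i < n" for i using inj that by (simp add: \<psi>_def)
  have "V = span (\<phi> ` {..<n})"
  proof (rule set_eqI)
    fix f
    have "(\<exists>c. f = (\<Sum>i<n. s (c i) (\<phi> i))) \<longleftrightarrow> (\<exists>u. f = (\<Sum>v\<in>\<phi> ` {..<n}. s (u v) v))"
    proof
      assume "\<exists>c. f = (\<Sum>i<n. s (c i) (\<phi> i))"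
      then obtain c where "f = (\<Sum>i<n. s (c i) (\<phi> i))" ..
      also have "\<dots> = (\<Sum>v\<in>\<phi> ` {..<n}. s (c (\<psi> v)) v)" unfolding r by (intro sum.cong) (auto simp: \<psi>)
      finally show "\<exists>u. f = (\<Sum>v\<in>\<phi> ` {..<n}. s (u v) v)" by (rule exI[of _ "\<lambda>v. c (\<psi> v)"])
    qed (auto simp: r)
    then show "f \<in> V \<longleftrightarrow> f \<in> span (\<phi> ` {..<n})" unfolding V by (auto simp: span_finite)
  qed
  moreover have "independent (\<phi> ` {..<n})"
  proof
    assume "dependent (\<phi> ` {..<n})"
    then obtain u i where "i < n" "u (\<phi> i) \<noteq> 0" "(\<Sum>i<n. s (u (\<phi> i)) (\<phi> i)) = 0"
      by (auto simp: dependent_finite r)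
    then show False using ind[of "\<lambda>i. u (\<phi> i)"] by blast
  qed
  ultimately have "dim V = card (\<phi> ` {..<n})" by (simp add: dim_span dim_eq_card_independent)
  then show ?thesis by (simp add: card_image[OF inj])
qed

lemma fdim_zero: "fdim s {0} 0"
  unfolding fdim_def by auto

text \<open>Lowering operators \<open>A j\<close> and raising operators \<open>C j\<close> of
  independent oscillators, linear only on \<open>X\<close>. Self-adjointness is replaced by
  \<open>lower_bound\<close>. The bound \<open>- b\<close> lies below the true bottom 0 of the
  spectrum of the sum of \<open>C j (A j f)\<close>, but any finite bound serves, since each
  lowering decreases an eigenvalue by the fixed amount \<open>c j\<close>.\<close>

locale ladder = vector_space scale
  for scale :: "complex \<Rightarrow> 'v::ab_group_add \<Rightarrow> 'v" (infixr "*c" 75) +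
  fixes X :: "'v set" and A C :: "'m::finite \<Rightarrow> 'v \<Rightarrow> 'v" and c :: "'m \<Rightarrow> real" and b :: real
  assumes X: "0 \<in> X" "\<And>f g. f \<in> X \<Longrightarrow> g \<in> X \<Longrightarrow> f + g \<in> X" "\<And>r f. f \<in> X \<Longrightarrow> r *c f \<in> X"
    and A: "\<And>j f. f \<in> X \<Longrightarrow> A j f \<in> X" "\<And>j f g. f \<in> X \<Longrightarrow> g \<in> X \<Longrightarrow> A j (f + g) = A j f + A j g"
      "\<And>j r f. f \<in> X \<Longrightarrow> A j (r *c f) = r *c A j f"
    and C: "\<And>j f. f \<in> X \<Longrightarrow> C j f \<in> X" "\<And>j f g. f \<in> X \<Longrightarrow> g \<in> X \<Longrightarrow> C j (f + g) = C j f + C j g"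
      "\<And>j r f. f \<in> X \<Longrightarrow> C j (r *c f) = r *c C j f"
    and AC: "\<And>i j f. f \<in> X \<Longrightarrow> A i (C j f) = C j (A i f) + (if i = j then complex_of_real (c j) *c f else 0)"
    and AA: "\<And>i j f. f \<in> X \<Longrightarrow> A i (A j f) = A j (A i f)"
    and CC: "\<And>i j f. f \<in> X \<Longrightarrow> C i (C j f) = C j (C i f)"
    and c: "\<And>j. c j > 0" and b: "b \<ge> 0"
    and lower_bound: "\<And>f z. f \<in> X \<Longrightarrow> f \<noteq> 0 \<Longrightarrow> (\<Sum>j\<in>UNIV. C j (A j f)) = z *c f \<Longrightarrow> Re z \<ge> - b"
begin

definition N where "N f = (\<Sum>j\<in>UNIV. C j (A j f))"

text \<open>Besides the eigenvalue it records in \<open>J\<close> which oscillators are already in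
  their ground state; \<open>J\<close> grows until it is everything.\<close>

definition E where "E J z = {f \<in> X. (\<forall>i\<in>J. A i f = 0) \<and> N f = z *c f}"

lemma X_sum: "(\<And>i. i \<in> I \<Longrightarrow> f i \<in> X) \<Longrightarrow> sum f I \<in> X"
  by (induction I rule: infinite_finite_induct) (auto intro: X)

lemma A0: "A j 0 = 0" using A(3)[OF X(1), of j 0] by simp
lemma C0: "C j 0 = 0" using C(3)[OF X(1), of j 0] by simp

lemma A_sum: "(\<And>i. i \<in> I \<Longrightarrow> f i \<in> X) \<Longrightarrow> A j (sum f I) = (\<Sum>i\<in>I. A j (f i))"
  by (induction I rule: infinite_finite_induct) (auto simp: A0 A(2) X_sum)

lemma C_sum: "(\<And>i. i \<in> I \<Longrightarrow> f i \<in> X) \<Longrightarrow> C j (sum f I) = (\<Sum>i\<in>I. C j (f i))"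
  by (induction I rule: infinite_finite_induct) (auto simp: C0 C(2) X_sum)

lemma A_diff: "f \<in> X \<Longrightarrow> g \<in> X \<Longrightarrow> A j (f - g) = A j f - A j g"
  using A(2)[of f "(- 1) *c g" j] A(3)[of g j "- 1"] X(3)[of g "- 1"] by simp

lemma N_linear: "f \<in> X \<Longrightarrow> g \<in> X \<Longrightarrow> N (f + g) = N f + N g" "f \<in> X \<Longrightarrow> N (r *c f) = r *c N f"
  by (simp_all add: N_def A C sum.distrib scale_sum_right)

lemma N_C: assumes "f \<in> X" shows "N (C j f) = C j (N f) + complex_of_real (c j) *c C j f"
proof -
  have "N (C j f) = (\<Sum>i\<in>UNIV. C j (C i (A i f)) + (if i = j then complex_of_real (c j) *c C j f else 0))"
    unfolding N_def using assms by (intro sum.cong) (auto simp: AC C A X CC C0)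
  then show ?thesis using assms by (simp add: sum.distrib N_def C_sum A C)
qed

lemma N_A: assumes "f \<in> X" shows "N (A j f) + complex_of_real (c j) *c A j f = A j (N f)"
proof -
  have "A j (N f) = (\<Sum>i\<in>UNIV. C i (A i (A j f)) + (if i = j then complex_of_real (c j) *c A j f else 0))"
    unfolding N_def using assms by (subst A_sum) (auto intro!: sum.cong simp: AC C A AA)
  then show ?thesis by (simp add: sum.distrib N_def)
qed

lemma E_subset: "f \<in> E J z \<Longrightarrow> f \<in> X" by (simp add: E_def)

lemma E_zero: "0 \<in> E J z" by (simp add: E_def X A0 N_def C0)

lemma E_add: "f \<in> E J z \<Longrightarrow> g \<in> E J z \<Longrightarrow> f + g \<in> E J z"
  by (auto simp: E_def X A N_linear scale_right_distrib)

lemma E_scale: "f \<in> E J z \<Longrightarrow> r *c f \<in> E J z"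
  by (auto simp: E_def X A N_linear scale_left_commute)

lemma E_diff: "f \<in> E J z \<Longrightarrow> g \<in> E J z \<Longrightarrow> f - g \<in> E J z"
  using E_add[of f J z "(- 1) *c g"] E_scale[of g J z "- 1"] by simp

lemma E_C: assumes "f \<in> E J z" "j \<notin> J" shows "C j f \<in> E J (z + c j)"
  using assms by (auto simp: E_def C N_C AC C0 scale_left_distrib)

lemma E_A: assumes "f \<in> E J z" shows "A j f \<in> E J (z - c j)"
proof -
  have f: "f \<in> X" "N f = z *c f" "\<And>i. i \<in> J \<Longrightarrow> A i f = 0" using assms by (auto simp: E_def)
  have "N (A j f) + complex_of_real (c j) *c A j f = z *c A j f" using N_A[OF f(1)] f by (simp add: A)
  then have "N (A j f) = (z - c j) *c A j f" by (simp add: scale_left_diff_distrib eq_diff_eq)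
  moreover have "A i (A j f) = 0" if "i \<in> J" for i using AA[OF f(1), of i j] f(3)[OF that] A0 by simp
  ultimately show ?thesis using A(1)[OF f(1)] by (simp add: E_def)
qed

lemma E_trivial: "Re z < - b \<Longrightarrow> E J z = {0}"
proof -
  assume z: "Re z < - b"
  have "f = 0" if f: "f \<in> E J z" for f
  proof (rule ccontr)
    assume "f \<noteq> 0"
    with f have "Re z \<ge> - b" by (intro lower_bound[of f z]) (auto simp: E_def N_def)
    with z show False by simp
  qed
  then show "E J z = {0}" using E_zero by blast
qed

text \<open>The shift by \<open>t > 0\<close> makes the induction work: on \<open>g + C\<^sub>j e\<close> with \<open>A\<^sub>j g = 0\<close> the operator
  \<open>C\<^sub>j A\<^sub>j + t\<close> acts as \<open>t\<close> on \<open>g\<close> and as \<open>C\<^sub>j A\<^sub>j + c\<^sub>j + t\<close> on \<open>e\<close>, which lives one level lower.\<close>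

lemma shifted_bijective:
  assumes "j \<notin> J"
  shows "Re z < - b + real n * c j \<Longrightarrow> t > 0 \<Longrightarrow>
    (\<forall>g\<in>E J z. \<exists>f\<in>E J z. C j (A j f) + complex_of_real t *c f = g) \<and>
    (\<forall>f\<in>E J z. C j (A j f) + complex_of_real t *c f = 0 \<longrightarrow> f = 0)"
proof (induction n arbitrary: z t)
  case 0
  then have "E J z = {0}" by (intro E_trivial) simp
  then show ?case by (simp add: A0 C0)
next
  case (Suc n)
  let ?z = "z - complex_of_real (c j)"
  have lt: "Re ?z < - b + real n * c j" using Suc.prems(1) by (simp add: distrib_right)
  note IH = Suc.IH[OF lt]
  have AC': "A j (C j e) = C j (A j e) + complex_of_real (c j) *c e" if "e \<in> X" for e using AC[OF that, of j j] by simp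
  have Ce: "C j e \<in> E J z" if "e \<in> E J ?z" for e using E_C[OF that assms] by simp
  \<comment> \<open>Choosing \<open>e\<close> one level lower with
    \<open>A j (C j e) = A j f\<close> leaves a remainder \<open>f - C j e\<close> annihilated by
    \<open>A j\<close>. Solvability is the induction hypothesis with shift
    \<open>c j\<close>.\<close>
  have dec: "\<exists>g e. g \<in> E J z \<and> A j g = 0 \<and> e \<in> E J ?z \<and> f = g + C j e" if f: "f \<in> E J z" for f
  proof -
    obtain e where e: "e \<in> E J ?z" "C j (A j e) + complex_of_real (c j) *c e = A j f"
      using IH[OF c[of j]] E_A[OF f] by blast
    have "A j (f - C j e) = 0"
      using e AC' E_subset f by (simp add: A_diff C)
    then show ?thesis using e f E_diff[OF f Ce[OF e(1)]] by (intro exI[of _ "f - C j e"] exI[of _ e]) simp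
  qed
  have op: "C j (A j (g + C j e)) + complex_of_real t *c (g + C j e)
      = complex_of_real t *c g + C j (C j (A j e) + complex_of_real (c j + t) *c e)"
    if "g \<in> E J z" "A j g = 0" "e \<in> E J ?z" for g e
  proof -
    have X': "g \<in> X" "e \<in> X" using that E_subset by auto
    show ?thesis using X' that(2)
      by (simp add: A C AC' X scale_right_distrib scale_left_distrib)
  qed
  have ct: "c j + t > 0" using c[of j] Suc.prems(2) by simp
  show ?case
  proof (intro conjI ballI impI)
    fix f assume "f \<in> E J z"
    then obtain g e where ge: "g \<in> E J z" "A j g = 0" "e \<in> E J ?z" "f = g + C j e" using dec by blast
    obtain e' where e': "e' \<in> E J ?z" "C j (A j e') + complex_of_real (c j + t) *c e' = e"
      using IH[OF ct] ge(3) by blast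
    let ?g = "complex_of_real (1 / t) *c g"
    have g': "?g \<in> E J z" "A j ?g = 0" "complex_of_real t *c ?g = g"
      using ge(1,2) E_subset Suc.prems(2) by (auto simp: E_scale A)
    have "?g + C j e' \<in> E J z" using g'(1) e'(1) Ce E_add by blast
    moreover have "C j (A j (?g + C j e')) + complex_of_real t *c (?g + C j e') = f"
      unfolding op[OF g'(1,2) e'(1)] g'(3) e'(2) ge(4) ..
    ultimately show "\<exists>f'\<in>E J z. C j (A j f') + complex_of_real t *c f' = f" by blast
  next
    fix f assume f: "f \<in> E J z" "C j (A j f) + complex_of_real t *c f = 0"
    obtain g e where ge: "g \<in> E J z" "A j g = 0" "e \<in> E J ?z" "f = g + C j e" using dec[OF f(1)] by blast
    define y where "y = C j (A j e) + complex_of_real (c j + t) *c e"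
    have yE: "y \<in> E J ?z"
    proof -
      have "C j (A j e) \<in> E J ?z" using E_C[OF E_A[OF ge(3), of j] assms] by simp
      then show ?thesis unfolding y_def using ge(3) E_add E_scale by blast
    qed
    have eq: "complex_of_real t *c g + C j y = 0" using f(2) unfolding ge(4) op[OF ge(1-3)] y_def .
    then have "A j (complex_of_real t *c g + C j y) = 0" by (simp add: A0)
    then have "C j (A j y) + complex_of_real (c j) *c y = 0"
      using E_subset[OF ge(1)] E_subset[OF yE] ge(2) by (simp add: A X C AC')
    then have y0: "y = 0" using IH[OF c[of j]] yE by blast
    then have "e = 0" using IH[OF ct] ge(3) unfolding y_def by blast
    moreover have "g = 0" using eq y0 Suc.prems(2) by (simp add: C0)
    ultimately show "f = 0" using ge(4) by (simp add: C0)
  qed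
qed

text \<open>\<open>E J z\<close> is the direct sum of the part killed by \<open>A j\<close> and the
  image under \<open>C j\<close> of the level below. The sum is direct and \<open>C j\<close>
  injective because \<open>A j\<close> after \<open>C j\<close> is the shifted operator, already
  known to be bijective.\<close>

lemma fdim_step:
  assumes j: "j \<notin> J" and d1: "fdim scale (E (insert j J) z) n1" and d2: "fdim scale (E J (z - c j)) n2"
  shows "fdim scale (E J z) (n1 + n2)"
proof -
  let ?z = "z - complex_of_real (c j)"
  obtain n where "Re ?z < - b + real n * c j"
    using reals_Archimedean3[OF c[of j], rule_format, of "Re ?z + b"] by (auto simp: algebra_simps)
  note bij = shifted_bijective[OF j this c[of j]]
  have AC': "A j (C j e) = C j (A j e) + complex_of_real (c j) *c e" if "e \<in> X" for e using AC[OF that, of j j] by simp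
  obtain p where p: "\<And>f. f \<in> E (insert j J) z \<longleftrightarrow> (\<exists>k. f = (\<Sum>i<n1. k i *c p i))"
    and pi: "\<And>k. (\<Sum>i<n1. k i *c p i) = 0 \<Longrightarrow> \<forall>i<n1. k i = 0"
    using d1 unfolding fdim_def by blast
  obtain q where q: "\<And>f. f \<in> E J ?z \<longleftrightarrow> (\<exists>k. f = (\<Sum>i<n2. k i *c q i))"
    and qi: "\<And>k. (\<Sum>i<n2. k i *c q i) = 0 \<Longrightarrow> \<forall>i<n2. k i = 0"
    using d2 unfolding fdim_def by blast
  have qE: "q i \<in> E J ?z" if "i < n2" for i
    unfolding q using that
    by (intro exI[of _ "\<lambda>k. if k = i then 1 else 0"]) (simp add: if_distrib[of "\<lambda>r. r *c _"] cong: if_cong)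
  have Cq: "C j (\<Sum>i<n2. k i *c q i) = (\<Sum>i<n2. k i *c C j (q i))" for k
    using E_subset[OF qE] by (subst C_sum) (auto simp: X C)
  define \<phi> where "\<phi> = case_sum p (\<lambda>i. C j (q i))"
  have split: "(\<Sum>i\<in>{..<n1} <+> {..<n2}. k i *c \<phi> i) = (\<Sum>i<n1. k (Inl i) *c p i) + C j (\<Sum>i<n2. k (Inr i) *c q i)" for k
    by (simp add: sum.Plus \<phi>_def Cq)
  have sub: "E (insert j J) z \<subseteq> E J z" by (auto simp: E_def)
  have "fdim scale (E J z) (card ({..<n1} <+> {..<n2}))"
  proof (rule fdimI[where \<phi> = \<phi>])
    fix f
    show "f \<in> E J z \<longleftrightarrow> (\<exists>k. f = (\<Sum>i\<in>{..<n1} <+> {..<n2}. k i *c \<phi> i))"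
    proof
      assume f: "f \<in> E J z"
      obtain e where e: "e \<in> E J ?z" "C j (A j e) + complex_of_real (c j) *c e = A j f"
        using bij E_A[OF f] by blast
      have "A j (f - C j e) = 0"
        using e AC' E_subset f by (simp add: A_diff C)
      moreover have "C j e \<in> E J z" using E_C[OF e(1) j] by simp
      ultimately have "f - C j e \<in> E (insert j J) z" using E_diff[OF f] by (simp add: E_def)
      then obtain k1 k2 where "f - C j e = (\<Sum>i<n1. k1 i *c p i)" "e = (\<Sum>i<n2. k2 i *c q i)"
        using e(1) unfolding p q by blast
      then have "f = (\<Sum>i\<in>{..<n1} <+> {..<n2}. case_sum k1 k2 i *c \<phi> i)"
        unfolding split by (simp add: algebra_simps)
      then show "\<exists>k. f = (\<Sum>i\<in>{..<n1} <+> {..<n2}. k i *c \<phi> i)" by blast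
    next
      assume "\<exists>k. f = (\<Sum>i\<in>{..<n1} <+> {..<n2}. k i *c \<phi> i)"
      then obtain k where "f = (\<Sum>i\<in>{..<n1} <+> {..<n2}. k i *c \<phi> i)" ..
      then have k: "f = (\<Sum>i<n1. k (Inl i) *c p i) + C j (\<Sum>i<n2. k (Inr i) *c q i)" by (simp only: split)
      have "(\<Sum>i<n1. k (Inl i) *c p i) \<in> E (insert j J) z" unfolding p by (rule exI, rule refl)
      then have "(\<Sum>i<n1. k (Inl i) *c p i) \<in> E J z" using sub by blast
      moreover have "(\<Sum>i<n2. k (Inr i) *c q i) \<in> E J ?z" unfolding q by (rule exI, rule refl)
      then have "C j (\<Sum>i<n2. k (Inr i) *c q i) \<in> E J z" using E_C[OF _ j] by fastforce
      ultimately show "f \<in> E J z" unfolding k by (rule E_add)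
    qed
  next
    fix k assume "(\<Sum>i\<in>{..<n1} <+> {..<n2}. k i *c \<phi> i) = 0"
    define g where "g = (\<Sum>i<n1. k (Inl i) *c p i)"
    define e where "e = (\<Sum>i<n2. k (Inr i) *c q i)"
    have z: "g + C j e = 0" using \<open>_ = 0\<close> unfolding split g_def e_def .
    have g: "g \<in> X" "A j g = 0" and e: "e \<in> E J ?z"
    proof -
      have "g \<in> E (insert j J) z" unfolding p g_def by (rule exI, rule refl)
      then show "g \<in> X" "A j g = 0" by (auto simp: E_def)
      show "e \<in> E J ?z" unfolding q e_def by (rule exI, rule refl)
    qed
    have "A j (g + C j e) = 0" using z by (simp add: A0)
    then have "C j (A j e) + complex_of_real (c j) *c e = 0" using g E_subset[OF e] by (simp add: A C AC')
    then have "e = 0" using bij e by blast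
    moreover from this have "g = 0" using z by (simp add: C0)
    ultimately show "\<forall>i\<in>{..<n1} <+> {..<n2}. k i = 0" using pi[of "\<lambda>i. k (Inl i)"] qi[of "\<lambda>i. k (Inr i)"]
      by (auto simp: g_def e_def)
  qed simp
  then show ?thesis by (simp add: card_Plus)
qed

definition levels :: "'m set \<Rightarrow> complex \<Rightarrow> ('m \<Rightarrow> nat) set" where
  "levels J z = {n. (\<forall>j\<in>J. n j = 0) \<and> complex_of_real (\<Sum>j\<in>UNIV. real (n j) * c j) = z}"

text \<open>Distinguishes occupation number zero from a successor at \<open>j\<close>, so that
  \<open>levels\<close> obeys the same recursion as the dimensions in
  \<open>fdim_step\<close>.\<close>

lemma levels_split:
  assumes "j \<notin> J"
  shows "levels J z = levels (insert j J) z \<union> (\<lambda>n. n(j := Suc (n j))) ` levels J (z - c j)"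
    "levels (insert j J) z \<inter> (\<lambda>n. n(j := Suc (n j))) ` levels J (z - c j) = {}"
    "inj (\<lambda>n. n(j := Suc (n j)))"
proof -
  have up: "(\<Sum>i\<in>UNIV. real ((n(j := Suc (n j))) i) * c i) = (\<Sum>i\<in>UNIV. real (n i) * c i) + c j" for n
  proof -
    have "(\<Sum>i\<in>UNIV. real ((n(j := Suc (n j))) i) * c i) = (\<Sum>i\<in>UNIV. real (n i) * c i + (if i = j then c j else 0))"
      by (intro sum.cong) (auto simp: distrib_right)
    then show ?thesis by (simp add: sum.distrib)
  qed
  show "levels J z = levels (insert j J) z \<union> (\<lambda>n. n(j := Suc (n j))) ` levels J (z - c j)"
  proof (intro equalityI subsetI)
    fix n assume n: "n \<in> levels J z"
    show "n \<in> levels (insert j J) z \<union> (\<lambda>n. n(j := Suc (n j))) ` levels J (z - c j)"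
    proof (cases "n j")
      case 0
      then show ?thesis using n by (simp add: levels_def)
    next
      case (Suc m)
      define n' where "n' = n(j := m)"
      have e: "n = n'(j := Suc (n' j))" using Suc by (auto simp: n'_def)
      have "complex_of_real (\<Sum>i\<in>UNIV. real (n i) * c i) = z" using n by (simp add: levels_def)
      then have "complex_of_real (\<Sum>i\<in>UNIV. real (n' i) * c i) = z - c j"
        unfolding e up by (simp add: eq_diff_eq)
      moreover have "\<forall>i\<in>J. n' i = 0" using n assms by (auto simp: levels_def n'_def)
      ultimately have "n' \<in> levels J (z - c j)" by (simp add: levels_def)
      then show ?thesis using e by blast
    qed
  next
    fix n assume "n \<in> levels (insert j J) z \<union> (\<lambda>n. n(j := Suc (n j))) ` levels J (z - c j)"
    then show "n \<in> levels J z"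
    proof
      assume "n \<in> (\<lambda>n. n(j := Suc (n j))) ` levels J (z - c j)"
      then obtain m where m: "m \<in> levels J (z - c j)" and n: "n = m(j := Suc (m j))" by blast
      have "complex_of_real (\<Sum>i\<in>UNIV. real (n i) * c i) = z"
        unfolding n up using m by (simp add: levels_def)
      moreover have "\<forall>i\<in>J. n i = 0" using m assms unfolding n by (auto simp: levels_def)
      ultimately show ?thesis by (simp add: levels_def)
    qed (simp add: levels_def)
  qed
  show "levels (insert j J) z \<inter> (\<lambda>n. n(j := Suc (n j))) ` levels J (z - c j) = {}"
    by (auto simp: levels_def)
  show "inj (\<lambda>n::'m \<Rightarrow> nat. n(j := Suc (n j)))"
  proof (rule injI, rule ext)
    fix m n :: "'m \<Rightarrow> nat" and i assume e: "m(j := Suc (m j)) = n(j := Suc (n j))"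
    show "m i = n i" using fun_cong[OF e, of i] by (cases "i = j") auto
  qed
qed

text \<open>The outer induction counts the oscillators not yet in their ground state, the inner one
  counts how often \<open>z\<close> can be lowered by \<open>c j\<close> before it falls below
  \<open>- b\<close>. When \<open>J\<close> is everything the operator is zero, so only
  \<open>z = 0\<close> survives.\<close>

theorem fdim_levels:
  assumes ground: "fdim scale (E UNIV 0) n0"
  shows "finite (levels J z) \<and> fdim scale (E J z) (card (levels J z) * n0)"
proof (induction "card (- J)" arbitrary: J z)
  case 0
  then have J: "J = UNIV" by auto
  show ?case
  proof (cases "z = 0")
    case True
    have "levels J z = {\<lambda>j. 0}" unfolding True J by (auto simp: levels_def)
    then show ?thesis using ground by (simp add: True J)
  next
    case False
    have "levels J z = {}" using False by (auto simp: levels_def J)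
    moreover have "E J z = {0}"
    proof -
      have "f = 0" if "f \<in> E J z" for f
      proof -
        have "N f = 0" using that by (simp add: E_def J N_def C0)
        then show ?thesis using that False by (simp add: E_def)
      qed
      then show ?thesis using E_zero by blast
    qed
    ultimately show ?thesis by (simp add: fdim_zero)
  qed
next
  case (Suc k)
  then obtain j where j: "j \<notin> J" by (metis card.empty Compl_iff ex_in_conv nat.distinct(1))
  have "- insert j J = - J - {j}" by auto
  then have "k = card (- insert j J)" using Suc.hyps(2) j by (simp add: card_Diff_singleton)
  note IH = Suc.hyps(1)[OF this]
  have "Re z < - b + real n * c j \<Longrightarrow> finite (levels J z) \<and> fdim scale (E J z) (card (levels J z) * n0)" for n
  proof (induction n arbitrary: z)
    case 0
    have "levels J z = {}"
    proof -
      have "(\<Sum>i\<in>UNIV. real (n i) * c i) \<ge> 0" for n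
        using c by (intro sum_nonneg mult_nonneg_nonneg) (auto intro: less_imp_le)
      then have "Re z \<ge> 0" if "n \<in> levels J z" for n
        using that unfolding levels_def by (metis (mono_tags, lifting) Re_complex_of_real mem_Collect_eq)
      then show ?thesis using 0 b by force
    qed
    then show ?case using E_trivial[of z J] 0 by (simp add: fdim_zero)
  next
    case (Suc n)
    have "Re (z - complex_of_real (c j)) < - b + real n * c j" using Suc.prems by (simp add: distrib_right)
    note 2 = Suc.IH[OF this]
    let ?u = "\<lambda>n. n(j := Suc (n j))"
    note sp = levels_split(1,2)[OF j, of z] levels_split(3)[OF j]
    have fin: "finite (levels J z)" unfolding sp(1) using IH[of z] 2 by simp
    have "card (levels J z) = card (levels (insert j J) z) + card (?u ` levels J (z - c j))"
      unfolding sp(1) using IH[of z] 2 by (intro card_Un_disjoint sp(2)) auto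
    also have "card (?u ` levels J (z - c j)) = card (levels J (z - c j))"
      by (rule card_image) (rule inj_on_subset[OF sp(3)], simp)
    finally show ?case using fin fdim_step[OF j conjunct2[OF IH[of z]] conjunct2[OF 2]]
      by (simp add: distrib_right)
  qed
  moreover obtain n where "Re z < - b + real n * c j"
    using reals_Archimedean3[OF c[of j], rule_format, of "Re z + b"] by (auto simp: algebra_simps)
  ultimately show ?case by blast
qed

end

section \<open>Landau levels on the torus\<close>

abbreviation (input) fscale :: "complex \<Rightarrow> ('a \<Rightarrow> complex) \<Rightarrow> 'a \<Rightarrow> complex" where
  "fscale c f \<equiv> (\<lambda>x. c * f x)"

lemma vector_space_fscale: "vector_space (\<lambda>c f. fscale c f)"
  by unfold_locales (auto simp: fun_eq_iff algebra_simps)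

lemma fun_sum_apply: "(\<Sum>i\<in>I. f i) x = (\<Sum>i\<in>I. f i x)"
  by (induction I rule: infinite_finite_induct) auto

text \<open>Sections in the gauge with potential \<open>- 2 \<pi> \<i> pform d\<close>. The \<open>k\<close>-th tensor power is covered by
  replacing \<open>d\<close> with \<open>k d\<close>.\<close>

definition qper :: "('m::finite \<Rightarrow> nat) \<Rightarrow> ('m phase \<Rightarrow> complex) set" where
  "qper d = {f. smooth_on UNIV f \<and> (\<forall>x. \<forall>b\<in>lattice \<times> lattice. f (x + b) = ee (pform d b x) * f x)}"

definition nab :: "('m::finite \<Rightarrow> nat) \<Rightarrow> 'm phase \<Rightarrow> ('m phase \<Rightarrow> complex) \<Rightarrow> 'm phase \<Rightarrow> complex" where
  "nab d v f x = dderiv f x v - 2 * pi * \<i> * pform d x v * f x"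

definition sform :: "('m::finite \<Rightarrow> nat) \<Rightarrow> 'm phase \<Rightarrow> 'm phase \<Rightarrow> real" where
  "sform d u v = pform d u v - pform d v u"

lemma pform_has_derivative: "((\<lambda>x. pform d x v) has_derivative (\<lambda>u. pform d u v)) F"
  using bounded_linear_imp_has_derivative pform_linear(2) linear_conv_bounded_linear by blast

lemma smooth_pform: "smooth_on UNIV (\<lambda>x. complex_of_real (pform d x v))"
  using smooth_on_bounded_linear[OF open_UNIV bounded_linear_of_real smooth_on_linear[OF open_UNIV]]
    pform_linear(2) linear_conv_bounded_linear by blast

lemma qperD:
  assumes "f \<in> qper d" shows "smooth_on UNIV f" "b \<in> lattice \<times> lattice \<Longrightarrow> f (x + b) = ee (pform d b x) * f x"
  using assms unfolding qper_def by blast+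

lemma smooth_UNIV_derivative: "smooth_on UNIV f \<Longrightarrow> (f has_derivative dderiv f x) (at x)"
  by (rule smooth_on_has_derivative) auto

lemma nab_eq: "nab d v f = (\<lambda>x. dderiv f x v + (- 2 * pi * \<i> * (complex_of_real (pform d x v)) * f x))"
  by (auto simp: nab_def fun_eq_iff)

lemma nab_smooth: "smooth_on UNIV f \<Longrightarrow> smooth_on UNIV (nab d v f)"
  unfolding nab_eq
  by (intro smooth_on_add smooth_on_mult smooth_on_dderiv smooth_pform smooth_on_const open_UNIV)

lemma nab_add: "smooth_on UNIV f \<Longrightarrow> smooth_on UNIV g \<Longrightarrow> nab d v (f + g) = nab d v f + nab d v g"
proof -
  assume fg: "smooth_on UNIV f" "smooth_on UNIV g"
  have "dderiv (f + g) x v = dderiv f x v + dderiv g x v" for x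
    unfolding plus_fun_def by (rule dderivI) (intro has_derivative_add smooth_UNIV_derivative fg)
  then show ?thesis by (auto simp: nab_def fun_eq_iff algebra_simps)
qed

lemma nab_scale: "smooth_on UNIV f \<Longrightarrow> nab d v (fscale c f) = fscale c (nab d v f)"
proof -
  assume f: "smooth_on UNIV f"
  have "dderiv (fscale c f) x v = c * dderiv f x v" for x
    by (rule dderivI) (intro has_derivative_mult_right smooth_UNIV_derivative f)
  then show ?thesis by (auto simp: nab_def fun_eq_iff algebra_simps)
qed

lemma nab_linear:
  assumes "smooth_on UNIV f"
  shows "nab d (u + v) f = nab d u f + nab d v f" "nab d (r *\<^sub>R v) f x = r * nab d v f x" "nab d (- v) f = - nab d v f"
proof -
  have dl: "linear (dderiv f y)" for y using dderiv_linear[OF smooth_on_differentiable[OF assms UNIV_I]] .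
  show "nab d (u + v) f = nab d u f + nab d v f" "nab d (r *\<^sub>R v) f x = r * nab d v f x" "nab d (- v) f = - nab d v f"
    by (simp_all add: nab_def fun_eq_iff pform_simps linear_add[OF dl] linear_scale[OF dl] linear_neg[OF dl] scaleR_conv_of_real[where 'a = complex] algebra_simps
        del: split_paired_All)
qed

lemma nab_has_derivative:
  assumes "smooth_on UNIV f"
  shows "(nab d v f has_derivative (\<lambda>u. dderiv (\<lambda>x. dderiv f x v) x u
    - 2 * pi * \<i> * (complex_of_real (pform d u v) * f x + complex_of_real (pform d x v) * dderiv f x u))) (at x)"
proof -
  have "((\<lambda>x. dderiv f x v - 2 * pi * \<i> * (complex_of_real (pform d x v) * f x)) has_derivative
     (\<lambda>u. dderiv (\<lambda>x. dderiv f x v) x u - 2 * pi * \<i> * (complex_of_real (pform d x v) * dderiv f x u + complex_of_real (pform d u v) * f x))) (at x)"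
    by (intro has_derivative_diff has_derivative_mult_right has_derivative_mult has_derivative_of_real
        pform_has_derivative smooth_UNIV_derivative assms smooth_on_dderiv)
  moreover have "nab d v f = (\<lambda>x. dderiv f x v - 2 * pi * \<i> * (complex_of_real (pform d x v) * f x))"
    by (auto simp: nab_def fun_eq_iff)
  ultimately show ?thesis by (simp add: add.commute)
qed

text \<open>Second derivatives commute, so only the derivative of the linear potential remains: the
  curvature is constant.\<close>

lemma nab_commute:
  assumes "smooth_on UNIV f"
  shows "nab d u (nab d v f) x = nab d v (nab d u f) x - 2 * pi * \<i> * sform d u v * f x"
  unfolding nab_def[of d u "nab d v f"] nab_def[of d v "nab d u f"] dderivI[OF nab_has_derivative[OF assms]]
  using dderiv_commute[OF assms, of u x v]
  by (simp add: nab_def sform_def algebra_simps)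

text \<open>Differentiating the phase \<open>ee (pform d b x)\<close> yields exactly the amount by
  which the potential changes from \<open>x\<close> to \<open>x + b\<close>.\<close>

lemma nab_qper:
  assumes f: "f \<in> qper d" shows "nab d v f \<in> qper d"
proof -
  note s = qperD(1)[OF f]
  have "nab d v f (x + b) = ee (pform d b x) * nab d v f x" if b: "b \<in> lattice \<times> lattice" for x b
  proof -
    have "((\<lambda>x. f (x + b)) has_derivative dderiv f (x + b)) (at x)"
      using dderiv_affine[OF bounded_linear_ident, of f x b] smooth_on_differentiable[OF s UNIV_I] by simp
    moreover have "(\<lambda>x. f (x + b)) = (\<lambda>x. ee (pform d b x) * f x)" using qperD(2)[OF f b] by auto
    ultimately have 1: "((\<lambda>x. ee (pform d b x) * f x) has_derivative dderiv f (x + b)) (at x)" by simp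
    have "(pform d b has_derivative pform d b) (at x)"
      using bounded_linear_imp_has_derivative pform_linear(1) linear_conv_bounded_linear by blast
    from fun_cong[OF has_derivative_unique[OF 1 has_derivative_mult[OF ee_has_derivative[OF this] smooth_UNIV_derivative[OF s]]], of v]
    have "dderiv f (x + b) v = ee (pform d b x) * dderiv f x v + 2 * pi * \<i> * (pform d b v) * ee (pform d b x) * f x"
      by simp
    then show ?thesis unfolding nab_def qperD(2)[OF f b] by (simp add: pform_simps) (simp add: algebra_simps)
  qed
  then show ?thesis using nab_smooth[OF s, of d v] unfolding qper_def by blast
qed

lemma qper_closed:
  "0 \<in> qper d" "f \<in> qper d \<Longrightarrow> g \<in> qper d \<Longrightarrow> f + g \<in> qper d" "f \<in> qper d \<Longrightarrow> fscale c f \<in> qper d"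
  by (auto simp: qper_def zero_fun_def plus_fun_def smooth_on_const algebra_simps
      intro!: smooth_on_add smooth_on_mult)

section \<open>The maximum principle\<close>

lemma second_derivative_at_max:
  fixes g g' :: "real \<Rightarrow> real"
  assumes "\<And>t. (g has_real_derivative g' t) (at t)" "(g' has_real_derivative D) (at 0)"
    "\<And>t. g t \<le> g 0"
  shows "D \<le> 0"
proof (rule ccontr)
  assume "\<not> D \<le> 0"
  then have "0 < D" by simp
  have g0: "g' 0 = 0"
    using DERIV_local_max[OF assms(1), of 1] assms(3) by simp
  obtain e where e: "e > 0" "\<And>h. 0 < h \<Longrightarrow> h < e \<Longrightarrow> g' 0 < g' (0 + h)"
    using has_real_derivative_pos_inc_right[OF assms(2) \<open>0 < D\<close>] by auto
  obtain z where z: "0 < z" "z < e / 2" "g (e / 2) - g 0 = (e / 2 - 0) * g' z"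
    using MVT2[of 0 "e / 2" g g'] e(1) assms(1) by auto
  have "g' z > 0" using e(2)[of z] z g0 e(1) by simp
  then have "g (e / 2) - g 0 > 0" unfolding z(3) using e(1) by (intro mult_pos_pos) auto
  then show False using assms(3)[of "e / 2"] by simp
qed

lemma lattice_reduction: "\<exists>b\<in>lattice. x + b \<in> cbox 0 (1 :: real ^ 'n)"
proof
  let ?b = "\<chi> i. - of_int \<lfloor>x $ i\<rfloor>"
  show "?b \<in> lattice" by (simp add: lattice_def)
  show "x + ?b \<in> cbox 0 1"
    by (auto simp: mem_box_cart) linarith+
qed

text \<open>The modulus is periodic although the function is not, so its maximum over a compact cell
  is global.\<close>

lemma qper_max:
  assumes f: "f \<in> qper d" obtains x0 where "\<And>x. norm (f x) \<le> norm (f x0)"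
proof -
  let ?K = "cbox (0 :: real ^ 'a) 1 \<times> cbox (0 :: real ^ 'a) 1"
  have c: "compact ?K" by (intro compact_Times compact_cbox)
  have ne: "?K \<noteq> {}" by (simp add: interval_ne_empty_cart)
  have "continuous_on ?K (\<lambda>x. norm (f x))"
    using smooth_on_UNIV_continuous[OF qperD(1)[OF f]] by (intro continuous_intros)
  then obtain x0 where x0: "\<And>x. x \<in> ?K \<Longrightarrow> norm (f x) \<le> norm (f x0)"
    using continuous_attains_sup[OF c ne] by metis
  have "norm (f x) \<le> norm (f x0)" for x
  proof -
    obtain p q where pq: "p \<in> lattice" "q \<in> lattice" "fst x + p \<in> cbox 0 1" "snd x + q \<in> cbox 0 1"
      using lattice_reduction by blast
    then have "norm (f (x + (p, q))) \<le> norm (f x0)" by (intro x0) (cases x, auto)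
    moreover have "norm (f (x + (p, q))) = norm (f x)" using qperD(2)[OF f, of "(p, q)" x] pq by (simp add: norm_mult)
    ultimately show ?thesis by simp
  qed
  then show ?thesis using that by blast
qed

text \<open>Along a line, half the second derivative of the squared modulus is the left-hand side:
  the potential is imaginary and drops out, so ordinary derivatives can be replaced by covariant
  ones.\<close>

lemma nab_second_derivative_max:
  assumes s: "smooth_on UNIV f" and mx: "\<And>x. norm (f x) \<le> norm (f x0)"
  shows "Re (cnj (f x0) * nab d v (nab d v f) x0) + (norm (nab d v f x0))\<^sup>2 \<le> 0"
proof -
  define \<theta> where "\<theta> x = 2 * pi * pform d x v" for x
  have D: "dderiv h x v = nab d v h x + \<i> * of_real (\<theta> x) * h x" for h :: "'a phase \<Rightarrow> complex" and x
    by (simp add: nab_def \<theta>_def)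
  define g where "g t = Re (cnj (f (x0 + t *\<^sub>R v)) * f (x0 + t *\<^sub>R v))" for t
  define g' where "g' t = 2 * Re (cnj (f (x0 + t *\<^sub>R v)) * nab d v f (x0 + t *\<^sub>R v))" for t
  have line: "((\<lambda>t. h (x0 + t *\<^sub>R v)) has_vector_derivative dderiv h (x0 + t *\<^sub>R v) v) (at t)"
    if "smooth_on UNIV h" for h :: "'a phase \<Rightarrow> complex" and t
    by (rule has_vector_derivative_line[OF smooth_UNIV_derivative[OF that]])
  have pr: "((\<lambda>t. Re (cnj (f (x0 + t *\<^sub>R v)) * h (x0 + t *\<^sub>R v))) has_real_derivative
      Re (cnj (f (x0 + t *\<^sub>R v)) * dderiv h (x0 + t *\<^sub>R v) v + cnj (dderiv f (x0 + t *\<^sub>R v) v) * h (x0 + t *\<^sub>R v))) (at t)"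
    if h: "smooth_on UNIV h" for h t
    unfolding has_real_derivative_iff_has_vector_derivative
    by (rule bounded_linear.has_vector_derivative[OF bounded_linear_Re])
      (intro has_vector_derivative_mult line[OF h] bounded_linear.has_vector_derivative[OF bounded_linear_cnj] line[OF s])
  have g: "(g has_real_derivative g' t) (at t)" for t
    unfolding g_def using pr[OF s, of t] by (simp add: g'_def D algebra_simps)
  have "((\<lambda>t. Re (cnj (f (x0 + t *\<^sub>R v)) * nab d v f (x0 + t *\<^sub>R v))) has_real_derivative
     Re (cnj (f x0) * nab d v (nab d v f) x0) + (norm (nab d v f x0))\<^sup>2) (at 0)"
    using pr[OF nab_smooth[OF s, of d v], of 0] unfolding D cmod_power2
    by (simp add: power2_eq_square algebra_simps)
  then have "(g' has_real_derivative 2 * (Re (cnj (f x0) * nab d v (nab d v f) x0) + (norm (nab d v f x0))\<^sup>2)) (at 0)"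
    unfolding g'_def by (rule DERIV_cmult)
  moreover have gn: "g t = (norm (f (x0 + t *\<^sub>R v)))\<^sup>2" for t
    unfolding g_def cmod_power2 by (simp add: power2_eq_square)
  then have "g t \<le> g 0" for t unfolding gn using mx by (simp add: power_mono)
  ultimately show ?thesis using second_derivative_at_max[OF g] by fastforce
qed

section \<open>Ladder operators of the Laplacian\<close>

definition lap :: "('m::finite \<Rightarrow> nat) \<Rightarrow> ('m \<Rightarrow> 'm phase) \<Rightarrow> ('m \<Rightarrow> 'm phase) \<Rightarrow> ('m phase \<Rightarrow> complex) \<Rightarrow> 'm phase \<Rightarrow> complex" where
  "lap d e f s x = - (\<Sum>j\<in>UNIV. nab d (e j) (nab d (e j) s) x + nab d (f j) (nab d (f j) s) x)"

text \<open>The covariant derivative along the antiholomorphic vector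
  \<open>e j + \<i> * f j\<close> for the complex structure taking \<open>e j\<close> to
  \<open>f j\<close>; its common kernel consists of the holomorphic sections. \<open>cre\<close>
  below is its formal adjoint.\<close>

definition ann :: "('m::finite \<Rightarrow> nat) \<Rightarrow> ('m \<Rightarrow> 'm phase) \<Rightarrow> ('m \<Rightarrow> 'm phase) \<Rightarrow> 'm \<Rightarrow> ('m phase \<Rightarrow> complex) \<Rightarrow> 'm phase \<Rightarrow> complex" where
  "ann d e f j s = nab d (e j) s + fscale \<i> (nab d (f j) s)"

definition cre :: "('m::finite \<Rightarrow> nat) \<Rightarrow> ('m \<Rightarrow> 'm phase) \<Rightarrow> ('m \<Rightarrow> 'm phase) \<Rightarrow> 'm \<Rightarrow> ('m phase \<Rightarrow> complex) \<Rightarrow> 'm phase \<Rightarrow> complex" where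
  "cre d e f j s = fscale (- 1) (nab d (e j) s) + fscale \<i> (nab d (f j) s)"

definition darboux :: "('m::finite \<Rightarrow> nat) \<Rightarrow> ('m \<Rightarrow> 'm phase) \<Rightarrow> ('m \<Rightarrow> 'm phase) \<Rightarrow> ('m \<Rightarrow> real) \<Rightarrow> bool" where
  "darboux d e f a \<longleftrightarrow> (\<forall>j. a j > 0) \<and> (\<forall>i j. sform d (e i) (f j) = (if i = j then a j else 0) \<and>
     sform d (e i) (e j) = 0 \<and> sform d (f i) (f j) = 0)"

lemma ann_apply: "ann d e f j s x = nab d (e j) s x + \<i> * nab d (f j) s x"
  by (simp add: ann_def)

lemma cre_apply: "cre d e f j s x = - nab d (e j) s x + \<i> * nab d (f j) s x"
  by (simp add: cre_def)

lemma nab_ann_cre: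
  fixes s :: "'m::finite phase \<Rightarrow> complex"
  assumes s: "smooth_on UNIV s"
  shows "nab d v (ann d e f j s) x = nab d v (nab d (e j) s) x + \<i> * nab d v (nab d (f j) s) x"
    "nab d v (cre d e f j s) x = - nab d v (nab d (e j) s) x + \<i> * nab d v (nab d (f j) s) x"
proof -
  have sm: "smooth_on UNIV (fscale c (nab d v s))" for c v
    by (intro smooth_on_mult smooth_on_const open_UNIV nab_smooth s)
  show "nab d v (ann d e f j s) x = nab d v (nab d (e j) s) x + \<i> * nab d v (nab d (f j) s) x"
    unfolding ann_def nab_add[OF nab_smooth[OF s] sm] nab_scale[OF nab_smooth[OF s]] by simp
  show "nab d v (cre d e f j s) x = - nab d v (nab d (e j) s) x + \<i> * nab d v (nab d (f j) s) x"
    unfolding cre_def nab_add[OF sm sm] nab_scale[OF nab_smooth[OF s]] by simp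
qed

text \<open>The mixed terms combine to \<open>- \<i>\<close> times the commutator of the derivatives
  along \<open>e j\<close> and \<open>f j\<close>, and the curvature turns this into the zero-point
  term \<open>2 * pi * a j\<close>.\<close>

lemma cre_ann:
  fixes s :: "'m::finite phase \<Rightarrow> complex"
  assumes D: "darboux d e f a" and s: "smooth_on UNIV s"
  shows "cre d e f j (ann d e f j s) x
    = - (nab d (e j) (nab d (e j) s) x + nab d (f j) (nab d (f j) s) x) - 2 * pi * a j * s x"
proof -
  have e: "sform d (e j) (f j) = a j" using D by (simp add: darboux_def)
  show ?thesis
    using nab_commute[OF s, of d "e j" "f j" x]
    unfolding cre_apply nab_ann_cre[OF s] by (simp add: e) (simp add: algebra_simps)
qed

text \<open>The commutator of \<open>ann\<close> and \<open>cre\<close> is \<open>2 * \<i>\<close>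
  times that of the two derivatives, hence the spacing \<open>4 * pi * a j\<close>. The bound is the
  total zero-point energy, because the maximum principle gives the Laplacian eigenvalues nonnegative
  real part.\<close>

lemma ladder_qper:
  assumes D: "darboux d e f a"
  shows "ladder (\<lambda>c f. fscale c f) (qper d) (ann d e f) (cre d e f) (\<lambda>j. 4 * pi * a j) (2 * pi * (\<Sum>j\<in>UNIV. a j))"
proof -
  have a: "a j > 0" for j using D by (auto simp: darboux_def)
  have S: "sform d (e i) (f j) = (if i = j then a j else 0)" "sform d (e i) (e j) = 0" "sform d (f i) (f j) = 0" for i j
    using D by (auto simp: darboux_def)
  have S': "sform d (f i) (e j) = (if i = j then - a j else 0)" for i j
    using S(1)[of j i] by (auto simp: sform_def)
  note S = S S'
  interpret vector_space "\<lambda>c f. fscale c f :: 'a phase \<Rightarrow> complex" by (rule vector_space_fscale)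
  have sm: "smooth_on UNIV (fscale c (nab d v s))" if "smooth_on UNIV s" for c v and s :: "'a phase \<Rightarrow> complex"
    by (intro smooth_on_mult smooth_on_const open_UNIV nab_smooth that)
  have sm2: "smooth_on UNIV (fscale c s)" if "smooth_on UNIV s" for c and s :: "'a phase \<Rightarrow> complex"
    by (intro smooth_on_mult smooth_on_const open_UNIV that)
  note ops = ann_def cre_def
  note nn = nab_add nab_scale nab_smooth sm sm2
  show ?thesis
  proof unfold_locales
    fix s t :: "'a phase \<Rightarrow> complex" and r j i z
    show "0 \<in> qper d" by (rule qper_closed)
    assume s: "s \<in> qper d"
    note ss = qperD(1)[OF s]
    show "fscale r s \<in> qper d" by (rule qper_closed(3)[OF s])
    show "ann d e f j s \<in> qper d" "cre d e f j s \<in> qper d" unfolding ops by (intro qper_closed nab_qper s)+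
    show "ann d e f j (fscale r s) = fscale r (ann d e f j s)" "cre d e f j (fscale r s) = fscale r (cre d e f j s)"
      unfolding ops by (rule ext, simp add: nn ss, (simp add: algebra_simps)?)+
    show "ann d e f i (cre d e f j s) = cre d e f j (ann d e f i s) + (if i = j then fscale (complex_of_real (4 * pi * a j)) s else 0)"
    proof
      fix x
      show "ann d e f i (cre d e f j s) x = (cre d e f j (ann d e f i s) + (if i = j then fscale (complex_of_real (4 * pi * a j)) s else 0)) x"
        using nab_commute[OF ss, of d "e i" "e j" x] nab_commute[OF ss, of d "e i" "f j" x]
          nab_commute[OF ss, of d "f i" "e j" x] nab_commute[OF ss, of d "f i" "f j" x]
        by (simp add: ann_apply cre_apply nab_ann_cre[OF ss] S) (simp add: algebra_simps)
    qed
    show "ann d e f i (ann d e f j s) = ann d e f j (ann d e f i s)"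
    proof
      fix x
      show "ann d e f i (ann d e f j s) x = ann d e f j (ann d e f i s) x"
        using nab_commute[OF ss, of d "e i" "e j" x] nab_commute[OF ss, of d "e i" "f j" x]
          nab_commute[OF ss, of d "f i" "e j" x] nab_commute[OF ss, of d "f i" "f j" x]
        by (simp add: ann_apply cre_apply nab_ann_cre[OF ss] S) (simp add: algebra_simps)
    qed
    show "cre d e f i (cre d e f j s) = cre d e f j (cre d e f i s)"
    proof
      fix x
      show "cre d e f i (cre d e f j s) x = cre d e f j (cre d e f i s) x"
        using nab_commute[OF ss, of d "e i" "e j" x] nab_commute[OF ss, of d "e i" "f j" x]
          nab_commute[OF ss, of d "f i" "e j" x] nab_commute[OF ss, of d "f i" "f j" x]
        by (simp add: ann_apply cre_apply nab_ann_cre[OF ss] S) (simp add: algebra_simps)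
    qed
    {
      assume t: "t \<in> qper d"
      note tt = qperD(1)[OF t]
      show "s + t \<in> qper d" by (rule qper_closed(2)[OF s t])
      show "ann d e f j (s + t) = ann d e f j s + ann d e f j t" "cre d e f j (s + t) = cre d e f j s + cre d e f j t"
        unfolding ops by (rule ext, simp add: nn ss tt, (simp add: algebra_simps)?)+
    }
    assume s0: "s \<noteq> 0" and eig: "(\<Sum>j\<in>UNIV. cre d e f j (ann d e f j s)) = fscale z s"
    \<comment> \<open>At a maximum of the modulus, the real part of \<open>cnj (s x0)\<close> times
      each second covariant derivative is at most 0. Pairing the eigenvalue equation at
      \<open>x0\<close> with \<open>cnj (s x0)\<close> therefore bounds \<open>Re z\<close>.\<close>
    obtain x0 where x0: "\<And>x. norm (s x) \<le> norm (s x0)" using qper_max[OF s] by blast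
    have "s x0 \<noteq> 0"
    proof
      assume "s x0 = 0"
      then have "s x = 0" for x using x0[of x] by simp
      then show False using s0 by auto
    qed
    have "z * s x0 = (\<Sum>j\<in>UNIV. cre d e f j (ann d e f j s) x0)"
      using fun_cong[OF eig, of x0] by (simp add: fun_sum_apply)
    also have "\<dots> = - (\<Sum>j\<in>UNIV. nab d (e j) (nab d (e j) s) x0 + nab d (f j) (nab d (f j) s) x0)
        - 2 * pi * (\<Sum>j\<in>UNIV. a j) * s x0"
      by (simp add: cre_ann[OF D ss] sum_subtractf sum_negf sum_distrib_left sum_distrib_right sum.distrib)
    finally have "(z + 2 * pi * (\<Sum>j\<in>UNIV. a j)) * s x0
        = - (\<Sum>j\<in>UNIV. nab d (e j) (nab d (e j) s) x0 + nab d (f j) (nab d (f j) s) x0)" by (simp add: algebra_simps)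
    then have "cnj (s x0) * ((z + 2 * pi * (\<Sum>j\<in>UNIV. a j)) * s x0)
        = - (\<Sum>j\<in>UNIV. cnj (s x0) * nab d (e j) (nab d (e j) s) x0 + cnj (s x0) * nab d (f j) (nab d (f j) s) x0)"
      by (simp add: sum_distrib_left distrib_left)
    moreover have "cnj (s x0) * ((z + 2 * pi * (\<Sum>j\<in>UNIV. a j)) * s x0) = (z + 2 * pi * (\<Sum>j\<in>UNIV. a j)) * of_real ((norm (s x0))\<^sup>2)"
      unfolding complex_norm_square by simp
    ultimately have "Re ((z + 2 * pi * (\<Sum>j\<in>UNIV. a j)) * of_real ((norm (s x0))\<^sup>2)) =
      - (\<Sum>j\<in>UNIV. Re (cnj (s x0) * nab d (e j) (nab d (e j) s) x0) + Re (cnj (s x0) * nab d (f j) (nab d (f j) s) x0))"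
      by (simp only: uminus_complex.sel Re_sum plus_complex.sel)
    also have "\<dots> \<ge> 0"
    proof -
      have "Re (cnj (s x0) * nab d v (nab d v s) x0) \<le> 0" for v
        using nab_second_derivative_max[OF ss x0, of d v] zero_le_power2[of "norm (nab d v s x0)"] by linarith
      then have "(\<Sum>j\<in>UNIV. Re (cnj (s x0) * nab d (e j) (nab d (e j) s) x0) + Re (cnj (s x0) * nab d (f j) (nab d (f j) s) x0)) \<le> 0"
        by (intro sum_nonpos add_nonpos_nonpos)
      then show ?thesis by simp
    qed
    finally have "0 \<le> (Re z + 2 * pi * (\<Sum>j\<in>UNIV. a j)) * (norm (s x0))\<^sup>2" by simp
    then show "- (2 * pi * (\<Sum>j\<in>UNIV. a j)) \<le> Re z"
      using \<open>s x0 \<noteq> 0\<close> by (simp add: zero_le_mult_iff)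
  next
    show "0 < 4 * pi * a j" for j using a by simp
    show "0 \<le> 2 * pi * (\<Sum>j\<in>UNIV. a j)" using a by (intro mult_nonneg_nonneg sum_nonneg) (auto intro: less_imp_le)
  qed
qed

theorem landau_levels:
  assumes D: "darboux d e f a"
    and ground: "fdim (\<lambda>c f. fscale c f) {s \<in> qper d. \<forall>j. ann d e f j s = 0} n0"
  defines "lev z \<equiv> {n. complex_of_real (2 * pi * (\<Sum>j\<in>UNIV. a j * (2 * real (n j) + 1))) = z}"
  shows "finite (lev z)" "fdim (\<lambda>c f. fscale c f) {s \<in> qper d. \<forall>x. lap d e f s x = z * s x} (card (lev z) * n0)"
proof -
  interpret ladder "\<lambda>c f. fscale c f" "qper d" "ann d e f" "cre d e f" "\<lambda>j. 4 * pi * a j" "2 * pi * (\<Sum>j\<in>UNIV. a j)"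
    by (rule ladder_qper[OF D])
  let ?b = "complex_of_real (2 * pi * (\<Sum>j\<in>UNIV. a j))"
  have N: "N s x = lap d e f s x - ?b * s x" if "s \<in> qper d" for s x
    unfolding N_def fun_sum_apply cre_ann[OF D qperD(1)[OF that]] lap_def
    by (simp add: sum_subtractf sum_negf sum_distrib_left sum_distrib_right sum.distrib)
  have N0: "N s = 0" if "\<forall>j. ann d e f j s = 0" for s
    using that C0 unfolding N_def by simp
  have "E UNIV 0 = {s \<in> qper d. \<forall>j. ann d e f j s = 0}"
  proof -
    have "fscale 0 s = 0" for s :: "'a phase \<Rightarrow> complex" by auto
    then show ?thesis using N0 by (auto simp: E_def)
  qed
  then have "fdim (\<lambda>c f. fscale c f) (E UNIV 0) n0" using ground by simp
  note fl = fdim_levels[OF this, of "{}" "z - ?b"]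
  have "E {} (z - ?b) = {s \<in> qper d. \<forall>x. lap d e f s x = z * s x}"
    using N by (auto simp: E_def fun_eq_iff left_diff_distrib)
  moreover have "levels {} (z - ?b) = lev z"
  proof -
    have "2 * pi * (\<Sum>j\<in>UNIV. a j * (2 * real (n j) + 1)) = (\<Sum>j\<in>UNIV. real (n j) * (4 * pi * a j)) + 2 * pi * (\<Sum>j\<in>UNIV. a j)" for n
      by (simp add: sum_distrib_left sum.distrib distrib_left mult_ac)
    then show ?thesis unfolding levels_def lev_def by (auto simp: eq_diff_eq simp del: of_real_sum)
  qed
  ultimately show "finite (lev z)" "fdim (\<lambda>c f. fscale c f) {s \<in> qper d. \<forall>x. lap d e f s x = z * s x} (card (lev z) * n0)"
    using fl by simp_all
qed

section \<open>Fourier analysis of periodic functions\<close>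

lemma axis_Basis: "axis j (1::real) \<in> Basis"
  by (auto simp: Basis_vec_def)

text \<open>The box lengthened by \<open>s\<close> in direction \<open>j\<close> is cut once at
  height \<open>s\<close> and once at height 1. Both cuts split off a slab of thickness
  \<open>s\<close>, and the two slabs are translates by a period.\<close>

lemma integral_periodic_shift:
  fixes g :: "real ^ 'm \<Rightarrow> complex"
  assumes cont: "continuous_on UNIV g" and per: "\<And>x. g (x + axis j 1) = g x" and s: "0 \<le> s" "s \<le> 1"
  shows "integral (cbox 0 1) (\<lambda>x. g (x + s *\<^sub>R axis j 1)) = integral (cbox 0 1) g"
proof -
  define e :: "real ^ 'm" where "e = axis j 1"
  have int: "g integrable_on cbox a b" for a b
    by (rule integrable_continuous) (rule continuous_on_subset[OF cont], simp)
  have e: "e \<in> Basis" by (simp add: e_def axis_Basis)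
  have ei: "x \<bullet> e = x $ j" "e $ i = (if i = j then 1 else 0)" for x i
    by (simp add: e_def inner_axis) (simp add: e_def axis_def)
  let ?T = "integral (cbox 0 (1 + s *\<^sub>R e)) g"
  have "?T = integral (cbox 0 (1 + s *\<^sub>R e) \<inter> {x. x \<bullet> e \<le> s}) g + integral (cbox 0 (1 + s *\<^sub>R e) \<inter> {x. x \<bullet> e \<ge> s}) g"
    by (rule integral_split[OF int e])
  also have "cbox 0 (1 + s *\<^sub>R e) \<inter> {x. x \<bullet> e \<ge> s} = cbox (s *\<^sub>R e) (1 + s *\<^sub>R e)"
    using s by (auto simp: mem_box_cart ei split: if_splits) (metis le_cases order_trans)+
  also have "cbox 0 (1 + s *\<^sub>R e) \<inter> {x. x \<bullet> e \<le> s} = cbox 0 (1 + (s - 1) *\<^sub>R e)"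
    using s by (auto simp: mem_box_cart ei split: if_splits) (smt (verit))+
  finally have T1: "?T = integral (cbox 0 (1 + (s - 1) *\<^sub>R e)) g + integral (cbox (s *\<^sub>R e) (1 + s *\<^sub>R e)) g" .
  have "?T = integral (cbox 0 (1 + s *\<^sub>R e) \<inter> {x. x \<bullet> e \<le> 1}) g + integral (cbox 0 (1 + s *\<^sub>R e) \<inter> {x. x \<bullet> e \<ge> 1}) g"
    by (rule integral_split[OF int e])
  also have "cbox 0 (1 + s *\<^sub>R e) \<inter> {x. x \<bullet> e \<ge> 1} = cbox (0 + e) (1 + (s - 1) *\<^sub>R e + e)"
    using s by (auto simp: mem_box_cart ei split: if_splits) (smt (verit))+
  also have "cbox 0 (1 + s *\<^sub>R e) \<inter> {x. x \<bullet> e \<le> 1} = cbox 0 1"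
    using s by (auto simp: mem_box_cart ei split: if_splits) (smt (verit))+
  also have "integral (cbox (0 + e) (1 + (s - 1) *\<^sub>R e + e)) g = integral (cbox 0 (1 + (s - 1) *\<^sub>R e)) g"
    using integral_shift_cbox[of "0 + e" e "1 + (s - 1) *\<^sub>R e + e" g] per by (simp add: e_def)
  finally have "integral (cbox (s *\<^sub>R e) (1 + s *\<^sub>R e)) g = integral (cbox 0 1) g" using T1 by simp
  then show ?thesis
    using integral_shift_cbox[of "s *\<^sub>R e" "s *\<^sub>R e" "1 + s *\<^sub>R e" g] by (simp add: e_def)
qed

text \<open>The integral over a period cell does not change under translation, so its derivative
  with respect to the translation vanishes; differentiation under the integral identifies that
  derivative.\<close>

lemma integral_periodic_derivative:
  fixes g :: "real ^ 'm \<Rightarrow> complex"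
  assumes der: "\<And>x. (g has_derivative g' x) (at x)" and cont: "\<And>v. continuous_on UNIV (\<lambda>x. g' x v)"
    and per: "\<And>x j. g (x + axis j 1) = g x"
  shows "integral (cbox 0 1) (\<lambda>x. g' x w) = 0"
proof -
  have cg: "continuous_on S g" for S
    by (intro continuous_at_imp_continuous_on ballI has_derivative_continuous[OF der])
  have ax: "integral (cbox 0 1) (\<lambda>x. g' x (axis j 1)) = 0" for j
  proof -
    let ?e = "axis j 1 :: real ^ 'm"
    have "((\<lambda>s. integral (cbox 0 1) (\<lambda>x. g (x + s *\<^sub>R ?e))) has_vector_derivative
        integral (cbox 0 1) (\<lambda>x. g' (x + 0 *\<^sub>R ?e) ?e)) (at 0 within {0..1})"
    proof (rule leibniz_rule_vector_derivative)
      show "((\<lambda>s. g (x + s *\<^sub>R ?e)) has_vector_derivative g' (x + s *\<^sub>R ?e) ?e) (at s within {0..1})" for x s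
        by (rule has_vector_derivative_line[OF der])
      show "(\<lambda>x. g (x + s *\<^sub>R ?e)) integrable_on cbox 0 1" for s
        by (intro integrable_continuous continuous_on_compose2[OF cg[of UNIV]] continuous_intros) auto
      show "continuous_on ({0..1} \<times> cbox 0 1) (\<lambda>(s, x). g' (x + s *\<^sub>R ?e) ?e)"
        unfolding split_beta by (intro continuous_on_compose2[OF cont] continuous_intros) auto
    qed auto
    moreover have "((\<lambda>s. integral (cbox 0 1) (\<lambda>x. g (x + s *\<^sub>R ?e))) has_vector_derivative 0) (at 0 within {0..1})"
    proof (rule has_vector_derivative_transform[of _ _ _ "\<lambda>s. integral (cbox 0 1) g"])
      show "integral (cbox 0 1) (\<lambda>x. g (x + s *\<^sub>R ?e)) = integral (cbox 0 1) g" if "s \<in> {0..1}" for s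
        using integral_periodic_shift[OF cg per] that by simp
    qed (auto intro!: derivative_eq_intros)
    ultimately show ?thesis
      using vector_derivative_unique_within_closed_interval[of 0 1 0 "\<lambda>s. integral (cbox 0 1) (\<lambda>x. g (x + s *\<^sub>R ?e))"] by auto
  qed
  have "integral (cbox 0 1) (\<lambda>x. g' x w) = integral (cbox 0 1) (\<lambda>x. \<Sum>j\<in>UNIV. w $ j *\<^sub>R g' x (axis j 1))"
  proof (rule integral_cong)
    fix x
    have l: "linear (g' x)" using der has_derivative_linear by blast
    have "g' x (\<Sum>j\<in>UNIV. w $ j *\<^sub>R axis j 1) = (\<Sum>j\<in>UNIV. w $ j *\<^sub>R g' x (axis j 1))"
      by (simp add: linear_sum[OF l] linear_scale[OF l])
    then show "g' x w = (\<Sum>j\<in>UNIV. w $ j *\<^sub>R g' x (axis j 1))" by (simp add: axis_expansion)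
  qed
  also have "\<dots> = (\<Sum>j\<in>UNIV. integral (cbox 0 1) (\<lambda>x. w $ j *\<^sub>R g' x (axis j 1)))"
    by (intro integral_sum integrable_continuous continuous_intros continuous_on_subset[OF cont]) auto
  also have "\<dots> = 0" by (simp add: ax)
  finally show ?thesis .
qed

definition freq :: "('m::finite \<Rightarrow> int) \<Rightarrow> real ^ 'm" where
  "freq n = (\<chi> j. of_int (n j))"

definition char :: "('m::finite \<Rightarrow> int) \<Rightarrow> real ^ 'm \<Rightarrow> complex" where
  "char n q = ee (freq n \<bullet> q)"

lemma freq_inner: "freq n \<bullet> q = (\<Sum>j\<in>UNIV. of_int (n j) * q $ j)"
  by (simp add: freq_def inner_vec_def)

lemma freq_lattice: "q \<in> lattice \<Longrightarrow> freq n \<bullet> q \<in> \<int>"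
  by (auto simp: freq_inner lattice_def intro!: Ints_sum Ints_mult)

lemma char_periodic: "b \<in> lattice \<Longrightarrow> char n (q + b) = char n q"
  by (simp add: char_def inner_add_right ee_add ee_Ints freq_lattice)

lemma char_has_derivative: "(char n has_derivative (\<lambda>v. (2 * pi * \<i> * of_real (freq n \<bullet> v)) * char n q)) (at q)"
  unfolding char_def by (intro ee_has_derivative derivative_intros)

lemma char_continuous: "continuous_on S (char n)"
  by (intro continuous_at_imp_continuous_on ballI has_derivative_continuous[OF char_has_derivative])

lemma freq_add: "freq (\<lambda>j. m j + n j) = freq m + freq n" "freq (\<lambda>j. - n j) = - freq n" "freq (\<lambda>j. m j - n j) = freq m - freq n"
  by (auto simp: freq_def vec_eq_iff)

lemma integral_char: "integral (cbox 0 1) (char n) = (if n = (\<lambda>j. 0) then 1 else 0)"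
proof (cases "n = (\<lambda>j. 0)")
  case True
  then have "char n = (\<lambda>q. 1)" by (auto simp: char_def freq_def inner_vec_def)
  then show ?thesis using True by (simp add: content_cbox_cart interval_ne_empty_cart)
next
  case False
  then obtain j where j: "n j \<noteq> 0" by auto
  have "integral (cbox 0 1) (\<lambda>q. (2 * pi * \<i> * of_real (freq n \<bullet> axis j 1)) * char n q) = 0"
    by (rule integral_periodic_derivative[OF char_has_derivative])
      (auto intro!: continuous_intros char_continuous char_periodic lattice_closed)
  then have "(2 * pi * \<i> * of_real (freq n \<bullet> axis j 1)) * integral (cbox 0 1) (char n) = 0" by simp
  moreover have "freq n \<bullet> axis j 1 \<noteq> 0" using j by (simp add: inner_axis freq_def)
  ultimately show ?thesis using False by simp
qed

section \<open>Trigonometric polynomials and uniqueness of Fourier coefficients\<close>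

inductive trig_poly :: "(real ^ 'm::finite \<Rightarrow> complex) \<Rightarrow> bool" where
  char: "trig_poly (\<lambda>q. c * char n q)"
| add: "trig_poly f \<Longrightarrow> trig_poly g \<Longrightarrow> trig_poly (\<lambda>q. f q + g q)"

lemma trig_poly_const: "trig_poly (\<lambda>q. c)"
  using trig_poly.char[of c "\<lambda>j. 0"] by (simp add: char_def freq_def inner_vec_def)

lemma trig_poly_mult_char: "trig_poly f \<Longrightarrow> trig_poly (\<lambda>q. c * char n q * f q)"
proof (induction rule: trig_poly.induct)
  case (char d m)
  have "(\<lambda>q. c * char n q * (d * char m q)) = (\<lambda>q. (c * d) * char (\<lambda>j. n j + m j) q)"
    by (auto simp: char_def freq_add inner_add_left ee_add)
  then show ?case using trig_poly.char by metis
next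
  case (add f g)
  then show ?case using trig_poly.add by (simp add: distrib_left)
qed

lemma trig_poly_mult: "trig_poly f \<Longrightarrow> trig_poly g \<Longrightarrow> trig_poly (\<lambda>q. f q * g q)"
proof (induction rule: trig_poly.induct)
  case (char c n)
  then show ?case by (rule trig_poly_mult_char)
next
  case (add f g)
  then show ?case using trig_poly.add by (simp add: distrib_right)
qed

lemma trig_poly_sum: "(\<And>i. i \<in> I \<Longrightarrow> trig_poly (f i)) \<Longrightarrow> trig_poly (\<lambda>q. \<Sum>i\<in>I. f i q)"
  by (induction I rule: infinite_finite_induct) (auto intro: trig_poly_const trig_poly.add)

lemma trig_poly_continuous: "trig_poly f \<Longrightarrow> continuous_on S f"
  by (induction rule: trig_poly.induct) (auto intro!: continuous_intros char_continuous)

text \<open>Embeds the torus in complex space, where the Stone-Weierstrass theorem for polynomials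
  on compact sets applies.\<close>

definition torus_map :: "real ^ 'm \<Rightarrow> complex ^ 'm" where
  "torus_map q = (\<chi> j. ee (q $ j))"

lemma ee_axis: "ee (q $ j) = char (\<lambda>i. if i = j then 1 else 0) q" "ee (- q $ j) = char (\<lambda>i. if i = j then - 1 else 0) q"
  by (auto simp: char_def freq_inner if_distrib[of of_int] if_distrib[of "\<lambda>z. z * _"] cong: if_cong)

text \<open>A real linear functional involves only real and imaginary parts of coordinates of
  modulus 1, that is, a character and its inverse. Sums and products stay trigonometric.\<close>

lemma trig_poly_real_polynomial:
  fixes p :: "complex ^ 'm::finite \<Rightarrow> real"
  assumes "real_polynomial_function p"
  shows "trig_poly (\<lambda>q. complex_of_real (p (torus_map q)))"
  using assms
proof (induction rule: real_polynomial_function.induct)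
  case (linear l)
  have lin: "linear l" using linear by (simp add: bounded_linear.linear)
  have ax: "axis j z = Re z *\<^sub>R axis j 1 + Im z *\<^sub>R axis j \<i>" for j :: 'm and z
    by (auto simp: axis_def vec_eq_iff complex_eq_iff)
  have tq: "torus_map q = (\<Sum>j\<in>UNIV. axis j (ee (q $ j)))" for q :: "real ^ 'm"
    by (simp add: torus_map_def vec_eq_iff axis_def if_distrib cong: if_cong)
  have re: "complex_of_real (Re z) = (z + cnj z) / 2" "complex_of_real (Im z) = (z - cnj z) / (2 * \<i>)" for z
    by (auto simp: complex_eq_iff)
  have eq: "complex_of_real (l (torus_map q)) = (\<Sum>j\<in>UNIV.
      ((1/2) * char (\<lambda>i. if i = j then 1 else 0) q + (1/2) * char (\<lambda>i. if i = j then - 1 else 0) q) * of_real (l (axis j 1))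
    + ((1/(2*\<i>)) * char (\<lambda>i. if i = j then 1 else 0) q + (-1/(2*\<i>)) * char (\<lambda>i. if i = j then - 1 else 0) q) * of_real (l (axis j \<i>)))" for q
  proof -
    have "l (torus_map q) = (\<Sum>j\<in>UNIV. Re (ee (q $ j)) * l (axis j 1) + Im (ee (q $ j)) * l (axis j \<i>))"
      unfolding tq linear_sum[OF lin] by (subst ax) (simp add: linear_add[OF lin] linear_scale[OF lin])
    then have "complex_of_real (l (torus_map q)) = (\<Sum>j\<in>UNIV. complex_of_real (Re (ee (q $ j))) * l (axis j 1) + complex_of_real (Im (ee (q $ j))) * l (axis j \<i>))"
      by simp
    moreover have "cnj (ee (q $ j)) = char (\<lambda>i. if i = j then - 1 else 0) q" for j
      unfolding cnj_ee by (rule ee_axis(2))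
    then have "complex_of_real (Re (ee (q $ j))) = (1/2) * char (\<lambda>i. if i = j then 1 else 0) q + (1/2) * char (\<lambda>i. if i = j then - 1 else 0) q"
      "complex_of_real (Im (ee (q $ j))) = (1/(2*\<i>)) * char (\<lambda>i. if i = j then 1 else 0) q + (-1/(2*\<i>)) * char (\<lambda>i. if i = j then - 1 else 0) q" for j
      unfolding re by (simp_all add: ee_axis(1) add_divide_distrib diff_divide_distrib right_diff_distrib)
    ultimately show ?thesis by simp
  qed
  show ?case unfolding eq
    by (intro trig_poly_sum trig_poly.add trig_poly_mult trig_poly_const trig_poly.char)
next
  case (const c)
  show ?case by (rule trig_poly_const)
next
  case (add f g)
  then show ?case using trig_poly.add by simp
next
  case (mult f g)
  then show ?case using trig_poly_mult by simp
qed

lemma torus_map_eq: "torus_map q = torus_map q' \<Longrightarrow> q - q' \<in> lattice"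
proof -
  assume e: "torus_map q = torus_map q'"
  have "(q - q') $ j \<in> \<int>" for j
  proof -
    have "ee (q $ j) = ee (q' $ j)" using e by (simp add: torus_map_def vec_eq_iff)
    then have "ee (q $ j - q' $ j) = 1"
      using ee_add[of "q $ j - q' $ j" "q' $ j"] by simp
    then have "cos (2 * pi * (q $ j - q' $ j)) = 1" by (simp add: ee_def complex_eq_iff)
    then obtain n :: int where "2 * pi * (q $ j - q' $ j) = of_int n * 2 * pi"
      unfolding cos_one_2pi_int by auto
    then have "q $ j - q' $ j = of_int n" by simp
    then show ?thesis by simp
  qed
  then show ?thesis by (simp add: lattice_def)
qed

text \<open>Vanishing coefficients make \<open>g\<close> orthogonal to all trigonometric
  polynomials. Approximating \<open>g\<close> by one within \<epsilon> bounds the integral of its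
  squared modulus by a multiple of \<epsilon>, and continuity makes \<open>g\<close> itself
  vanish.\<close>

lemma Fourier_uniqueness:
  fixes g :: "real ^ 'm::finite \<Rightarrow> complex"
  assumes cont: "continuous_on UNIV g" and per: "\<And>x b. b \<in> lattice \<Longrightarrow> g (x + b) = g x"
    and zero: "\<And>n. integral (cbox 0 1) (\<lambda>q. g q * char n q) = 0"
  shows "g x = 0"
proof -
  let ?K = "cbox (0 :: real ^ 'm) 1"
  have cg: "continuous_on S g" for S using cont continuous_on_subset by blast
  have trig0: "integral ?K (\<lambda>q. g q * h q) = 0" if "trig_poly h" for h
    using that
  proof (induction rule: trig_poly.induct)
    case (char c n)
    have "integral ?K (\<lambda>q. c * (g q * char n q)) = 0" using zero[of n] by simp
    then show ?case by (simp add: mult_ac)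
  next
    case (add f h)
    have "integral ?K (\<lambda>q. g q * f q + g q * h q) = integral ?K (\<lambda>q. g q * f q) + integral ?K (\<lambda>q. g q * h q)"
      by (intro integral_add integrable_continuous continuous_intros cg trig_poly_continuous add)
    then show ?case using add by (simp add: distrib_left)
  qed
  have ct: "continuous_on S (torus_map :: real ^ 'm \<Rightarrow> complex ^ 'm)" for S
    unfolding torus_map_def ee_def cis_conv_exp by (intro continuous_intros)
  define T where "T = torus_map ` ?K"
  have T: "compact T" unfolding T_def by (intro compact_continuous_image ct compact_cbox)
  \<comment> \<open>The function on the embedded torus induced by \<open>g\<close>. The choice of
    preimage is harmless, because two preimages differ by a lattice vector.\<close>
  define G where "G z = g (SOME q. q \<in> ?K \<and> torus_map q = z)" for z
  have G: "G (torus_map q) = g q" if q: "q \<in> ?K" for q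
  proof -
    define r where "r = (SOME r. r \<in> ?K \<and> torus_map r = torus_map q)"
    have "r \<in> ?K \<and> torus_map r = torus_map q" unfolding r_def by (rule someI[of _ q]) (use q in auto)
    then have "r - q \<in> lattice" using torus_map_eq by blast
    then have "g (q + (r - q)) = g q" by (rule per)
    then show ?thesis by (simp add: G_def r_def)
  qed
  \<comment> \<open>The cell is compact, so the preimage of a closed set under \<open>G\<close> is
    the continuous image of a compact set.\<close>
  have "continuous_on T G"
    unfolding continuous_on_closed_vimage[OF compact_imp_closed[OF T]]
  proof (intro allI impI)
    fix B :: "complex set" assume B: "closed B"
    have "G -` B \<inter> T = torus_map ` (g -` B \<inter> ?K)" using G by (auto simp: T_def)
    moreover have "closed (g -` B \<inter> ?K)" using continuous_on_closed_vimage[of ?K g] cg B by (simp add: closed_cbox)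
    then have "compact (g -` B \<inter> ?K)" using compact_Int_closed[OF compact_cbox, of "g -` B \<inter> ?K" 0 1] by (simp add: Int_commute Int_left_commute)
    ultimately show "closed (G -` B \<inter> T)" using compact_continuous_image[OF ct] compact_imp_closed by metis
  qed
  define A where "A = integral ?K (\<lambda>q. norm (g q))"
  have bound: "integral ?K (\<lambda>q. (norm (g q))\<^sup>2) \<le> A * \<epsilon>" if \<epsilon>: "\<epsilon> > 0" for \<epsilon>
  proof -
    obtain P where P: "polynomial_function P" "\<And>z. z \<in> T \<Longrightarrow> norm (G z - P z) < \<epsilon>"
      using Stone_Weierstrass_polynomial_function[OF T \<open>continuous_on T G\<close> \<epsilon>] by blast
    have rp: "real_polynomial_function (\<lambda>z. Re (P z))" "real_polynomial_function (\<lambda>z. Im (P z))"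
      using P(1) bounded_linear_Re bounded_linear_Im unfolding polynomial_function_def comp_def by blast+
    \<comment> \<open>The conjugate of the approximating polynomial on the torus. It is again
      trigonometric and hence orthogonal to \<open>g\<close>, so it may be subtracted under the
      integral at no cost.\<close>
    define h where "h q = of_real (Re (P (torus_map q))) + (- \<i>) * of_real (Im (P (torus_map q)))" for q
    have h: "trig_poly h" unfolding h_def
      by (intro trig_poly.add trig_poly_mult trig_poly_const trig_poly_real_polynomial rp)
    have hc: "h q = cnj (P (torus_map q))" for q by (simp add: h_def complex_eq_iff)
    have i1: "(\<lambda>q. of_real ((norm (g q))\<^sup>2) :: complex) integrable_on ?K"
      by (intro integrable_continuous continuous_intros cg)
    have i2: "(\<lambda>q. g q * h q) integrable_on ?K"
      by (intro integrable_continuous continuous_intros cg trig_poly_continuous h)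
    have "of_real (integral ?K (\<lambda>q. (norm (g q))\<^sup>2)) = integral ?K (\<lambda>q. of_real ((norm (g q))\<^sup>2) :: complex)"
    proof -
      have "(\<lambda>q. (norm (g q))\<^sup>2) integrable_on ?K" by (intro integrable_continuous continuous_intros cg)
      from integral_linear[OF this bounded_linear_of_real[where 'a = complex]] show ?thesis by (simp add: comp_def)
    qed
    also have "\<dots> = integral ?K (\<lambda>q. of_real ((norm (g q))\<^sup>2) - g q * h q)"
      using integral_diff[OF i1 i2] trig0[OF h] by simp
    finally have "norm (complex_of_real (integral ?K (\<lambda>q. (norm (g q))\<^sup>2))) = norm (integral ?K (\<lambda>q. of_real ((norm (g q))\<^sup>2) - g q * h q))"
      by simp
    also have "\<dots> \<le> integral ?K (\<lambda>q. norm (g q) * \<epsilon>)"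
    proof (rule integral_norm_bound_integral)
      show "(\<lambda>q. of_real ((norm (g q))\<^sup>2) - g q * h q) integrable_on ?K" using integrable_diff[OF i1 i2] .
      show "(\<lambda>q. norm (g q) * \<epsilon>) integrable_on ?K" by (intro integrable_continuous continuous_intros cg)
      fix q assume q: "q \<in> ?K"
      have "of_real ((norm (g q))\<^sup>2) - g q * h q = g q * cnj (G (torus_map q) - P (torus_map q))"
        unfolding complex_norm_square hc G[OF q] by (simp add: algebra_simps)
      then have "norm (of_real ((norm (g q))\<^sup>2) - g q * h q) = norm (g q) * norm (G (torus_map q) - P (torus_map q))"
        by (simp only: norm_mult complex_mod_cnj)
      then show "norm (of_real ((norm (g q))\<^sup>2) - g q * h q) \<le> norm (g q) * \<epsilon>"
        using P(2)[of "torus_map q"] q by (simp add: T_def mult_left_mono)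
    qed
    finally show ?thesis by (simp add: A_def)
  qed
  have "integral ?K (\<lambda>q. (norm (g q))\<^sup>2) \<le> 0"
  proof (rule field_le_epsilon)
    fix e :: real assume e: "e > 0"
    have A: "A \<ge> 0" unfolding A_def by (intro integral_nonneg integrable_continuous continuous_intros cg) auto
    have "A * (e / (A + 1)) \<le> e" using A e by (simp add: field_simps)
    then show "integral ?K (\<lambda>q. (norm (g q))\<^sup>2) \<le> 0 + e" using bound[of "e / (A + 1)"] A e by simp
  qed
  moreover have "integral ?K (\<lambda>q. (norm (g q))\<^sup>2) \<ge> 0"
    by (intro integral_nonneg integrable_continuous continuous_intros cg) auto
  ultimately have i0: "integral ?K (\<lambda>q. (norm (g q))\<^sup>2) = 0" by simp
  have "(\<lambda>q. (norm (g q))\<^sup>2) integrable_on ?K" by (intro integrable_continuous continuous_intros cg)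
  then have hi: "((\<lambda>q. (norm (g q))\<^sup>2) has_integral 0) ?K" using i0 by (simp add: has_integral_integrable_integral)
  have K0: "g q = 0" if "q \<in> ?K" for q
  proof -
    have "continuous_on ?K (\<lambda>q. (norm (g q))\<^sup>2)" by (intro continuous_intros cg)
    from has_integral_0_cbox_imp_0[OF this _ hi _ that] show ?thesis by (simp add: interval_ne_empty_cart)
  qed
  obtain b where b: "b \<in> lattice" "x + b \<in> ?K" using lattice_reduction by blast
  then show ?thesis using per[OF b(1), of x] K0[OF b(2)] by simp
qed

section \<open>Differentiable series\<close>

text \<open>Summable majorants for the derivatives in the finitely many basis directions give one
  majorant for their operator norms, hence uniform convergence of the derived series.\<close>

lemma series_has_derivative:
  fixes f :: "nat \<Rightarrow> 'a::euclidean_space \<Rightarrow> complex"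
  assumes S: "open S" "convex S" "x \<in> S"
    and der: "\<And>i x. x \<in> S \<Longrightarrow> (f i has_derivative f' i x) (at x)"
    and M: "\<And>b. summable (M b)" "\<And>b i x. x \<in> S \<Longrightarrow> norm (f' i x b) \<le> M b i"
    and sm: "summable (\<lambda>i. f i x)"
  shows "((\<lambda>x. \<Sum>i. f i x) has_derivative (\<lambda>h. \<Sum>i. f' i x h)) (at x)"
proof -
  define N where "N i = (\<Sum>b\<in>Basis. M b i)" for i
  have sN: "summable N" unfolding N_def by (intro summable_sum M)
  have bd: "norm (f' i y h) \<le> N i * norm h" if y: "y \<in> S" for i y h
  proof -
    have l: "linear (f' i y)" using der[OF y] has_derivative_linear by blast
    have "f' i y h = (\<Sum>b\<in>Basis. (h \<bullet> b) *\<^sub>R f' i y b)"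
      using linear_sum[OF l, of "\<lambda>b. (h \<bullet> b) *\<^sub>R b" Basis] linear_scale[OF l]
      by (simp add: euclidean_representation)
    also have "norm \<dots> \<le> (\<Sum>b\<in>Basis. norm h * M b i)"
    proof (rule sum_norm_le)
      fix b :: 'a assume b: "b \<in> Basis"
      show "norm ((h \<bullet> b) *\<^sub>R f' i y b) \<le> norm h * M b i"
        using mult_mono[OF Basis_le_norm[OF b, of h] M(2)[OF y, of i b]] by simp
    qed
    finally show ?thesis by (simp add: N_def sum_distrib_left mult.commute)
  qed
  have sf: "summable (\<lambda>i. f' i y h)" if "y \<in> S" for y h
    by (rule summable_comparison_test'[OF summable_mult2[OF sN, of "norm h"], of 0]) (use bd[OF that] in auto)
  have "\<exists>g. \<forall>x\<in>S. (\<lambda>n. f n x) sums (g x) \<and> (g has_derivative (\<lambda>h. \<Sum>i. f' i x h)) (at x within S)"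
  proof (rule has_derivative_series[OF S(2) _ _ S(3)])
    show "(f n has_derivative f' n x) (at x within S)" if "x \<in> S" for n x
      using der[OF that] by (rule has_derivative_at_withinI)
    show "(\<lambda>n. f n x) sums (\<Sum>n. f n x)" using sm by (rule summable_sums)
    fix e :: real assume e: "e > 0"
    obtain n0 where n0: "\<And>n. n \<ge> n0 \<Longrightarrow> norm (\<Sum>i. N (i + n)) < e" using suminf_exist_split[OF e sN] by blast
    show "\<forall>\<^sub>F n in sequentially. \<forall>x\<in>S. \<forall>h. norm ((\<Sum>i<n. f' i x h) - (\<Sum>i. f' i x h)) \<le> e * norm h"
      unfolding eventually_sequentially
    proof (intro exI[of _ n0] allI impI ballI)
      fix n and y h :: 'a assume n: "n0 \<le> n" and y: "y \<in> S"
      have s2: "summable (\<lambda>i. N (i + n) * norm h)" using sN summable_ignore_initial_segment summable_mult2 by blast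
      have "norm ((\<Sum>i<n. f' i y h) - (\<Sum>i. f' i y h)) = norm (\<Sum>i. f' (i + n) y h)"
        using suminf_minus_initial_segment[OF sf[OF y, of h], of n] by (simp add: norm_minus_commute)
      also have "\<dots> \<le> (\<Sum>i. N (i + n) * norm h)"
        by (rule norm_suminf_le[OF _ s2]) (rule bd[OF y])
      also have "\<dots> = (\<Sum>i. N (i + n)) * norm h"
        using sN summable_ignore_initial_segment suminf_mult2[symmetric] by blast
      also have "\<dots> \<le> e * norm h" using n0[OF n] by (intro mult_right_mono) auto
      finally show "norm ((\<Sum>i<n. f' i y h) - (\<Sum>i. f' i y h)) \<le> e * norm h" .
    qed
  qed
  then obtain g where g: "\<And>y. y \<in> S \<Longrightarrow> (\<lambda>n. f n y) sums (g y)" "(g has_derivative (\<lambda>h. \<Sum>i. f' i x h)) (at x within S)"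
    using S(3) by blast
  have "(g has_derivative (\<lambda>h. \<Sum>i. f' i x h)) (at x)" using g(2) at_within_open[OF S(3,1)] by simp
  then show ?thesis
    by (rule has_derivative_transform_within_open[OF _ S(1,3)]) (use g(1) sums_unique in blast)
qed

text \<open>A finite set of indices lies in a cube, where the sum factors into one-dimensional sums.
  Each factor is at most twice a geometric series, 0 being counted on both sides.\<close>

lemma summable_int_vectors: "(\<lambda>n::'m::finite \<Rightarrow> int. exp (- (\<Sum>j\<in>UNIV. real_of_int \<bar>n j\<bar>))) summable_on UNIV"
proof (rule nonneg_bdd_above_summable_on)
  let ?\<rho> = "\<lambda>z::int. exp (- real_of_int \<bar>z\<bar>)"
  have eq: "exp (- (\<Sum>j\<in>UNIV. real_of_int \<bar>n j\<bar>)) = (\<Prod>j\<in>UNIV. ?\<rho> (n j))" for n :: "'m \<Rightarrow> int"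
    by (simp add: exp_sum sum_negf[symmetric])
  define G where "G = (\<Sum>i. exp (- 1 :: real) ^ i)"
  have sG: "summable (\<lambda>i. exp (- 1 :: real) ^ i)" by (rule summable_geometric) simp
  have one: "(\<Sum>z\<in>{- int K..int K}. ?\<rho> z) \<le> 2 * G" for K
  proof -
    have "{- int K..int K} \<subseteq> int ` {..K} \<union> (\<lambda>i. - int i) ` {..K}"
    proof
      fix z assume z: "z \<in> {- int K..int K}"
      then have "z = int (nat z) \<and> nat z \<le> K \<or> z = - int (nat (- z)) \<and> nat (- z) \<le> K" by auto
      then show "z \<in> int ` {..K} \<union> (\<lambda>i. - int i) ` {..K}" by blast
    qed
    then have "(\<Sum>z\<in>{- int K..int K}. ?\<rho> z) \<le> (\<Sum>z\<in>int ` {..K} \<union> (\<lambda>i. - int i) ` {..K}. ?\<rho> z)"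
      by (intro sum_mono2) auto
    also have "\<dots> \<le> (\<Sum>z\<in>int ` {..K}. ?\<rho> z) + (\<Sum>z\<in>(\<lambda>i. - int i) ` {..K}. ?\<rho> z)"
      by (simp add: sum_Un sum_nonneg)
    also have "\<dots> = 2 * (\<Sum>i\<le>K. exp (- 1) ^ i)"
      by (simp add: sum.reindex inj_on_def exp_of_nat_mult[symmetric])
    also have "(\<Sum>i\<le>K. exp (- 1 :: real) ^ i) \<le> G" unfolding G_def by (intro sum_le_suminf sG) auto
    finally show ?thesis by simp
  qed
  show "bdd_above (sum (\<lambda>n::'m \<Rightarrow> int. exp (- (\<Sum>j\<in>UNIV. real_of_int \<bar>n j\<bar>))) ` {F. F \<subseteq> UNIV \<and> finite F})"
  proof (rule bdd_aboveI2)
    fix F :: "('m \<Rightarrow> int) set" assume F: "F \<in> {F. F \<subseteq> UNIV \<and> finite F}"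
    define K where "K = Max (insert 0 ((\<lambda>(n, j). nat \<bar>n j\<bar>) ` (F \<times> UNIV)))"
    have K: "\<bar>n j\<bar> \<le> int K" if "n \<in> F" for n j
    proof -
      have "nat \<bar>n j\<bar> \<le> K" unfolding K_def using F that by (intro Max_ge) auto
      then show ?thesis by simp
    qed
    have "F \<subseteq> PiE UNIV (\<lambda>j. {- int K..int K})" 
      unfolding PiE_UNIV_domain using K by (auto simp: Pi_def abs_le_iff) (metis minus_le_iff)
    then have "(\<Sum>n\<in>F. \<Prod>j\<in>UNIV. ?\<rho> (n j)) \<le> (\<Sum>n\<in>PiE (UNIV :: 'm set) (\<lambda>j. {- int K..int K}). \<Prod>j\<in>UNIV. ?\<rho> (n j))"
      by (intro sum_mono2) (auto intro!: finite_PiE prod_nonneg)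
    also have "\<dots> = (\<Prod>j\<in>(UNIV::'m set). \<Sum>z\<in>{- int K..int K}. ?\<rho> z)"
      by (rule prod_sum_PiE[symmetric]) auto
    also have "\<dots> \<le> (\<Prod>j\<in>(UNIV::'m set). 2 * G)" using one by (intro prod_mono) (auto intro!: sum_nonneg)
    finally show "(\<Sum>n\<in>F. exp (- (\<Sum>j\<in>UNIV. real_of_int \<bar>n j\<bar>))) \<le> (\<Prod>j\<in>(UNIV::'m set). 2 * G)" by (simp only: eq)
  qed
qed simp

section \<open>Theta functions\<close>

definition ddot :: "('m::finite \<Rightarrow> nat) \<Rightarrow> real ^ 'm \<Rightarrow> real ^ 'm \<Rightarrow> real" where
  "ddot d p q = (\<Sum>j\<in>UNIV. real (d j) * (p $ j * q $ j))"

lemma pform_ddot: "pform d x v = ddot d (fst x) (snd v)"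
  by (simp add: pform_def ddot_def)

lemma ddot_simps:
  "ddot d (x + y) v = ddot d x v + ddot d y v" "ddot d x (v + w) = ddot d x v + ddot d x w"
  "ddot d (r *\<^sub>R x) v = r * ddot d x v" "ddot d x (r *\<^sub>R v) = r * ddot d x v"
  "ddot d (x - y) v = ddot d x v - ddot d y v" "ddot d x (v - w) = ddot d x v - ddot d x w"
  "ddot d 0 v = 0" "ddot d x 0 = 0"
  by (auto simp: ddot_def distrib_left distrib_right sum.distrib sum_distrib_left sum_subtractf
      right_diff_distrib left_diff_distrib mult_ac)

text \<open>The value of \<open>pform d x\<close>, for \<open>x\<close> with first component
  \<open>p\<close>, on the complex vector \<open>(t, \<sigma> t) - \<i> * (0, Y t)\<close>. For the
  \<sigma> and \<open>Y\<close> of a complex structure this vector is antiholomorphic and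
  \<open>bform\<close> is the period matrix of the torus, weighted by \<open>d\<close>.\<close>

definition bform :: "('m::finite \<Rightarrow> nat) \<Rightarrow> (real ^ 'm \<Rightarrow> real ^ 'm) \<Rightarrow> (real ^ 'm \<Rightarrow> real ^ 'm) \<Rightarrow> real ^ 'm \<Rightarrow> real ^ 'm \<Rightarrow> complex" where
  "bform d \<sigma> Y p t = complex_of_real (ddot d p (\<sigma> t)) - \<i> * complex_of_real (ddot d p (Y t))"

text \<open>The polynomial prefactors that differentiation of the terms of a theta series produces.\<close>

inductive polyfam :: "(real ^ 'm \<Rightarrow> 'm::finite phase \<Rightarrow> complex) \<Rightarrow> bool" where
  const: "polyfam (\<lambda>\<nu> x. c)"
| linear: "bounded_linear l \<Longrightarrow> polyfam (\<lambda>\<nu> x. l (\<nu>, x))"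
| add: "polyfam P \<Longrightarrow> polyfam Q \<Longrightarrow> polyfam (\<lambda>\<nu> x. P \<nu> x + Q \<nu> x)"
| mult: "polyfam P \<Longrightarrow> polyfam Q \<Longrightarrow> polyfam (\<lambda>\<nu> x. P \<nu> x * Q \<nu> x)"

text \<open>Exponential bounds replace polynomial ones because their constants combine easily under
  sums and products; Gaussian decay beats them just as well.\<close>

lemma polyfam_growth:
  "polyfam P \<Longrightarrow> \<exists>C L. C \<ge> 0 \<and> L \<ge> 0 \<and> (\<forall>\<nu> x. norm (P \<nu> x) \<le> C * exp (L * (norm \<nu> + norm x)))"
proof (induction rule: polyfam.induct)
  case (const c)
  show ?case by (intro exI[of _ "norm c"] exI[of _ 0]) simp
next
  case (linear l)
  obtain K where K: "K \<ge> 0" "\<And>z. norm (l z) \<le> norm z * K"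
    using bounded_linear.nonneg_bounded[OF linear] by blast
  have "norm (l (\<nu>, x)) \<le> K * exp (1 * (norm \<nu> + norm x))" for \<nu> and x :: "'a phase"
  proof -
    have "norm (\<nu>, x) \<le> norm \<nu> + norm x" by (rule norm_Pair_le)
    also have "\<dots> \<le> exp (norm \<nu> + norm x)" using exp_ge_add_one_self[of "norm \<nu> + norm x"] by linarith
    finally have "norm (\<nu>, x) * K \<le> exp (norm \<nu> + norm x) * K" using K(1) by (rule mult_right_mono)
    then show ?thesis using K(2)[of "(\<nu>, x)"] by (simp add: mult.commute)
  qed
  then show ?case using K(1) by (intro exI[of _ K] exI[of _ 1]) auto
next
  case (add P Q)
  then obtain C L C' L' where CL: "C \<ge> 0" "L \<ge> 0" "\<And>\<nu> x. norm (P \<nu> x) \<le> C * exp (L * (norm \<nu> + norm x))"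
    "C' \<ge> 0" "L' \<ge> 0" "\<And>\<nu> x. norm (Q \<nu> x) \<le> C' * exp (L' * (norm \<nu> + norm x))" by blast
  have "norm (P \<nu> x + Q \<nu> x) \<le> (C + C') * exp ((L + L') * (norm \<nu> + norm x))" for \<nu> x
  proof -
    let ?s = "norm \<nu> + norm x"
    have "norm (P \<nu> x + Q \<nu> x) \<le> C * exp (L * ?s) + C' * exp (L' * ?s)"
      using norm_triangle_ineq[of "P \<nu> x" "Q \<nu> x"] CL(3)[of \<nu> x] CL(6)[of \<nu> x] by linarith
    also have "\<dots> \<le> C * exp ((L + L') * ?s) + C' * exp ((L + L') * ?s)"
      using CL by (intro add_mono mult_left_mono) (auto simp: mult_right_mono)
    finally show ?thesis by (simp add: distrib_right)
  qed
  then show ?case using CL by (intro exI[of _ "C + C'"] exI[of _ "L + L'"]) auto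
next
  case (mult P Q)
  then obtain C L C' L' where CL: "C \<ge> 0" "L \<ge> 0" "\<And>\<nu> x. norm (P \<nu> x) \<le> C * exp (L * (norm \<nu> + norm x))"
    "C' \<ge> 0" "L' \<ge> 0" "\<And>\<nu> x. norm (Q \<nu> x) \<le> C' * exp (L' * (norm \<nu> + norm x))" by blast
  have "norm (P \<nu> x * Q \<nu> x) \<le> (C * C') * exp ((L + L') * (norm \<nu> + norm x))" for \<nu> x
  proof -
    have "norm (P \<nu> x * Q \<nu> x) \<le> (C * exp (L * (norm \<nu> + norm x))) * (C' * exp (L' * (norm \<nu> + norm x)))"
      unfolding norm_mult using CL by (intro mult_mono) auto
    then show ?thesis by (simp add: distrib_right exp_add mult_ac)
  qed
  then show ?case using CL by (intro exI[of _ "C * C'"] exI[of _ "L + L'"]) auto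
qed

lemma polyfam_derivative:
  "polyfam P \<Longrightarrow> \<exists>P'. (\<forall>v. polyfam (P' v)) \<and> (\<forall>\<nu> x. (P \<nu> has_derivative (\<lambda>v. P' v \<nu> x)) (at x))"
proof (induction rule: polyfam.induct)
  case (const c)
  show ?case by (intro exI[of _ "\<lambda>v \<nu> x. 0"]) (auto intro: polyfam.const)
next
  case (linear l)
  have "((\<lambda>x. l (\<nu>, x)) has_derivative (\<lambda>v. l (0, v))) (at x)" for \<nu> and x :: "'a phase"
    by (rule bounded_linear.has_derivative[OF linear]) (auto intro!: derivative_eq_intros)
  then show ?case by (intro exI[of _ "\<lambda>v \<nu> x. l (0, v)"]) (auto intro: polyfam.const)
next
  case (add P Q)
  then obtain P' Q' where PQ: "\<And>v. polyfam (P' v)" "\<And>\<nu> x. (P \<nu> has_derivative (\<lambda>v. P' v \<nu> x)) (at x)"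
    "\<And>v. polyfam (Q' v)" "\<And>\<nu> x. (Q \<nu> has_derivative (\<lambda>v. Q' v \<nu> x)) (at x)" by metis
  then show ?case by (intro exI[of _ "\<lambda>v \<nu> x. P' v \<nu> x + Q' v \<nu> x"] conjI allI polyfam.add has_derivative_add PQ)
next
  case (mult P Q)
  then obtain P' Q' where PQ: "\<And>v. polyfam (P' v)" "\<And>\<nu> x. (P \<nu> has_derivative (\<lambda>v. P' v \<nu> x)) (at x)"
    "\<And>v. polyfam (Q' v)" "\<And>\<nu> x. (Q \<nu> has_derivative (\<lambda>v. Q' v \<nu> x)) (at x)" by metis
  then show ?case using mult.hyps
    by (intro exI[of _ "\<lambda>v \<nu> x. P \<nu> x * Q' v \<nu> x + P' v \<nu> x * Q \<nu> x"] conjI allI polyfam.add polyfam.mult has_derivative_mult PQ)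
qed

text \<open>A common majorant, up to constants, for the terms of all theta series on a bounded
  set.\<close>

definition wt :: "('m::finite \<Rightarrow> int) \<Rightarrow> real" where
  "wt n = exp (- (\<Sum>j\<in>UNIV. real_of_int \<bar>n j\<bar>))"

text \<open>Differentiation of series works with sequences, reindexing by lattice translations with
  unordered sums; the enumeration mediates between them.\<close>

definition enum :: "nat \<Rightarrow> ('m::finite \<Rightarrow> int)" where
  "enum = from_nat_into UNIV"

lemma bij_enum: "bij (enum :: nat \<Rightarrow> ('m::finite \<Rightarrow> int))"
proof -
  have "infinite (UNIV :: ('m \<Rightarrow> int) set)"
  proof
    assume "finite (UNIV :: ('m \<Rightarrow> int) set)"
    moreover have "inj (\<lambda>z::int. (\<lambda>j::'m. z))" by (auto simp: inj_def fun_eq_iff)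
    ultimately have "finite (UNIV :: int set)" using finite_imageD finite_subset subset_UNIV by metis
    then show False by simp
  qed
  then show ?thesis unfolding enum_def using bij_betw_from_nat_into[of "UNIV :: ('m \<Rightarrow> int) set"] by simp
qed

lemma summable_wt: "summable (\<lambda>i. wt (enum i :: 'm::finite \<Rightarrow> int))"
proof -
  have "(\<lambda>i. wt (enum i :: 'm \<Rightarrow> int)) summable_on UNIV"
    unfolding summable_on_reindex_bij_betw[OF bij_enum] using summable_int_vectors by (simp add: wt_def[abs_def])
  then show ?thesis by (rule summable_on_imp_summable)
qed

lemma enum_series:
  fixes g :: "('m::finite \<Rightarrow> int) \<Rightarrow> complex"
  assumes "\<And>n. norm (g n) \<le> K * wt n"
  shows "summable (\<lambda>i. g (enum i))" "(\<Sum>i. g (enum i)) = infsum g UNIV"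
proof -
  have s: "summable (\<lambda>i. norm (g (enum i)))"
    by (rule summable_comparison_test'[OF summable_mult[OF summable_wt, of K], of 0]) (use assms in auto)
  then show s': "summable (\<lambda>i. g (enum i))" by (rule summable_norm_cancel)
  have "((\<lambda>i. g (enum i)) has_sum (\<Sum>i. g (enum i))) UNIV"
    by (rule norm_summable_imp_has_sum[OF s summable_sums[OF s']])
  then have "infsum (\<lambda>i. g (enum i)) UNIV = (\<Sum>i. g (enum i))" by (rule infsumI)
  then show "(\<Sum>i. g (enum i)) = infsum g UNIV" using infsum_reindex_bij_betw[OF bij_enum, of g] by simp
qed

text \<open>The Riemann bilinear relations, symmetry and a positive definite imaginary part, are all
  that theta functions need to know about the complex structure.\<close>

locale theta_data =
  fixes d :: "'m::finite \<Rightarrow> nat" and \<sigma> Y :: "real ^ 'm \<Rightarrow> real ^ 'm"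
  assumes d: "\<And>j. d j > 0" and lin\<sigma>: "linear \<sigma>" and linY: "linear Y"
    and sym: "\<And>p t. bform d \<sigma> Y p t = bform d \<sigma> Y t p"
    and pos: "\<And>t. t \<noteq> 0 \<Longrightarrow> Im (bform d \<sigma> Y t t) > 0"
begin

abbreviation bb where "bb \<equiv> bform d \<sigma> Y"

definition nu :: "('m \<Rightarrow> int) \<Rightarrow> real ^ 'm" where "nu n = (\<chi> j. of_int (n j) / d j)"

text \<open>The exponent of a theta term: a character in \<open>q\<close> and, in modulus, a
  Gaussian in \<open>p\<close> centred at \<nu>. The quadratic part is what makes the term solve the
  ground state equation.\<close>

definition ph :: "real ^ 'm \<Rightarrow> 'm phase \<Rightarrow> complex" where
  "ph \<nu> x = bb (fst x - \<nu>) (fst x - \<nu>) / 2 + complex_of_real (ddot d \<nu> (snd x))"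

definition F :: "real ^ 'm \<Rightarrow> 'm phase \<Rightarrow> complex" where "F \<nu> x = exp (2 * pi * \<i> * ph \<nu> x)"

definition Lf :: "'m phase \<Rightarrow> real ^ 'm \<Rightarrow> 'm phase \<Rightarrow> complex" where
  "Lf v \<nu> x = bb (fst x - \<nu>) (fst v) + complex_of_real (ddot d \<nu> (snd v))"

lemma nu_freq: "ddot d (nu n) q = freq n \<bullet> q"
  using d by (auto simp: ddot_def nu_def freq_inner intro!: sum.cong)

lemma bb_bilinear: "bilinear bb"
  unfolding bilinear_def
  by (auto intro!: linearI simp: bform_def ddot_simps linear_add[OF lin\<sigma>] linear_add[OF linY]
      linear_scale[OF lin\<sigma>] linear_scale[OF linY] scaleR_conv_of_real[where 'a = complex] algebra_simps)

lemmas bb_simps = bilinear_ladd[OF bb_bilinear] bilinear_radd[OF bb_bilinear]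
  bilinear_lsub[OF bb_bilinear] bilinear_rsub[OF bb_bilinear] bilinear_lzero[OF bb_bilinear] bilinear_rzero[OF bb_bilinear]

lemma bb_bounded: "bounded_bilinear bb"
  using bb_bilinear bilinear_conv_bounded_bilinear by blast

lemma ph_has_derivative: "(ph \<nu> has_derivative (\<lambda>v. Lf v \<nu> x)) (at x)"
proof -
  have 1: "((\<lambda>x. fst x - \<nu>) has_derivative fst) (at x)" by (auto intro!: derivative_eq_intros)
  have "bounded_linear (ddot d \<nu>)"
    using linear_conv_bounded_linear by (metis linearI ddot_simps(2,4) real_scaleR_def)
  from bounded_linear.has_derivative[OF this has_derivative_snd[OF has_derivative_ident]]
  have 2: "((\<lambda>x. ddot d \<nu> (snd x)) has_derivative (\<lambda>v. ddot d \<nu> (snd v))) (at x)" .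
  have "(ph \<nu> has_derivative (\<lambda>v. (bb (fst x - \<nu>) (fst v) + bb (fst v) (fst x - \<nu>)) / 2 + complex_of_real (ddot d \<nu> (snd v)))) (at x)"
    unfolding ph_def
    by (intro has_derivative_add bounded_linear.has_derivative[OF bounded_linear_divide] bounded_bilinear.FDERIV[OF bb_bounded] has_derivative_of_real 1 2)
  then show ?thesis by (rule has_derivative_eq_rhs) (simp add: Lf_def sym[of "fst _" "fst x - \<nu>"] fun_eq_iff)
qed

lemma exp_ph_has_derivative: "((\<lambda>x. exp (a * ph \<nu> x)) has_derivative (\<lambda>v. a * Lf v \<nu> x * exp (a * ph \<nu> x))) (at x)"
proof -
  have e: "(exp has_derivative (*) (exp z)) (at z)" for z :: complex
    using DERIV_exp[of z] by (simp add: has_field_derivative_def)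
  from has_derivative_compose[OF has_derivative_mult_right[OF ph_has_derivative] this]
  show ?thesis by (rule has_derivative_eq_rhs) (simp add: fun_eq_iff mult_ac)
qed

lemma F_has_derivative: "(F \<nu> has_derivative (\<lambda>v. 2 * pi * \<i> * Lf v \<nu> x * F \<nu> x)) (at x)"
  unfolding F_def by (rule exp_ph_has_derivative)

lemma polyfam_Lf: "polyfam (Lf v)"
proof -
  have "linear (\<lambda>z. Lf v (fst z) (snd z))"
    by (auto intro!: linearI simp: Lf_def bilinear_lsub[OF bb_bilinear] bilinear_ladd[OF bb_bilinear] bilinear_lmul[OF bb_bilinear]
        ddot_simps scaleR_conv_of_real[where 'a = complex] algebra_simps)
  then have "bounded_linear (\<lambda>z. Lf v (fst z) (snd z))" using linear_conv_bounded_linear by blast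
  from polyfam.linear[OF this] show ?thesis by simp
qed

lemma norm_F: "norm (F \<nu> x) = exp (- pi * Im (bb (fst x - \<nu>) (fst x - \<nu>)))"
  by (simp add: F_def ph_def)

lemma nu_weight: "(\<Sum>j\<in>UNIV. real_of_int \<bar>n j\<bar>) \<le> (\<Sum>j\<in>UNIV. real (d j)) * norm (nu n)"
proof -
  have "real_of_int \<bar>n j\<bar> \<le> real (d j) * norm (nu n)" for j
  proof -
    have "real_of_int \<bar>n j\<bar> = real (d j) * \<bar>nu n $ j\<bar>" using d[of j] by (simp add: nu_def abs_divide)
    then show ?thesis using component_le_norm_cart[of "nu n" j] by (simp add: mult_left_mono)
  qed
  then show ?thesis unfolding sum_distrib_right by (rule sum_mono)
qed

text \<open>The modulus of \<open>F\<close> is a Gaussian in the distance from the first component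
  of \<open>x\<close> to \<open>nu n\<close>, which absorbs the exponential growth of the prefactor
  and still leaves the factor \<open>wt n\<close>.\<close>

lemma term_bound:
  assumes P: "polyfam P"
  obtains K where "\<And>n x. norm x \<le> R \<Longrightarrow> norm (P (nu n) x * F (nu n) x) \<le> K * wt n"
proof -
  obtain C L where CL: "C \<ge> 0" "L \<ge> 0" "\<And>\<nu> x. norm (P \<nu> x) \<le> C * exp (L * (norm \<nu> + norm x))"
    using polyfam_growth[OF P] by blast
  have "bilin (\<lambda>p t. Im (bb p t))"
    unfolding bilin_def bilinear_def
    by (auto intro!: linearI simp: bb_simps bilinear_lmul[OF bb_bilinear] bilinear_rmul[OF bb_bilinear])
  from form_lower_bound[OF this pos] obtain c where c: "c > 0" "\<And>t. c * (norm t)\<^sup>2 \<le> Im (bb t t)" by blast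
  define l where "l = (\<Sum>j\<in>UNIV. real (d j))"
  \<comment> \<open>The Gaussian rate \<open>pi * c\<close> is halved because
    \<open>norm (fst x - nu n)\<^sup>2\<close> is only bounded below by
    \<open>?r\<^sup>2 / 2 - R\<^sup>2\<close>.\<close>
  define k where "k = pi * c / 2"
  have k: "k > 0" using c by (simp add: k_def)
  define K where "K = C * exp (L * R + pi * c * R\<^sup>2 + (L + l)\<^sup>2 / (4 * k))"
  show ?thesis
  proof (rule that[of K])
    fix n and x :: "'m phase" assume x: "norm x \<le> R"
    let ?r = "norm (nu n)"
    have R: "R \<ge> 0" using x norm_ge_zero order_trans by blast
    have px: "norm (fst x) \<le> R" using x norm_fst_le[of "fst x" "snd x"] by simp
    have "?r \<le> norm (fst x - nu n) + norm (fst x)"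
      using norm_triangle_ineq4[of "fst x" "fst x - nu n"] by simp
    then have "?r\<^sup>2 \<le> (norm (fst x - nu n) + norm (fst x))\<^sup>2" by (intro power_mono) auto
    also have "\<dots> \<le> 2 * (norm (fst x - nu n))\<^sup>2 + 2 * (norm (fst x))\<^sup>2"
      using zero_le_power2[of "norm (fst x - nu n) - norm (fst x)"] by (simp add: power2_eq_square algebra_simps)
    also have "\<dots> \<le> 2 * (norm (fst x - nu n))\<^sup>2 + 2 * R\<^sup>2" using px by (simp add: power_mono)
    finally have q: "(norm (fst x - nu n))\<^sup>2 \<ge> ?r\<^sup>2 / 2 - R\<^sup>2" by simp
    have "pi * c * (?r\<^sup>2 / 2 - R\<^sup>2) \<le> pi * c * (norm (fst x - nu n))\<^sup>2" using q c by (intro mult_left_mono) auto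
    also have "\<dots> \<le> pi * Im (bb (fst x - nu n) (fst x - nu n))" using c(2)[of "fst x - nu n"] by (simp add: mult.assoc)
    finally have F1: "norm (F (nu n) x) \<le> exp (- (k * ?r\<^sup>2) + pi * c * R\<^sup>2)"
      unfolding norm_F by (simp add: k_def algebra_simps)
    \<comment> \<open>Completing the square. The rate \<open>L\<close> comes from the prefactor, and
      \<open>l\<close> pays for replacing the norm of the index by \<open>wt n\<close>.\<close>
    have sq: "(L + l) * ?r - k * ?r\<^sup>2 \<le> (L + l)\<^sup>2 / (4 * k)"
    proof -
      have "0 \<le> (2 * k * ?r - (L + l))\<^sup>2" by simp
      then have "4 * k * ((L + l) * ?r - k * ?r\<^sup>2) \<le> (L + l)\<^sup>2" by (simp add: power2_eq_square algebra_simps)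
      then show ?thesis using k by (simp add: field_simps)
    qed
    have "norm (P (nu n) x) \<le> C * exp (L * (?r + R))"
      using CL(3)[of "nu n" x] x CL(1,2) by (elim order_trans) (auto intro!: mult_left_mono)
    then have "norm (P (nu n) x * F (nu n) x) \<le> (C * exp (L * (?r + R))) * exp (- (k * ?r\<^sup>2) + pi * c * R\<^sup>2)"
      unfolding norm_mult using F1 CL(1) by (intro mult_mono) auto
    also have "\<dots> = C * exp (L * R + pi * c * R\<^sup>2 + (L * ?r - k * ?r\<^sup>2))"
      by (simp add: exp_add[symmetric] algebra_simps)
    also have "\<dots> \<le> C * exp (L * R + pi * c * R\<^sup>2 + ((L + l)\<^sup>2 / (4 * k) - (\<Sum>j\<in>UNIV. real_of_int \<bar>n j\<bar>)))"
      using sq nu_weight[of n] CL(1) by (intro mult_left_mono) (auto simp: l_def[symmetric] algebra_simps)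
    also have "\<dots> = K * wt n" by (simp add: K_def wt_def exp_add[symmetric] exp_diff[symmetric])
    finally show "norm (P (nu n) x * F (nu n) x) \<le> K * wt n" .
  qed
qed

definition thetaP :: "(('m \<Rightarrow> int) \<Rightarrow> complex) \<Rightarrow> (real ^ 'm \<Rightarrow> 'm phase \<Rightarrow> complex) \<Rightarrow> 'm phase \<Rightarrow> complex" where
  "thetaP c P x = (\<Sum>i. c (enum i) * (P (nu (enum i)) x * F (nu (enum i)) x))"

lemma coeff_bound:
  assumes c: "\<forall>n. norm (c n) \<le> B" and P: "polyfam P"
  shows "\<exists>K. \<forall>n x. norm x \<le> R \<longrightarrow> norm (c n * (P (nu n) x * F (nu n) x)) \<le> K * wt n"
proof -
  obtain K where K: "\<And>n x. norm x \<le> R \<Longrightarrow> norm (P (nu n) x * F (nu n) x) \<le> K * wt n"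
    using term_bound[OF P, of R] by auto
  have "norm (c n * (P (nu n) x * F (nu n) x)) \<le> (B * K) * wt n" if "norm x \<le> R" for n x
  proof -
    have "B \<ge> 0" using c norm_ge_zero order_trans by metis
    then show ?thesis unfolding norm_mult[of "c n"] mult.assoc using c K[OF that] by (intro mult_mono) auto
  qed
  then show ?thesis by blast
qed

lemma thetaP_summable:
  assumes "\<forall>n. norm (c n) \<le> B" "polyfam P"
  shows "summable (\<lambda>i. c (enum i) * (P (nu (enum i)) x * F (nu (enum i)) x))"
    "thetaP c P x = infsum (\<lambda>n. c n * (P (nu n) x * F (nu n) x)) UNIV"
proof -
  obtain K where K: "\<And>n y. norm y \<le> norm x \<Longrightarrow> norm (c n * (P (nu n) y * F (nu n) y)) \<le> K * wt n"
    using coeff_bound[OF assms, of "norm x"] by auto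
  note e = enum_series[of "\<lambda>n. c n * (P (nu n) x * F (nu n) x)" K, OF K[OF order_refl]]
  show "summable (\<lambda>i. c (enum i) * (P (nu (enum i)) x * F (nu (enum i)) x))"
    "thetaP c P x = infsum (\<lambda>n. c n * (P (nu n) x * F (nu n) x)) UNIV"
    using e by (simp_all add: thetaP_def)
qed

lemma thetaP_has_derivative:
  assumes c: "\<forall>n. norm (c n) \<le> B" and P: "polyfam P"
    and D: "\<And>v. polyfam (D v)" "\<And>\<nu> x. (P \<nu> has_derivative (\<lambda>v. D v \<nu> x)) (at x)"
  shows "(thetaP c P has_derivative (\<lambda>v. thetaP c (\<lambda>\<nu> x. D v \<nu> x + P \<nu> x * ((2 * pi * \<i>) * Lf v \<nu> x)) x)) (at x)"
proof -
  define P' where "P' v \<nu> x = D v \<nu> x + P \<nu> x * ((2 * pi * \<i>) * Lf v \<nu> x)" for v \<nu> x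
  have P': "polyfam (P' v)" for v
    unfolding P'_def by (intro polyfam.add polyfam.mult polyfam.const D P polyfam_Lf)
  have "(thetaP c P has_derivative (\<lambda>v. thetaP c (P' v) x)) (at x)"
  proof -
    define R where "R = norm x + 1"
    have "\<forall>v. \<exists>K. \<forall>n x. norm x \<le> R \<longrightarrow> norm (c n * (P' v (nu n) x * F (nu n) x)) \<le> K * wt n"
      by (intro allI coeff_bound[OF c P'])
    then obtain K where K: "\<And>v n x. norm x \<le> R \<Longrightarrow> norm (c n * (P' v (nu n) x * F (nu n) x)) \<le> K v * wt n" by metis
    show ?thesis unfolding thetaP_def
    proof (rule series_has_derivative[OF open_ball convex_ball, of x 0 R _ _ "\<lambda>v i. K v * wt (enum i :: 'm \<Rightarrow> int)"])
      show "x \<in> ball 0 R" by (simp add: R_def)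
      show "((\<lambda>x. c (enum i) * (P (nu (enum i)) x * F (nu (enum i)) x)) has_derivative
          (\<lambda>v. c (enum i) * (P' v (nu (enum i)) y * F (nu (enum i)) y))) (at y)" for i y
        by (rule has_derivative_eq_rhs[OF has_derivative_mult_right[OF has_derivative_mult[OF D(2) F_has_derivative]]])
          (simp add: P'_def fun_eq_iff algebra_simps)
      show "summable (\<lambda>i. K v * wt (enum i :: 'm \<Rightarrow> int))" for v by (intro summable_mult summable_wt)
      show "norm (c (enum i) * (P' v (nu (enum i)) y * F (nu (enum i)) y)) \<le> K v * wt (enum i :: 'm \<Rightarrow> int)" if "y \<in> ball 0 R" for v i y
        by (rule K) (use that in simp)
      show "summable (\<lambda>i. c (enum i) * (P (nu (enum i)) x * F (nu (enum i)) x))" by (rule thetaP_summable(1)[OF c P])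
    qed
  qed
  then show ?thesis unfolding P'_def .
qed

lemma thetaP_derivative_polyfam:
  assumes c: "\<forall>n. norm (c n) \<le> B" and P: "polyfam P"
  obtains P' where "\<And>v. polyfam (P' v)" "\<And>x. (thetaP c P has_derivative (\<lambda>v. thetaP c (P' v) x)) (at x)"
proof -
  obtain D where D: "\<And>v. polyfam (D v)" "\<And>\<nu> x. (P \<nu> has_derivative (\<lambda>v. D v \<nu> x)) (at x)"
    using polyfam_derivative[OF P] by blast
  show ?thesis
    by (rule that[OF _ thetaP_has_derivative[OF c P D]])
      (intro polyfam.add polyfam.mult polyfam.const D P polyfam_Lf)
qed

text \<open>Differentiating a theta series only changes the prefactor \<open>P\<close> within
  \<open>polyfam\<close>, so the induction runs over all prefactors at once.\<close>

lemma thetaP_smooth: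
  assumes c: "\<forall>n. norm (c n) \<le> B" and P: "polyfam P"
  shows "smooth_on UNIV (thetaP c P)"
proof -
  have "Ck_on k UNIV (thetaP c P)" if "polyfam P" for k P
    using that
  proof (induction k arbitrary: P)
    case 0
    obtain P' where "\<And>x. (thetaP c P has_derivative (\<lambda>v. thetaP c (P' v) x)) (at x)"
      using thetaP_derivative_polyfam[OF c 0] by metis
    then have "thetaP c P differentiable (at x)" for x unfolding differentiable_def by blast
    then show ?case by (simp add: differentiable_at_imp_continuous_on)
  next
    case (Suc k)
    obtain P' where P': "\<And>v. polyfam (P' v)" and der: "\<And>x. (thetaP c P has_derivative (\<lambda>v. thetaP c (P' v) x)) (at x)"
      using thetaP_derivative_polyfam[OF c Suc.prems] by metis
    have "(\<lambda>x. dderiv (thetaP c P) x v) = thetaP c (P' v)" for v using dderivI[OF der] by auto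
    moreover have "thetaP c P differentiable (at x)" for x using der unfolding differentiable_def by blast
    ultimately show ?case using Suc.IH[OF P'] by simp
  qed
  then show ?thesis using P by (simp add: smooth_on_def)
qed

text \<open>Holomorphicity of \<open>s\<close> for the model connection, tested only on the vectors
  \<open>(t, \<sigma> t) - \<i> * (0, Y t)\<close>; the potential has been moved to the right as
  \<open>bb\<close>.\<close>

definition ground :: "('m phase \<Rightarrow> complex) set" where
  "ground = {s \<in> qper d. \<forall>t x. dderiv s x (t, \<sigma> t) - \<i> * dderiv s x (0, Y t) = 2 * pi * \<i> * bb (fst x) t * s x}"

text \<open>The contribution of \<nu> through the centre of the Gaussian cancels its contribution
  through the character. Every term, whatever its index, therefore solves the same equation.\<close>

lemma F_PDE: "Lf (t, \<sigma> t) \<nu> x - \<i> * Lf (0, Y t) \<nu> x = bb (fst x) t"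
proof -
  have "bb (fst x - \<nu>) t + bb \<nu> t = bb (fst x) t" by (simp add: bb_simps)
  then show ?thesis by (simp add: Lf_def bb_simps bform_def[of _ _ _ \<nu>])
qed

text \<open>Moving \<open>p\<close> by the lattice vector \<open>freq l\<close> moves the centre
  \<open>nu n\<close> by \<open>- freq l\<close>, that is, the index by multiples of
  \<open>d j\<close>. Residue classes modulo \<open>d\<close> are thus what counts the ground
  states.\<close>

definition shift :: "('m \<Rightarrow> int) \<Rightarrow> ('m \<Rightarrow> int) \<Rightarrow> ('m \<Rightarrow> int)" where
  "shift l n = (\<lambda>j. n j - int (d j) * l j)"

lemma bij_shift: "bij (shift l)"
  by (rule bij_betw_byWitness[of _ "\<lambda>n j. n j + int (d j) * l j"]) (auto simp: shift_def)

lemma nu_shift: "nu (shift l n) = nu n - freq l"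
proof -
  have "(real_of_int (n j) - real (d j) * of_int (l j)) / real (d j) = of_int (n j) / real (d j) - of_int (l j)" for j
    using d[of j] by (simp add: diff_divide_distrib)
  then show ?thesis by (simp add: nu_def shift_def freq_def vec_eq_iff)
qed

lemma exp_ph_periodic: "l' \<in> lattice \<Longrightarrow> ph (nu n) (x + (0, l')) = ph (nu n) x + of_real (freq n \<bullet> l')"
  by (simp add: ph_def ddot_simps nu_freq)

lemma F_shift:
  assumes b: "l' \<in> lattice"
  shows "F (nu n) (x + (freq l, l')) = ee (pform d (freq l, l') x) * F (nu (shift l n)) x"
proof -
  have i: "ee (freq n \<bullet> l') = 1" by (intro ee_Ints freq_lattice b)
  have "ph (nu n) (x + (freq l, l')) = ph (nu (shift l n)) x + of_real (ddot d (freq l) (snd x)) + of_real (freq n \<bullet> l')"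
    unfolding ph_def nu_shift by (simp add: ddot_simps nu_freq algebra_simps)
  then have "F (nu n) (x + (freq l, l')) = F (nu (shift l n)) x * ee (ddot d (freq l) (snd x)) * ee (freq n \<bullet> l')"
    unfolding F_def ee_eq_exp by (simp add: distrib_left exp_add)
  then show ?thesis by (simp add: i pform_ddot)
qed

lemma lattice_freq: assumes "b \<in> lattice" obtains l where "b = freq l"
proof -
  have "\<forall>j. \<exists>z. b $ j = real_of_int z" using assms by (auto simp: lattice_def elim: Ints_cases)
  then obtain l where "\<And>j. b $ j = real_of_int (l j)" by metis
  then have "b = freq l" by (simp add: freq_def vec_eq_iff)
  then show ?thesis using that by blast
qed

abbreviation "theta c \<equiv> thetaP c (\<lambda>\<nu> x. 1)"

text \<open>Lattice translations permute the terms up to the prescribed phase, so coefficients that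
  depend only on residue classes give a quasi-periodic sum. The equation passes to the sum
  termwise.\<close>

lemma theta_ground:
  assumes c: "\<forall>n. norm (c n) \<le> B" and per: "\<And>l n. c (shift l n) = c n"
  shows "theta c \<in> ground"
proof -
  have one: "polyfam (\<lambda>\<nu> x. 1 :: complex)" by (rule polyfam.const)
  have "theta c (x + b) = ee (pform d b x) * theta c x" if b: "b \<in> lattice \<times> lattice" for x b
  proof -
    obtain l l' where l: "b = (freq l, l')" "l' \<in> lattice" using b lattice_freq by (metis SigmaE)
    have "theta c (x + b) = infsum (\<lambda>n. ee (pform d b x) * (c n * (1 * F (nu (shift l n)) x))) UNIV"
      unfolding thetaP_summable(2)[OF c one] l(1) F_shift[OF l(2)] by (simp add: mult_ac)
    also have "\<dots> = ee (pform d b x) * infsum (\<lambda>n. c n * (1 * F (nu (shift l n)) x)) UNIV"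
      by (rule infsum_cmult_right')
    also have "infsum (\<lambda>n. c n * (1 * F (nu (shift l n)) x)) UNIV = infsum (\<lambda>n. (\<lambda>m. c m * (1 * F (nu m) x)) (shift l n)) UNIV"
      by (simp add: per)
    also have "\<dots> = infsum (\<lambda>m. c m * (1 * F (nu m) x)) UNIV"
      by (rule infsum_reindex_bij_betw[OF bij_shift])
    finally show ?thesis unfolding thetaP_summable(2)[OF c one] .
  qed
  then have q: "theta c \<in> qper d" using thetaP_smooth[OF c one] unfolding qper_def by blast
  have der: "dderiv (theta c) x v = thetaP c (\<lambda>\<nu> x. 2 * pi * \<i> * Lf v \<nu> x) x" for x v
    using dderivI[OF thetaP_has_derivative[OF c one, of "\<lambda>v \<nu> x. 0"]] by (simp add: polyfam.const)
  have "dderiv (theta c) x (t, \<sigma> t) - \<i> * dderiv (theta c) x (0, Y t) = 2 * pi * \<i> * bb (fst x) t * theta c x" for t x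
  proof -
    have pL: "polyfam (\<lambda>\<nu> x. 2 * pi * \<i> * Lf v \<nu> x)" for v by (intro polyfam.mult polyfam.const polyfam_Lf)
    note s1 = thetaP_summable(1)[OF c pL, of "(t, \<sigma> t)" x]
    note s2 = thetaP_summable(1)[OF c pL, of "(0, Y t)" x]
    have tm: "c n * ((2 * pi * \<i> * Lf (t, \<sigma> t) (nu n) x) * F (nu n) x) - \<i> * (c n * ((2 * pi * \<i> * Lf (0, Y t) (nu n) x) * F (nu n) x))
        = (2 * pi * \<i> * bb (fst x) t) * (c n * (1 * F (nu n) x))" for n
      unfolding F_PDE[of t "nu n" x, symmetric] by (simp add: algebra_simps)
    have "dderiv (theta c) x (t, \<sigma> t) - \<i> * dderiv (theta c) x (0, Y t) =
       (\<Sum>i. c (enum i) * ((2 * pi * \<i> * Lf (t, \<sigma> t) (nu (enum i)) x) * F (nu (enum i)) x)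
         - \<i> * (c (enum i) * ((2 * pi * \<i> * Lf (0, Y t) (nu (enum i)) x) * F (nu (enum i)) x)))"
      unfolding der thetaP_def by (simp only: suminf_mult[OF s2, symmetric] suminf_diff[OF s1 summable_mult[OF s2], symmetric])
    also have "\<dots> = (\<Sum>i. (2 * pi * \<i> * bb (fst x) t) * (c (enum i) * (1 * F (nu (enum i)) x)))"
      unfolding tm ..
    also have "\<dots> = (2 * pi * \<i> * bb (fst x) t) * theta c x"
      unfolding thetaP_def by (rule suminf_mult[OF thetaP_summable(1)[OF c one]])
    finally show ?thesis .
  qed
  then show ?thesis using q by (simp add: ground_def)
qed

text \<open>The Fourier coefficient of \<open>s\<close> in the variables \<open>q\<close>, divided
  by the corresponding coefficient of the theta term \<open>F (nu n)\<close>. The division removes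
  the Gaussian dependence on \<open>p\<close>.\<close>

definition U :: "('m \<Rightarrow> int) \<Rightarrow> ('m phase \<Rightarrow> complex) \<Rightarrow> real ^ 'm \<Rightarrow> complex" where
  "U n s p = integral (cbox 0 1) (\<lambda>q. s (p, q) * exp (- (2 * pi * \<i>) * ph (nu n) (p, q)))"

lemma U_integrand_has_derivative:
  assumes "smooth_on UNIV s"
  shows "((\<lambda>x. s x * exp (- (2 * pi * \<i>) * ph \<nu> x)) has_derivative
    (\<lambda>v. (dderiv s x v - 2 * pi * \<i> * Lf v \<nu> x * s x) * exp (- (2 * pi * \<i>) * ph \<nu> x))) (at x)"
  by (rule has_derivative_eq_rhs[OF has_derivative_mult[OF smooth_UNIV_derivative[OF assms] exp_ph_has_derivative]])
    (simp add: fun_eq_iff algebra_simps)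

lemma continuous_ph: "continuous_on S (ph \<nu>)" "continuous_on S (\<lambda>x. Lf v \<nu> x)"
proof -
  show "continuous_on S (ph \<nu>)"
    by (intro continuous_at_imp_continuous_on ballI has_derivative_continuous[OF ph_has_derivative])
  show "continuous_on S (\<lambda>x. Lf v \<nu> x)"
    unfolding Lf_def by (intro continuous_intros bounded_bilinear.continuous_on[OF bb_bounded])
qed

lemma U_integrand_continuous:
  assumes s: "smooth_on UNIV s"
  shows "continuous_on S (\<lambda>x. s x * exp (- (2 * pi * \<i>) * ph \<nu> x))"
    "continuous_on S (\<lambda>x. (dderiv s x v - 2 * pi * \<i> * Lf v \<nu> x * s x) * exp (- (2 * pi * \<i>) * ph \<nu> x))"
proof -
  note c = smooth_on_UNIV_continuous[OF s] smooth_on_UNIV_continuous[OF smooth_on_dderiv[OF s]] continuous_ph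
  show "continuous_on S (\<lambda>x. s x * exp (- (2 * pi * \<i>) * ph \<nu> x))"
    by (intro continuous_on_mult continuous_on_exp continuous_on_const c)
  show "continuous_on S (\<lambda>x. (dderiv s x v - 2 * pi * \<i> * Lf v \<nu> x * s x) * exp (- (2 * pi * \<i>) * ph \<nu> x))"
    by (intro continuous_on_mult continuous_on_diff continuous_on_exp continuous_on_const c)
qed

text \<open>Along \<open>(t, \<sigma> t)\<close> the ground state equation turns the derivative of the integrand into a derivative
  in the periodic directions, which integrates to 0.\<close>

lemma U_constant:
  assumes s: "s \<in> ground"
  shows "U n s p = U n s 0"
proof -
  have sq: "s \<in> qper d" and pde: "\<And>t x. dderiv s x (t, \<sigma> t) - \<i> * dderiv s x (0, Y t) = 2 * pi * \<i> * bb (fst x) t * s x"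
    using s by (auto simp: ground_def)
  note sm = qperD(1)[OF sq]
  let ?\<nu> = "nu n"
  define u where "u x = s x * exp (- (2 * pi * \<i>) * ph ?\<nu> x)" for x
  define u' where "u' x v = (dderiv s x v - 2 * pi * \<i> * Lf v ?\<nu> x * s x) * exp (- (2 * pi * \<i>) * ph ?\<nu> x)" for x v
  have ud: "(u has_derivative u' x) (at x)" for x
    unfolding u_def u'_def by (rule U_integrand_has_derivative[OF sm])
  have cu: "continuous_on S u" "continuous_on S (\<lambda>x. u' x v)" for S v
    unfolding u_def u'_def by (rule U_integrand_continuous[OF sm])+
  have uper: "u (p, q + b) = u (p, q)" if b: "b \<in> lattice" for p q b
  proof -
    have "s ((p, q) + (0, b)) = s (p, q)"
      using qperD(2)[OF sq, of "(0, b)" "(p, q)"] b by (simp add: pform_axis lattice_closed)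
    moreover have "exp (- (2 * pi * \<i>) * ph ?\<nu> ((p, q) + (0, b))) = exp (- (2 * pi * \<i>) * ph ?\<nu> (p, q)) * ee (- (freq n \<bullet> b))"
      unfolding exp_ph_periodic[OF b] ee_eq_exp exp_add[symmetric] by (simp add: algebra_simps)
    moreover have "ee (- (freq n \<bullet> b)) = 1" by (intro ee_Ints) (simp add: freq_lattice b)
    ultimately show ?thesis by (simp add: u_def)
  qed
  have lin: "linear (u' x)" for x using ud has_derivative_linear by blast
  have u0: "u' x (t, \<sigma> t) - \<i> * u' x (0, Y t) = 0" for x t
  proof -
    have "u' x (t, \<sigma> t) - \<i> * u' x (0, Y t) = ((dderiv s x (t, \<sigma> t) - \<i> * dderiv s x (0, Y t))
      - 2 * pi * \<i> * (Lf (t, \<sigma> t) ?\<nu> x - \<i> * Lf (0, Y t) ?\<nu> x) * s x) * exp (- (2 * pi * \<i>) * ph ?\<nu> x)"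
      by (simp add: u'_def algebra_simps)
    then show ?thesis unfolding pde F_PDE by simp
  qed
  have int0: "integral (cbox 0 1) (\<lambda>q. u' (p, q) (0, w)) = 0" for p w
  proof (rule integral_periodic_derivative[where g = "\<lambda>q. u (p, q)" and g' = "\<lambda>q w. u' (p, q) (0, w)"])
    show "((\<lambda>q. u (p, q)) has_derivative (\<lambda>w. u' (p, q) (0, w))) (at q)" for q
      by (rule has_derivative_compose[OF _ ud]) (auto intro!: derivative_eq_intros)
    show "continuous_on UNIV (\<lambda>q. u' (p, q) (0, v))" for v
      by (intro continuous_on_compose2[OF cu(2)[of UNIV]] continuous_intros) auto
    show "u (p, q + axis j 1) = u (p, q)" for q j by (rule uper) (rule lattice_closed)
  qed
  have iu: "(\<lambda>q. u' (p, q) v) integrable_on cbox 0 1" for p v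
    by (intro integrable_continuous continuous_on_compose2[OF cu(2)[of UNIV]] continuous_intros) auto
  have t0: "integral (cbox 0 1) (\<lambda>q. u' (p, q) (t, 0)) = 0" for p t
  proof -
    have "u' x (t, 0) = \<i> * u' x (0, Y t) - u' x (0, \<sigma> t)" for x
    proof -
      have "u' x (t, \<sigma> t) = u' x (t, 0) + u' x (0, \<sigma> t)" using linear_add[OF lin, of x "(t, 0)" "(0, \<sigma> t)"] by simp
      then show ?thesis using u0[of x t] by (simp add: algebra_simps)
    qed
    then have "integral (cbox 0 1) (\<lambda>q. u' (p, q) (t, 0)) = integral (cbox 0 1) (\<lambda>q. \<i> * u' (p, q) (0, Y t) - u' (p, q) (0, \<sigma> t))" by simp
    also have "\<dots> = \<i> * integral (cbox 0 1) (\<lambda>q. u' (p, q) (0, Y t)) - integral (cbox 0 1) (\<lambda>q. u' (p, q) (0, \<sigma> t))"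
      using iu by (subst integral_diff) (auto intro: integrable_on_cmult_left)
    finally show ?thesis by (simp add: int0)
  qed
  have der: "((\<lambda>r. integral (cbox 0 1) (\<lambda>q. u (r *\<^sub>R p, q))) has_vector_derivative 0) (at r within {0..1})" if r: "r \<in> {0..1}" for r
  proof -
    have "((\<lambda>r. integral (cbox 0 1) (\<lambda>q. u (r *\<^sub>R p, q))) has_vector_derivative integral (cbox 0 1) (\<lambda>q. u' (r *\<^sub>R p, q) (p, 0))) (at r within {0..1})"
    proof (rule leibniz_rule_vector_derivative)
      show "((\<lambda>r. u (r *\<^sub>R p, q)) has_vector_derivative u' (r *\<^sub>R p, q) (p, 0)) (at r within {0..1})" for r q
        using has_vector_derivative_line[of u "u' (r *\<^sub>R p, q)" "(0, q)" r "(p, 0)" "{0..1}"] ud by simp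
      show "(\<lambda>q. u (r *\<^sub>R p, q)) integrable_on cbox 0 1" for r
        by (intro integrable_continuous continuous_on_compose2[OF cu(1)[of UNIV]] continuous_intros) auto
      show "continuous_on ({0..1} \<times> cbox 0 1) (\<lambda>(r, q). u' (r *\<^sub>R p, q) (p, 0))"
        unfolding split_beta by (intro continuous_on_compose2[OF cu(2)[of UNIV]] continuous_intros) auto
    qed (use r in auto)
    then show ?thesis by (simp add: t0)
  qed
  obtain k where "\<And>r. r \<in> {0..1} \<Longrightarrow> integral (cbox 0 1) (\<lambda>q. u (r *\<^sub>R p, q)) = k"
    using has_vector_derivative_zero_constant[of "{0..1::real}" "\<lambda>r. integral (cbox 0 1) (\<lambda>q. u (r *\<^sub>R p, q))"] der by auto
  from this[of 0] this[of 1] show ?thesis by (simp add: U_def u_def)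
qed

text \<open>Quasi-periodicity in \<open>p\<close> relates index \<open>n\<close> at
  \<open>p = freq l\<close> to index \<open>shift l n\<close> at \<open>p = 0\<close>, and the value
  does not depend on \<open>p\<close>.\<close>

lemma U_shift:
  assumes s: "s \<in> ground"
  shows "U (shift l n) s 0 = U n s 0"
proof -
  have sq: "s \<in> qper d" using s by (simp add: ground_def)
  have "s (freq l, q) * exp (- (2 * pi * \<i>) * ph (nu n) (freq l, q)) = s (0, q) * exp (- (2 * pi * \<i>) * ph (nu (shift l n)) (0, q))" for q :: "real ^ 'm"
  proof -
    have 0: "(0 :: real ^ 'm) \<in> lattice" "freq l \<in> lattice" by (auto simp: lattice_closed) (simp add: lattice_def freq_def)
    have e: "s (freq l, q) = ee (pform d (freq l, 0) (0, q)) * s (0, q)" using qperD(2)[OF sq, of "(freq l, 0)" "(0, q)"] 0 by simp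
    have f: "F (nu n) (freq l, q) = ee (pform d (freq l, 0) (0, q)) * F (nu (shift l n)) (0, q)" using F_shift[OF 0(1), of n "(0, q)" l] by simp
    have inv: "exp (- (2 * pi * \<i>) * ph \<nu> x) = inverse (F \<nu> x)" for \<nu> x unfolding F_def exp_minus[symmetric] by simp
    show ?thesis unfolding inv e f by simp
  qed
  then have "U n s (freq l) = U (shift l n) s 0" by (simp add: U_def)
  then show ?thesis using U_constant[OF s, of n "freq l"] by simp
qed

definition reps :: "('m \<Rightarrow> int) set" where "reps = {r. \<forall>j. 0 \<le> r j \<and> r j < int (d j)}"

definition red :: "('m \<Rightarrow> int) \<Rightarrow> ('m \<Rightarrow> int)" where "red n = (\<lambda>j. n j mod int (d j))"

lemma red_shift: "red (shift l n) = red n"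
  by (auto simp: red_def shift_def fun_eq_iff mod_diff_right_eq[symmetric] simp del: mod_diff_right_eq)

lemma red_reps: "red n \<in> reps" using d by (auto simp: red_def reps_def)

lemma red_id: "n \<in> reps \<Longrightarrow> red n = n" by (auto simp: red_def reps_def fun_eq_iff)

lemma finite_reps: "finite reps" and card_reps: "card reps = (\<Prod>j\<in>UNIV. d j)"
proof -
  have e: "reps = PiE UNIV (\<lambda>j. {0..<int (d j)})" by (auto simp: reps_def PiE_UNIV_domain)
  show "finite reps" unfolding e by (rule finite_PiE) auto
  show "card reps = (\<Prod>j\<in>UNIV. d j)" unfolding e by (subst card_PiE) auto
qed

lemma U_red: assumes "s \<in> ground" shows "U n s 0 = U (red n) s 0"
proof -
  have "red n = shift (\<lambda>j. n j div int (d j)) n" by (auto simp: red_def shift_def fun_eq_iff minus_mult_div_eq_mod)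
  then show ?thesis using U_shift[OF assms] by simp
qed

text \<open>Independence of \<open>p\<close> and invariance under shifts reduce all Fourier
  coefficients of all slices \<open>s (p, _)\<close> to those with index in
  \<open>reps\<close>.\<close>

lemma ground_zero:
  assumes s: "s \<in> ground" and z: "\<And>r. r \<in> reps \<Longrightarrow> U r s 0 = 0"
  shows "s = 0"
proof
  fix x :: "'m phase"
  have sq: "s \<in> qper d" using s by (simp add: ground_def)
  obtain p q where x: "x = (p, q)" by force
  have "s (p, q) = 0"
  proof (rule Fourier_uniqueness[of "\<lambda>q. s (p, q)"])
    show "continuous_on UNIV (\<lambda>q. s (p, q))"
      by (intro continuous_on_compose2[OF smooth_on_UNIV_continuous[OF qperD(1)[OF sq], of UNIV]] continuous_intros) auto
    show "s (p, q + b) = s (p, q)" if "b \<in> lattice" for q b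
      using qperD(2)[OF sq, of "(0, b)" "(p, q)"] that by (simp add: pform_axis lattice_closed)
    fix n :: "'m \<Rightarrow> int"
    \<comment> \<open>\<open>U\<close> integrates against the inverse character, so the frequency
      \<open>n\<close> belongs to the index \<open>- n\<close>.\<close>
    define m where "m = (\<lambda>j. - n j)"
    define k :: complex where "k = exp (- (2 * complex_of_real pi * \<i>) * (bb (p - nu m) (p - nu m) / 2))"
    have k: "k \<noteq> 0" by (simp add: k_def)
    have c: "exp (- (2 * pi * \<i>) * ph (nu m) (p, q)) = k * char n q" for q
      unfolding ph_def k_def char_def ee_eq_exp
      by (simp add: nu_freq m_def freq_add exp_add[symmetric] algebra_simps)
    have "U m s p = 0" using U_constant[OF s] U_red[OF s] z red_reps by metis
    then have "integral (cbox 0 1) (\<lambda>q. k * (s (p, q) * char n q)) = 0" unfolding U_def c by (simp add: mult_ac)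
    then show "integral (cbox 0 1) (\<lambda>q. s (p, q) * char n q) = 0" using k by simp
  qed
  then show "s x = 0 x" by (simp add: x)
qed

text \<open>Uniform convergence on the cell allows termwise integration, and orthogonality of
  characters leaves the term with index \<open>r\<close>, whose Gaussian factors cancel.\<close>

lemma U_theta:
  assumes c: "\<forall>n. norm (c n) \<le> B"
  shows "U r (theta c) 0 = c r"
proof -
  have one: "polyfam (\<lambda>\<nu> x. 1 :: complex)" by (rule polyfam.const)
  let ?K = "cbox (0 :: real ^ 'm) 1"
  obtain R where R: "\<And>q. q \<in> ?K \<Longrightarrow> norm q \<le> R" using bounded_cbox bounded_iff by metis
  obtain K where K: "\<And>n x. norm x \<le> R \<Longrightarrow> norm (c n * (1 * F (nu n) x)) \<le> K * wt n" using coeff_bound[OF c one, of R] by auto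
  define g where "g q = exp (- (2 * pi * \<i>) * ph (nu r) (0, q))" for q
  have cg: "continuous_on S g" for S
    unfolding g_def by (intro continuous_intros continuous_on_compose2[OF continuous_ph(1)[of UNIV]]) auto
  have cF: "continuous_on S (\<lambda>q. F \<nu> (0, q))" for S \<nu>
    unfolding F_def by (intro continuous_intros continuous_on_compose2[OF continuous_ph(1)[of UNIV]]) auto
  define f where "f i q = c (enum i) * (1 * F (nu (enum i)) (0, q))" for i q
  have "uniform_limit ?K (\<lambda>N q. \<Sum>i<N. f i q) (\<lambda>q. \<Sum>i. f i q) sequentially"
  proof (rule Weierstrass_m_test[OF _ summable_mult[OF summable_wt, of K]])
    fix i q assume "q \<in> ?K"
    then have "norm (0 :: real ^ 'm, q) \<le> R" using R by (simp add: norm_Pair)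
    then show "norm (f i q) \<le> K * wt (enum i :: 'm \<Rightarrow> int)" unfolding f_def by (rule K)
  qed
  then have ul: "uniform_limit ?K (\<lambda>N q. (\<Sum>i<N. f i q) * g q) (\<lambda>q. (\<Sum>i. f i q) * g q) sequentially"
  proof (rule uniform_lim_mult[OF _ uniform_limit_const])
    have "bounded ((\<lambda>q. theta c (0, q)) ` ?K)"
      by (intro compact_imp_bounded compact_continuous_image compact_cbox
          continuous_on_compose2[OF smooth_on_UNIV_continuous[OF thetaP_smooth[OF c one], of UNIV]] continuous_intros) auto
    then show "bounded ((\<lambda>q. \<Sum>i. f i q) ` ?K)" by (simp add: thetaP_def f_def)
    show "bounded (g ` ?K)" by (intro compact_imp_bounded compact_continuous_image compact_cbox cg)
  qed
  have cn: "continuous_on ?K (\<lambda>q. (\<Sum>i<N. f i q) * g q)" for N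
    unfolding f_def by (intro continuous_intros cg cF)
  obtain I J where I: "\<And>N. ((\<lambda>q. (\<Sum>i<N. f i q) * g q) has_integral I N) ?K"
    and J: "((\<lambda>q. (\<Sum>i. f i q) * g q) has_integral J) ?K" and lim: "I \<longlonglongrightarrow> J"
    using uniform_limit_integral_cbox[OF ul cn trivial_limit_sequentially] by blast
  have U: "U r (theta c) 0 = J"
    using integral_unique[OF J] by (simp add: U_def thetaP_def f_def g_def)
  have Iterm: "integral ?K (\<lambda>q. f i q * g q) = (if enum i = r then c r else 0)" for i
  proof -
    let ?n = "enum i :: 'm \<Rightarrow> int"
    define k :: complex where "k = exp (2 * pi * \<i> * (bb (nu ?n) (nu ?n) / 2 - bb (nu r) (nu r) / 2))"
    have "F (nu ?n) (0, q) * g q = k * char (\<lambda>j. ?n j - r j) q" for q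
    proof -
      have "bb (0 - \<nu>) (0 - \<nu>) = bb \<nu> \<nu>" for \<nu> by (simp add: bb_simps bilinear_lneg[OF bb_bilinear] bilinear_rneg[OF bb_bilinear])
      then show ?thesis unfolding F_def g_def k_def char_def ee_eq_exp ph_def fst_conv snd_conv exp_add[symmetric]
        by (simp add: nu_freq freq_add inner_diff_left exp_add[symmetric] algebra_simps)
    qed
    then have "integral ?K (\<lambda>q. f i q * g q) = integral ?K (\<lambda>q. (c ?n * k) * char (\<lambda>j. ?n j - r j) q)"
      by (simp add: f_def mult.assoc)
    also have "\<dots> = (c ?n * k) * (if (\<lambda>j. ?n j - r j) = (\<lambda>j. 0) then 1 else 0)" by (simp add: integral_char)
    also have "(\<lambda>j. ?n j - r j) = (\<lambda>j. 0) \<longleftrightarrow> ?n = r" by (auto simp: fun_eq_iff)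
    finally show ?thesis by (simp add: k_def)
  qed
  have "I N = (\<Sum>i<N. if enum i = r then c r else 0)" for N
  proof -
    have "I N = integral ?K (\<lambda>q. \<Sum>i<N. f i q * g q)" using integral_unique[OF I[of N]] by (simp add: sum_distrib_right)
    also have "\<dots> = (\<Sum>i<N. integral ?K (\<lambda>q. f i q * g q))"
      unfolding f_def by (intro integral_sum integrable_continuous continuous_intros cg cF) auto
    finally show ?thesis by (simp add: Iterm)
  qed
  then have "I = (\<lambda>N. \<Sum>i<N. if enum i = r then c r else 0)" by auto
  then have "(\<lambda>i. if enum i = r then c r else 0) sums J" using lim by (simp add: sums_def)
  moreover obtain i0 where i0: "enum i0 = r" using bij_enum by (metis bij_pointE)
  have "enum i = r \<longleftrightarrow> i = i0" for i using bij_is_inj[OF bij_enum] i0 by (metis injD)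
  then have "(\<lambda>i. if enum i = r then c r else 0) = (\<lambda>i. if i = i0 then c r else 0)" by simp
  then have "(\<lambda>i. if enum i = r then c r else 0) sums c r" using sums_single[of i0 "\<lambda>_. c r"] by simp
  ultimately show ?thesis using U sums_unique2 by blast
qed

lemma ground_closed:
  "0 \<in> ground" "s \<in> ground \<Longrightarrow> t \<in> ground \<Longrightarrow> s + t \<in> ground" "s \<in> ground \<Longrightarrow> fscale k s \<in> ground"
proof -
  have dz: "dderiv (0 :: 'm phase \<Rightarrow> complex) x v = 0" for x v unfolding zero_fun_def by simp
  show "0 \<in> ground" unfolding ground_def by (simp add: qper_closed dz)
  {
    assume st: "s \<in> ground" "t \<in> ground"
    then have q: "s \<in> qper d" "t \<in> qper d" by (auto simp: ground_def)
    have "dderiv (s + t) x v = dderiv s x v + dderiv t x v" for x v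
      unfolding plus_fun_def by (rule dderivI) (intro has_derivative_add smooth_UNIV_derivative qperD(1)[OF q(1)] qperD(1)[OF q(2)])
    then show "s + t \<in> ground" using st qper_closed(2)[OF q] by (auto simp: ground_def algebra_simps)
  }
  assume s: "s \<in> ground"
  then have q: "s \<in> qper d" by (auto simp: ground_def)
  have "dderiv (fscale k s) x v = k * dderiv s x v" for x v
    by (rule dderivI) (intro has_derivative_mult_right smooth_UNIV_derivative qperD(1)[OF q])
  moreover have "k * dderiv s x (t, \<sigma> t) - \<i> * (k * dderiv s x (0, Y t)) = 2 * pi * \<i> * bb (fst x) t * (k * s x)" for t x
  proof -
    have "k * dderiv s x (t, \<sigma> t) - \<i> * (k * dderiv s x (0, Y t)) = k * (dderiv s x (t, \<sigma> t) - \<i> * dderiv s x (0, Y t))"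
      by (simp add: algebra_simps)
    also have "dderiv s x (t, \<sigma> t) - \<i> * dderiv s x (0, Y t) = 2 * pi * \<i> * bb (fst x) t * s x" using s unfolding ground_def by blast
    finally show ?thesis by simp
  qed
  ultimately show "fscale k s \<in> ground" using qper_closed(3)[OF q, of k] by (auto simp: ground_def)
qed

lemma ground_sum: "(\<And>i. i \<in> I \<Longrightarrow> f i \<in> ground) \<Longrightarrow> sum f I \<in> ground"
  by (induction I rule: infinite_finite_induct) (auto intro: ground_closed)

lemma U_linear:
  assumes "s \<in> ground" "t \<in> ground"
  shows "U n (s + t) 0 = U n s 0 + U n t 0" "U n (fscale k s) 0 = k * U n s 0"
proof -
  have i: "(\<lambda>q. s (0, q) * exp (- (2 * pi * \<i>) * ph (nu n) (0, q))) integrable_on cbox 0 1" if "s \<in> ground" for s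
    by (intro integrable_continuous continuous_on_compose2[OF U_integrand_continuous(1)[of s UNIV]] continuous_intros)
      (use that in \<open>auto simp: ground_def qper_def\<close>)
  show "U n (s + t) 0 = U n s 0 + U n t 0"
    unfolding U_def using integral_add[OF i[OF assms(1)] i[OF assms(2)]] by (simp add: distrib_right)
  show "U n (fscale k s) 0 = k * U n s 0"
    unfolding U_def by (simp add: mult.assoc)
qed

lemma U_zero: "U n 0 0 = 0" by (simp add: U_def)

lemma U_sum: "(\<And>i. i \<in> I \<Longrightarrow> f i \<in> ground) \<Longrightarrow> U n (sum f I) 0 = (\<Sum>i\<in>I. U n (f i) 0)"
  by (induction I rule: infinite_finite_induct) (auto simp: U_zero U_linear ground_sum)

text \<open>The functionals \<open>U r\<close> for \<open>r\<close> in \<open>reps\<close> are dual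
  to the theta series of the residue classes and, by \<open>ground_zero\<close>, separate ground
  states.\<close>

theorem fdim_ground: "fdim (\<lambda>c f. fscale c f) ground (\<Prod>j\<in>UNIV. d j)"
proof -
  define ind :: "('m \<Rightarrow> int) \<Rightarrow> ('m \<Rightarrow> int) \<Rightarrow> complex" where "ind r n = (if red n = r then 1 else 0)" for r n
  have ind1: "\<forall>n. norm (ind r n) \<le> 1" for r by (simp add: ind_def)
  have g: "theta (ind r) \<in> ground" for r
    by (rule theta_ground[OF ind1]) (simp add: ind_def red_shift)
  have gs: "fscale k (theta (ind r)) \<in> ground" for k r by (rule ground_closed(3)[OF g])
  have Us: "U r (\<Sum>i\<in>reps. fscale (k i) (theta (ind i))) 0 = k r" if r: "r \<in> reps" for r k
  proof -
    have "U r (\<Sum>i\<in>reps. fscale (k i) (theta (ind i))) 0 = (\<Sum>i\<in>reps. U r (fscale (k i) (theta (ind i))) 0)"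
      by (rule U_sum) (rule gs)
    also have "\<dots> = (\<Sum>i\<in>reps. k i * ind i r)"
      unfolding U_linear(2)[OF g g] U_theta[OF ind1] ..
    also have "\<dots> = k r" using r finite_reps by (simp add: ind_def red_id if_distrib[of "\<lambda>z. _ * z"] cong: if_cong)
    finally show ?thesis .
  qed
  have "fdim (\<lambda>c f. fscale c f) ground (card reps)"
  proof (rule fdimI[OF finite_reps, where \<phi> = "\<lambda>r. theta (ind r)"])
    fix s
    show "s \<in> ground \<longleftrightarrow> (\<exists>c. s = (\<Sum>i\<in>reps. fscale (c i) (theta (ind i))))"
    proof
      assume s: "s \<in> ground"
      define t where "t = (\<Sum>i\<in>reps. fscale (U i s 0) (theta (ind i)))"
      have t: "t \<in> ground" unfolding t_def by (intro ground_sum gs)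
      have mt: "fscale (- 1) t \<in> ground" by (rule ground_closed(3)[OF t])
      have z0: "s + fscale (- 1) t = 0"
      proof (rule ground_zero)
        show "s + fscale (- 1) t \<in> ground" by (rule ground_closed(2)[OF s mt])
        show "U r (s + fscale (- 1) t) 0 = 0" if "r \<in> reps" for r
          unfolding U_linear(1)[OF s mt] U_linear(2)[OF t t] unfolding t_def Us[OF that] by simp
      qed
      have "s x = t x" for x
      proof -
        from fun_cong[OF z0, of x] have "s x + - t x = 0" unfolding plus_fun_def zero_fun_def by simp
        then show ?thesis by simp
      qed
      then have "s = t" by auto
      then show "\<exists>c. s = (\<Sum>i\<in>reps. fscale (c i) (theta (ind i)))" unfolding t_def by (intro exI[of _ "\<lambda>i. U i s 0"])
    next
      assume "\<exists>c. s = (\<Sum>i\<in>reps. fscale (c i) (theta (ind i)))"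
      then obtain c where "s = (\<Sum>i\<in>reps. fscale (c i) (theta (ind i)))" ..
      moreover have "(\<Sum>i\<in>reps. fscale (c i) (theta (ind i))) \<in> ground" by (intro ground_sum gs)
      ultimately show "s \<in> ground" by simp
    qed
  next
    fix c assume z: "(\<Sum>i\<in>reps. fscale (c i) (theta (ind i))) = 0"
    show "\<forall>r\<in>reps. c r = 0"
    proof
      fix r assume "r \<in> reps"
      from Us[OF this, of c] show "c r = 0" unfolding z U_zero by simp
    qed
  qed
  then show ?thesis by (simp add: card_reps)
qed

end

section \<open>The ground states\<close>

lemma bilin_sform: "bilin (sform d)"
  unfolding bilin_def bilinear_def by (intro conjI allI linearI) (simp_all add: sform_def pform_simps algebra_simps)

text \<open>The frame determines a complex structure \<open>J\<close> compatible with
  \<open>sform d\<close>. Writing \<open>J\<close> as a graph over the Lagrangian subspace of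
  vectors \<open>(0, y)\<close> produces \<sigma> and \<open>Y\<close>, hence a period matrix, and
  holomorphic sections become \<open>ground\<close>.\<close>

lemma ground_states_fdim:
  fixes d :: "'m::finite \<Rightarrow> nat"
  assumes D: "darboux d e f a" and d: "\<And>j. d j > 0"
    and expan: "\<And>x. x = (\<Sum>j\<in>UNIV. (sform d x (f j) / a j) *\<^sub>R e j + (sform d (e j) x / a j) *\<^sub>R f j)"
  shows "fdim (\<lambda>c f. fscale c f) {s \<in> qper d. \<forall>j. ann d e f j s = 0} (\<Prod>j\<in>UNIV. d j)"
proof -
  interpret S: bilin "sform d" by (rule bilin_sform)
  have skew: "sform d x y = - sform d y x" for x y by (simp add: sform_def)
  have a: "a j > 0" for j using D by (auto simp: darboux_def)
  have ef: "sform d (e i) (f j) = (if i = j then a j else 0)" "sform d (e i) (e j) = 0" "sform d (f i) (f j) = 0" for i j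
    using D by (auto simp: darboux_def)
  define al where "al j x = sform d x (f j) / a j" for j x
  define be where "be j x = sform d (e j) x / a j" for j x
  have expan': "x = (\<Sum>j\<in>UNIV. al j x *\<^sub>R e j + be j x *\<^sub>R f j)" for x
    unfolding al_def be_def by (rule expan)
  define J where "J x = (\<Sum>j\<in>UNIV. al j x *\<^sub>R f j - be j x *\<^sub>R e j)" for x
  have linJ: "linear J"
    by (rule linearI) (simp_all add: J_def al_def be_def S.bil_simps add_divide_distrib scaleR_add_left sum.distrib[symmetric] scaleR_sum_right scaleR_right_diff_distrib algebra_simps)
  have alJ: "al j (J x) = - be j x" for j x
  proof -
    have "sform d (J x) (f j) = (\<Sum>i\<in>UNIV. - (be i x * (if i = j then a j else 0)))"
      unfolding J_def S.sum_left by (intro sum.cong) (simp_all add: S.bil_simps ef)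
    then show ?thesis using a[of j] by (simp add: al_def sum_negf if_distrib[of "\<lambda>z. _ * z"] cong: if_cong)
  qed
  have beJ: "be j (J x) = al j x" for j x
  proof -
    have "sform d (e j) (J x) = (\<Sum>i\<in>UNIV. al i x * (if i = j then a j else 0))"
      unfolding J_def S.sum_right by (intro sum.cong) (auto simp: S.bil_simps ef)
    then show ?thesis using a[of j] by (simp add: be_def if_distrib[of "\<lambda>z. _ * z"] cong: if_cong)
  qed
  have JJ: "J (J x) = - x" for x
  proof -
    have "J (J x) = - (\<Sum>j\<in>UNIV. al j x *\<^sub>R e j + be j x *\<^sub>R f j)"
      by (subst J_def) (auto simp: alJ beJ sum_negf[symmetric] intro!: sum.cong)
    then show ?thesis using expan'[of x] by simp
  qed
  have sf: "sform d x y = (\<Sum>j\<in>UNIV. a j * (al j x * be j y - be j x * al j y))" for x y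
  proof -
    have "sform d x y = (\<Sum>j\<in>UNIV. al j x * sform d (e j) y + be j x * sform d (f j) y)"
      by (subst expan'[of x]) (simp add: S.sum_left S.bil_simps)
    also have "\<dots> = (\<Sum>j\<in>UNIV. a j * (al j x * be j y - be j x * al j y))"
    proof (rule sum.cong)
      fix j
      have "sform d (e j) y = a j * be j y" "sform d (f j) y = - (a j * al j y)"
        using a[of j] skew[of "f j" y] by (simp_all add: be_def al_def)
      then show "al j x * sform d (e j) y + be j x * sform d (f j) y = a j * (al j x * be j y - be j x * al j y)"
        by (simp add: algebra_simps)
    qed simp
    finally show ?thesis .
  qed
  have g: "sform d x (J y) = (\<Sum>j\<in>UNIV. a j * (al j x * al j y + be j x * be j y))" for x y
    unfolding sf[of x "J y"] by (simp add: alJ beJ)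
  have g_sym: "sform d x (J y) = sform d y (J x)" for x y unfolding g by (simp add: mult.commute)
  have g_inv: "sform d (J x) (J y) = sform d x y" for x y unfolding sf[of "J x"] sf[of x y] by (simp add: alJ beJ algebra_simps)
  have g_pos: "sform d x (J x) > 0" if "x \<noteq> 0" for x
  proof -
    have nn: "0 \<le> a j * (al j x * al j x + be j x * be j x)" for j
      using a[of j] by (intro mult_nonneg_nonneg) auto
    have "\<exists>j. al j x \<noteq> 0 \<or> be j x \<noteq> 0"
    proof (rule ccontr)
      assume "\<not> (\<exists>j. al j x \<noteq> 0 \<or> be j x \<noteq> 0)"
      then have "x = 0" using expan'[of x] by simp
      with that show False by simp
    qed
    then obtain j where "al j x \<noteq> 0 \<or> be j x \<noteq> 0" ..
    then have "0 < a j * (al j x * al j x + be j x * be j x)"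
      using a[of j] by (intro mult_pos_pos) (simp_all only: sum_squares_gt_zero_iff)
    then show ?thesis unfolding g using nn by (intro sum_pos2[of _ j]) auto
  qed
  have s0: "sform d (0, y) z = - ddot d (fst z) y" "sform d z (0, y) = ddot d (fst z) y" for y z
    by (simp_all add: sform_def pform_ddot ddot_simps)
  \<comment> \<open>Positivity of \<open>sform d x (J x)\<close> prevents \<open>J (0, y)\<close>
    from lying in the Lagrangian subspace unless \<open>y = 0\<close>. Hence \<open>T\<close> is
    invertible, and its inverse \<open>Y\<close> parametrises the image of that subspace as
    \<open>(t, \<sigma> t)\<close>.\<close>
  define T where "T y = fst (J (0, y))" for y
  have zero2: "(0 :: real ^ 'm, x + y) = (0, x) + (0, y)" "(0 :: real ^ 'm, r *\<^sub>R x) = r *\<^sub>R (0, x)" for x y :: "real ^ 'm" and r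
    by simp_all
  have linT: "linear T"
    by (rule linearI) (simp_all only: T_def zero2 linear_add[OF linJ] linear_scale[OF linJ] fst_add fst_scaleR)
  have injT: "inj T"
  proof (rule linear_injective_0[OF linT, THEN iffD2], intro allI impI)
    fix y assume "T y = 0"
    then have "sform d (0, y) (J (0, y)) = 0" by (simp add: s0 T_def ddot_simps)
    then show "y = 0" using g_pos[of "(0, y)"] by (auto simp: zero_prod_def)
  qed
  have surjT: "surj T" by (rule linear_injective_imp_surjective[OF linT injT]) simp
  define Y where "Y = inv T"
  have TY: "T (Y t) = t" "Y (T y) = y" for t y using injT surjT by (simp_all add: Y_def surj_f_inv_f)
  have linY: "linear Y"
    by (rule linearI) (metis TY linear_add[OF linT], metis TY linear_scale[OF linT])
  define \<sigma> where "\<sigma> t = snd (J (0, Y t))" for t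
  have JY: "J (0, Y t) = (t, \<sigma> t)" for t
    using TY(1)[of t] by (simp add: \<sigma>_def T_def prod_eq_iff)
  have JX: "J (t, \<sigma> t) = - (0, Y t)" for t using JJ[of "(0, Y t)"] by (simp only: JY)
  have lin\<sigma>: "linear \<sigma>"
    by (rule linearI) (simp_all only: \<sigma>_def linear_add[OF linY] linear_scale[OF linY] zero2 linear_add[OF linJ] linear_scale[OF linJ] snd_add snd_scaleR)
  have dY: "ddot d p (Y t) = - sform d (0, Y t) (J (0, Y p))" for p t
    unfolding s0(1) JY by simp
  interpret theta_data d \<sigma> Y
  proof (rule theta_data.intro)
    show "d j > 0" for j by (rule d)
    show "linear \<sigma>" "linear Y" by (rule lin\<sigma> linY)+
    \<comment> \<open>The real part is symmetric because \<open>J\<close> preserves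
      \<open>sform d\<close> and so maps a Lagrangian subspace to another, the imaginary part
      because \<open>sform d x (J y)\<close> is a symmetric form.\<close>
    show "bform d \<sigma> Y p t = bform d \<sigma> Y t p" for p t
    proof -
      have "sform d (p, \<sigma> p) (t, \<sigma> t) = sform d (0, Y p) (0, Y t)" unfolding JY[symmetric] by (rule g_inv)
      then have "ddot d p (\<sigma> t) = ddot d t (\<sigma> p)" unfolding s0 by (simp add: sform_def pform_ddot ddot_simps)
      moreover have "ddot d p (Y t) = ddot d t (Y p)" unfolding dY using g_sym by simp
      ultimately show ?thesis by (simp add: bform_def)
    qed
    show "0 < Im (bform d \<sigma> Y t t)" if "t \<noteq> 0" for t
    proof -
      have "Y t \<noteq> 0" using TY(1)[of t] linear_0[OF linT] that by auto
      then have "sform d (0, Y t) (J (0, Y t)) > 0" by (intro g_pos) (simp add: zero_prod_def)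
      then show ?thesis by (simp add: bform_def dY)
    qed
  qed
  have "{s \<in> qper d. \<forall>j. ann d e f j s = 0} = ground"
  proof (intro set_eqI iffI)
    fix s assume "s \<in> {s \<in> qper d. \<forall>j. ann d e f j s = 0}"
    then have s: "s \<in> qper d" and an0: "\<And>j. ann d e f j s = 0" by blast+
    have an: "nab d (e j) s x + \<i> * nab d (f j) s x = 0" for j x
      unfolding ann_apply[symmetric] an0 by simp
    note sm = qperD(1)[OF s]
    have lin: "linear (\<lambda>v. nab d v s x)" for x
      by (rule linearI) (simp_all add: nab_linear[OF sm] scaleR_conv_of_real)
    have G: "nab d v s x + \<i> * nab d (J v) s x = 0" for v x
    proof -
      have "nab d v s x = (\<Sum>j\<in>UNIV. al j v *\<^sub>R nab d (e j) s x + be j v *\<^sub>R nab d (f j) s x)"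
        by (subst expan'[of v]) (simp add: linear_sum[OF lin] linear_add[OF lin] linear_scale[OF lin])
      moreover have "nab d (J v) s x = (\<Sum>j\<in>UNIV. al j v *\<^sub>R nab d (f j) s x - be j v *\<^sub>R nab d (e j) s x)"
        unfolding J_def by (simp add: linear_sum[OF lin] linear_diff[OF lin] linear_scale[OF lin])
      ultimately have "nab d v s x + \<i> * nab d (J v) s x = (\<Sum>j\<in>UNIV. (of_real (al j v) - \<i> * of_real (be j v)) * (nab d (e j) s x + \<i> * nab d (f j) s x))"
        by (simp add: sum_distrib_left sum.distrib[symmetric] scaleR_conv_of_real algebra_simps)
      then show ?thesis by (simp add: an)
    qed
    have "dderiv s x (t, \<sigma> t) - \<i> * dderiv s x (0, Y t) = 2 * pi * \<i> * bb (fst x) t * s x" for t x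
    proof -
      have "nab d (t, \<sigma> t) s x - \<i> * nab d (0, Y t) s x = 0" using G[of "(t, \<sigma> t)" x] unfolding JX nab_linear(3)[OF sm] by simp
      then show ?thesis by (simp add: nab_def pform_ddot bform_def algebra_simps)
    qed
    then show "s \<in> ground" using s unfolding ground_def by blast
  next
    fix s assume gr: "s \<in> ground"
    then have s: "s \<in> qper d" and pde: "\<And>t x. dderiv s x (t, \<sigma> t) - \<i> * dderiv s x (0, Y t) = 2 * pi * \<i> * bb (fst x) t * s x"
      unfolding ground_def by blast+
    note sm = qperD(1)[OF s]
    have lin: "linear (\<lambda>v. nab d v s x)" for x
      by (rule linearI) (simp_all add: nab_linear[OF sm] scaleR_conv_of_real)
    define G where "G v x = nab d v s x + \<i> * nab d (J v) s x" for v x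
    have Gadd: "G (u + v) x = G u x + G v x" for u v x
      unfolding G_def by (simp only: linear_add[OF linJ] linear_add[OF lin]) (simp add: algebra_simps)
    have GX: "G (t, \<sigma> t) x = 0" for t x
    proof -
      have "nab d (t, \<sigma> t) s x - \<i> * nab d (0, Y t) s x = 0"
        using pde[of x t] by (simp add: nab_def pform_ddot bform_def algebra_simps)
      then show ?thesis unfolding G_def JX nab_linear(3)[OF sm] by simp
    qed
    \<comment> \<open>Applying \<open>J\<close> multiplies the equation by a unit, so it passes from
      \<open>(t, \<sigma> t)\<close> to \<open>(0, Y t)\<close>; together these vectors
      span.\<close>
    have G0: "G (0, y) x = 0" for y x
    proof -
      have "G (0, Y t) x = \<i> * G (t, \<sigma> t) x" for t
        unfolding G_def JX JY nab_linear(3)[OF sm] by (simp add: algebra_simps)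
      from this[of "T y"] show ?thesis by (simp add: GX TY)
    qed
    have G: "G v x = 0" for v x
    proof -
      have "v = (fst v, \<sigma> (fst v)) + (0, snd v - \<sigma> (fst v))" by (simp add: prod_eq_iff)
      then show ?thesis using Gadd[of "(fst v, \<sigma> (fst v))" "(0, snd v - \<sigma> (fst v))" x] GX G0 by simp
    qed
    have Je: "J (e j) = f j" for j
    proof -
      have "al i (e j) = (if i = j then 1 else 0)" "be i (e j) = 0" for i
        using a[of i] by (auto simp: al_def be_def ef)
      then show ?thesis by (simp add: J_def if_distrib[of "\<lambda>r. r *\<^sub>R _"] cong: if_cong)
    qed
    have "ann d e f j s = 0" for j
    proof
      fix x show "ann d e f j s x = 0 x" using G[of "e j" x] by (simp add: ann_apply G_def Je)
    qed
    then show "s \<in> {s \<in> qper d. \<forall>j. ann d e f j s = 0}" using s by simp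
  qed
  then show ?thesis using fdim_ground by simp
qed

section \<open>The spectrum\<close>

lemma fdim_image:
  assumes "fdim s V n" and T: "\<And>c f. T (s c f) = s' c (T f)" "\<And>f g. T (f + g) = T f + T g" "T 0 = 0"
    and inj: "\<And>f. f \<in> V \<Longrightarrow> T f = 0 \<Longrightarrow> f = 0"
  shows "fdim s' (T ` V) n"
proof -
  obtain \<phi> where V: "\<And>f. f \<in> V \<longleftrightarrow> (\<exists>c. f = (\<Sum>i<n. s (c i) (\<phi> i)))"
    and ind: "\<And>c. (\<Sum>i<n. s (c i) (\<phi> i)) = 0 \<Longrightarrow> \<forall>i<n. c i = 0"
    using assms(1) unfolding fdim_def by blast
  have "T (sum g I) = (\<Sum>i\<in>I. T (g i))" for g :: "nat \<Rightarrow> _" and I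
    by (induction I rule: infinite_finite_induct) (auto simp: T)
  then have Ts: "T (\<Sum>i<n. s (c i) (\<phi> i)) = (\<Sum>i<n. s' (c i) (T (\<phi> i)))" for c by (simp add: T(1))
  show ?thesis unfolding fdim_def
  proof (intro exI[of _ "\<lambda>i. T (\<phi> i)"] conjI allI)
    show "f \<in> T ` V \<longleftrightarrow> (\<exists>c. f = (\<Sum>i<n. s' (c i) (T (\<phi> i))))" for f
      unfolding Ts[symmetric] image_iff Bex_def V by auto
    show "(\<Sum>i<n. s' (c i) (T (\<phi> i))) = 0 \<longrightarrow> (\<forall>i<n. c i = 0)" for c
    proof
      assume "(\<Sum>i<n. s' (c i) (T (\<phi> i))) = 0"
      moreover have "(\<Sum>i<n. s (c i) (\<phi> i)) \<in> V" unfolding V by (rule exI, rule refl)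
      ultimately have "(\<Sum>i<n. s (c i) (\<phi> i)) = 0" using inj Ts by simp
      then show "\<forall>i<n. c i = 0" by (rule ind)
    qed
  qed
qed

lemma vector_space_sections: "vector_space (\<lambda>(c::complex) s i x. c * s i x)"
  by unfold_locales (auto simp: fun_eq_iff algebra_simps)

lemma bilinear_axis_expansion:
  fixes B :: "real ^ 'n \<Rightarrow> real ^ 'n \<Rightarrow> complex"
  assumes B: "bilinear B"
  shows "(\<Sum>i\<in>UNIV. \<Sum>j\<in>UNIV. of_real (x $ i * y $ j) * B (axis i 1) (axis j 1)) = B x y"
proof -
  have l: "linear (B u)" "linear (\<lambda>u. B u v)" for u v using B by (auto simp: bilinear_def)
  have "B x y = B (\<Sum>i\<in>UNIV. x $ i *\<^sub>R axis i 1) (\<Sum>j\<in>UNIV. y $ j *\<^sub>R axis j 1)" by (simp only: axis_expansion)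
  also have "\<dots> = (\<Sum>i\<in>UNIV. x $ i *\<^sub>R B (axis i 1) (\<Sum>j\<in>UNIV. y $ j *\<^sub>R axis j 1))"
    by (simp only: linear_sum[OF l(2)] linear_scale[OF l(2)])
  also have "\<dots> = (\<Sum>i\<in>UNIV. x $ i *\<^sub>R (\<Sum>j\<in>UNIV. y $ j *\<^sub>R B (axis i 1) (axis j 1)))"
    by (simp only: linear_sum[OF l(1)] linear_scale[OF l(1)])
  finally show ?thesis by (simp add: scaleR_sum_right scaleR_conv_of_real mult.assoc sum_distrib_left)
qed

text \<open>Constant coefficients make the right-hand side of the Koszul formula vanish, and
  definiteness makes 0 the unique solution.\<close>

lemma levi_civita_invariant:
  assumes h: "riemannian_metric h" "\<And>x. h x = h 0"
  shows "levi_civita h x u v = 0"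
proof -
  have c: "(\<lambda>y. h y v w) = (\<lambda>y. h 0 v w)" for v w by (rule ext) (rule fun_cong[OF fun_cong[OF h(2)]])
  have z: "(\<forall>w. 2 * h x z w = 0) \<longleftrightarrow> z = 0" for z
  proof
    assume "\<forall>w. 2 * h x z w = 0"
    then have "h x z z = 0" by simp
    then show "z = 0" using h(1) unfolding riemannian_metric_def by (metis less_irrefl)
  next
    have "bilinear (h x)" using h(1) unfolding riemannian_metric_def by blast
    then show "z = 0 \<Longrightarrow> \<forall>w. 2 * h x z w = 0" by (simp add: bilinear_lzero)
  qed
  have "dderiv (\<lambda>y. h y v w) x u + dderiv (\<lambda>y. h y u w) x v - dderiv (\<lambda>y. h y u v) x w = 0" for w
    by (simp add: c[of v w] c[of u w] c[of u v])
  then have "levi_civita h x u v = (THE y. \<forall>w. 2 * h x y w = 0)" unfolding levi_civita_def by (simp only:)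
  then show ?thesis unfolding z by simp
qed

text \<open>Sections of the \<open>k\<close>-th power correspond to quasi-periodic functions through
  the \<open>k\<close>-th power of the frame \<gamma>. The correspondence takes covariant
  derivatives to \<open>nab\<close>, so \<open>landau_levels\<close> and
  \<open>ground_states_fdim\<close> give the multiplicities.\<close>

theorem spectrum_formula:
  fixes h \<omega> :: "'m::finite bilinear_field" and L :: "('i, 'm) line_bundle" and u v :: "'m \<Rightarrow> 'm euc" and \<mu> :: complex
  assumes \<omega>: "symplectic_form \<omega>" "\<And>x. \<omega> x = \<omega> 0" and h: "riemannian_metric h" "\<And>x. h x = h 0"
    and pre: "prequantum_bundle \<omega> L \<theta>"
    and nf: "normal_partial (h 0) (\<omega> 0) UNIV e' f' a" and fr: "frobenius_partial (\<omega> 0) UNIV u v d" and k: "k > 0"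
  defines "lev \<equiv> {n :: 'm \<Rightarrow> nat. complex_of_real (2 * pi * (\<Sum>j\<in>UNIV. (real k * a j) * (2 * real (n j) + 1))) = 2 * (of_nat k)\<^sup>2 * \<mu>}"
  shows "finite lev" "Spec k h L \<theta> \<mu> = card lev * (\<Prod>j\<in>UNIV. k * d j)"
proof -
  have w: "symplectic (\<omega> 0)"
    using \<omega>(1) unfolding symplectic_form_def symplectic_def bilin_def symplectic_axioms_def by auto
  have H: "bilin (h 0)" "\<And>x y. h 0 x y = h 0 y x"
    using h(1) unfolding riemannian_metric_def bilin_def by auto
  have d: "\<And>j. d j > 0" using fr unfolding frobenius_partial_def by auto
  define \<Phi> where "\<Phi> y = (\<Sum>j\<in>UNIV. fst y $ j *\<^sub>R u j) + (\<Sum>j\<in>UNIV. snd y $ j *\<^sub>R v j)" for y :: "'m phase"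
  note \<Phi> = frobenius_coordinates[OF w fr, folded \<Phi>_def]
  define F where "F = inv \<Phi>"
  have F: "F (\<Phi> y) = y" "\<Phi> (F x) = x" for x y
    using \<Phi>(2) by (auto simp: F_def bij_is_inj bij_is_surj surj_f_inv_f)
  have linF: "linear F"
    by (rule linearI) (metis F linear_add[OF \<Phi>(1)], metis F linear_scale[OF \<Phi>(1)])
  have bl: "bounded_linear F" "bounded_linear \<Phi>" using linF \<Phi>(1) linear_conv_bounded_linear by blast+
  obtain c \<gamma> where
    \<gamma>1: "\<And>i y. \<Phi> y + c \<in> patch L i \<Longrightarrow> norm (\<gamma> i y) = 1" and
    \<gamma>d: "\<And>i y. \<Phi> y + c \<in> patch L i \<Longrightarrow>
      (\<gamma> i has_derivative (\<lambda>v. (- 2 * pi * \<i> * pform d y v - \<theta> i (\<Phi> y + c) (\<Phi> v)) * \<gamma> i y)) (at y)" and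
    \<gamma>t: "\<And>i j y. \<Phi> y + c \<in> patch L i \<Longrightarrow> \<Phi> y + c \<in> patch L j \<Longrightarrow> \<gamma> i y = trans L i j (\<Phi> y + c) * \<gamma> j y" and
    \<gamma>p: "\<And>i y b. \<Phi> y + c \<in> patch L i \<Longrightarrow> b \<in> lattice \<times> lattice \<Longrightarrow> \<gamma> i y = ee (pform d b y) * \<gamma> i (y + b)"
    using gauge_exists[OF pre \<omega>(2) \<Phi> d] by blast
  \<comment> \<open>The \<open>k\<close>-th power has \<open>k\<close> times the potential. This
    scales the oscillator weights to \<open>real k * a j\<close> and the number of ground states to
    the product of the \<open>k * d j\<close>.\<close>
  define dk where "dk j = k * d j" for j
  have pk: "pform dk x y = real k * pform d x y" for x y by (simp add: pform_def dk_def sum_distrib_left mult.assoc)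
  have sk: "sform dk x y = real k * \<omega> 0 (\<Phi> x) (\<Phi> y)" for x y
    by (simp add: sform_def pk \<Phi>(4) right_diff_distrib)
  have dk: "dk j > 0" for j using d k by (simp add: dk_def)
  define e where "e j = F (e' j)" for j
  define f where "f j = F (f' j)" for j
  have a: "a j > 0" and we: "\<omega> 0 (e' j) x = a j * h 0 (f' j) x" "\<omega> 0 x (f' j) = a j * h 0 (e' j) x"
    and on: "h 0 (e' i) (e' j) = (if i = j then 1 else 0)" "h 0 (f' i) (f' j) = (if i = j then 1 else 0)"
    "h 0 (e' i) (f' j) = 0" for i j x
    using nf unfolding normal_partial_def by auto
  have D: "darboux dk e f (\<lambda>j. real k * a j)"
    unfolding darboux_def sk e_def f_def F
  proof (intro conjI allI)
    fix i j
    show "0 < real k * a j" using k a by simp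
    show "real k * \<omega> 0 (e' i) (f' j) = (if i = j then real k * a j else 0)" by (simp add: we(2) on H(2)[of "e' j"])
    show "real k * \<omega> 0 (e' i) (e' j) = 0" by (simp add: we(1) H(2)[of "f' i"] on)
    show "real k * \<omega> 0 (f' i) (f' j) = 0" by (simp add: we(2) on)
  qed
  have "x = (\<Sum>j\<in>UNIV. (sform dk x (f j) / (real k * a j)) *\<^sub>R e j + (sform dk (e j) x / (real k * a j)) *\<^sub>R f j)" for x
  proof -
    have "x = F (\<Sum>j\<in>UNIV. h 0 (e' j) (\<Phi> x) *\<^sub>R e' j + h 0 (f' j) (\<Phi> x) *\<^sub>R f' j)"
      using normal_basis_matrix(2)[OF H nf, of "\<Phi> x"] F by metis
    also have "\<dots> = (\<Sum>j\<in>UNIV. h 0 (e' j) (\<Phi> x) *\<^sub>R e j + h 0 (f' j) (\<Phi> x) *\<^sub>R f j)"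
      by (simp add: linear_sum[OF linF] linear_add[OF linF] linear_scale[OF linF] e_def f_def)
    also have "\<dots> = (\<Sum>j\<in>UNIV. (sform dk x (f j) / (real k * a j)) *\<^sub>R e j + (sform dk (e j) x / (real k * a j)) *\<^sub>R f j)"
    proof (rule sum.cong)
      fix j
      show "h 0 (e' j) (\<Phi> x) *\<^sub>R e j + h 0 (f' j) (\<Phi> x) *\<^sub>R f j
        = (sform dk x (f j) / (real k * a j)) *\<^sub>R e j + (sform dk (e j) x / (real k * a j)) *\<^sub>R f j"
        using a[of j] k by (simp add: sk f_def[of j] e_def[of j] F we)
    qed simp
    finally show ?thesis .
  qed
  note gs = ground_states_fdim[OF D dk this]
  \<comment> \<open>Clears the factor \<open>(1 / k)\<^sup>2 / 2\<close> of the Hamiltonian from the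
    eigenvalue equation.\<close>
  let ?z = "2 * (of_nat k)\<^sup>2 * \<mu>"
  define V where "V = {s \<in> qper dk. \<forall>x. lap dk e f s x = ?z * s x}"
  note ll = landau_levels[OF D gs, of ?z, folded V_def]
  show "finite lev" using ll(1) unfolding lev_def .
  have fV: "fdim (\<lambda>c f. fscale c f) V (card lev * (\<Prod>j\<in>UNIV. k * d j))"
    using ll(2) unfolding lev_def dk_def .

  have bndl: "hermitian_line_bundle L" and conn: "hermitian_connection L \<theta>"
    using pre unfolding prequantum_bundle_def by auto
  have opn: "open (patch L i)" and inv_patch: "x \<in> patch L i \<Longrightarrow> b \<in> lattice \<Longrightarrow> x + b \<in> patch L i" for i x b
    using bndl unfolding hermitian_line_bundle_def by blast+
  have cover: "\<exists>i. x \<in> patch L i" for x using bndl unfolding hermitian_line_bundle_def by blast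
  have \<theta>: "smooth_on (patch L i) (\<lambda>x. \<theta> i x w)" "x \<in> patch L i \<Longrightarrow> linear (\<theta> i x)" for i x w
    using conn unfolding hermitian_connection_def by blast+
  define G where "G x = F x + - F c" for x
  have G: "\<Phi> (G x) + c = x" "G (\<Phi> y + c) = y" "G (x + b) = G x + F b" for x y b
    by (simp_all add: G_def linear_add[OF linF] linear_add[OF \<Phi>(1)] linear_neg[OF \<Phi>(1)] linear_diff[OF \<Phi>(1)] F)
  have Flat: "F b \<in> lattice \<times> lattice" if b: "b \<in> lattice" for b
  proof -
    obtain y where "y \<in> lattice \<times> lattice" "b = \<Phi> y" using \<Phi>(3) b by blast
    then show ?thesis by (simp add: F)
  qed
  define W where "W i = {y. \<Phi> y + c \<in> patch L i}" for i
  have opW: "open (W i)" for i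
  proof -
    have "continuous_on UNIV (\<lambda>y. \<Phi> y + c)" by (intro continuous_intros linear_continuous_on bl)
    then have "open ((\<lambda>y. \<Phi> y + c) -` patch L i)" using opn continuous_on_open_vimage[OF open_UNIV] by auto
    then show ?thesis by (simp add: W_def vimage_def)
  qed
  have GW: "G x \<in> W i" if "x \<in> patch L i" for x i using that by (simp add: W_def G)
  have \<gamma>s: "smooth_on (W i) (\<gamma> i)" for i
  proof (rule smooth_on_multiplicative_ode[OF opW])
    show "(\<gamma> i has_derivative (\<lambda>v. (- 2 * pi * \<i> * pform d y v - \<theta> i (\<Phi> y + c) (\<Phi> v)) * \<gamma> i y)) (at y)" if "y \<in> W i" for y
      by (rule \<gamma>d) (use that in \<open>simp add: W_def\<close>)
    fix w
    have "smooth_on (W i) (\<lambda>y. (- 2 * pi * \<i>) * complex_of_real (pform d y w) + (- 1) * \<theta> i (\<Phi> y + c) (\<Phi> w))"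
      by (intro smooth_on_add smooth_on_mult smooth_on_const opW smooth_on_subset[OF smooth_pform]
          smooth_on_affine[OF opW bl(2) _ \<theta>(1)]) (auto simp: W_def)
    then show "smooth_on (W i) (\<lambda>y. - 2 * pi * \<i> * pform d y w - \<theta> i (\<Phi> y + c) (\<Phi> w))" by simp
  qed
  \<comment> \<open>Multiplication by the \<open>k\<close>-th power of the frame in the affine
    coordinates \<open>G\<close>, extended by 0 outside the patch as \<open>smooth_sections\<close>
    prescribes.\<close>
  define T where "T s i x = (if x \<in> patch L i then \<gamma> i (G x) ^ k * s (G x) else 0)" for s i x
  have \<gamma>0: "\<gamma> i (G x) \<noteq> 0" if "x \<in> patch L i" for i x
  proof -
    have "norm (\<gamma> i (G x)) = 1" by (rule \<gamma>1) (simp add: G that)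
    then show ?thesis by auto
  qed
  have Td: "((T s i) has_derivative (\<lambda>w. \<gamma> i (G x) ^ k * (nab dk (F w) s (G x)) - of_nat k * \<theta> i x w * T s i x)) (at x)"
    if s: "smooth_on UNIV s" and x: "x \<in> patch L i" for s i x
  proof -
    have Gd: "(G has_derivative F) (at x)"
      unfolding G_def
      by (rule has_derivative_eq_rhs[OF has_derivative_add[OF bounded_linear_imp_has_derivative[OF bl(1)] has_derivative_const]]) simp
    have 1: "((\<lambda>x. \<gamma> i (G x)) has_derivative (\<lambda>w. (- 2 * pi * \<i> * pform d (G x) (F w) - \<theta> i x w) * \<gamma> i (G x))) (at x)"
      using has_derivative_compose[OF Gd \<gamma>d[of "G x" i]] by (simp add: G F x)
    have 2: "((\<lambda>x. s (G x)) has_derivative (\<lambda>w. dderiv s (G x) (F w))) (at x)"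
      by (rule has_derivative_compose[OF Gd smooth_UNIV_derivative[OF s]])
    obtain k' where k': "k = Suc k'" using k by (cases k) auto
    have "((\<lambda>x. \<gamma> i (G x) ^ k * s (G x)) has_derivative
       (\<lambda>w. \<gamma> i (G x) ^ k * (nab dk (F w) s (G x)) - of_nat k * \<theta> i x w * (\<gamma> i (G x) ^ k * s (G x)))) (at x)"
      by (rule has_derivative_eq_rhs[OF has_derivative_mult[OF has_derivative_power[OF 1] 2]])
        (simp add: nab_def pk fun_eq_iff k' algebra_simps)
    then have "(T s i has_derivative (\<lambda>w. \<gamma> i (G x) ^ k * (nab dk (F w) s (G x)) - of_nat k * \<theta> i x w * (\<gamma> i (G x) ^ k * s (G x)))) (at x)"
      by (rule has_derivative_transform_within_open[OF _ opn x]) (simp add: T_def)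
    then show ?thesis using x by (simp add: T_def)
  qed
  \<comment> \<open>The derivative of the frame cancels the connection form and leaves the model
    potential.\<close>
  have cov: "covd (power_connection k \<theta> i) w (T s i) x = T (nab dk (F w) s) i x"
    if s: "smooth_on UNIV s" and x: "x \<in> patch L i" for s i x w
    unfolding covd_def dderivI[OF Td[OF s x]] power_connection_def by (simp add: T_def x)
  have cov2: "second_covd h (power_connection k \<theta> i) w1 w2 (T s i) x = T (nab dk (F w1) (nab dk (F w2) s)) i x"
    if s: "smooth_on UNIV s" and x: "x \<in> patch L i" for s i x w1 w2
  proof -
    have d1: "T (nab dk (F w2) s) i differentiable (at x)"
      using Td[OF nab_smooth[OF s] x] unfolding differentiable_def by blast
    have "dderiv (covd (power_connection k \<theta> i) w2 (T s i)) x w1 = dderiv (T (nab dk (F w2) s) i) x w1"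
      by (rule dderiv_cong(1)[OF opn x _ d1]) (simp add: cov[OF s])
    then have "covd (power_connection k \<theta> i) w1 (covd (power_connection k \<theta> i) w2 (T s i)) x = covd (power_connection k \<theta> i) w1 (T (nab dk (F w2) s) i) x"
      by (simp add: covd_def[of _ w1] cov[OF s x])
    moreover have "covd (power_connection k \<theta> i) 0 (T s i) x = 0"
    proof -
      have "T s i differentiable (at x)" using Td[OF s x] unfolding differentiable_def by blast
      then show ?thesis using linear_0[OF dderiv_linear] linear_0[OF \<theta>(2)[OF x]] by (simp add: covd_def power_connection_def)
    qed
    ultimately show ?thesis
      unfolding second_covd_def levi_civita_invariant[OF h] by (simp add: cov[OF nab_smooth[OF s] x])
  qed
  have lapT: "laplacian h (power_connection k \<theta> i) (T s i) x = \<gamma> i (G x) ^ k * lap dk e f s (G x)"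
    if s: "smooth_on UNIV s" and x: "x \<in> patch L i" for s i x
  proof -
    define B where "B w1 w2 = nab dk (F w1) (nab dk (F w2) s) (G x)" for w1 w2
    have bB: "bilinear B"
    proof -
      have sc: "nab dk (r *\<^sub>R w) s = fscale (of_real r) (nab dk w s)" for r w
        by (rule ext) (simp add: nab_linear(2)[OF s])
      show ?thesis unfolding bilinear_def
        by (auto intro!: linearI simp: B_def linear_add[OF linF] linear_scale[OF linF] nab_linear(1)[OF s] sc
            nab_linear(1,2)[OF nab_smooth[OF s]] nab_add[OF nab_smooth[OF s] nab_smooth[OF s]] nab_scale[OF nab_smooth[OF s]] scaleR_conv_of_real[where 'a = complex])
    qed
    have gram: "gram h x = formmat (h 0)" unfolding gram_def formmat_def h(2)[of x] ..
    have "laplacian h (power_connection k \<theta> i) (T s i) x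
      = - (\<Sum>p\<in>UNIV. \<Sum>q\<in>UNIV. complex_of_real (matrix_inv (formmat (h 0)) $ p $ q) * (\<gamma> i (G x) ^ k * B (axis p 1) (axis q 1)))"
      unfolding laplacian_def gram cov2[OF s x] by (simp add: T_def x B_def)
    also have "\<dots> = - (\<gamma> i (G x) ^ k * (\<Sum>p\<in>UNIV. \<Sum>q\<in>UNIV. \<Sum>j\<in>UNIV.
        (of_real (e' j $ p * e' j $ q) + of_real (f' j $ p * f' j $ q)) * B (axis p 1) (axis q 1)))"
      \<comment> \<open>The inverse Gram matrix is the sum of the squares of the frame vectors, so
        the coordinate trace of the bilinear form \<open>B\<close> becomes its trace over the
        frame.\<close>
      unfolding normal_basis_matrix(1)[OF H nf] by (simp add: sum_distrib_left sum_distrib_right mult_ac)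
    also have "(\<Sum>p\<in>UNIV. \<Sum>q\<in>UNIV. \<Sum>j\<in>UNIV. (of_real (e' j $ p * e' j $ q) + of_real (f' j $ p * f' j $ q)) * B (axis p 1) (axis q 1))
      = (\<Sum>p\<in>UNIV. \<Sum>j\<in>UNIV. \<Sum>q\<in>UNIV. (of_real (e' j $ p * e' j $ q) + of_real (f' j $ p * f' j $ q)) * B (axis p 1) (axis q 1))"
      by (intro sum.cong refl sum.swap)
    also have "\<dots> = (\<Sum>j\<in>UNIV. \<Sum>p\<in>UNIV. \<Sum>q\<in>UNIV. (of_real (e' j $ p * e' j $ q) + of_real (f' j $ p * f' j $ q)) * B (axis p 1) (axis q 1))"
      by (rule sum.swap)
    also have "\<dots> = (\<Sum>j\<in>UNIV. B (e' j) (e' j) + B (f' j) (f' j))"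
      by (simp only: distrib_right sum.distrib bilinear_axis_expansion[OF bB])
    finally show ?thesis by (simp add: lap_def B_def e_def f_def)
  qed
  have T_section: "T s \<in> smooth_sections (tensor_power k L)" if s: "s \<in> qper dk" for s
    unfolding smooth_sections_def tensor_power_def
  proof (intro CollectI conjI allI ballI impI, simp_all)
    fix i
    have "smooth_on (W i) (\<lambda>y. \<gamma> i y ^ k * s y)"
      by (intro smooth_on_mult smooth_on_power \<gamma>s opW smooth_on_subset[OF qperD(1)[OF s]]) simp
    from smooth_on_affine[OF opn bl(1) _ this, of i "- F c"]
    have "smooth_on (patch L i) (\<lambda>x. \<gamma> i (G x) ^ k * s (G x))" using GW by (simp add: G_def)
    then show "smooth_on (patch L i) (T s i)" by (rule smooth_on_cong[OF opn, rotated]) (simp add: T_def)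
    show "periodic_on (patch L i) (T s i)" unfolding periodic_on_def
    proof (intro ballI)
      fix x b :: "'m euc" assume x: "x \<in> patch L i" and b: "b \<in> lattice"
      have "\<gamma> i (G x) = ee (pform d (F b) (G x)) * \<gamma> i (G x + F b)" by (rule \<gamma>p) (simp_all add: G x Flat b)
      moreover have "s (G x + F b) = ee (pform d (F b) (G x)) ^ k * s (G x)"
        unfolding qperD(2)[OF s Flat[OF b]] ee_power pk ..
      ultimately show "T s i (x + b) = T s i x"
        using inv_patch[OF x b] x by (simp add: T_def G power_mult_distrib)
    qed
    show "T s i x = 0" if "x \<notin> patch L i" for x using that by (simp add: T_def)
    show "T s i x = trans L i j x ^ k * T s j x" if "x \<in> patch L i \<and> x \<in> patch L j" for j x
      using \<gamma>t[of "G x" i j] that by (simp add: T_def G power_mult_distrib)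
  qed
  have T_eigen: "T s \<in> eigensections k h L \<theta> \<mu> \<longleftrightarrow> s \<in> V" if s: "s \<in> qper dk" for s
  proof -
    have eq: "(1 / of_nat k)\<^sup>2 / 2 * laplacian h (power_connection k \<theta> i) (T s i) x = \<mu> * T s i x
        \<longleftrightarrow> lap dk e f s (G x) = ?z * s (G x)" if x: "x \<in> patch L i" for i x
    proof -
      have "(1 / of_nat k)\<^sup>2 / 2 * laplacian h (power_connection k \<theta> i) (T s i) x = \<mu> * T s i x
        \<longleftrightarrow> \<gamma> i (G x) ^ k * ((1 / of_nat k)\<^sup>2 / 2 * lap dk e f s (G x)) = \<gamma> i (G x) ^ k * (\<mu> * s (G x))"
        unfolding lapT[OF qperD(1)[OF s] x] by (simp add: T_def x mult_ac)
      also have "\<dots> \<longleftrightarrow> (1 / of_nat k)\<^sup>2 / 2 * lap dk e f s (G x) = \<mu> * s (G x)" using \<gamma>0[OF x] by (simp add: mult_ac)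
      also have "\<dots> \<longleftrightarrow> lap dk e f s (G x) = ?z * s (G x)" using k by (simp add: field_simps power2_eq_square)
      finally show ?thesis .
    qed
    have "(\<forall>i. \<forall>x\<in>patch L i. lap dk e f s (G x) = ?z * s (G x)) \<longleftrightarrow> (\<forall>y. lap dk e f s y = ?z * s y)"
      using cover G(2) by metis
    then show ?thesis unfolding eigensections_def V_def using T_section[OF s] s eq by simp
  qed
  have T_surj: "\<exists>s\<in>qper dk. T s = \<tau>" if \<tau>: "\<tau> \<in> smooth_sections (tensor_power k L)" for \<tau>
  proof -
    have \<tau>s: "smooth_on (patch L i) (\<tau> i)" and \<tau>p: "periodic_on (patch L i) (\<tau> i)" and \<tau>0: "x \<notin> patch L i \<Longrightarrow> \<tau> i x = 0"
      and \<tau>t: "x \<in> patch L i \<Longrightarrow> x \<in> patch L j \<Longrightarrow> \<tau> i x = trans L i j x ^ k * \<tau> j x" for i j x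
    proof -
      have "(\<forall>i. smooth_on (patch L i) (\<tau> i) \<and> periodic_on (patch L i) (\<tau> i) \<and> (\<forall>x. x \<notin> patch L i \<longrightarrow> \<tau> i x = 0)) \<and>
          (\<forall>i j. \<forall>x\<in>patch L i \<inter> patch L j. \<tau> i x = trans L i j x ^ k * \<tau> j x)"
        using \<tau> by (simp add: smooth_sections_def tensor_power_def)
      then show "smooth_on (patch L i) (\<tau> i)" "periodic_on (patch L i) (\<tau> i)" "x \<notin> patch L i \<Longrightarrow> \<tau> i x = 0"
        "x \<in> patch L i \<Longrightarrow> x \<in> patch L j \<Longrightarrow> \<tau> i x = trans L i j x ^ k * \<tau> j x"
        by blast+
    qed
    define \<iota> where "\<iota> x = (SOME i. x \<in> patch L i)" for x
    have \<iota>: "x \<in> patch L (\<iota> x)" for x unfolding \<iota>_def using cover by (rule someI_ex)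
    \<comment> \<open>The frame has modulus 1, so conjugation inverts it; the value does not depend
      on the patch chosen at the point.\<close>
    define s where "s y = cnj (\<gamma> (\<iota> (\<Phi> y + c)) y) ^ k * \<tau> (\<iota> (\<Phi> y + c)) (\<Phi> y + c)" for y
    have s_eq: "s y = cnj (\<gamma> i y) ^ k * \<tau> i (\<Phi> y + c)" if i: "\<Phi> y + c \<in> patch L i" for i y
    proof -
      let ?x = "\<Phi> y + c" and ?j = "\<iota> (\<Phi> y + c)"
      have tn: "norm (trans L ?j i ?x) = 1" using bndl i \<iota> unfolding hermitian_line_bundle_def by blast
      have "s y = cnj (trans L ?j i ?x * \<gamma> i y) ^ k * (trans L ?j i ?x ^ k * \<tau> i ?x)"
        unfolding s_def using \<gamma>t[OF \<iota> i] \<tau>t[OF \<iota> i] by simp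
      also have "\<dots> = (trans L ?j i ?x * cnj (trans L ?j i ?x)) ^ k * (cnj (\<gamma> i y) ^ k * \<tau> i ?x)"
        by (simp add: power_mult_distrib mult_ac)
      finally show ?thesis using cnj_cancel(1)[OF tn] by simp
    qed
    have "smooth_on UNIV s"
    proof (rule smooth_on_local)
      fix y :: "'m phase"
      let ?i = "\<iota> (\<Phi> y + c)"
      have "smooth_on (W ?i) (\<lambda>y. cnj (\<gamma> ?i y) ^ k * \<tau> ?i (\<Phi> y + c))"
        by (intro smooth_on_mult smooth_on_power smooth_on_bounded_linear[OF _ bounded_linear_cnj] \<gamma>s opW
            smooth_on_affine[OF opW bl(2) _ \<tau>s]) (simp add: W_def)
      then have "smooth_on (W ?i) s" by (rule smooth_on_cong[OF opW, rotated]) (simp add: W_def s_eq)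
      then show "\<exists>V. open V \<and> y \<in> V \<and> smooth_on V s" using opW \<iota> by (intro exI[of _ "W ?i"]) (auto simp: W_def)
    qed
    moreover have "s (y + b) = ee (pform dk b y) * s y" if b: "b \<in> lattice \<times> lattice" for y b
    proof -
      let ?i = "\<iota> (\<Phi> y + c)"
      have bl': "\<Phi> b \<in> lattice" using \<Phi>(3) b by blast
      have e: "\<Phi> (y + b) + c = (\<Phi> y + c) + \<Phi> b" by (simp add: linear_add[OF \<Phi>(1)])
      have i': "\<Phi> (y + b) + c \<in> patch L ?i" unfolding e by (rule inv_patch[OF \<iota> bl'])
      have "\<tau> ?i (\<Phi> (y + b) + c) = \<tau> ?i (\<Phi> y + c)" unfolding e using \<tau>p[of ?i] \<iota> bl' unfolding periodic_on_def by blast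
      moreover have "cnj (\<gamma> ?i (y + b)) = ee (pform d b y) * cnj (\<gamma> ?i y)"
        unfolding \<gamma>p[OF \<iota> b] by (simp add: cnj_ee mult.assoc[symmetric] ee_add[symmetric])
      ultimately show ?thesis unfolding s_eq[OF i'] s_def[of y] by (simp add: power_mult_distrib ee_power pk)
    qed
    ultimately have sq: "s \<in> qper dk" unfolding qper_def by blast
    have "T s i x = \<tau> i x" for i x
    proof (cases "x \<in> patch L i")
      case True
      have "norm (\<gamma> i (G x)) = 1" by (rule \<gamma>1) (simp add: G True)
      moreover have "s (G x) = cnj (\<gamma> i (G x)) ^ k * \<tau> i x" using s_eq[of "G x" i] by (simp add: G True)
      ultimately show ?thesis using True by (simp add: T_def mult.assoc[symmetric] power_mult_distrib[symmetric] cnj_cancel)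
    qed (simp add: T_def \<tau>0)
    then show ?thesis using sq by blast
  qed
  have "T ` V = eigensections k h L \<theta> \<mu>"
  proof (intro equalityI subsetI)
    fix \<tau> assume "\<tau> \<in> T ` V"
    then obtain s where "s \<in> V" "\<tau> = T s" by blast
    moreover from this have "s \<in> qper dk" by (simp add: V_def)
    ultimately show "\<tau> \<in> eigensections k h L \<theta> \<mu>" using T_eigen by blast
  next
    fix \<tau> assume \<tau>: "\<tau> \<in> eigensections k h L \<theta> \<mu>"
    then have "\<tau> \<in> smooth_sections (tensor_power k L)" by (simp add: eigensections_def)
    then obtain s where "s \<in> qper dk" "T s = \<tau>" using T_surj by blast
    then show "\<tau> \<in> T ` V" using T_eigen \<tau> by blast
  qed
  moreover have "fdim (\<lambda>(c::complex) s i x. c * s i x) (T ` V) (card lev * (\<Prod>j\<in>UNIV. k * d j))"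
  proof (rule fdim_image[OF fV])
    show "T (fscale r s) = (\<lambda>i x. r * T s i x)" for r s by (auto simp: T_def fun_eq_iff)
    show "T (s + t) = T s + T t" for s t by (auto simp: T_def fun_eq_iff algebra_simps)
    show "T 0 = 0" by (auto simp: T_def fun_eq_iff)
    fix s assume z: "T s = 0"
    show "s = 0"
    proof
      fix y
      obtain i where i: "\<Phi> y + c \<in> patch L i" using cover by blast
      have "T s i (\<Phi> y + c) = 0" using z by simp
      then show "s y = 0 y" using \<gamma>0[OF i] i by (simp add: T_def G(2))
    qed
  qed
  ultimately show "Spec k h L \<theta> \<mu> = card lev * (\<Prod>j\<in>UNIV. k * d j)"
    unfolding Spec_def using fdim_dim[OF vector_space_sections] by metis
qed

section \<open>From multiplicities back to the geometry\<close>

lemma integer_class_Ints: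
  assumes "integer_class \<omega>" "\<And>x. \<omega> x = \<omega> 0" "x \<in> lattice" "y \<in> lattice"
  shows "\<omega> 0 x y \<in> \<int>"
proof -
  have e: "\<omega> (s *\<^sub>R x + t *\<^sub>R y) x y = \<omega> 0 x y" for s t :: real
    by (rule fun_cong[OF fun_cong[OF assms(2)]])
  from assms(1)[unfolded integer_class_def, rule_format, OF assms(3,4)]
  show ?thesis unfolding e by simp
qed

lemma unit_weights_from_levels:
  fixes a b :: "'m::finite \<Rightarrow> real"
  assumes a: "\<And>j. a j = 1" and b: "\<And>j. b j > 0"
    and eq: "\<And>x. (\<exists>n. x = (\<Sum>j\<in>UNIV. a j * (2 * real (n j) + 1))) \<longleftrightarrow> (\<exists>n. x = (\<Sum>j\<in>UNIV. b j * (2 * real (n j) + 1)))"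
  shows "b j = 1"
proof -
  let ?A = "\<lambda>c n. \<Sum>j\<in>UNIV. c j * (2 * real (n j) + 1)"
  have A: "?A a n = real CARD('m) + 2 * real (\<Sum>j\<in>UNIV. n j)" for n :: "'m \<Rightarrow> nat"
    by (simp add: a sum.distrib sum_distrib_left)
  \<comment> \<open>The lowest level of each family belongs to the other family, giving inequalities
    both ways between \<open>sum b UNIV\<close> and \<open>CARD('m)\<close>.\<close>
  obtain n0 :: "'m \<Rightarrow> nat" where n0: "?A b (\<lambda>j. 0) = ?A a n0"
    using iffD2[OF eq, OF exI, OF refl, of "\<lambda>j. 0"] by (elim exE)
  obtain n1 :: "'m \<Rightarrow> nat" where n1: "?A a (\<lambda>j. 0) = ?A b n1"
    using iffD1[OF eq, OF exI, OF refl, of "\<lambda>j. 0"] by (elim exE)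
  have "sum b UNIV \<le> ?A b n1" by (intro sum_mono) (use b in \<open>auto intro: less_imp_le\<close>)
  moreover have "?A b (\<lambda>j. 0) = sum b UNIV" by simp
  moreover have "?A a (\<lambda>j. 0) = real CARD('m)" by (simp add: a)
  moreover have "0 \<le> real (\<Sum>j\<in>UNIV. n0 j)" by (rule of_nat_0_le_iff)
  ultimately have sb: "sum b UNIV = real CARD('m)" using n0 n1 unfolding A by linarith
  have ge: "b i \<ge> 1" for i
  proof -
    obtain n2 :: "'m \<Rightarrow> nat" where n2: "?A b (\<lambda>j. if j = i then 1 else 0) = ?A a n2"
      using iffD2[OF eq, OF exI, OF refl, of "\<lambda>j. if j = i then 1 else 0"] by (elim exE)
    have "?A b (\<lambda>j. if j = i then 1 else 0) = (\<Sum>j\<in>UNIV. b j + (if j = i then 2 * b i else 0))"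
      by (intro sum.cong) auto
    then have "b i = real (\<Sum>j\<in>UNIV. n2 j)" using n2 sb unfolding A by (simp add: sum.distrib)
    then show ?thesis using b[of i] by (metis Suc_leI One_nat_def of_nat_0_less_iff of_nat_1 of_nat_le_iff)
  qed
  \<comment> \<open>Weights that are at least 1 and have average 1 must all equal 1.\<close>
  have "(\<Sum>i\<in>UNIV. b i - 1) = 0" using sb by (simp add: sum_subtractf)
  then have "\<forall>i\<in>UNIV. b i - 1 = 0" using ge by (subst (asm) sum_nonneg_eq_0_iff) auto
  then show ?thesis by simp
qed

definition spectral_levels :: "nat \<Rightarrow> ('m::finite \<Rightarrow> real) \<Rightarrow> complex \<Rightarrow> ('m \<Rightarrow> nat) set" where
  "spectral_levels k a \<mu> =
     {n. complex_of_real (2 * pi * (\<Sum>j\<in>UNIV. (real k * a j) * (2 * real (n j) + 1))) = 2 * (of_nat k)\<^sup>2 * \<mu>}"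

text \<open>Condenses the geometry to the weights \<open>a\<close> and the lattice number
  \<open>D\<close>. The metric enters the spectrum only through \<open>a\<close>, and in the Kaehler
  case \<open>a\<close> is trivial and \<open>D\<close> is fixed by the volume.\<close>

lemma invariant_normal_data:
  fixes h \<omega> :: "'m::finite bilinear_field" and L :: "('i, 'm) line_bundle"
  assumes \<omega>: "symplectic_form \<omega>" "translation_invariant \<omega>" "integer_class \<omega>"
    and h: "riemannian_metric h" "translation_invariant h" and pre: "prequantum_bundle \<omega> L \<theta>"
  shows "\<exists>(a :: 'm \<Rightarrow> real) D. (\<forall>j. a j > 0) \<and> (kaehler h \<omega> \<longleftrightarrow> (\<forall>j. a j = 1)) \<and> D > 0 \<and>
    (kaehler h \<omega> \<longrightarrow> (real D)\<^sup>2 = (riemannian_volume h)\<^sup>2) \<and>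
    (\<forall>k \<mu>. k > 0 \<longrightarrow> finite (spectral_levels k a \<mu>) \<and>
      Spec k h L \<theta> \<mu> = card (spectral_levels k a \<mu>) * (k ^ CARD('m) * D))"
proof -
  have \<omega>0: "\<omega> x = \<omega> 0" for x using \<omega>(2) unfolding translation_invariant_def by (metis add_0)
  have h0: "h x = h 0" for x using h(2) unfolding translation_invariant_def by (metis add_0)
  have w: "symplectic (\<omega> 0)"
    using \<omega>(1) unfolding symplectic_form_def symplectic_def bilin_def symplectic_axioms_def by auto
  have H: "bilin (h 0)" "\<And>x y. h 0 x y = h 0 y x" "\<And>x. x \<noteq> 0 \<Longrightarrow> h 0 x x > 0"
    using h(1) unfolding riemannian_metric_def bilin_def by auto
  have dim: "DIM('m euc) = 2 * CARD('m)" by simp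
  obtain e f :: "'m \<Rightarrow> 'm euc" and a where nf: "normal_partial (h 0) (\<omega> 0) UNIV e f a"
    using symplectic_normal_form[OF H w dim] .
  obtain u v d where fr: "frobenius_partial (\<omega> 0) UNIV u v d"
    using frobenius_basis[OF w integer_class_Ints[OF \<omega>(3) \<omega>0]] .
  define D where "D = (\<Prod>j\<in>UNIV. d j)"
  have d: "\<And>j. d j > 0" using fr unfolding frobenius_partial_def by auto
  show ?thesis
  proof (intro exI[of _ a] exI[of _ D] conjI allI impI)
    show "a j > 0" for j using nf unfolding normal_partial_def by auto
    show "kaehler h \<omega> \<longleftrightarrow> (\<forall>j. a j = 1)" by (rule kaehler_iff_normal[OF h(1) h0 \<omega>(1) \<omega>0 nf])
    show "D > 0" unfolding D_def using d by (intro prod_pos) auto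
    show "(real D)\<^sup>2 = (riemannian_volume h)\<^sup>2" if "kaehler h \<omega>"
      using kaehler_volume[OF h(1) h0 that] frobenius_det[OF w fr] by (simp add: D_def)
    fix k :: nat and \<mu> assume k: "k > 0"
    have p: "(\<Prod>j\<in>UNIV. k * d j) = k ^ CARD('m) * D" by (simp add: D_def prod.distrib)
    note sf = spectrum_formula[OF \<omega>(1) \<omega>0 h(1) h0 pre nf fr k]
    show "finite (spectral_levels k a \<mu>)" unfolding spectral_levels_def by (rule sf(1))
    show "Spec k h L \<theta> \<mu> = card (spectral_levels k a \<mu>) * (k ^ CARD('m) * D)"
      unfolding spectral_levels_def sf(2) p ..
  qed
qed

theorem theorem1p2:
  fixes h h' \<omega> \<omega>' :: "'m::finite bilinear_field"
    and L :: "('i, 'm) line_bundle" and \<theta> :: "('i, 'm) connection_forms"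
    and L' :: "('j, 'm) line_bundle" and \<theta>' :: "('j, 'm) connection_forms"
  assumes "symplectic_form \<omega>" and "translation_invariant \<omega>" and "integer_class \<omega>"
    and "riemannian_metric h" and "translation_invariant h"
    and "prequantum_bundle \<omega> L \<theta>"
    and "symplectic_form \<omega>'" and "translation_invariant \<omega>'" and "integer_class \<omega>'"
    and "riemannian_metric h'" and "translation_invariant h'"
    and "prequantum_bundle \<omega>' L' \<theta>'"
  shows "(Spec 1 h L \<theta> = Spec 1 h' L' \<theta>' \<longrightarrow> (kaehler h \<omega> \<longleftrightarrow> kaehler h' \<omega>')) \<and>
    (kaehler h \<omega> \<and> kaehler h' \<omega>' \<and> riemannian_volume h = riemannian_volume h' \<longrightarrow>
       (\<forall>k>0. Spec k h L \<theta> = Spec k h' L' \<theta>'))"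
proof -
  obtain a :: "'m \<Rightarrow> real" and D where 1: "(\<forall>j. a j > 0) \<and> (kaehler h \<omega> \<longleftrightarrow> (\<forall>j. a j = 1)) \<and> D > 0 \<and>
    (kaehler h \<omega> \<longrightarrow> (real D)\<^sup>2 = (riemannian_volume h)\<^sup>2) \<and>
    (\<forall>k \<mu>. k > 0 \<longrightarrow> finite (spectral_levels k a \<mu>) \<and>
      Spec k h L \<theta> \<mu> = card (spectral_levels k a \<mu>) * (k ^ CARD('m) * D))"
    using invariant_normal_data[OF assms(1-6)] by (elim exE)
  obtain a' :: "'m \<Rightarrow> real" and D' where 2: "(\<forall>j. a' j > 0) \<and> (kaehler h' \<omega>' \<longleftrightarrow> (\<forall>j. a' j = 1)) \<and> D' > 0 \<and>
    (kaehler h' \<omega>' \<longrightarrow> (real D')\<^sup>2 = (riemannian_volume h')\<^sup>2) \<and>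
    (\<forall>k \<mu>. k > 0 \<longrightarrow> finite (spectral_levels k a' \<mu>) \<and>
      Spec k h' L' \<theta>' \<mu> = card (spectral_levels k a' \<mu>) * (k ^ CARD('m) * D'))"
    using invariant_normal_data[OF assms(7-12)] by (elim exE)
  from 1 have a: "\<And>j. a j > 0" and K: "kaehler h \<omega> \<longleftrightarrow> (\<forall>j. a j = 1)" and D: "D > 0"
    "kaehler h \<omega> \<Longrightarrow> (real D)\<^sup>2 = (riemannian_volume h)\<^sup>2"
    and fin: "\<And>k \<mu>. k > 0 \<Longrightarrow> finite (spectral_levels k a \<mu>)"
    and Sp: "\<And>k \<mu>. k > 0 \<Longrightarrow> Spec k h L \<theta> \<mu> = card (spectral_levels k a \<mu>) * (k ^ CARD('m) * D)"
    by blast+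
  from 2 have a': "\<And>j. a' j > 0" and K': "kaehler h' \<omega>' \<longleftrightarrow> (\<forall>j. a' j = 1)" and D': "D' > 0"
    "kaehler h' \<omega>' \<Longrightarrow> (real D')\<^sup>2 = (riemannian_volume h')\<^sup>2"
    and fin': "\<And>k \<mu>. k > 0 \<Longrightarrow> finite (spectral_levels k a' \<mu>)"
    and Sp': "\<And>k \<mu>. k > 0 \<Longrightarrow> Spec k h' L' \<theta>' \<mu> = card (spectral_levels k a' \<mu>) * (k ^ CARD('m) * D')"
    by blast+
  \<comment> \<open>Writing \<mu> as \<open>pi * x\<close> removes the common factor and leaves an
    equation between real numbers.\<close>
  have S1: "spectral_levels 1 b (of_real (pi * x)) = {n. x = (\<Sum>j\<in>UNIV. b j * (2 * real (n j) + 1))}" for b :: "'m \<Rightarrow> real" and x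
  proof -
    have "complex_of_real (2 * pi * (\<Sum>j\<in>UNIV. (real 1 * b j) * (2 * real (n j) + 1))) = 2 * (of_nat 1)\<^sup>2 * of_real (pi * x)
      \<longleftrightarrow> complex_of_real (2 * pi * (\<Sum>j\<in>UNIV. b j * (2 * real (n j) + 1))) = complex_of_real (2 * pi * x)" for n :: "'m \<Rightarrow> nat"
      by simp
    then show ?thesis unfolding spectral_levels_def of_real_eq_iff by auto
  qed
  \<comment> \<open>Finiteness of the levels and positivity of \<open>D\<close> make a multiplicity
    vanish exactly when no level gives that value, so the supports can be compared without knowing
    the multiplicities.\<close>
  have supp: "Spec 1 h L \<theta> (of_real (pi * x)) \<noteq> 0 \<longleftrightarrow> (\<exists>n. x = (\<Sum>j\<in>UNIV. a j * (2 * real (n j) + 1)))"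
    "Spec 1 h' L' \<theta>' (of_real (pi * x)) \<noteq> 0 \<longleftrightarrow> (\<exists>n. x = (\<Sum>j\<in>UNIV. a' j * (2 * real (n j) + 1)))" for x
    unfolding Sp[OF zero_less_one] Sp'[OF zero_less_one]
    using fin[OF zero_less_one, of "of_real (pi * x)"] fin'[OF zero_less_one, of "of_real (pi * x)"] D(1) D'(1)
    unfolding S1 by (auto simp: card_eq_0_iff)
  show ?thesis
  proof (intro conjI impI allI)
    assume "Spec 1 h L \<theta> = Spec 1 h' L' \<theta>'"
    then have eq: "(\<exists>n. x = (\<Sum>j\<in>UNIV. a j * (2 * real (n j) + 1))) \<longleftrightarrow> (\<exists>n. x = (\<Sum>j\<in>UNIV. a' j * (2 * real (n j) + 1)))" for x
      using supp[of x] by simp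
    show "kaehler h \<omega> \<longleftrightarrow> kaehler h' \<omega>'"
      unfolding K K' using unit_weights_from_levels[of a a', OF _ a' eq] unit_weights_from_levels[of a' a, OF _ a eq[symmetric]] by blast
  next
    fix k :: nat
    assume A: "kaehler h \<omega> \<and> kaehler h' \<omega>' \<and> riemannian_volume h = riemannian_volume h'" and k: "0 < k"
    then have "a = a'" using K K' by auto
    \<comment> \<open>\<open>D\<close> and \<open>D'\<close> are natural numbers, so the equality of
      their squares that the volume provides determines them.\<close>
    moreover have "(real D)\<^sup>2 = (real D')\<^sup>2" using A D(2) D'(2) by simp
    then have "D = D'" by simp
    ultimately show "Spec k h L \<theta> = Spec k h' L' \<theta>'" using Sp[OF k] Sp'[OF k] by auto
  qed
qed

end
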